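(* Let $\Omega\subset\mathbb{R}^3$ be a domain, and let $f:\Omega\to\mathbb{R}^3$ be a nonconstant sense-preserving quasiregular mapping whose coordinate functions are harmonic. Then $$J_f(x)>0\qquad\text{for all }x\in\Omega.$$ Consequently, $f$ is locally a real-analytic diffeomorphism. In particular, if $f:\Omega\to\Omega'$ is a quasiconformal harmonic homeomorphism between domains $\Omega,\Omega'\subset\mathbb{R}^3$, then $J_f\neq0$ everywhere in $\Omega$.
   Context: $Df$ is the differential, $\|Df\|$ its operator norm, and $J_f=\det Df$ the Jacobian. For a domain $\Omega\subset\mathbb{R}^n$, a nonconstant mapping $f:\Omega\to\mathbb{R}^n$ is sense-preserving $K$-quasiregular if $f\in W^{1,n}_{\mathrm{loc}}(\Omega,\mathbb{R}^n)$, $J_f\ge0$ a.e. in $\Omega$, and $\|Df(x)\|^n\le K J_f(x)$ for a.e. $x\in\Omega$. It is sense-preserving quasiregular if this holds for some finite constant $K$. A quasiconformal mapping is a homeomorphic quasiregular mapping; in the last assertion orientation-reversing quasiconformal maps (those whose composition with a reflection of the target is sense-preserving quasiregular) are allowed. Harmonic means that each coordinate function is harmonic with respect to the Euclidean Laplacian. *)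

theory Defs
  imports "HOL-Analysis.Analysis"
begin

definition is_domain :: "(real^'n) set \<Rightarrow> bool" where
  "is_domain \<Omega> \<longleftrightarrow> open \<Omega> \<and> connected \<Omega> \<and> \<Omega> \<noteq> {}"

definition partial :: "'n \<Rightarrow> (real^'n \<Rightarrow> real) \<Rightarrow> real^'n \<Rightarrow> real" where
  "partial i u x = frechet_derivative u (at x) (axis i 1)"

text \<open>The class \<open>C\<^sup>k\<close>, meant for open \<open>S\<close>: there \<open>u\<close> is \<open>C\<^sup>k\<^sup>+\<^sup>1\<close> iff it is differentiable
  with all partial derivatives of class \<open>C\<^sup>k\<close>.\<close>

primrec Ck_on :: "nat \<Rightarrow> (real^'n) set \<Rightarrow> (real^'n \<Rightarrow> real) \<Rightarrow> bool" where
  "Ck_on 0 S u \<longleftrightarrow> continuous_on S u"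
| "Ck_on (Suc k) S u \<longleftrightarrow> u differentiable_on S \<and> (\<forall>i. Ck_on k S (partial i u))"

definition laplacian :: "(real^'n \<Rightarrow> real) \<Rightarrow> real^'n \<Rightarrow> real" where
  "laplacian u x = (\<Sum>i\<in>UNIV. partial i (partial i u) x)"

definition harmonic_on :: "(real^'n) set \<Rightarrow> (real^'n \<Rightarrow> real) \<Rightarrow> bool" where
  "harmonic_on S u \<longleftrightarrow> Ck_on 2 S u \<and> (\<forall>x\<in>S. laplacian u x = 0)"

definition harmonic_map_on :: "(real^'n) set \<Rightarrow> (real^'n \<Rightarrow> real^'m) \<Rightarrow> bool" where
  "harmonic_map_on S f \<longleftrightarrow> (\<forall>j. harmonic_on S (\<lambda>x. f x $ j))"

text \<open>The library's \<^const>\<open>jacobian\<close> is the matrix of the classical derivative; it is meaningful only where \<open>f\<close> is differentiable.\<close>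

definition jacobian_det :: "(real^'n \<Rightarrow> real^'n) \<Rightarrow> real^'n \<Rightarrow> real" where
  "jacobian_det f x = det (jacobian f (at x))"

definition Lp_loc :: "real \<Rightarrow> (real^'n) set \<Rightarrow> (real^'n \<Rightarrow> real) \<Rightarrow> bool" where
  "Lp_loc p \<Omega> u \<longleftrightarrow> (\<forall>C. compact C \<and> C \<subseteq> \<Omega> \<longrightarrow>
     set_borel_measurable lebesgue C u \<and>
     set_integrable lebesgue C (\<lambda>x. \<bar>u x\<bar> powr p))"

definition test_function :: "(real^'n) set \<Rightarrow> (real^'n \<Rightarrow> real) \<Rightarrow> bool" where
  "test_function \<Omega> \<phi> \<longleftrightarrow> (\<forall>k. Ck_on k UNIV \<phi>) \<and>
     (\<exists>C. compact C \<and> C \<subseteq> \<Omega> \<and> (\<forall>x. x \<notin> C \<longrightarrow> \<phi> x = 0))"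

definition has_weak_partial ::
    "(real^'n) set \<Rightarrow> 'n \<Rightarrow> (real^'n \<Rightarrow> real) \<Rightarrow> (real^'n \<Rightarrow> real) \<Rightarrow> bool" where
  "has_weak_partial \<Omega> i u g \<longleftrightarrow> Lp_loc 1 \<Omega> u \<and> Lp_loc 1 \<Omega> g \<and>
     (\<forall>\<phi>. test_function \<Omega> \<phi> \<longrightarrow>
        (LINT x:\<Omega>|lebesgue. u x * partial i \<phi> x) = - (LINT x:\<Omega>|lebesgue. g x * \<phi> x))"

text \<open>\<open>D x\<close> is the matrix with rows indexed by the components of \<open>f\<close>, as in \<^const>\<open>matrix\<close>.\<close>

definition has_weak_differential ::
    "(real^'n) set \<Rightarrow> (real^'n \<Rightarrow> real^'m) \<Rightarrow> (real^'n \<Rightarrow> real^'n^'m) \<Rightarrow> bool" where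
  "has_weak_differential \<Omega> f D \<longleftrightarrow>
     (\<forall>i j. has_weak_partial \<Omega> i (\<lambda>x. f x $ j) (\<lambda>x. D x $ j $ i))"

definition W1p_loc :: "real \<Rightarrow> (real^'n) set \<Rightarrow> (real^'n \<Rightarrow> real^'m) \<Rightarrow> bool" where
  "W1p_loc p \<Omega> f \<longleftrightarrow> (\<forall>j. Lp_loc p \<Omega> (\<lambda>x. f x $ j)) \<and>
     (\<exists>D. has_weak_differential \<Omega> f D \<and> (\<forall>i j. Lp_loc p \<Omega> (\<lambda>x. D x $ j $ i)))"

text \<open>The weak differential is unique up to null sets, so it does not matter which
  representative \<open>D\<close> the almost-everywhere conditions refer to.\<close>

definition sp_K_quasiregular ::
    "real \<Rightarrow> (real^'n) set \<Rightarrow> (real^'n \<Rightarrow> real^'n) \<Rightarrow> bool" where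
  "sp_K_quasiregular K \<Omega> f \<longleftrightarrow>
     \<not> f constant_on \<Omega> \<and>
     W1p_loc (real CARD('n)) \<Omega> f \<and>
     (\<exists>D. has_weak_differential \<Omega> f D \<and>
        (AE x in lebesgue. x \<in> \<Omega> \<longrightarrow> det (D x) \<ge> 0) \<and>
        (AE x in lebesgue. x \<in> \<Omega> \<longrightarrow> onorm ((*v) (D x)) ^ CARD('n) \<le> K * det (D x)))"

definition sp_quasiregular :: "(real^'n) set \<Rightarrow> (real^'n \<Rightarrow> real^'n) \<Rightarrow> bool" where
  "sp_quasiregular \<Omega> f \<longleftrightarrow> (\<exists>K. sp_K_quasiregular K \<Omega> f)"

text \<open>Reflection in the hyperplane through \<open>a\<close> with normal \<open>v \<noteq> 0\<close>.\<close>

definition hyperplane_reflection :: "real^'n \<Rightarrow> real^'n \<Rightarrow> real^'n \<Rightarrow> real^'n" where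
  "hyperplane_reflection a v y = y - (2 * ((y - a) \<bullet> v) / (v \<bullet> v)) *\<^sub>R v"

text \<open>Orientation-reversing maps are included.\<close>

definition quasiconformal ::
    "(real^'n) set \<Rightarrow> (real^'n) set \<Rightarrow> (real^'n \<Rightarrow> real^'n) \<Rightarrow> bool" where
  "quasiconformal \<Omega> \<Omega>' f \<longleftrightarrow> (\<exists>g. homeomorphism \<Omega> \<Omega>' f g) \<and>
     (sp_quasiregular \<Omega> f \<or>
      (\<exists>a v. v \<noteq> 0 \<and> sp_quasiregular \<Omega> (hyperplane_reflection a v \<circ> f)))"

text \<open>The power series runs over multi-indices \<open>\<alpha>\<close>. For open \<open>S\<close> this is real analyticity on
  \<open>S\<close>; in general it is analyticity in a neighbourhood of every point of \<open>S\<close>.\<close>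

definition real_analytic_on :: "(real^'n) set \<Rightarrow> (real^'n \<Rightarrow> real) \<Rightarrow> bool" where
  "real_analytic_on S u \<longleftrightarrow> (\<forall>a\<in>S. \<exists>r>0. \<exists>c :: ('n \<Rightarrow> nat) \<Rightarrow> real. \<forall>x\<in>ball a r.
     ((\<lambda>\<alpha>. c \<alpha> * (\<Prod>i\<in>UNIV. (x $ i - a $ i) ^ \<alpha> i)) has_sum u x) UNIV)"

definition real_analytic_map_on :: "(real^'n) set \<Rightarrow> (real^'n \<Rightarrow> real^'m) \<Rightarrow> bool" where
  "real_analytic_map_on S f \<longleftrightarrow> (\<forall>j. real_analytic_on S (\<lambda>x. f x $ j))"

definition real_analytic_diffeomorphism ::
    "(real^'n) set \<Rightarrow> (real^'n) set \<Rightarrow> (real^'n \<Rightarrow> real^'n) \<Rightarrow> bool" where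
  "real_analytic_diffeomorphism U V f \<longleftrightarrow> open U \<and> open V \<and>
     (\<exists>g. homeomorphism U V f g \<and> real_analytic_map_on U f \<and> real_analytic_map_on V g)"

definition locally_real_analytic_diffeomorphism ::
    "(real^'n) set \<Rightarrow> (real^'n \<Rightarrow> real^'n) \<Rightarrow> bool" where
  "locally_real_analytic_diffeomorphism \<Omega> f \<longleftrightarrow>
     (\<forall>x\<in>\<Omega>. \<exists>U V. x \<in> U \<and> U \<subseteq> \<Omega> \<and> real_analytic_diffeomorphism U V f)"

end

theory Submission
  imports Defs "HOL-Complex_Analysis.Conformal_Mappings"
begin

text \<open>The distortion inequality holds pointwise, so a zero \<open>x\<^sub>0\<close> of the Jacobian is a zero of the differential,
  and blowing up \<open>f\<close> at \<open>x\<^sub>0\<close> gives a nonzero homogeneous harmonic map \<open>P\<close> of degree \<open>m \<ge> 2\<close> that satisfies the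
  same distortion inequality. A further blow-up at a point \<open>p \<noteq> 0\<close> is invariant in the direction \<open>p\<close>, which
  rules out zeros of the Jacobian of \<open>P\<close> away from the origin. Hence \<open>m\<close> is odd by symmetry, and \<open>P\<close> is a covering
  of the simply connected punctured space, thus injective there. For the harmonic polynomial \<open>w = Re ((x\<^sub>1 + i x\<^sub>2) ^ m)\<close>
  let \<open>Y\<close> be the solution of \<open>(DP)\<^sup>T Y = grad w\<close>; it is homogeneous of degree \<open>0\<close>. At a point \<open>x\<^sub>1\<close> where \<open>e \<bullet> Y\<close>
  is extremal, a blow-up of \<open>w - Y x\<^sub>1 \<bullet> P\<close> is a planar harmonic function with a gradient component of constant sign,
  which is impossible unless \<open>P x\<^sub>1\<close> is parallel to \<open>e\<close>. So the maximum and the minimum of \<open>e \<bullet> Y\<close> lie on one line through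
  the origin, where \<open>Y\<close> is constant. Therefore \<open>Y\<close> is constant, and it vanishes because \<open>grad w\<close> does at one point;
  this contradicts \<open>w \<noteq> 0\<close>.\<close>

section \<open>Holomorphic functions of several complex variables\<close>

text \<open>Harmonicity and injectivity alone do not suffice: the harmonic homeomorphism (x^3 - 3 x
  z^2 + y z, y - 3 x z, z) of space has Jacobian 3 x^2. At its zeros the differential keeps rank
  two, which the distortion inequality forbids; being invariant under scaling, the inequality
  survives every blow-up with the same constant. \<open>Y\<close> serves to build a scalar harmonic
  function with a critical point at a prescribed place, \<open>w - Y x1 \<bullet> P\<close> at
  \<open>x1\<close>. Scalar functions feel no distortion, so a sign has to replace it: extremality
  of \<open>e \<bullet> Y\<close> fixes the sign of one gradient component. This is decisive for
  planar functions, where the component is the real part of an entire function; planarity is the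
  invariance along \<open>x1\<close>. The component in the invariant direction vanishes anyway,
  whence the exceptional case \<open>P x1\<close> parallel to \<open>e\<close>, and injectivity of
  \<open>P\<close> collects the exceptional points on one line. The blow-ups need a Taylor expansion
  with two derivatives, the second for Laplace's equation; hence the analyticity of harmonic
  functions, obtained from the Newton kernel.\<close>

lemma continuous_on_if_locally:
  fixes f :: "'a::t2_space \<Rightarrow> 'b::topological_space"
  assumes "\<And>x. x \<in> S \<Longrightarrow> \<exists>N. open N \<and> x \<in> N \<and> continuous_on (S \<inter> N) f"
  shows "continuous_on S f"
proof -
  have "continuous (at x within S) f" if "x \<in> S" for x
  proof -
  from that obtain N where N: "open N" "x \<in> N" "continuous_on (S \<inter> N) f"
    using assms by blast
  then have "continuous (at x within S \<inter> N) f"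
    using \<open>x \<in> S\<close> by (simp add: continuous_on_eq_continuous_within)
  moreover have "at x within S \<inter> N = at x within S"
    using N by (intro at_within_nhd[of x N]) auto
  ultimately show ?thesis
    by simp
  qed
  then show ?thesis by (simp add: continuous_on_eq_continuous_within)
qed

lemma norm_axis [simp]: "norm (axis i h :: 'a::real_normed_vector ^ 'n) = norm h"
  by (simp add: norm_vec_def L2_set_def axis_def if_distrib [of norm] if_distrib [of "\<lambda>x. x^2"]
      cong: if_cong)

lemma bounded_linear_axis: "bounded_linear (axis i :: 'a \<Rightarrow> 'a::real_normed_vector ^ 'n)"
  proof (rule bounded_linear_intro[where K=1])
  show "norm (axis i x :: 'a ^ 'n) \<le> norm x * 1" for x by simp
qed (auto simp: vec_eq_iff axis_def)

lemma axis_0 [simp]: "axis i 0 = (0 :: 'a::zero ^ 'n)"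
  by (simp add: axis_def vec_eq_iff)

lemma axis_add: "axis i (x + y) = axis i x + (axis i y :: 'a::monoid_add ^ 'n)"
  by (auto simp: vec_eq_iff axis_def)

lemma continuous_on_axis [continuous_intros]:
  fixes g :: "_ \<Rightarrow> 'a::real_normed_vector"
  assumes "continuous_on S g"
  shows "continuous_on S (\<lambda>x. axis i (g x) :: 'a ^ 'n)"
  using bounded_linear.continuous_on[OF bounded_linear_axis assms] .

text \<open>Cauchy's formula for the derivative over the fixed interval [0, 1]: the dependence on
  \<open>w\<close> and on any parameter of \<open>f\<close> sits in the integrand alone, so that
  continuity and differentiation under the integral apply.\<close>

lemma deriv_circle_integral:
  assumes "continuous_on (cball w r) f" "f holomorphic_on ball w r" "r > 0"
  shows "deriv f w = integral (cbox 0 1)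
      (\<lambda>\<theta>::real. f (w + r * exp (2 * of_real pi * \<i> * \<theta>)) / (r * exp (2 * of_real pi * \<i> * \<theta>)))"
proof -
  have "(2 * pi * \<i>) * deriv f w = contour_integral(circlepath w r) (\<lambda>u. f u/(u-w)^2)"
    using assms by (subst Cauchy_contour_integral_circlepath_2) auto
  also have "\<dots> = integral {0..1} (\<lambda>\<theta>. f (circlepath w r \<theta>) / (circlepath w r \<theta> - w)^2
      * (2 * pi * \<i> * r * exp (2 * of_real pi * \<i> * \<theta>)))"
    unfolding contour_integral_integral
    by (intro integral_cong) (auto simp: vector_derivative_circlepath)
  also have "\<dots> = integral {0..1} (\<lambda>\<theta>::real. (2 * pi * \<i>) *
     (f (w + r * exp (2 * of_real pi * \<i> * \<theta>)) / (r * exp (2 * of_real pi * \<i> * \<theta>))))"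
    using assms(3) by (intro integral_cong) (auto simp: circlepath power2_eq_square field_simps)
  also have "\<dots> = (2 * pi * \<i>) * integral (cbox 0 1)
     (\<lambda>\<theta>::real. f (w + r * exp (2 * of_real pi * \<i> * \<theta>)) / (r * exp (2 * of_real pi * \<i> * \<theta>)))"
    by (subst integral_mult_right[symmetric]) simp
  finally show ?thesis by simp
qed

text \<open>Near \<open>w0\<close> all derivatives are circle integrals with one common radius
  \<open>s\<close>, so joint continuity of \<open>K\<close> passes to the derivative;
  differentiability in \<open>t\<close> is not involved.\<close>

lemma continuous_on_deriv_param:
  fixes K :: "complex \<Rightarrow> 't::t2_space \<Rightarrow> complex"
  assumes cont: "continuous_on (U \<times> T) (\<lambda>(w,t). K w t)" and "open U"
    and holK: "\<And>t. t \<in> T \<Longrightarrow> (\<lambda>w. K w t) holomorphic_on U"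
  shows "continuous_on (U \<times> T) (\<lambda>(w,t). deriv (\<lambda>w. K w t) w)"
proof (rule continuous_on_if_locally)
  fix x assume "x \<in> U \<times> T"
  then obtain w0 t0 where x: "x = (w0,t0)" "w0 \<in> U" "t0 \<in> T" by auto
  from \<open>open U\<close> x(2) obtain r where r: "r > 0" "cball w0 r \<subseteq> U"
    using open_contains_cball by blast
  define s where "s = r / 2"
  have s: "s > 0" using r by (simp add: s_def)
  have sub: "cball w s \<subseteq> U" if "w \<in> ball w0 s" for w
  proof -
    have "cball w s \<subseteq> cball w0 r"
      using that unfolding s_def cball_subset_cball_iff by (simp add: dist_commute)
    with r show ?thesis by auto
  qed
  have eq: "deriv (\<lambda>w. K w t) w = integral (cbox 0 1)
      (\<lambda>\<theta>::real. K (w + s * exp (2 * of_real pi * \<i> * \<theta>)) t / (s * exp (2 * of_real pi * \<i> * \<theta>)))"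
    if "w \<in> ball w0 s" "t \<in> T" for w t
  proof (rule deriv_circle_integral)
    have "(\<lambda>w. K w t) holomorphic_on cball w s"
      using holK[OF that(2)] sub[OF that(1)] holomorphic_on_subset by blast
    then show "continuous_on (cball w s) (\<lambda>w. K w t)" "(\<lambda>w. K w t) holomorphic_on ball w s"
      by (auto intro: holomorphic_on_imp_continuous_on holomorphic_on_subset)
  qed (use s in auto)
  have mem: "w + s * exp (2 * of_real pi * \<i> * of_real \<theta>) \<in> U" if "w \<in> ball w0 s" for w and \<theta> :: real
  proof -
    have "norm (s * exp (2 * of_real pi * \<i> * of_real \<theta>)) = s"
      using s by (simp add: norm_mult)
    then have "w + s * exp (2 * of_real pi * \<i> * of_real \<theta>) \<in> cball w s"
      by (simp add: dist_norm)
    then show ?thesis using sub[OF that] by blast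
  qed
  have "continuous_on (ball w0 s \<times> T) (\<lambda>p. integral (cbox 0 1)
      (\<lambda>\<theta>::real. K (fst p + s * exp (2 * of_real pi * \<i> * \<theta>)) (snd p) / (s * exp (2 * of_real pi * \<i> * \<theta>))))"
  proof (rule integral_continuous_on_param)
    have "continuous_on ((ball w0 s \<times> T) \<times> cbox 0 1)
       (\<lambda>q. (\<lambda>(w,t). K w t) (fst (fst q) + s * exp (2 * of_real pi * \<i> * of_real (snd q)), snd (fst q)))"
      by (rule continuous_on_compose2[OF cont]) (auto intro!: continuous_intros mem)
    then have "continuous_on ((ball w0 s \<times> T) \<times> cbox 0 1)
       (\<lambda>q. K (fst (fst q) + s * exp (2 * of_real pi * \<i> * of_real (snd q))) (snd (fst q))
         / (s * exp (2 * of_real pi * \<i> * of_real (snd q))))"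
      using s by (intro continuous_intros) auto
    then show "continuous_on ((ball w0 s \<times> T) \<times> cbox 0 1)
       (\<lambda>(p,\<theta>). K (fst p + s * exp (2 * of_real pi * \<i> * of_real \<theta>)) (snd p)
         / (s * exp (2 * of_real pi * \<i> * of_real \<theta>)))"
      by (simp add: case_prod_unfold)
  qed
  then have "continuous_on (ball w0 s \<times> T) (\<lambda>(w,t). deriv (\<lambda>w. K w t) w)"
    by (rule continuous_on_eq) (auto simp: eq)
  moreover have "U \<times> T \<inter> ball w0 s \<times> UNIV = ball w0 s \<times> T"
    using sub s by (force intro: less_imp_le)
  ultimately show "\<exists>N. open N \<and> x \<in> N \<and>
      continuous_on (U \<times> T \<inter> N) (\<lambda>(w,t). deriv (\<lambda>w. K w t) w)"
    using s x by (intro exI[of _ "ball w0 s \<times> UNIV"]) (auto simp: open_Times)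
qed

text \<open>Continuity together with holomorphy in each variable separately. By Osgood's lemma this
  amounts to full holomorphy (\<open>holo_has_derivative\<close>), and it keeps all verifications
  one-dimensional.\<close>

definition holo :: "(complex^'n) set \<Rightarrow> (complex^'n \<Rightarrow> complex) \<Rightarrow> bool" where
  "holo U G \<longleftrightarrow> continuous_on U G \<and>
     (\<forall>z\<in>U. \<forall>i. (\<lambda>h. G (z + axis i h)) field_differentiable (at 0))"

definition cpartial :: "'n \<Rightarrow> (complex^'n \<Rightarrow> complex) \<Rightarrow> complex^'n \<Rightarrow> complex" where
  "cpartial i G z = deriv (\<lambda>h. G (z + axis i h)) 0"

lemma holo_subset: "holo U G \<Longrightarrow> V \<subseteq> U \<Longrightarrow> holo V G"
  by (auto simp: holo_def intro: continuous_on_subset)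

lemma holo_continuous: "holo U G \<Longrightarrow> continuous_on U G"
  by (simp add: holo_def)

lemma holo_has_cpartial:
  assumes "holo U G" "z + axis i h \<in> U"
  shows "((\<lambda>h. G (z + axis i h)) has_field_derivative cpartial i G (z + axis i h)) (at h)"
proof -
  have "((\<lambda>k. G (z + axis i h + axis i k)) has_field_derivative cpartial i G (z + axis i h)) (at 0)"
    using assms unfolding holo_def cpartial_def by (simp add: DERIV_deriv_iff_field_differentiable)
  then have "((\<lambda>k. G (z + axis i (h + k))) has_field_derivative cpartial i G (z + axis i h)) (at 0)"
    by (simp add: axis_add add.assoc)
  then show ?thesis
    using DERIV_shift[of "\<lambda>k. G (z + axis i k)" "cpartial i G (z + axis i h)" 0 h] by (simp add: add.commute)
qed

lemma open_line:
  assumes "open U"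
  shows "open {h. z + axis i h \<in> (U :: ('a::real_normed_vector ^ 'n) set)}"
proof -
  have "continuous_on UNIV (\<lambda>h. z + axis i h)" by (intro continuous_intros)
  from open_vimage[OF assms this] show ?thesis by (simp add: vimage_def)
qed

lemma holo_line:
  assumes "holo U G"
  shows "(\<lambda>h. G (z + axis i h)) holomorphic_on {h. z + axis i h \<in> U}"
  unfolding holomorphic_on_def field_differentiable_def
  by (blast intro: has_field_derivative_at_within holo_has_cpartial[OF assms])

lemma deriv_line:
  assumes "holo U G" "z + axis i h \<in> U"
  shows "deriv (\<lambda>h. G (z + axis i h)) h = cpartial i G (z + axis i h)"
  using holo_has_cpartial[OF assms] by (rule DERIV_imp_deriv)

lemma holo_cong:
  assumes "holo U G" "open U" "\<And>z. z \<in> U \<Longrightarrow> G z = H z"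
  shows "holo U H"
  unfolding holo_def
proof (intro conjI ballI allI)
  show "continuous_on U H"
    using assms by (auto simp: holo_def cong: continuous_on_cong)
next
  fix z i assume z: "z \<in> U"
  have "open {h. z + axis i h \<in> U}" using assms by (simp add: open_line)
  moreover have "0 \<in> {h. z + axis i h \<in> U}" using z by simp
  moreover obtain D where "((\<lambda>h. G (z + axis i h)) has_field_derivative D) (at 0)"
    using assms z unfolding holo_def field_differentiable_def by blast
  ultimately have "((\<lambda>h. H (z + axis i h)) has_field_derivative D) (at 0)"
    using assms(3) by (auto elim!: has_field_derivative_transform_within_open)
  then show "(\<lambda>h. H (z + axis i h)) field_differentiable (at 0)"
    by (auto simp: field_differentiable_def)
qed

text \<open>On each complex line Leibniz's rule applies, since
  \<open>continuous_on_deriv_param\<close> makes the derivative of the integrand jointly continuous.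
  Both the partial derivatives and the Newton potential are integrals of this kind.\<close>

lemma holo_integral:
  fixes K :: "complex^'n \<Rightarrow> 'b::euclidean_space \<Rightarrow> complex"
  assumes cont: "continuous_on (U \<times> cbox a b) (\<lambda>(z,y). K z y)" and "open U"
    and holK: "\<And>y. y \<in> cbox a b \<Longrightarrow> holo U (\<lambda>z. K z y)"
  shows "holo U (\<lambda>z. integral (cbox a b) (K z))"
  unfolding holo_def
proof (intro conjI ballI allI)
  show "continuous_on U (\<lambda>z. integral (cbox a b) (K z))"
    by (rule integral_continuous_on_param[OF cont])
next
  fix z i assume z: "z \<in> U"
  define L where "L = {h. z + axis i h \<in> U}"
  have "open L" unfolding L_def using \<open>open U\<close> by (rule open_line)
  have "0 \<in> L" using z by (simp add: L_def)
  with \<open>open L\<close> obtain r where r: "r > 0" "ball 0 r \<subseteq> L"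
    using open_contains_ball by blast
  have mem: "z + axis i h \<in> U" if "h \<in> ball 0 r" for h using r that by (auto simp: L_def)
  have contL: "continuous_on (ball 0 r \<times> cbox a b) (\<lambda>(h,y). K (z + axis i h) y)"
  proof -
    have "continuous_on (ball 0 r \<times> cbox a b) (\<lambda>p. (\<lambda>(z,y). K z y) (z + axis i (fst p), snd p))"
      by (rule continuous_on_compose2[OF cont]) (use mem in \<open>auto intro!: continuous_intros\<close>)
    then show ?thesis by (simp add: case_prod_unfold)
  qed
  have hol: "(\<lambda>h. K (z + axis i h) y) holomorphic_on ball 0 r" if "y \<in> cbox a b" for y
    using holo_line[OF holK[OF that], of z i] r by (auto simp: L_def intro: holomorphic_on_subset)
  have "(\<lambda>h. integral (cbox a b) (K (z + axis i h))) holomorphic_on ball 0 r"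
  proof (rule leibniz_rule_holomorphic)
    show "((\<lambda>h. K (z + axis i h) y) has_field_derivative deriv (\<lambda>h. K (z + axis i h) y) h) (at h within ball 0 r)"
      if "h \<in> ball 0 r" "y \<in> cbox a b" for h y
      using hol[OF that(2)] that(1) by (meson holomorphic_derivI open_ball)
    show "K (z + axis i h) integrable_on cbox a b" if "h \<in> ball 0 r" for h
    proof (rule integrable_continuous)
      have "continuous_on (cbox a b) (\<lambda>y. (\<lambda>(z,y). K z y) (z + axis i h, y))"
        by (rule continuous_on_compose2[OF cont]) (use mem that in \<open>auto intro!: continuous_intros\<close>)
      then show "continuous_on (cbox a b) (K (z + axis i h))" by simp
    qed
    show "continuous_on (ball 0 r \<times> cbox a b) (\<lambda>(x, t). deriv (\<lambda>h. K (z + axis i h) t) x)"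
      by (rule continuous_on_deriv_param[OF contL open_ball hol])
  qed auto
  then show "(\<lambda>h. integral (cbox a b) (K (z + axis i h))) field_differentiable (at 0)"
    using r(1) by (auto intro: holomorphic_on_imp_differentiable_at[of _ "ball 0 r"])
qed

lemma cpartial_circle_integral:
  assumes "holo U G" "open U" "\<And>h. norm h \<le> r \<Longrightarrow> z + axis i h \<in> U" "r > 0"
  shows "cpartial i G z = integral (cbox 0 1)
      (\<lambda>\<theta>::real. G (z + axis i (r * exp (2 * of_real pi * \<i> * \<theta>))) / (r * exp (2 * of_real pi * \<i> * \<theta>)))"
proof -
  have hol: "(\<lambda>h. G (z + axis i h)) holomorphic_on cball 0 r"
    using holo_line[OF assms(1), of z i] by (rule holomorphic_on_subset) (use assms(3) in auto)
  show ?thesis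
    unfolding cpartial_def
    using deriv_circle_integral[OF holomorphic_on_imp_continuous_on[OF hol]
        holomorphic_on_subset[OF hol ball_subset_cball] assms(4)] by simp
qed

lemma holo_if_locally:
  assumes "\<And>z. z \<in> U \<Longrightarrow> \<exists>N. open N \<and> z \<in> N \<and> holo N G"
  shows "holo U G"
  unfolding holo_def
proof (intro conjI ballI allI)
  show "continuous_on U G"
    using assms by (intro continuous_on_if_locally) (meson continuous_on_subset holo_def inf_le2)
  show "(\<lambda>h. G (z + axis i h)) field_differentiable (at 0)" if "z \<in> U" for z i
    using assms[OF that] by (auto simp: holo_def)
qed

lemma holo_translate:
  assumes "holo U G"
  shows "holo {z. z + b \<in> U} (\<lambda>z. G (z + b))"
proof -
  have "continuous_on {z. z + b \<in> U} (\<lambda>z. G (z + b))"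
    using assms unfolding holo_def
    by (intro continuous_on_compose2[of U G _ "\<lambda>z. z + b"]) (auto intro!: continuous_intros)
  moreover have "(\<lambda>h. G (z + axis i h + b)) field_differentiable (at 0)" if "z + b \<in> U" for z i
  proof -
    have "(\<lambda>h. G (z + b + axis i h)) field_differentiable (at 0)"
      using assms that by (simp add: holo_def)
    then show ?thesis by (simp add: add.assoc add.commute[of b])
  qed
  ultimately show ?thesis unfolding holo_def by auto
qed

lemma holo_cmult:
  assumes "holo U G"
  shows "holo U (\<lambda>z. c * G z)"
  using assms unfolding holo_def
  by (auto intro!: continuous_intros field_differentiable_mult field_differentiable_const)

lemma cball_line:
  fixes z0 :: "complex^'n"
  assumes "cball z0 (2*r) \<subseteq> U" "z \<in> ball z0 r" "norm h \<le> r"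
  shows "z + axis i h \<in> U"
proof -
  have "dist z0 (z + axis i h) \<le> dist z0 z + norm (axis i h :: complex^'n)"
    by (metis add_diff_cancel_left' dist_norm dist_triangle norm_minus_commute)
  also have "\<dots> \<le> 2 * r" using assms by simp
  finally show ?thesis using assms by auto
qed

text \<open>A partial derivative is a circle integral of translates of \<open>G\<close>, so it
  inherits holomorphy in all variables at once from \<open>holo_integral\<close>.\<close>

lemma holo_cpartial:
  assumes "holo U G" "open U"
  shows "holo U (cpartial i G)"
proof (rule holo_if_locally)
  fix z0 assume "z0 \<in> U"
  then obtain r' where r': "r' > 0" "cball z0 r' \<subseteq> U"
    using \<open>open U\<close> open_contains_cball by blast
  define r where "r = r' / 2"
  have r: "r > 0" "cball z0 (2*r) \<subseteq> U" using r' by (auto simp: r_def)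
  note mem = cball_line[OF r(2)]
  have nrm: "norm (r * exp (2 * of_real pi * \<i> * of_real \<theta>)) \<le> r" for \<theta> :: real
    using r by (simp add: norm_mult)
  have "holo (ball z0 r) (\<lambda>z. integral (cbox 0 1)
     (\<lambda>\<theta>::real. G (z + axis i (r * exp (2 * of_real pi * \<i> * \<theta>))) / (r * exp (2 * of_real pi * \<i> * \<theta>))))"
  proof (rule holo_integral)
    have "continuous_on (ball z0 r \<times> cbox 0 1)
      (\<lambda>p. G (fst p + axis i (r * exp (2 * of_real pi * \<i> * of_real (snd p)))))"
      by (rule continuous_on_compose2[OF holo_continuous[OF assms(1)]])
         (use mem nrm in \<open>auto intro!: continuous_intros\<close>)
    then have "continuous_on (ball z0 r \<times> cbox 0 1)
      (\<lambda>p. G (fst p + axis i (r * exp (2 * of_real pi * \<i> * of_real (snd p))))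
        / (r * exp (2 * of_real pi * \<i> * of_real (snd p))))"
      using r by (intro continuous_intros) auto
    then show "continuous_on (ball z0 r \<times> cbox 0 1)
      (\<lambda>(z,\<theta>). G (z + axis i (r * exp (2 * of_real pi * \<i> * of_real \<theta>)))
        / (r * exp (2 * of_real pi * \<i> * of_real \<theta>)))"
      by (simp add: case_prod_unfold)
    fix \<theta> :: real
    have "holo (ball z0 r) (\<lambda>z. G (z + axis i (r * exp (2 * of_real pi * \<i> * of_real \<theta>))))"
      by (rule holo_subset[OF holo_translate[OF assms(1)]]) (use mem nrm in auto)
    from holo_cmult[OF this, of "inverse (r * exp (2 * of_real pi * \<i> * of_real \<theta>))"]
    show "holo (ball z0 r) (\<lambda>z. G (z + axis i (r * exp (2 * of_real pi * \<i> * of_real \<theta>)))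
        / (r * exp (2 * of_real pi * \<i> * of_real \<theta>)))"
      by (simp add: field_simps)
  qed auto
  then have "holo (ball z0 r) (cpartial i G)"
    by (rule holo_cong) (use cpartial_circle_integral[OF assms, of r] mem r in auto)
  then show "\<exists>N. open N \<and> z0 \<in> N \<and> holo N (cpartial i G)"
    using r by (intro exI[of _ "ball z0 r"]) auto
qed

lemma cpartial_bound:
  assumes "holo U G" "open U" "r > 0" "\<And>h. norm h \<le> r \<Longrightarrow> z + axis i h \<in> U"
    "\<And>h. norm h = r \<Longrightarrow> norm (G (z + axis i h)) \<le> M"
  shows "norm (cpartial i G z) \<le> M / r"
proof -
  have hol: "(\<lambda>h. G (z + axis i h)) holomorphic_on cball 0 r"
    using holo_line[OF assms(1), of z i] by (rule holomorphic_on_subset) (use assms(4) in auto)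
  then have "norm ((deriv ^^ 1) (\<lambda>h. G (z + axis i h)) 0) \<le> fact 1 * M / r ^ 1"
    by (intro Cauchy_inequality)
       (use assms in \<open>auto intro: holomorphic_on_imp_continuous_on holomorphic_on_subset\<close>)
  then show ?thesis by (simp add: cpartial_def)
qed

text \<open>Osgood's lemma, by induction over the set \<open>I\<close> of coordinates that may move:
  the increment splits into a part \<open>h'\<close> in \<open>I\<close>, covered by the induction
  hypothesis, and a step along the axis \<open>j\<close>, where the mean value inequality is used
  with \<open>cpartial j G\<close> close to its value at \<open>z\<close>.\<close>

lemma holo_has_derivative:
  fixes G :: "complex^'n \<Rightarrow> complex"
  assumes "holo U G" "open U" "z \<in> U"
  shows "(G has_derivative (\<lambda>h. \<Sum>i\<in>UNIV. cpartial i G z * h $ i)) (at z)"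
proof -
  have "\<exists>d>0. \<forall>w\<in>ball z d. \<forall>h. (\<forall>i. i \<notin> I \<longrightarrow> h $ i = 0) \<and> norm h < d \<longrightarrow>
     norm (G (w + h) - G w - (\<Sum>i\<in>I. cpartial i G z * h $ i)) \<le> e * (\<Sum>i\<in>I. norm (h $ i))"
    if "e > 0" for e I
    using finite[of I]
  proof (induction I rule: finite_induct)
    case empty
    have "h = 0" if "\<forall>i. h $ i = 0" for h :: "complex^'n" using that by (simp add: vec_eq_iff)
    then show ?case by (intro exI[of _ 1]) force
  next
    case (insert j I)
    then obtain d1 where d1: "d1 > 0" and IH:
      "\<And>w h. w \<in> ball z d1 \<Longrightarrow> (\<forall>i. i \<notin> I \<longrightarrow> h $ i = 0) \<Longrightarrow> norm h < d1 \<Longrightarrow>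
        norm (G (w + h) - G w - (\<Sum>i\<in>I. cpartial i G z * h $ i)) \<le> e * (\<Sum>i\<in>I. norm (h $ i))"
      by blast
    have "continuous_on U (cpartial j G)"
      using holo_cpartial[OF assms(1,2)] holo_continuous by blast
    then have "continuous (at z) (cpartial j G)"
      using assms by (simp add: continuous_on_eq_continuous_at)
    then obtain d2 where d2: "d2 > 0" "\<And>w. w \<in> ball z d2 \<Longrightarrow> norm (cpartial j G w - cpartial j G z) < e"
      using \<open>e > 0\<close> unfolding continuous_at_eps_delta by (auto simp: dist_norm norm_minus_commute)
    obtain d3 where d3: "d3 > 0" "ball z d3 \<subseteq> U"
      using assms open_contains_ball by blast
    \<comment> \<open>The distance of the base point from \<open>z\<close>, the part
      \<open>h'\<close> and the step along the axis \<open>j\<close> are each below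
      \<open>d\<close>, so every point met lies in \<open>ball z (3 * d)\<close>.\<close>
    define d where "d = Min {d1, d2, d3} / 3"
    have d: "d > 0" "3 * d \<le> d1" "3 * d \<le> d2" "3 * d \<le> d3" using d1 d2(1) d3(1) by (auto simp: d_def)
    have "norm (G (w + h) - G w - (\<Sum>i\<in>insert j I. cpartial i G z * h $ i))
             \<le> e * (\<Sum>i\<in>insert j I. norm (h $ i))"
      if w: "w \<in> ball z d" and h: "\<forall>i. i \<notin> insert j I \<longrightarrow> h $ i = 0" "norm h < d" for w h
    proof -
      define k where "k = axis j (h $ j)"
      define h' where "h' = h - k"
      have hk: "h = h' + k" by (simp add: h'_def)
      have h'I: "h' $ i = h $ i" if "i \<in> I" for i
        using that insert.hyps by (auto simp: h'_def k_def axis_def)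
      have h'0: "h' $ i = 0" if "i \<notin> I" for i
        using that h by (cases "i = j") (auto simp: h'_def k_def axis_def)
      have nh': "norm h' \<le> norm h"
        unfolding norm_vec_def by (rule L2_set_mono) (auto simp: h'_def k_def axis_def)
      have nk: "norm (h $ j) \<le> norm h" by (rule Finite_Cartesian_Product.norm_nth_le)
      define w' where "w' = w + h'"
      have w'1: "dist z w' < 2 * d"
        using w nh' h norm_triangle_ineq[of "w - z" h'] unfolding w'_def dist_norm mem_ball
        by (simp add: norm_minus_commute algebra_simps)
      have seg: "w' + axis j s \<in> ball z (3 * d)" if "norm s \<le> norm (h $ j)" for s :: complex
        using that nk h w'1 norm_triangle_ineq[of "w' - z" "axis j s"] unfolding dist_norm mem_ball
        by (simp add: norm_minus_commute algebra_simps)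
      have one: "norm (G (w' + axis j (h $ j)) - cpartial j G z * h $ j - (G (w' + axis j 0) - cpartial j G z * 0)) \<le> e * norm (h $ j - 0)"
      proof (rule field_differentiable_bound[where S = "cball 0 (norm (h $ j))"
            and f = "\<lambda>s. G (w' + axis j s) - cpartial j G z * s"
            and f' = "\<lambda>s. cpartial j G (w' + axis j s) - cpartial j G z"])
        fix s :: complex assume "s \<in> cball 0 (norm (h $ j))"
        then have s: "w' + axis j s \<in> ball z (3 * d)" using seg by simp
        then have sU: "w' + axis j s \<in> U" using d d3 by auto
        show "((\<lambda>s. G (w' + axis j s) - cpartial j G z * s) has_field_derivative cpartial j G (w' + axis j s) - cpartial j G z)
           (at s within cball 0 (norm (h $ j)))"
          using DERIV_subset[OF holo_has_cpartial[OF assms(1) sU]]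
          by (auto intro!: derivative_eq_intros)
        show "norm (cpartial j G (w' + axis j s) - cpartial j G z) \<le> e"
          using d2(2)[of "w' + axis j s"] s d by (auto intro: less_imp_le)
      qed auto
      have two: "norm (G (w + h') - G w - (\<Sum>i\<in>I. cpartial i G z * h' $ i)) \<le> e * (\<Sum>i\<in>I. norm (h' $ i))"
        by (rule IH) (use w d nh' h h'0 in auto)
      have "G (w + h) - G w - (\<Sum>i\<in>insert j I. cpartial i G z * h $ i)
         = (G (w' + axis j (h $ j)) - cpartial j G z * h $ j - (G (w' + axis j 0) - cpartial j G z * 0))
         + (G (w + h') - G w - (\<Sum>i\<in>I. cpartial i G z * h' $ i))"
      proof -
        have "G (w + h) = G (w' + axis j (h $ j))" by (simp add: w'_def h'_def k_def)
        moreover have "(\<Sum>i\<in>I. cpartial i G z * h $ i) = (\<Sum>i\<in>I. cpartial i G z * h' $ i)"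
          using h'I by (intro sum.cong) auto
        ultimately show ?thesis using insert.hyps by (simp add: w'_def)
      qed
      also have "norm \<dots> \<le> e * norm (h $ j) + e * (\<Sum>i\<in>I. norm (h' $ i))"
        using norm_triangle_mono[OF one two] by simp
      also have "\<dots> = e * (\<Sum>i\<in>insert j I. norm (h $ i))"
        using insert.hyps h'I by (simp add: algebra_simps)
      finally show ?thesis .
    qed
    then show ?case using d(1) by blast
  qed
  note * = this[of _ UNIV, simplified]
  have bl: "bounded_linear (\<lambda>h. \<Sum>i\<in>UNIV. cpartial i G z * h $ i)"
    by (intro bounded_linear_sum bounded_linear_mult_right[THEN bounded_linear_compose] bounded_linear_vec_nth)
  show ?thesis
    unfolding has_derivative_at_alt
  proof (intro conjI bl allI impI)
    fix e :: real assume "e > 0"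
    define e' where "e' = e / real CARD('n)"
    have e': "e' > 0" using \<open>e > 0\<close> by (simp add: e'_def)
    obtain d where d: "d > 0" "\<And>w h. w \<in> ball z d \<Longrightarrow> norm h < d \<Longrightarrow>
       norm (G (w + h) - G w - (\<Sum>i\<in>UNIV. cpartial i G z * h $ i)) \<le> e' * (\<Sum>i\<in>UNIV. norm (h $ i))"
      using *[OF e'] by auto
    have "norm (G y - G z - (\<Sum>i\<in>UNIV. cpartial i G z * (y - z) $ i)) \<le> e * norm (y - z)" if "norm (y - z) < d" for y
    proof -
      have "norm (G y - G z - (\<Sum>i\<in>UNIV. cpartial i G z * (y - z) $ i)) \<le> e' * (\<Sum>i\<in>UNIV. norm ((y - z) $ i))"
        using d(2)[of z "y - z"] that d(1) by simp
      also have "\<dots> \<le> e' * (\<Sum>i\<in>(UNIV::'n set). norm (y - z))"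
        using e' by (intro mult_left_mono sum_mono Finite_Cartesian_Product.norm_nth_le) auto
      also have "\<dots> = e * norm (y - z)" by (simp add: e'_def)
      finally show ?thesis .
    qed
    with d(1) show "\<exists>d>0. \<forall>y. norm (y - z) < d \<longrightarrow>
        norm (G y - G z - (\<Sum>i\<in>UNIV. cpartial i G z * (y - z) $ i)) \<le> e * norm (y - z)" by blast
  qed
qed

section \<open>Power series on polydiscs\<close>

definition polydisc :: "complex^'n \<Rightarrow> real \<Rightarrow> (complex^'n) set" where
  "polydisc a r = {z. \<forall>i. norm (z $ i - a $ i) < r}"

lemma open_polydisc: "open (polydisc a r)"
proof -
  have "polydisc a r = (\<Inter>i\<in>UNIV. {z. norm (z $ i - a $ i) < r})"
    by (auto simp: polydisc_def)
  moreover have "open {z. norm (z $ i - a $ i) < r}" for i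
    by (intro open_Collect_less continuous_intros)
  ultimately show ?thesis by auto
qed

lemma centre_in_polydisc [simp]: "r > 0 \<Longrightarrow> a \<in> polydisc a r"
  by (simp add: polydisc_def)

lemma polydisc_mono: "r \<le> s \<Longrightarrow> polydisc a r \<subseteq> polydisc a s"
  by (auto simp: polydisc_def intro: less_le_trans)

lemma polydisc_subset_ball:
  fixes a :: "complex^'n"
  shows "polydisc a (r / real CARD('n)) \<subseteq> ball a r"
proof
  fix z assume z: "z \<in> polydisc a (r / real CARD('n))"
  have "norm (z - a) \<le> (\<Sum>i\<in>UNIV. norm ((z - a) $ i))"
    by (simp add: norm_vec_def L2_set_le_sum)
  also have "\<dots> < (\<Sum>i\<in>(UNIV::'n set). r / real CARD('n))"
    using z by (intro sum_strict_mono) (auto simp: polydisc_def)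
  also have "\<dots> = r" by simp
  finally show "z \<in> ball a r" by (simp add: dist_norm norm_minus_commute)
qed

lemma holo_cpartial_funpow: "holo U G \<Longrightarrow> open U \<Longrightarrow> holo U ((cpartial i ^^ k) G)"
  by (induction k) (auto intro: holo_cpartial)

lemma higher_deriv_line:
  assumes "holo U G" "open U" "z + axis i h \<in> U"
  shows "(deriv ^^ k) (\<lambda>h. G (z + axis i h)) h = (cpartial i ^^ k) G (z + axis i h)"
  using assms(3)
proof (induction k arbitrary: h)
  case (Suc k)
  have "open {h. z + axis i h \<in> U}" using assms(2) by (rule open_line)
  then have "eventually (\<lambda>h. h \<in> {h. z + axis i h \<in> U}) (nhds h)"
    using Suc.prems by (intro eventually_nhds_in_open) auto
  then have "eventually (\<lambda>h. (deriv ^^ k) (\<lambda>h. G (z + axis i h)) h = (cpartial i ^^ k) G (z + axis i h)) (nhds h)"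
    by (rule eventually_mono) (use Suc.IH in auto)
  then have "deriv ((deriv ^^ k) (\<lambda>h. G (z + axis i h))) h = deriv (\<lambda>h. (cpartial i ^^ k) G (z + axis i h)) h"
    by (rule deriv_cong_ev) simp
  then show ?case
    using deriv_line[OF holo_cpartial_funpow[OF assms(1,2)] Suc.prems] by simp
qed simp

text \<open>Setting the coordinate \<open>j\<close> to \<open>b\<close> makes a function constant in
  that coordinate and leaves it holomorphic in the others; the Taylor coefficients with respect to
  the variable \<open>j\<close> have this form.\<close>

lemma holo_freeze:
  assumes "holo U H" and sub: "\<And>z. z \<in> U \<Longrightarrow> z + axis j (b - z $ j) \<in> U"
  shows "holo U (\<lambda>z. H (z + axis j (b - z $ j)))"
  unfolding holo_def
proof (intro conjI ballI allI)
  show "continuous_on U (\<lambda>z. H (z + axis j (b - z $ j)))"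
    by (rule continuous_on_compose2[OF holo_continuous[OF assms(1)]])
       (use sub in \<open>auto intro!: continuous_intros\<close>)
next
  fix z i assume z: "z \<in> U"
  show "(\<lambda>h. H (z + axis i h + axis j (b - (z + axis i h) $ j))) field_differentiable (at 0)"
  proof (cases "i = j")
    case True
    have "z + axis i h + axis j (b - (z + axis i h) $ j) = z + axis j (b - z $ j)" for h
      using True by (auto simp: vec_eq_iff axis_def)
    then show ?thesis by (simp only: field_differentiable_const)
  next
    case False
    have eq: "z + axis i h + axis j (b - (z + axis i h) $ j) = (z + axis j (b - z $ j)) + axis i h" for h
      using False by (auto simp: vec_eq_iff axis_def)
    show ?thesis using assms(1) sub[OF z] unfolding holo_def eq by blast
  qed
qed

text \<open>Multi-indices over \<open>I\<close> are total functions vanishing off \<open>I\<close>: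
  adding a coordinate is a function update, and for all coordinates the whole type results.\<close>

definition supported :: "'n set \<Rightarrow> ('n \<Rightarrow> nat) set" where
  "supported I = {\<alpha>. \<forall>i. i \<notin> I \<longrightarrow> \<alpha> i = 0}"

lemma supported_UNIV [simp]: "supported UNIV = UNIV"
  by (simp add: supported_def)

lemma supported_empty: "supported {} = {\<lambda>_. 0}"
  by (auto simp: supported_def)

lemma has_sum_supported_insert:
  assumes "j \<notin> I"
  shows "(F has_sum S) (supported (insert j I)) \<longleftrightarrow>
     ((\<lambda>(\<alpha>,k). F (\<alpha>(j := k))) has_sum S) (supported I \<times> UNIV)"
proof -
  have "bij_betw (\<lambda>(\<alpha>,k). \<alpha>(j := k)) (supported I \<times> UNIV) (supported (insert j I))"
    by (rule bij_betwI[where g = "\<lambda>\<alpha>. (\<alpha>(j := 0), \<alpha> j)"])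
       (use assms in \<open>auto simp: supported_def fun_eq_iff\<close>)
  from has_sum_reindex_bij_betw[OF this, of F S] show ?thesis
    by (simp add: case_prod_unfold)
qed

lemma summable_on_supported_insert:
  assumes "j \<notin> I"
  shows "F summable_on (supported (insert j I)) \<longleftrightarrow>
     (\<lambda>(\<alpha>,k). F (\<alpha>(j := k))) summable_on (supported I \<times> UNIV)"
  by (simp add: summable_on_def has_sum_supported_insert[OF assms])

lemma summable_on_geometric_product:
  fixes t :: "'n::finite \<Rightarrow> real"
  assumes "\<And>i. 0 \<le> t i" "\<And>i. t i < 1"
  shows "(\<lambda>\<alpha>. \<Prod>i\<in>I. t i ^ \<alpha> i) summable_on supported I"
  using finite[of I]
proof (induction I rule: finite_induct)
  case empty
  then show ?case by (simp add: supported_empty)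
next
  case (insert j I)
  have s2: "(\<lambda>k. t j ^ k) summable_on (UNIV :: nat set)"
    using assms by (intro norm_summable_imp_summable_on) (simp add: summable_geometric power_abs)
  have "(\<lambda>(\<alpha>, k). (\<Prod>i\<in>I. t i ^ \<alpha> i) * t j ^ k) summable_on (supported I \<times> UNIV)"
  proof (rule summable_on_SigmaI)
    show "((\<lambda>k. case (\<alpha>, k) of (\<alpha>, k) \<Rightarrow> (\<Prod>i\<in>I. t i ^ \<alpha> i) * t j ^ k) has_sum
         (\<Prod>i\<in>I. t i ^ \<alpha> i) * infsum (\<lambda>k. t j ^ k) UNIV) UNIV" for \<alpha>
      using s2 by (simp add: has_sum_cmult_right)
    show "(\<lambda>\<alpha>. (\<Prod>i\<in>I. t i ^ \<alpha> i) * infsum (\<lambda>k. t j ^ k) UNIV) summable_on supported I"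
      by (intro summable_on_cmult_left insert.IH)
  qed (auto intro!: mult_nonneg_nonneg prod_nonneg zero_le_power assms)
  moreover have "(\<Prod>i\<in>insert j I. t i ^ (\<alpha>(j := k)) i) = (\<Prod>i\<in>I. t i ^ \<alpha> i) * t j ^ k" for \<alpha> k
  proof -
    have "(\<Prod>i\<in>I. t i ^ (\<alpha>(j := k)) i) = (\<Prod>i\<in>I. t i ^ \<alpha> i)"
      using insert.hyps by (intro prod.cong) auto
    then show ?thesis using insert.hyps by (simp add: mult.commute)
  qed
  ultimately show ?case
    unfolding summable_on_supported_insert[OF insert.hyps(2)] by simp
qed

text \<open>Induction over the coordinates already expanded: \<open>c \<alpha>\<close> is still a
  function of \<open>z\<close>, constant in the coordinates of \<open>I\<close>, and is expanded by
  the one-variable Taylor series in the next coordinate \<open>j\<close>. The Cauchy bounds give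
  absolute summability, so the iterated sum is a sum over multi-indices.\<close>

lemma holo_power_series_aux:
  fixes G :: "complex^'n \<Rightarrow> complex"
  assumes "holo (polydisc a r) G" "0 < s" "s < r" and M: "\<And>z. z \<in> polydisc a r \<Longrightarrow> norm (G z) \<le> M"
  shows "\<exists>c. (\<forall>\<alpha>. holo (polydisc a r) (c \<alpha>)) \<and>
     (\<forall>\<alpha>. \<forall>z\<in>polydisc a r. norm (c \<alpha> z) \<le> M / s ^ (\<Sum>i\<in>I. \<alpha> i)) \<and>
     (\<forall>\<alpha> z w. (\<forall>i. i \<notin> I \<longrightarrow> z $ i = w $ i) \<longrightarrow> z \<in> polydisc a r \<longrightarrow> w \<in> polydisc a r \<longrightarrow> c \<alpha> z = c \<alpha> w) \<and>
     (\<forall>z\<in>polydisc a s. ((\<lambda>\<alpha>. c \<alpha> z * (\<Prod>i\<in>I. (z $ i - a $ i) ^ \<alpha> i)) has_sum G z) (supported I))"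
  using finite[of I]
proof (induction I rule: finite_induct)
  case empty
  have "((\<lambda>\<alpha>. G z * (\<Prod>i\<in>{}. (z $ i - a $ i) ^ \<alpha> i)) has_sum G z) (supported {})" for z
    using has_sum_finite[of "{\<lambda>_::'n. 0::nat}" "\<lambda>\<alpha>. G z"] by (simp add: supported_empty)
  moreover have "z = w" if "\<forall>i. z $ i = w $ i" for z w :: "complex^'n" using that by (simp add: vec_eq_iff)
  ultimately show ?case using assms by (intro exI[of _ "\<lambda>_. G"]) auto
next
  case (insert j I)
  define U where "U = polydisc a r"
  have "open U" by (simp add: U_def open_polydisc)
  obtain c where c: "\<And>\<alpha>. holo U (c \<alpha>)"
    "\<And>\<alpha> z. z \<in> U \<Longrightarrow> norm (c \<alpha> z) \<le> M / s ^ (\<Sum>i\<in>I. \<alpha> i)"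
    "\<And>\<alpha> z w. (\<And>i. i \<notin> I \<Longrightarrow> z $ i = w $ i) \<Longrightarrow> z \<in> U \<Longrightarrow> w \<in> U \<Longrightarrow> c \<alpha> z = c \<alpha> w"
    "\<And>z. z \<in> polydisc a s \<Longrightarrow> ((\<lambda>\<alpha>. c \<alpha> z * (\<Prod>i\<in>I. (z $ i - a $ i) ^ \<alpha> i)) has_sum G z) (supported I)"
    using insert.IH unfolding U_def by blast
  \<comment> \<open>\<open>p z\<close> has the coordinate \<open>j\<close> moved to the centre; the
    one-variable series is taken along the axis \<open>j\<close> from there.\<close>
  define p where "p z = z + axis j (a $ j - z $ j)" for z :: "complex^'n"
  have pU: "p z + axis j h \<in> U" if "z \<in> U" "norm h < r" for z h
    using that by (auto simp: p_def U_def polydisc_def axis_def)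
  have pU0: "p z \<in> U" if "z \<in> U" for z using pU[OF that, of 0] assms by simp
  define d where "d \<alpha> z = (cpartial j ^^ \<alpha> j) (c (\<alpha>(j := 0))) (p z) / fact (\<alpha> j)" for \<alpha> z
  have 1: "holo U (d \<alpha>)" for \<alpha>
  proof -
    have "holo U (\<lambda>z. (cpartial j ^^ \<alpha> j) (c (\<alpha>(j := 0))) (p z))"
      unfolding p_def by (rule holo_freeze[OF holo_cpartial_funpow[OF c(1) \<open>open U\<close>]]) (use pU0 p_def in auto)
    from holo_cmult[OF this, of "1 / fact (\<alpha> j)"] show ?thesis by (simp add: d_def[abs_def])
  qed
  have line: "(\<lambda>h. c \<alpha> (p z + axis j h)) holomorphic_on ball 0 r" if "z \<in> U" for \<alpha> z
    by (rule holomorphic_on_subset[OF holo_line[OF c(1)]]) (use that pU in auto)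
  have hd: "(deriv ^^ k) (\<lambda>h. c \<alpha> (p z + axis j h)) 0 = (cpartial j ^^ k) (c \<alpha>) (p z)" if "z \<in> U" for \<alpha> z k
    using higher_deriv_line[OF c(1) \<open>open U\<close>, of "p z" j 0] pU0[OF that] by simp
  have 2: "norm (d \<alpha> z) \<le> M / s ^ (\<Sum>i\<in>insert j I. \<alpha> i)" if "z \<in> U" for \<alpha> z
  proof -
    define \<beta> where "\<beta> = \<alpha>(j := 0)"
    have "norm ((deriv ^^ \<alpha> j) (\<lambda>h. c \<beta> (p z + axis j h)) 0) \<le> fact (\<alpha> j) * (M / s ^ (\<Sum>i\<in>I. \<beta> i)) / s ^ \<alpha> j"
    proof (rule Cauchy_inequality)
      show "(\<lambda>h. c \<beta> (p z + axis j h)) holomorphic_on ball 0 s"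
        using assms by (intro holomorphic_on_subset[OF line[OF that]]) auto
      have "(\<lambda>h. c \<beta> (p z + axis j h)) holomorphic_on cball 0 s"
        using assms by (intro holomorphic_on_subset[OF line[OF that]]) auto
      then show "continuous_on (cball 0 s) (\<lambda>h. c \<beta> (p z + axis j h))"
        by (rule holomorphic_on_imp_continuous_on)
      fix h :: complex assume "norm (0 - h) = s"
      then show "norm (c \<beta> (p z + axis j h)) \<le> M / s ^ (\<Sum>i\<in>I. \<beta> i)"
        using pU[OF that, of h] assms by (intro c(2)) auto
    qed (use assms in auto)
    moreover have "(\<Sum>i\<in>I. \<beta> i) = (\<Sum>i\<in>I. \<alpha> i)"
      using insert.hyps by (intro sum.cong) (auto simp: \<beta>_def)
    ultimately have "norm ((cpartial j ^^ \<alpha> j) (c \<beta>) (p z)) \<le> fact (\<alpha> j) * (M / (s ^ (\<Sum>i\<in>I. \<alpha> i) * s ^ \<alpha> j))"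
      using hd[OF that] by simp
    then show ?thesis
      using insert.hyps by (simp add: d_def \<beta>_def[symmetric] norm_divide power_add field_simps)
  qed
  have 3: "d \<alpha> z = d \<alpha> w" if "\<And>i. i \<notin> insert j I \<Longrightarrow> z $ i = w $ i" "z \<in> U" "w \<in> U" for \<alpha> z w
  proof -
    have eq: "c \<beta> (p z + axis j h) = c \<beta> (p w + axis j h)" if "norm h < r" for h \<beta>
      using that \<open>z \<in> U\<close> \<open>w \<in> U\<close> \<open>\<And>i. i \<notin> insert j I \<Longrightarrow> z $ i = w $ i\<close>
      by (intro c(3) pU) (auto simp: p_def axis_def)
    have "eventually (\<lambda>h. h \<in> ball 0 r) (nhds (0::complex))"
      using assms by (intro eventually_nhds_in_open) auto
    then have "eventually (\<lambda>h. c \<beta> (p z + axis j h) = c \<beta> (p w + axis j h)) (nhds 0)" for \<beta>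
      by (rule eventually_mono) (use eq in auto)
    then have "(deriv ^^ k) (\<lambda>h. c \<beta> (p z + axis j h)) 0 = (deriv ^^ k) (\<lambda>h. c \<beta> (p w + axis j h)) 0" for \<beta> k
      by (rule higher_deriv_cong_ev) simp
    then show ?thesis using that hd by (simp add: d_def)
  qed
  have 4: "((\<lambda>\<alpha>. d \<alpha> z * (\<Prod>i\<in>insert j I. (z $ i - a $ i) ^ \<alpha> i)) has_sum G z) (supported (insert j I))"
    if z: "z \<in> polydisc a s" for z
  proof -
    have zU: "z \<in> U" using z assms polydisc_mono[of s r a] by (auto simp: U_def)
    define t where "t i = norm (z $ i - a $ i) / s" for i
    have t: "0 \<le> t i" "t i < 1" for i using z assms by (auto simp: t_def polydisc_def)
    define F where "F \<alpha> = d \<alpha> z * (\<Prod>i\<in>insert j I. (z $ i - a $ i) ^ \<alpha> i)" for \<alpha>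
    have "M \<ge> 0" using M[of a] norm_ge_zero[of "G a"] assms by (smt (verit) centre_in_polydisc)
    have "norm (F \<alpha>) \<le> M * (\<Prod>i\<in>insert j I. t i ^ \<alpha> i)" for \<alpha>
    proof -
      have "norm (F \<alpha>) \<le> M / s ^ (\<Sum>i\<in>insert j I. \<alpha> i) * norm (\<Prod>i\<in>insert j I. (z $ i - a $ i) ^ \<alpha> i)"
        unfolding F_def norm_mult by (intro mult_right_mono 2 zU) auto
      also have "\<dots> = M * (\<Prod>i\<in>insert j I. t i ^ \<alpha> i)"
        unfolding t_def power_divide prod_dividef
        by (simp add: prod_norm[symmetric] norm_power power_sum)
      finally show ?thesis .
    qed
    moreover have "(\<lambda>\<alpha>. M * (\<Prod>i\<in>insert j I. t i ^ \<alpha> i)) summable_on supported (insert j I)"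
      by (intro summable_on_cmult_right summable_on_geometric_product t)
    ultimately have "(\<lambda>\<alpha>. norm (F \<alpha>)) summable_on supported (insert j I)"
      by (intro summable_on_comparison_test[where g = "\<lambda>\<alpha>. norm (F \<alpha>)"]) auto
    then have Fsum: "F summable_on supported (insert j I)"
      by (rule abs_summable_summable)
    have inner: "((\<lambda>k. F (\<alpha>(j := k))) has_sum c \<alpha> z * (\<Prod>i\<in>I. (z $ i - a $ i) ^ \<alpha> i)) UNIV"
      if \<alpha>: "\<alpha> \<in> supported I" for \<alpha>
    proof -
      have \<alpha>0: "\<alpha>(j := 0) = \<alpha>" using \<alpha> insert.hyps by (auto simp: supported_def fun_eq_iff)
      have zp: "z = p z + axis j (z $ j - a $ j)" by (auto simp: p_def vec_eq_iff axis_def)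
      have *: "(\<lambda>k. (deriv ^^ k) (\<lambda>h. c \<alpha> (p z + axis j h)) 0 / fact k * ((z $ j - a $ j) - 0) ^ k) sums
          (\<lambda>h. c \<alpha> (p z + axis j h)) (z $ j - a $ j)"
        by (rule holomorphic_power_series[OF line[OF zU]]) (use zU in \<open>auto simp: U_def polydisc_def\<close>)
      have sums: "(\<lambda>k. d (\<alpha>(j := k)) z * (z $ j - a $ j) ^ k) sums c \<alpha> z"
      proof -
        have 1: "(deriv ^^ k) (\<lambda>h. c \<alpha> (p z + axis j h)) 0 / fact k = d (\<alpha>(j := k)) z" for k
          unfolding d_def fun_upd_same fun_upd_upd \<alpha>0 hd[OF zU] ..
        have 2: "c \<alpha> (p z + axis j (z $ j - a $ j)) = c \<alpha> z"
          by (rule arg_cong[OF zp[symmetric]])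
        show ?thesis using * unfolding 1 2 diff_zero .
      qed
      have "(\<lambda>k. F (\<alpha>(j := k))) = (\<lambda>k. d (\<alpha>(j := k)) z * (z $ j - a $ j) ^ k * (\<Prod>i\<in>I. (z $ i - a $ i) ^ \<alpha> i))"
      proof
        fix k
        have "(\<Prod>i\<in>I. (z $ i - a $ i) ^ (\<alpha>(j := k)) i) = (\<Prod>i\<in>I. (z $ i - a $ i) ^ \<alpha> i)"
          using insert.hyps by (intro prod.cong) auto
        then show "F (\<alpha>(j := k)) = d (\<alpha>(j := k)) z * (z $ j - a $ j) ^ k * (\<Prod>i\<in>I. (z $ i - a $ i) ^ \<alpha> i)"
          unfolding F_def using insert.hyps by simp
      qed
      then have F_sums: "(\<lambda>k. F (\<alpha>(j := k))) sums (c \<alpha> z * (\<Prod>i\<in>I. (z $ i - a $ i) ^ \<alpha> i))"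
        using sums_mult2[OF sums] by simp
      \<comment> \<open>The Taylor series only gives ordered convergence through
        \<open>sums\<close>; unordered summability is taken from the double family, and the two
        values must agree.\<close>
      have "(\<lambda>(\<alpha>,k). F (\<alpha>(j := k))) summable_on (supported I \<times> UNIV)"
        using Fsum summable_on_supported_insert[OF insert.hyps(2)] by blast
      from summable_on_SigmaD1[OF this \<alpha>]
      have "(\<lambda>k. F (\<alpha>(j := k))) summable_on UNIV" by simp
      then obtain S where S: "((\<lambda>k. F (\<alpha>(j := k))) has_sum S) UNIV" by (auto simp: summable_on_def)
      then have "S = c \<alpha> z * (\<Prod>i\<in>I. (z $ i - a $ i) ^ \<alpha> i)"
        using F_sums has_sum_imp_sums sums_unique2 by blast
      with S show ?thesis by simp
    qed
    have "((\<lambda>(\<alpha>,k). F (\<alpha>(j := k))) has_sum G z) (supported I \<times> UNIV)"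
    proof (rule has_sum_SigmaI)
      show "(\<lambda>(\<alpha>,k). F (\<alpha>(j := k))) summable_on (supported I \<times> UNIV)"
        using Fsum summable_on_supported_insert[OF insert.hyps(2)] by blast
      show "((\<lambda>\<alpha>. c \<alpha> z * (\<Prod>i\<in>I. (z $ i - a $ i) ^ \<alpha> i)) has_sum G z) (supported I)"
        by (rule c(4)[OF z])
    qed (use inner in auto)
    then show ?thesis
      unfolding has_sum_supported_insert[OF insert.hyps(2)] F_def[symmetric] .
  qed
  show ?case
    using 1 2 3 4 unfolding U_def by (intro exI[of _ d]) blast
qed

theorem holo_power_series:
  fixes G :: "complex^'n \<Rightarrow> complex"
  assumes "holo (polydisc a r) G" "0 < s" "s < r" "\<And>z. z \<in> polydisc a r \<Longrightarrow> norm (G z) \<le> M"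
  obtains c where "\<And>\<alpha>. norm (c \<alpha>) \<le> M / s ^ (\<Sum>i\<in>UNIV. \<alpha> i)"
    "\<And>z. z \<in> polydisc a s \<Longrightarrow> ((\<lambda>\<alpha>. c \<alpha> * (\<Prod>i\<in>UNIV. (z $ i - a $ i) ^ \<alpha> i)) has_sum G z) UNIV"
proof -
  obtain c where c: "\<And>\<alpha> z. z \<in> polydisc a r \<Longrightarrow> norm (c \<alpha> z) \<le> M / s ^ (\<Sum>i\<in>UNIV. \<alpha> i)"
     "\<And>\<alpha> z w. z \<in> polydisc a r \<Longrightarrow> w \<in> polydisc a r \<Longrightarrow> c \<alpha> z = c \<alpha> w"
     "\<And>z. z \<in> polydisc a s \<Longrightarrow> ((\<lambda>\<alpha>. c \<alpha> z * (\<Prod>i\<in>UNIV. (z $ i - a $ i) ^ \<alpha> i)) has_sum G z) UNIV"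
    using holo_power_series_aux[OF assms, of UNIV] unfolding supported_UNIV by blast
  have a: "a \<in> polydisc a r" using assms by simp
  have sub: "polydisc a s \<subseteq> polydisc a r" using assms by (intro polydisc_mono) simp
  show thesis
  proof (rule that[of "\<lambda>\<alpha>. c \<alpha> a"])
    fix z assume z: "z \<in> polydisc a s"
    then have "c \<alpha> a = c \<alpha> z" for \<alpha> using c(2) a sub by blast
    then show "((\<lambda>\<alpha>. c \<alpha> a * (\<Prod>i\<in>UNIV. (z $ i - a $ i) ^ \<alpha> i)) has_sum G z) UNIV"
      using c(3)[OF z] by simp
  qed (use c(1) a in auto)
qed

section \<open>Real functions with a local holomorphic extension\<close>

definition cvec :: "real^'n \<Rightarrow> complex^'n" where
  "cvec x = (\<chi> i. of_real (x $ i))"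

lemma cvec_nth [simp]: "cvec x $ i = of_real (x $ i)"
  by (simp add: cvec_def)

lemma bounded_linear_cvec: "bounded_linear cvec"
proof (rule bounded_linear_intro[where K = 1])
  show "norm (cvec x) \<le> norm x * 1" for x :: "real^'n"
    by (simp add: norm_vec_def)
next
  show "cvec (r *\<^sub>R x) = r *\<^sub>R cvec x" for r and x :: "real^'n"
    by (simp add: vec_eq_iff) (simp add: scaleR_conv_of_real)
qed (simp add: vec_eq_iff)

lemma continuous_on_cvec [continuous_intros]: "continuous_on S f \<Longrightarrow> continuous_on S (\<lambda>x. cvec (f x))"
  by (rule bounded_linear.continuous_on[OF bounded_linear_cvec])

lemma open_cvec_vimage: "open U \<Longrightarrow> open {x. cvec x \<in> U}"
  using open_vimage[of U cvec] continuous_on_cvec[OF continuous_on_id, of UNIV] by (simp add: vimage_def)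

lemma cvec_diff: "cvec (x - y) = cvec x - cvec y"
  by (simp add: vec_eq_iff)

lemma cvec_in_polydisc: "x \<in> ball a r \<Longrightarrow> cvec x \<in> polydisc (cvec a) r"
proof -
  assume "x \<in> ball a r"
  moreover have "norm (x $ i - a $ i) \<le> norm (x - a)" for i
    using Finite_Cartesian_Product.norm_nth_le[of "x - a" i] by simp
  ultimately show ?thesis
    unfolding polydisc_def mem_ball dist_norm
    by (auto simp: norm_minus_commute simp flip: of_real_diff intro: le_less_trans)
qed

lemma has_derivative_Re_holo:
  fixes u :: "real^'n \<Rightarrow> real"
  assumes "holo U G" "open U" "cvec x \<in> U" "\<And>y. cvec y \<in> U \<Longrightarrow> u y = Re (G (cvec y))"
  shows "(u has_derivative (\<lambda>h. \<Sum>i\<in>UNIV. Re (cpartial i G (cvec x)) * h $ i)) (at x)"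
proof -
  have "((\<lambda>y. G (cvec y)) has_derivative (\<lambda>h. \<Sum>i\<in>UNIV. cpartial i G (cvec x) * cvec h $ i)) (at x)"
    by (rule has_derivative_compose[OF bounded_linear.has_derivative[OF bounded_linear_cvec has_derivative_ident]
          holo_has_derivative[OF assms(1-3)]])
  then have "((\<lambda>y. Re (G (cvec y))) has_derivative (\<lambda>h. Re (\<Sum>i\<in>UNIV. cpartial i G (cvec x) * cvec h $ i))) (at x)"
    by (rule bounded_linear.has_derivative[OF bounded_linear_Re])
  moreover have "open {y. cvec y \<in> U}" using assms(2) by (rule open_cvec_vimage)
  ultimately have "(u has_derivative (\<lambda>h. Re (\<Sum>i\<in>UNIV. cpartial i G (cvec x) * cvec h $ i))) (at x)"
    by (rule has_derivative_transform_within_open) (use assms in auto)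
  then show ?thesis by simp
qed

lemma partial_eqI:
  assumes "(u has_derivative (\<lambda>h. \<Sum>i\<in>UNIV. d i * h $ i)) (at x)"
  shows "partial i u x = d i"
proof -
  have "partial i u x = (\<Sum>k\<in>UNIV. d k * axis i 1 $ k)"
    unfolding partial_def frechet_derivative_at[OF assms, symmetric] ..
  also have "\<dots> = d i" by (simp add: axis_def if_distrib cong: if_cong)
  finally show ?thesis .
qed

lemma partial_Re_holo:
  assumes "holo U G" "open U" "cvec x \<in> U" "\<And>y. cvec y \<in> U \<Longrightarrow> u y = Re (G (cvec y))"
  shows "partial i u x = Re (cpartial i G (cvec x))"
  using partial_eqI[OF has_derivative_Re_holo[OF assms]] .

lemma has_derivative_partial:
  fixes u :: "real^'n \<Rightarrow> real"
  assumes "u differentiable (at x)"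
  shows "(u has_derivative (\<lambda>h. \<Sum>i\<in>UNIV. partial i u x * h $ i)) (at x)"
proof -
  have D: "(u has_derivative frechet_derivative u (at x)) (at x)"
    using assms by (simp add: frechet_derivative_works)
  then interpret L: bounded_linear "frechet_derivative u (at x)" by (rule has_derivative_bounded_linear)
  have "frechet_derivative u (at x) = (\<lambda>h. \<Sum>i\<in>UNIV. partial i u x * h $ i)"
  proof
    fix h :: "real^'n"
    have "h = (\<Sum>i\<in>UNIV. h $ i *\<^sub>R axis i 1)"
      by (simp add: vec_eq_iff axis_def if_distrib cong: if_cong)
    then have "frechet_derivative u (at x) h = frechet_derivative u (at x) (\<Sum>i\<in>UNIV. h $ i *\<^sub>R axis i 1)" by simp
    also have "\<dots> = (\<Sum>i\<in>UNIV. partial i u x * h $ i)"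
      by (simp add: L.sum L.scaleR partial_def mult.commute)
    finally show "frechet_derivative u (at x) h = (\<Sum>i\<in>UNIV. partial i u x * h $ i)" .
  qed
  with D show ?thesis by simp
qed

text \<open>For real-valued functions, local extendability to a holomorphic function of several complex variables is
  equivalent to analyticity, and much easier to manipulate than the power series.\<close>

definition cext :: "(real^'n) set \<Rightarrow> (real^'n \<Rightarrow> real) \<Rightarrow> bool" where
  "cext S u \<longleftrightarrow> (\<forall>a\<in>S. \<exists>r>0. \<exists>G. holo (polydisc (cvec a) r) G \<and>
     (\<forall>x. cvec x \<in> polydisc (cvec a) r \<longrightarrow> u x = Re (G (cvec x))))"

lemma cextE:
  assumes "cext S u" "a \<in> S"
  obtains r G where "r > 0" "holo (polydisc (cvec a) r) G"
    "\<And>x. cvec x \<in> polydisc (cvec a) r \<Longrightarrow> u x = Re (G (cvec x))"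
  using assms unfolding cext_def by blast

lemma cext_differentiable:
  assumes "cext S u" "a \<in> S"
  shows "u differentiable (at a)"
proof -
  obtain r G where "r > 0" "holo (polydisc (cvec a) r) G"
    "\<And>x. cvec x \<in> polydisc (cvec a) r \<Longrightarrow> u x = Re (G (cvec x))"
    using cextE[OF assms] by blast
  then have "(u has_derivative (\<lambda>h. \<Sum>i\<in>UNIV. Re (cpartial i G (cvec a)) * h $ i)) (at a)"
    by (intro has_derivative_Re_holo[OF _ open_polydisc]) auto
  then show ?thesis by (auto simp: differentiable_def)
qed

lemma cext_has_derivative:
  assumes "cext S u" "a \<in> S"
  shows "(u has_derivative (\<lambda>h. \<Sum>i\<in>UNIV. partial i u a * h $ i)) (at a)"
  by (rule has_derivative_partial[OF cext_differentiable[OF assms]])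

lemma cext_partial:
  assumes "cext S u"
  shows "cext S (partial i u)"
  unfolding cext_def
proof
  fix a assume "a \<in> S"
  with assms obtain r G where G: "r > 0" "holo (polydisc (cvec a) r) G"
    "\<And>x. cvec x \<in> polydisc (cvec a) r \<Longrightarrow> u x = Re (G (cvec x))"
    by (elim cextE) auto
  then show "\<exists>r>0. \<exists>G. holo (polydisc (cvec a) r) G \<and>
     (\<forall>x. cvec x \<in> polydisc (cvec a) r \<longrightarrow> partial i u x = Re (G (cvec x)))"
    by (intro exI[of _ r] conjI exI[of _ "cpartial i G"])
       (auto simp: partial_Re_holo open_polydisc intro: holo_cpartial)
qed

lemma cext_continuous_on: "cext S u \<Longrightarrow> continuous_on S u"
  using cext_differentiable differentiable_imp_continuous_within
  by (blast intro: continuous_at_imp_continuous_on)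

lemma cext_Ck_on: "cext S u \<Longrightarrow> Ck_on k S u"
proof (induction k arbitrary: u)
  case (Suc k)
  then show ?case
    using cext_differentiable[OF Suc.prems] cext_partial[OF Suc.prems]
    by (auto simp: differentiable_on_def differentiable_at_imp_differentiable_on
        intro: differentiable_at_withinI)
qed (auto intro: cext_continuous_on)

section \<open>Algebraic closure properties\<close>

lemma holo_const: "holo U (\<lambda>_. c)"
  by (simp add: holo_def)

lemma holo_add: "holo U G \<Longrightarrow> holo U H \<Longrightarrow> holo U (\<lambda>z. G z + H z)"
  by (auto simp: holo_def intro!: continuous_intros field_differentiable_add)

lemma holo_mult: "holo U G \<Longrightarrow> holo U H \<Longrightarrow> holo U (\<lambda>z. G z * H z)"
  by (auto simp: holo_def intro!: continuous_intros field_differentiable_mult)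

lemma holo_diff: "holo U G \<Longrightarrow> holo U H \<Longrightarrow> holo U (\<lambda>z. G z - H z)"
  by (auto simp: holo_def intro!: continuous_intros field_differentiable_diff)

lemma holo_sum: "(\<And>j. j \<in> A \<Longrightarrow> holo U (G j)) \<Longrightarrow> holo U (\<lambda>z. \<Sum>j\<in>A. G j z)"
  by (induction A rule: infinite_finite_induct) (auto intro: holo_add holo_const)

lemma holo_prod: "(\<And>j. j \<in> A \<Longrightarrow> holo U (G j)) \<Longrightarrow> holo U (\<lambda>z. \<Prod>j\<in>A. G j z)"
  by (induction A rule: infinite_finite_induct) (auto intro: holo_mult holo_const)

lemma holo_power: "holo U G \<Longrightarrow> holo U (\<lambda>z. G z ^ k)"
  by (induction k) (auto intro: holo_mult holo_const)

lemma holo_coord: "holo U (\<lambda>z :: complex^'n. z $ i)"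
proof -
  have "(\<lambda>h. z $ i + axis j h $ i) field_differentiable at 0" for z :: "complex^'n" and j
    by (cases "i = j") (auto simp: axis_def intro!: derivative_intros field_differentiable_const field_differentiable_add field_differentiable_ident)
  then show ?thesis by (auto simp: holo_def intro!: continuous_intros)
qed

lemma cext_add:
  assumes "cext S u" "cext S v"
  shows "cext S (\<lambda>x. u x + v x)"
  unfolding cext_def
proof
  fix a assume a: "a \<in> S"
  obtain r G where G: "r > 0" "holo (polydisc (cvec a) r) G"
    "\<And>x. cvec x \<in> polydisc (cvec a) r \<Longrightarrow> u x = Re (G (cvec x))"
    using cextE[OF assms(1) a] by blast
  obtain s H where H: "s > 0" "holo (polydisc (cvec a) s) H"
    "\<And>x. cvec x \<in> polydisc (cvec a) s \<Longrightarrow> v x = Re (H (cvec x))"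
    using cextE[OF assms(2) a] by blast
  define t where "t = min r s"
  have sub: "polydisc (cvec a) t \<subseteq> polydisc (cvec a) r" "polydisc (cvec a) t \<subseteq> polydisc (cvec a) s"
    by (auto simp: t_def intro!: polydisc_mono)
  have "holo (polydisc (cvec a) t) (\<lambda>z. G z + H z)"
    using G(2) H(2) sub by (blast intro: holo_add holo_subset)
  then show "\<exists>r>0. \<exists>G. holo (polydisc (cvec a) r) G \<and>
     (\<forall>x. cvec x \<in> polydisc (cvec a) r \<longrightarrow> u x + v x = Re (G (cvec x)))"
    using G(1,3) H(1,3) subsetD[OF sub(1)] subsetD[OF sub(2)]
    by (intro exI[of _ t] conjI exI[of _ "\<lambda>z. G z + H z"]) (auto simp: t_def)
qed

lemma cext_cmult:
  assumes "cext S u"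
  shows "cext S (\<lambda>x. c * u x)"
  unfolding cext_def
proof
  fix a assume "a \<in> S"
  then obtain r G where G: "r > 0" "holo (polydisc (cvec a) r) G"
    "\<And>x. cvec x \<in> polydisc (cvec a) r \<Longrightarrow> u x = Re (G (cvec x))"
    using cextE[OF assms] by blast
  then show "\<exists>r>0. \<exists>G. holo (polydisc (cvec a) r) G \<and>
     (\<forall>x. cvec x \<in> polydisc (cvec a) r \<longrightarrow> c * u x = Re (G (cvec x)))"
    by (intro exI[of _ r] conjI exI[of _ "\<lambda>z. of_real c * G z"]) (auto intro: holo_cmult)
qed

lemma cext_const: "cext S (\<lambda>_. c)"
  unfolding cext_def by (auto intro!: exI[of _ "1::real"] exI[of _ "\<lambda>_. of_real c"] holo_const)

lemma cext_sum: "(\<And>j. j \<in> A \<Longrightarrow> cext S (u j)) \<Longrightarrow> cext S (\<lambda>x. \<Sum>j\<in>A. u j x)"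
  by (induction A rule: infinite_finite_induct) (auto intro: cext_add cext_const)

lemma cext_subset: "cext S u \<Longrightarrow> T \<subseteq> S \<Longrightarrow> cext T u"
  by (auto simp: cext_def)

lemma holo_bounded_subpolydisc:
  assumes "holo (polydisc a r) G" "s < r"
  obtains M where "\<And>z. z \<in> polydisc a s \<Longrightarrow> norm (G z) \<le> M"
proof -
  define C where "C = {z. \<forall>i. norm (z $ i - a $ i) \<le> s}"
  have "C = (\<Inter>i\<in>UNIV. {z. norm (z $ i - a $ i) \<le> s})" by (auto simp: C_def)
  moreover have "closed {z. norm (z $ i - a $ i) \<le> s}" for i
    by (intro closed_Collect_le continuous_intros)
  ultimately have "closed C" by auto
  moreover have "bounded C"
  proof -
    have "norm z \<le> (\<Sum>i\<in>UNIV. s + norm (a $ i))" if "z \<in> C" for z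
    proof -
      have "norm z \<le> (\<Sum>i\<in>UNIV. norm (z $ i))" by (simp add: norm_vec_def L2_set_le_sum)
      also have "\<dots> \<le> (\<Sum>i\<in>UNIV. s + norm (a $ i))"
      proof (rule sum_mono)
        fix i show "norm (z $ i) \<le> s + norm (a $ i)"
          using that norm_triangle_ineq[of "z $ i - a $ i" "a $ i"] by (auto simp: C_def dest: spec[of _ i])
      qed
      finally show ?thesis .
    qed
    then show ?thesis by (auto simp: bounded_iff)
  qed
  ultimately have "compact C" by (simp add: compact_eq_bounded_closed)
  moreover have "C \<subseteq> polydisc a r" using assms(2) by (auto simp: C_def polydisc_def intro: le_less_trans)
  ultimately have "bounded (G ` C)"
    using assms(1) by (meson compact_continuous_image compact_imp_bounded continuous_on_subset holo_continuous)
  then obtain M where "\<And>z. z \<in> C \<Longrightarrow> norm (G z) \<le> M" by (auto simp: bounded_iff)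
  then show ?thesis using that[of M] by (auto simp: C_def polydisc_def less_imp_le)
qed

text \<open>The monomials are real on real points, so taking real parts term by term turns the
  complex series into a real one with coefficients \<open>Re (c \<alpha>)\<close>.\<close>

lemma cext_real_analytic_on:
  assumes "cext S u"
  shows "real_analytic_on S u"
  unfolding real_analytic_on_def
proof
  fix a assume a: "a \<in> S"
  obtain r G where G: "r > 0" "holo (polydisc (cvec a) r) G"
    "\<And>x. cvec x \<in> polydisc (cvec a) r \<Longrightarrow> u x = Re (G (cvec x))"
    using cextE[OF assms(1) a] by blast
  obtain M where M: "\<And>z. z \<in> polydisc (cvec a) (r/2) \<Longrightarrow> norm (G z) \<le> M"
    using holo_bounded_subpolydisc[OF G(2), of "r/2"] G(1) by auto
  have hol: "holo (polydisc (cvec a) (r/2)) G"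
    using G(1) by (intro holo_subset[OF G(2)] polydisc_mono) auto
  have r4: "0 < r/4" "r/4 < r/2" using G(1) by auto
  obtain c where c: "\<And>z. z \<in> polydisc (cvec a) (r/4) \<Longrightarrow>
      ((\<lambda>\<alpha>. c \<alpha> * (\<Prod>i\<in>UNIV. (z $ i - cvec a $ i) ^ \<alpha> i)) has_sum G z) UNIV"
    by (rule holo_power_series[OF hol r4(1) r4(2) M]) (assumption, rule that)
  have "((\<lambda>\<alpha>. Re (c \<alpha>) * (\<Prod>i\<in>UNIV. (x $ i - a $ i) ^ \<alpha> i)) has_sum u x) UNIV" if "x \<in> ball a (r/4)" for x
  proof -
    have x: "cvec x \<in> polydisc (cvec a) (r/4)" using that by (rule cvec_in_polydisc)
    then have ux: "u x = Re (G (cvec x))" using G polydisc_mono[of "r/4" r "cvec a"] by auto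
    have "((\<lambda>\<alpha>. Re (c \<alpha> * (\<Prod>i\<in>UNIV. (cvec x $ i - cvec a $ i) ^ \<alpha> i))) has_sum Re (G (cvec x))) UNIV"
      by (rule has_sum_Re[OF c[OF x]])
    moreover have "c \<alpha> * (\<Prod>i\<in>UNIV. (cvec x $ i - cvec a $ i) ^ \<alpha> i)
        = c \<alpha> * of_real (\<Prod>i\<in>UNIV. (x $ i - a $ i) ^ \<alpha> i)" for \<alpha> by simp
    ultimately show ?thesis by (simp only: ux Re_complex_of_real times_complex.sel Im_complex_of_real mult_zero_right diff_zero)
  qed
  then show "\<exists>r>0. \<exists>c. \<forall>x\<in>ball a r. ((\<lambda>\<alpha>. c \<alpha> * (\<Prod>i\<in>UNIV. (x $ i - a $ i) ^ \<alpha> i)) has_sum u x) UNIV"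
    using G(1) by (intro exI[of _ "r/4"] conjI exI[of _ "\<lambda>\<alpha>. Re (c \<alpha>)"]) auto
qed

definition cnjv :: "complex^'n \<Rightarrow> complex^'n" where "cnjv z = (\<chi> i. cnj (z $ i))"

text \<open>Schwarz reflection: averaging \<open>G z\<close> with \<open>cnj (G (cnjv z))\<close>
  removes the imaginary part on real points. The identity theorem needs \<open>G\<close> itself, not
  only its real part, to agree with \<open>u\<close> there.\<close>

lemma cext_real_extension:
  assumes "cext S u" "a \<in> S"
  obtains r G where "r > 0" "holo (polydisc (cvec a) r) G"
    "\<And>x. cvec x \<in> polydisc (cvec a) r \<Longrightarrow> G (cvec x) = of_real (u x)"
proof -
  obtain r G where G: "r > 0" "holo (polydisc (cvec a) r) G"
    "\<And>x. cvec x \<in> polydisc (cvec a) r \<Longrightarrow> u x = Re (G (cvec x))"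
    using cextE[OF assms] by blast
  have sub: "cnjv z \<in> polydisc (cvec a) r" if "z \<in> polydisc (cvec a) r" for z
    using that unfolding polydisc_def cnjv_def
    by simp (metis complex_cnj_complex_of_real complex_cnj_diff complex_mod_cnj)
  have line: "cnjv (z + axis i h) = cnjv z + axis i (cnj h)" for z :: "complex^'a" and i h
    by (auto simp: cnjv_def vec_eq_iff axis_def)
  define H where "H z = cnj (G (cnjv z))" for z
  have "holo (polydisc (cvec a) r) H"
    unfolding holo_def
  proof (intro conjI ballI allI)
    have "continuous_on (polydisc (cvec a) r) (\<lambda>z. G (cnjv z))"
      by (rule continuous_on_compose2[OF holo_continuous[OF G(2)]])
         (use sub in \<open>auto simp: cnjv_def intro!: continuous_intros\<close>)
    then show "continuous_on (polydisc (cvec a) r) H" unfolding H_def by (intro continuous_intros)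
    fix z i assume "z \<in> polydisc (cvec a) r"
    then obtain D where "((\<lambda>h. G (cnjv z + axis i h)) has_field_derivative D) (at 0)"
      using G(2) sub unfolding holo_def field_differentiable_def by blast
    then have "(cnj \<circ> (\<lambda>h. G (cnjv z + axis i h)) \<circ> cnj has_field_derivative cnj D) (at (cnj 0))"
      by (intro has_field_derivative_cnj_cnj) simp
    then show "(\<lambda>h. H (z + axis i h)) field_differentiable (at 0)"
      unfolding H_def line o_def field_differentiable_def by auto
  qed
  from holo_cmult[OF holo_add[OF G(2) this], of "1/2"]
  have "holo (polydisc (cvec a) r) (\<lambda>z. (1/2) * (G z + H z))" .
  moreover have "(1/2) * (G (cvec x) + H (cvec x)) = of_real (u x)" if "cvec x \<in> polydisc (cvec a) r" for x
  proof -
    have "cnjv (cvec x) = cvec x" by (simp add: cnjv_def vec_eq_iff)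
    then show ?thesis using G(3)[OF that] by (simp add: H_def complex_add_cnj)
  qed
  ultimately show thesis using that G(1) by blast
qed

section \<open>Unique continuation\<close>

lemma convex_polydisc: "convex (polydisc a r)"
proof -
  have "polydisc a r = (\<Inter>i\<in>UNIV. (\<lambda>z. z $ i) -` ball (a $ i) r)"
    by (auto simp: polydisc_def dist_norm norm_minus_commute)
  moreover have "convex ((\<lambda>z. z $ i) -` ball (a $ i) r)" for i
    by (intro convex_linear_vimage bounded_linear.linear[OF bounded_linear_vec_nth] convex_ball)
  ultimately show ?thesis by (auto intro: convex_INT)
qed

text \<open>The complex line through \<open>y\<close> and \<open>x\<close> reduces the claim to the
  identity theorem in one variable: \<open>G\<close> equals \<open>c\<close> on a short real segment
  issuing from \<open>y\<close>, and the part \<open>T\<close> of the line inside the polydisc is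
  convex.\<close>

lemma cext_constant_spreads:
  assumes G: "r > 0" "holo (polydisc (cvec a) r) G"
    "\<And>x. cvec x \<in> polydisc (cvec a) r \<Longrightarrow> G (cvec x) = of_real (u x)"
    and y: "y \<in> ball a r" "e > 0" "\<And>x. x \<in> ball y e \<Longrightarrow> u x = c"
    and x: "x \<in> ball a r"
  shows "u x = c"
proof -
  define v where "v = x - y"
  define \<gamma> where "\<gamma> t = cvec y + t *s cvec v" for t :: complex
  have \<gamma>_has_der: "(\<gamma> has_derivative (\<lambda>t. t *s cvec v)) (at t)" for t
  proof -
    have "bounded_linear (\<lambda>t. t *s cvec v)"
      by (rule bounded_linear_intro[where K="norm (cvec v)"])
         (auto simp: vec_eq_iff algebra_simps norm_vec_def norm_mult L2_set_right_distrib)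
    then show ?thesis unfolding \<gamma>_def by (auto intro!: derivative_eq_intros bounded_linear_imp_has_derivative)
  qed
  define T where "T = \<gamma> -` polydisc (cvec a) r"
  have "open T" unfolding T_def
    using \<gamma>_has_der by (intro open_vimage open_polydisc) (meson has_derivative_continuous continuous_at_imp_continuous_on)
  have "convex T"
  proof -
    have "\<gamma> (\<alpha> *\<^sub>R s + \<beta> *\<^sub>R t) = \<alpha> *\<^sub>R \<gamma> s + \<beta> *\<^sub>R \<gamma> t" if "\<alpha> + \<beta> = 1" for \<alpha> \<beta> s t
    proof -
      have b: "\<beta> = 1 - \<alpha>" using that by simp
      show ?thesis unfolding b vec_eq_iff by (simp add: \<gamma>_def) (simp add: scaleR_conv_of_real algebra_simps)
    qed
    then show ?thesis using convexD[OF convex_polydisc[of "cvec a" r]] unfolding T_def convex_def by auto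
  qed
  have real: "\<gamma> (of_real t) = cvec (y + t *\<^sub>R v)" for t by (simp add: \<gamma>_def vec_eq_iff)
  have "0 \<in> T" "1 \<in> T" using cvec_in_polydisc[OF y(1)] cvec_in_polydisc[OF x] real[of 0] real[of 1]
    by (auto simp: T_def v_def)
  have hol: "(\<lambda>t. G (\<gamma> t)) holomorphic_on T"
  proof (rule holomorphic_onI)
    fix t assume "t \<in> T"
    then have "((\<lambda>t. G (\<gamma> t)) has_derivative (\<lambda>h. \<Sum>i\<in>UNIV. cpartial i G (\<gamma> t) * (h *s cvec v) $ i)) (at t)"
      using holo_has_derivative[OF G(2) open_polydisc, of "\<gamma> t"]
      by (intro has_derivative_compose[OF \<gamma>_has_der]) (auto simp: T_def)
    then have "((\<lambda>t. G (\<gamma> t)) has_field_derivative (\<Sum>i\<in>UNIV. cpartial i G (\<gamma> t) * cvec v $ i)) (at t)"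
      unfolding has_field_derivative_def
      by (rule has_derivative_eq_rhs) (auto simp: fun_eq_iff sum_distrib_left sum_distrib_right mult_ac)
    then show "(\<lambda>t. G (\<gamma> t)) field_differentiable (at t within T)"
      by (metis field_differentiable_at_within field_differentiable_def)
  qed
  \<comment> \<open>Scaled so that \<open>y + t *\<^sub>R v\<close> stays in \<open>ball y e\<close>
    for \<open>0 < t < d\<close>; the added 1 covers the case \<open>v = 0\<close>.\<close>
  define d where "d = e / (norm v + 1)"
  have d: "d > 0" using y(2) by (simp add: d_def add_nonneg_pos)
  have zero: "G (\<gamma> t) - of_real c = 0" if "t \<in> of_real ` {0<..<d} \<inter> T" for t
  proof -
    from that obtain \<tau> where \<tau>: "t = of_real \<tau>" "0 < \<tau>" "\<tau> < d" by auto
    have "norm (\<tau> *\<^sub>R v) < e"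
    proof -
      have "norm (\<tau> *\<^sub>R v) = \<tau> * norm v" using \<tau> by simp
      also have "\<dots> \<le> \<tau> * (norm v + 1)" using \<tau> by (intro mult_left_mono) auto
      also have "\<dots> < e" using \<tau>(3) unfolding d_def by (simp add: pos_less_divide_eq add_nonneg_pos)
      finally show ?thesis .
    qed
    then have "u (y + \<tau> *\<^sub>R v) = c" by (intro y(3)) (simp add: dist_norm)
    moreover have "cvec (y + \<tau> *\<^sub>R v) \<in> polydisc (cvec a) r"
      using that \<tau> real by (auto simp: T_def)
    ultimately show ?thesis using G(3) by (simp add: \<tau>(1) real)
  qed
  have "G (\<gamma> 1) - of_real c = 0"
  proof (rule analytic_continuation[where f = "\<lambda>t. G (\<gamma> t) - of_real c" and w = 1 and S = T and U = "of_real ` {0<..<d} \<inter> T" and \<xi> = 0])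
    show "(\<lambda>t. G (\<gamma> t) - of_real c) holomorphic_on T" using hol by (intro holomorphic_intros)
    show "connected T" using \<open>convex T\<close> by (rule convex_connected)
    show "0 islimpt (complex_of_real ` {0<..<d} \<inter> T)"
    proof -
      obtain \<epsilon> where \<epsilon>: "\<epsilon> > 0" "ball 0 \<epsilon> \<subseteq> T" using \<open>open T\<close> \<open>0 \<in> T\<close> open_contains_ball by blast
      show ?thesis unfolding islimpt_approachable
      proof (intro allI impI)
        fix \<delta> :: real assume "\<delta> > 0"
        define \<tau> where "\<tau> = Min {\<delta>, \<epsilon>, d} / 2"
        have "\<tau> > 0" "\<tau> < \<delta>" "\<tau> < \<epsilon>" "\<tau> < d"
          using \<open>\<delta> > 0\<close> \<epsilon> d by (auto simp: \<tau>_def min_def)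
        then show "\<exists>x'\<in>complex_of_real ` {0<..<d} \<inter> T. x' \<noteq> 0 \<and> dist x' 0 < \<delta>"
          using \<epsilon> by (intro bexI[of _ "of_real \<tau>"]) auto
      qed
    qed
  qed (use \<open>open T\<close> \<open>0 \<in> T\<close> \<open>1 \<in> T\<close> zero in auto)
  moreover have "\<gamma> 1 = cvec x" using real[of 1] by (simp add: v_def)
  moreover have "G (cvec x) = of_real (u x)" by (rule G(3)[OF cvec_in_polydisc[OF x]])
  ultimately show ?thesis by simp
qed

text \<open>The set of points near which \<open>u\<close> equals \<open>c\<close> is open by its
  definition, and it is closed in \<open>S\<close> because around any limit point the constant
  spreads over a whole ball.\<close>

theorem cext_unique_continuation:
  assumes u: "cext S u" and S: "open S" "connected S" and y: "y \<in> S" "e > 0" "\<And>x. x \<in> ball y e \<Longrightarrow> u x = c"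
    and "x \<in> S"
  shows "u x = c"
proof -
  define A where "A = {z\<in>S. \<exists>e>0. \<forall>x\<in>ball z e. u x = c}"
  have "openin (top_of_set S) A"
    unfolding openin_contains_ball
  proof (intro conjI ballI)
    fix z assume "z \<in> A"
    then obtain e where e: "e > 0" "\<forall>x\<in>ball z e. u x = c" by (auto simp: A_def)
    have "ball z e \<inter> S \<subseteq> A"
    proof
      fix w assume w: "w \<in> ball z e \<inter> S"
      then obtain d where "d > 0" "ball w d \<subseteq> ball z e" using open_contains_ball by (metis IntD1 open_ball)
      then show "w \<in> A" using e w by (auto simp: A_def)
    qed
    with e show "\<exists>e>0. ball z e \<inter> S \<subseteq> A" by blast
  qed (auto simp: A_def)
  moreover have "closedin (top_of_set S) A"
  proof -
    have "z \<in> A" if zS: "z \<in> S" and zA: "z \<in> closure A" for z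
    proof -
      obtain r G where G: "r > 0" "holo (polydisc (cvec z) r) G"
        "\<And>x. cvec x \<in> polydisc (cvec z) r \<Longrightarrow> G (cvec x) = of_real (u x)"
        using cext_real_extension[OF u zS] by metis
      obtain y where y: "y \<in> A" "y \<in> ball z r" using zA G(1)
        by (metis closure_approachable dist_commute mem_ball)
      then obtain e where e: "e > 0" "\<And>x. x \<in> ball y e \<Longrightarrow> u x = c" by (auto simp: A_def)
      have "u x = c" if "x \<in> ball z r" for x
        by (rule cext_constant_spreads[OF G y(2) e that])
      then show ?thesis using G(1) zS by (auto simp: A_def)
    qed
    then have "A = S \<inter> closure A" using closure_subset[of A] by (auto simp: A_def)
    then show ?thesis by (metis closed_closure closedin_closed_Int)
  qed
  moreover have "y \<in> A" using y by (auto simp: A_def)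
  ultimately have "A = S" using S(2) by (auto simp: connected_clopen)
  with \<open>x \<in> S\<close> have "x \<in> A" by simp
  then show ?thesis by (auto simp: A_def)
qed

section \<open>Blow-up at a point\<close>

lemma finite_multi_indices: "finite {\<alpha> :: 'n::finite \<Rightarrow> nat. (\<Sum>i\<in>UNIV. \<alpha> i) \<le> k}"
proof -
  have "\<alpha> i \<le> (\<Sum>i\<in>UNIV. \<alpha> i)" for \<alpha> :: "'n \<Rightarrow> nat" and i
    by (rule member_le_sum) auto
  then have "{\<alpha> :: 'n \<Rightarrow> nat. (\<Sum>i\<in>UNIV. \<alpha> i) \<le> k} \<subseteq> PiE UNIV (\<lambda>_. {..k})"
    by (auto intro: le_trans)
  then show ?thesis by (rule finite_subset) (auto intro: finite_PiE)
qed

text \<open>The terms of the power series are grouped by total degree. Only degrees N > k enter the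
  remainder, and each carries a factor (\<delta> / s)^N, at most (\<delta> / s)^(k + 1).\<close>

lemma holo_homogeneous_expansion:
  fixes G :: "complex^'n \<Rightarrow> complex"
  assumes "holo (polydisc a r) G" "r > 0"
  obtains Q s B where "\<And>k. holo UNIV (Q k)" "\<And>k t w. Q k (t *s w) = t ^ k * Q k w" "0 < s" "s \<le> r"
    "\<And>k \<delta> z. 0 < \<delta> \<Longrightarrow> \<delta> \<le> s \<Longrightarrow> z \<in> polydisc a \<delta> \<Longrightarrow>
        norm (G z - (\<Sum>l\<le>k. Q l (z - a))) \<le> B * \<delta> ^ Suc k / s ^ Suc k"
proof -
  obtain M where M: "\<And>z. z \<in> polydisc a (r/2) \<Longrightarrow> norm (G z) \<le> M"
    using holo_bounded_subpolydisc[OF assms(1), of "r/2"] assms(2) by auto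
  have hol: "holo (polydisc a (r/2)) G"
    using assms by (intro holo_subset[OF assms(1)] polydisc_mono) auto
  define s0 where "s0 = r / 4"
  have s0: "0 < s0" "s0 < r/2" using assms(2) by (auto simp: s0_def)
  obtain c where c: "\<And>\<alpha>. norm (c \<alpha>) \<le> M / s0 ^ (\<Sum>i\<in>UNIV. \<alpha> i)"
    "\<And>z. z \<in> polydisc a s0 \<Longrightarrow> ((\<lambda>\<alpha>. c \<alpha> * (\<Prod>i\<in>UNIV. (z $ i - a $ i) ^ \<alpha> i)) has_sum G z) UNIV"
    by (rule holo_power_series[OF hol s0(1) s0(2) M]) (assumption, rule that)
  define A where "A k = {\<alpha> :: 'n \<Rightarrow> nat. (\<Sum>i\<in>UNIV. \<alpha> i) = k}" for k
  have finA: "finite (A k)" for k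
    using finite_multi_indices[of k] by (rule rev_finite_subset) (auto simp: A_def)
  define Q where "Q k w = (\<Sum>\<alpha>\<in>A k. c \<alpha> * (\<Prod>i\<in>UNIV. w $ i ^ \<alpha> i))" for k w
  \<comment> \<open>Half the radius of the coefficient bound: the spare factor (1/2)^N makes the
    remainder summable over all multi-indices, with total \<open>S\<close>.\<close>
  define s where "s = s0 / 2"
  define S where "S = infsum (\<lambda>\<alpha>. \<Prod>i\<in>UNIV. (1/2::real) ^ \<alpha> i) (UNIV :: ('n \<Rightarrow> nat) set)"
  have "(\<lambda>\<alpha>. \<Prod>i\<in>UNIV. (1/2::real) ^ \<alpha> i) summable_on (supported (UNIV :: 'n set))"
    by (rule summable_on_geometric_product) auto
  then have S: "((\<lambda>\<alpha>. \<Prod>i\<in>UNIV. (1/2::real) ^ \<alpha> i) has_sum S) (UNIV :: ('n \<Rightarrow> nat) set)"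
    by (simp add: S_def)
  show thesis
  proof (rule that[of Q s "M * S"])
    show "holo UNIV (Q k)" for k
      unfolding Q_def by (intro holo_sum holo_mult holo_const holo_prod holo_power holo_coord)
    show "Q k (t *s w) = t ^ k * Q k w" for k t w
    proof -
      have "c \<alpha> * (\<Prod>i\<in>UNIV. (t *s w) $ i ^ \<alpha> i) = t ^ k * (c \<alpha> * (\<Prod>i\<in>UNIV. w $ i ^ \<alpha> i))" if "\<alpha> \<in> A k" for \<alpha>
      proof -
        have "(\<Prod>i\<in>UNIV. t ^ \<alpha> i) = t ^ k" using that by (simp add: A_def power_sum[symmetric])
        then show ?thesis by (simp add: power_mult_distrib prod.distrib)
      qed
      then show ?thesis unfolding Q_def sum_distrib_left by (rule sum.cong[OF refl])
    qed
    show "0 < s" "s \<le> r" using s0 by (auto simp: s_def)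
    fix k \<delta> z assume \<delta>: "0 < \<delta>" "\<delta> \<le> s" and z: "z \<in> polydisc a \<delta>"
    have zs0: "z \<in> polydisc a s0"
      using z polydisc_mono[of \<delta> s0 a] \<delta> s0 by (auto simp: s_def)
    define f where "f \<alpha> = c \<alpha> * (\<Prod>i\<in>UNIV. (z $ i - a $ i) ^ \<alpha> i)" for \<alpha>
    define F where "F = {\<alpha> :: 'n \<Rightarrow> nat. (\<Sum>i\<in>UNIV. \<alpha> i) \<le> k}"
    have finF: "finite F" unfolding F_def by (rule finite_multi_indices)
    have "((\<lambda>\<alpha>. if \<alpha> \<in> F then f \<alpha> else 0) has_sum sum f F) UNIV"
      using has_sum_finite[OF finF, of f] by (subst has_sum_cong_neutral[where T = F and g = f]) auto
    then have hs: "((\<lambda>\<alpha>. f \<alpha> - (if \<alpha> \<in> F then f \<alpha> else 0)) has_sum G z - sum f F) UNIV"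
      using has_sum_add[OF c(2)[OF zs0] has_sum_cmult_right[where c = "-1"]]
      unfolding f_def[symmetric] by fastforce
    have "F = (\<Union>l\<le>k. A l)" by (auto simp: F_def A_def)
    then have "sum f F = (\<Sum>l\<le>k. sum f (A l))"
      by (simp only:) (rule sum.UNION_disjoint, auto simp: finA, auto simp: A_def)
    also have "\<dots> = (\<Sum>l\<le>k. Q l (z - a))" by (simp add: Q_def f_def)
    finally have sumF: "sum f F = (\<Sum>l\<le>k. Q l (z - a))" .
    have "M \<ge> 0" using M[of a] norm_ge_zero[of "G a"] assms(2) centre_in_polydisc[of "r/2" a] by (meson half_gt_zero order_trans)
    have bound: "norm (f \<alpha> - (if \<alpha> \<in> F then f \<alpha> else 0)) \<le> M * (\<delta> / s) ^ Suc k * (\<Prod>i\<in>UNIV. (1/2) ^ \<alpha> i)" for \<alpha>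
    proof (cases "\<alpha> \<in> F")
      case True
      have "0 \<le> \<delta> / s" using \<delta> by simp
      then have "0 \<le> M * (\<delta> / s) ^ Suc k * (\<Prod>i\<in>UNIV. (1/2) ^ \<alpha> i)"
        using \<open>M \<ge> 0\<close> by (intro mult_nonneg_nonneg prod_nonneg zero_le_power) auto
      with True show ?thesis by (simp del: power_Suc)
    next
      case False
      define N where "N = (\<Sum>i\<in>UNIV. \<alpha> i)"
      have N: "Suc k \<le> N" using False by (auto simp: F_def N_def)
      have "norm (\<Prod>i\<in>UNIV. (z $ i - a $ i) ^ \<alpha> i) \<le> (\<Prod>i\<in>UNIV. \<delta> ^ \<alpha> i)"
        unfolding prod_norm[symmetric] norm_power using z
        by (intro prod_mono conjI power_mono) (auto simp: polydisc_def intro: less_imp_le)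
      also have "\<dots> = \<delta> ^ N" by (simp add: N_def power_sum)
      finally have "norm (f \<alpha>) \<le> M / s0 ^ N * \<delta> ^ N"
        unfolding f_def norm_mult using c(1)[of \<alpha>] \<open>M \<ge> 0\<close> s0 by (intro mult_mono) (auto simp: N_def)
      also have "\<dots> = M * (\<delta> / s) ^ N * (1/2) ^ N"
        by (simp add: s_def power_divide power_mult_distrib)
      also have "\<dots> \<le> M * (\<delta> / s) ^ Suc k * (1/2) ^ N"
        using \<open>M \<ge> 0\<close> \<delta> N by (intro mult_right_mono mult_left_mono power_decreasing) auto
      finally show ?thesis using False by (simp add: N_def power_sum)
    qed
    have "((\<lambda>\<alpha>. M * (\<delta> / s) ^ Suc k * (\<Prod>i\<in>UNIV. (1/2) ^ \<alpha> i)) has_sum M * (\<delta> / s) ^ Suc k * S)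
        (UNIV :: ('n \<Rightarrow> nat) set)"
      by (intro has_sum_cmult_right S)
    from norm_infsum_le[OF hs this bound] sumF
    show "norm (G z - (\<Sum>l\<le>k. Q l (z - a))) \<le> M * S * \<delta> ^ Suc k / s ^ Suc k"
      by (simp add: power_divide mult_ac)
  qed
qed

text \<open>A Cauchy estimate on a circle of radius \<delta>, which stays in the polydisc of radius
  2 * \<delta>: each differentiation costs one power of \<delta> and the factor
  \<open>2 ^ Suc p\<close>.\<close>

lemma cpartial_decay:
  assumes "holo (polydisc b s) R" "0 < d" "d \<le> s"
    "\<And>\<delta> z. 0 < \<delta> \<Longrightarrow> \<delta> \<le> d \<Longrightarrow> z \<in> polydisc b \<delta> \<Longrightarrow> norm (R z) \<le> B * \<delta> ^ Suc p"
    and "0 < \<delta>" "\<delta> \<le> d / 2" "z \<in> polydisc b \<delta>"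
  shows "norm (cpartial i R z) \<le> (B * 2 ^ Suc p) * \<delta> ^ p"
proof -
  have in2: "z + axis i h \<in> polydisc b (2*\<delta>)" if "norm h \<le> \<delta>" for h
    unfolding polydisc_def
  proof (intro CollectI allI)
    fix j
    have "norm ((z + axis i h) $ j - b $ j) \<le> norm (z $ j - b $ j) + norm (axis i h $ j)"
      using norm_triangle_ineq[of "z $ j - b $ j" "axis i h $ j"] by (simp add: algebra_simps)
    also have "\<dots> < \<delta> + \<delta>"
      using assms(7) that assms(5) by (intro add_less_le_mono) (auto simp: polydisc_def axis_def)
    finally show "norm ((z + axis i h) $ j - b $ j) < 2 * \<delta>" by simp
  qed
  have "norm (cpartial i R z) \<le> B * (2 * \<delta>) ^ Suc p / \<delta>"
  proof (rule cpartial_bound[OF assms(1) open_polydisc])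
    show "z + axis i h \<in> polydisc b s" if "norm h \<le> \<delta>" for h
      using in2[OF that] polydisc_mono[of "2*\<delta>" s b] assms by auto
    show "norm (R (z + axis i h)) \<le> B * (2 * \<delta>) ^ Suc p" if "norm h = \<delta>" for h
      using in2[of h] that assms by (intro assms(4)) auto
  qed (use assms in auto)
  also have "\<dots> = (B * 2 ^ Suc p) * \<delta> ^ p"
    using assms(5) by (simp add: power_mult_distrib)
  finally show ?thesis .
qed

section \<open>Rules for partial derivatives\<close>

lemma partial_translate:
  assumes "u differentiable (at (x - b))"
  shows "partial i (\<lambda>y. u (y - b)) x = partial i u (x - b)"
proof -
  have "((\<lambda>y. y - b) has_derivative (\<lambda>h. h)) (at x)" by (auto intro!: derivative_eq_intros)
  from has_derivative_compose[OF this has_derivative_partial[OF assms]]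
  show ?thesis by (rule partial_eqI)
qed

lemma partial_scale:
  assumes "u differentiable (at (t *\<^sub>R x))"
  shows "partial i (\<lambda>y. u (t *\<^sub>R y)) x = t * partial i u (t *\<^sub>R x)"
proof -
  have "((\<lambda>y. t *\<^sub>R y) has_derivative (\<lambda>h. t *\<^sub>R h)) (at x)" by (auto intro!: derivative_eq_intros)
  from has_derivative_compose[OF this has_derivative_partial[OF assms]]
  have "((\<lambda>y. u (t *\<^sub>R y)) has_derivative (\<lambda>h. \<Sum>i\<in>UNIV. (t * partial i u (t *\<^sub>R x)) * h $ i)) (at x)"
    by (rule has_derivative_eq_rhs) (simp add: fun_eq_iff mult_ac)
  then show ?thesis by (rule partial_eqI)
qed

lemma partial_add:
  assumes "u differentiable (at x)" "v differentiable (at x)"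
  shows "partial i (\<lambda>y. u y + v y) x = partial i u x + partial i v x"
proof -
  have "((\<lambda>y. u y + v y) has_derivative (\<lambda>h. \<Sum>i\<in>UNIV. (partial i u x + partial i v x) * h $ i)) (at x)"
    using has_derivative_add[OF has_derivative_partial[OF assms(1)] has_derivative_partial[OF assms(2)]]
    by (rule has_derivative_eq_rhs) (simp add: fun_eq_iff algebra_simps sum.distrib)
  then show ?thesis by (rule partial_eqI)
qed

lemma partial_cmult:
  assumes "u differentiable (at x)"
  shows "partial i (\<lambda>y. c * u y) x = c * partial i u x"
proof -
  have "((\<lambda>y. c * u y) has_derivative (\<lambda>h. \<Sum>i\<in>UNIV. (c * partial i u x) * h $ i)) (at x)"
    using has_derivative_mult_right[OF has_derivative_partial[OF assms(1)]]
    by (rule has_derivative_eq_rhs) (simp add: fun_eq_iff algebra_simps sum_distrib_left)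
  then show ?thesis by (rule partial_eqI)
qed

lemma partial_const [simp]: "partial i (\<lambda>_. c) x = 0"
  by (simp add: partial_def)

lemma partial_cong_open:
  assumes "open S" "x \<in> S" "\<And>y. y \<in> S \<Longrightarrow> u y = v y"
  shows "partial i u x = partial i v x"
proof -
  have "(u has_derivative D) (at x) \<longleftrightarrow> (v has_derivative D) (at x)" for D
    using assms by (metis has_derivative_transform_within_open)
  then show ?thesis by (simp add: partial_def frechet_derivative_def)
qed

lemma partial_homogeneous:
  assumes "cext UNIV q" "\<And>x. q (t *\<^sub>R x) = \<kappa> * q x"
  shows "t * partial i q (t *\<^sub>R x) = \<kappa> * partial i q x"
proof -
  have "t * partial i q (t *\<^sub>R x) = partial i (\<lambda>y. q (t *\<^sub>R y)) x"
    using cext_differentiable[OF assms(1)] by (simp add: partial_scale)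
  also have "\<dots> = partial i (\<lambda>y. \<kappa> * q y) x" by (simp add: assms(2))
  also have "\<dots> = \<kappa> * partial i q x" using cext_differentiable[OF assms(1)] by (simp add: partial_cmult)
  finally show ?thesis .
qed

lemma cext_translate:
  assumes "cext UNIV q"
  shows "cext UNIV (\<lambda>x. q (x - b))"
  unfolding cext_def
proof
  fix a
  obtain r G where G: "r > 0" "holo (polydisc (cvec (a - b)) r) G"
    "\<And>x. cvec x \<in> polydisc (cvec (a - b)) r \<Longrightarrow> q x = Re (G (cvec x))"
    using cextE[OF assms, of "a - b"] by blast
  have shift: "z + - cvec b \<in> polydisc (cvec (a - b)) r \<longleftrightarrow> z \<in> polydisc (cvec a) r" for z
    by (simp add: polydisc_def algebra_simps)
  have "holo {z. z + - cvec b \<in> polydisc (cvec (a - b)) r} (\<lambda>z. G (z + - cvec b))"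
    by (rule holo_translate[OF G(2)])
  then have "holo (polydisc (cvec a) r) (\<lambda>z. G (z + - cvec b))" by (simp only: shift Collect_mem_eq)
  moreover have "q (x - b) = Re (G (cvec x + - cvec b))" if "cvec x \<in> polydisc (cvec a) r" for x
    using G(3)[of "x - b"] shift[of "cvec x"] that by (simp add: cvec_diff)
  ultimately show "\<exists>r>0. \<exists>G. holo (polydisc (cvec a) r) G \<and>
     (\<forall>x. cvec x \<in> polydisc (cvec a) r \<longrightarrow> q (x - b) = Re (G (cvec x)))"
    using G(1) by (intro exI[of _ r] conjI exI[of _ "\<lambda>z. G (z + - cvec b)"]) auto
qed

lemma holo_cext_UNIV: "holo UNIV Q \<Longrightarrow> cext UNIV (\<lambda>x. Re (Q (cvec x)))"
  unfolding cext_def by (auto intro!: exI[of _ "1::real"] exI[of _ Q] holo_subset[of UNIV Q])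

text \<open>The comparison with the leading part \<open>q m\<close> includes first and second
  derivatives: the first carry the distortion inequality to the blow-up, the second carry Laplace's
  equation.\<close>

lemma cext_homogeneous_expansion:
  fixes u :: "real^'n \<Rightarrow> real"
  assumes "cext {a} u"
  obtains q where "\<And>k. cext UNIV (q k)" "\<And>k t x. q k (t *\<^sub>R x) = t ^ k * q k x"
    "\<And>x. q 0 x = u a"
    "(\<And>k x. k \<ge> 1 \<Longrightarrow> q k x = 0) \<Longrightarrow> \<exists>e>0. \<forall>x\<in>ball a e. u x = u a"
    "\<And>m. m \<ge> 1 \<Longrightarrow> (\<And>k x. 1 \<le> k \<Longrightarrow> k < m \<Longrightarrow> q k x = 0) \<Longrightarrow>
       \<exists>d>0. \<exists>B. \<forall>\<delta> x. 0 < \<delta> \<longrightarrow> \<delta> \<le> d \<longrightarrow> x \<in> ball a \<delta> \<longrightarrow>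
         \<bar>u x - u a - q m (x - a)\<bar> \<le> B * \<delta> ^ Suc m \<and>
         (\<forall>i. \<bar>partial i u x - partial i (q m) (x - a)\<bar> \<le> B * \<delta> ^ m) \<and>
         (\<forall>i k. \<bar>partial k (partial i u) x - partial k (partial i (q m)) (x - a)\<bar> \<le> B * \<delta> ^ (m - 1))"
proof -
  obtain r G where G: "r > 0" "holo (polydisc (cvec a) r) G"
    "\<And>x. cvec x \<in> polydisc (cvec a) r \<Longrightarrow> u x = Re (G (cvec x))"
    using cextE[OF assms] by blast
  obtain Q s B where Q: "\<And>k. holo UNIV (Q k)" "\<And>k t w. Q k (t *s w) = t ^ k * Q k w" "0 < s" "s \<le> r"
    "\<And>k \<delta> z. 0 < \<delta> \<Longrightarrow> \<delta> \<le> s \<Longrightarrow> z \<in> polydisc (cvec a) \<delta> \<Longrightarrow>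
        norm (G z - (\<Sum>l\<le>k. Q l (z - cvec a))) \<le> B * \<delta> ^ Suc k / s ^ Suc k"
    using holo_homogeneous_expansion[OF G(2,1)] by metis
  define q where "q k x = Re (Q k (cvec x))" for k x
  have q_hom: "q k (t *\<^sub>R x) = t ^ k * q k x" for k t x
  proof -
    have "cvec (t *\<^sub>R x) = of_real t *s cvec x" by (simp add: vec_eq_iff)
    then show ?thesis by (simp add: q_def Q(2) flip: of_real_power)
  qed
  have q0c: "q 0 x = q 0 0" for x using q_hom[of 0 0 x] by simp
  have sub: "cvec x \<in> polydisc (cvec a) r" if "x \<in> ball a \<delta>" "\<delta> \<le> s" for x \<delta>
    using cvec_in_polydisc[OF that(1)] polydisc_mono[of \<delta> r "cvec a"] that Q(4) by auto
  have approx: "\<bar>u x - (\<Sum>l\<le>k. q l (x - a))\<bar> \<le> B * \<delta> ^ Suc k / s ^ Suc k"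
    if "0 < \<delta>" "\<delta> \<le> s" "x \<in> ball a \<delta>" for k \<delta> x
  proof -
    have "u x - (\<Sum>l\<le>k. q l (x - a)) = Re (G (cvec x) - (\<Sum>l\<le>k. Q l (cvec x - cvec a)))"
      using G(3)[OF sub[OF that(3,2)]] by (simp add: q_def cvec_diff)
    also have "\<bar>\<dots>\<bar> \<le> norm (G (cvec x) - (\<Sum>l\<le>k. Q l (cvec x - cvec a)))" by (rule abs_Re_le_cmod)
    also have "\<dots> \<le> B * \<delta> ^ Suc k / s ^ Suc k" by (rule Q(5)[OF that(1,2) cvec_in_polydisc[OF that(3)]])
    finally show ?thesis .
  qed
  have q0: "q 0 x = u a" for x
  proof -
    have "\<bar>u a - q 0 0\<bar> \<le> \<epsilon>" if "\<epsilon> > 0" for \<epsilon>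
    proof -
      define \<delta> where "\<delta> = min s (\<epsilon> * s / (\<bar>B\<bar> + 1))"
      have \<delta>: "0 < \<delta>" "\<delta> \<le> s" "\<delta> \<le> \<epsilon> * s / (\<bar>B\<bar> + 1)" using that Q(3) by (auto simp: \<delta>_def)
      have "\<bar>u a - q 0 0\<bar> \<le> B * \<delta> / s" using approx[OF \<delta>(1,2), of a 0] \<delta>(1) by simp
      also have "\<dots> \<le> (\<bar>B\<bar> + 1) * \<delta> / s" using \<delta> Q(3) by (intro divide_right_mono mult_right_mono) auto
      also have "\<dots> \<le> (\<bar>B\<bar> + 1) * (\<epsilon> * s / (\<bar>B\<bar> + 1)) / s"
        using \<delta>(3) Q(3) by (intro divide_right_mono mult_left_mono) auto
      also have "\<dots> = \<epsilon>"
      proof -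
        have "\<bar>B\<bar> + 1 \<noteq> 0" by arith
        then show ?thesis using Q(3) by simp
      qed
      finally show ?thesis .
    qed
    then have "u a = q 0 0" using field_le_epsilon[of "\<bar>u a - q 0 0\<bar>" 0] by simp
    then show ?thesis using q0c[of x] by simp
  qed
  show thesis
  proof (rule that[of q])
    show q_cext: "cext UNIV (q k)" for k unfolding q_def by (rule holo_cext_UNIV[OF Q(1)])
    show "q k (t *\<^sub>R x) = t ^ k * q k x" for k t x by (rule q_hom)
    show "q 0 x = u a" for x by (rule q0)
    show "\<exists>e>0. \<forall>x\<in>ball a e. u x = u a" if z: "\<And>k x. k \<ge> 1 \<Longrightarrow> q k x = 0"
    proof (intro exI[of _ "s/2"] conjI ballI)
      fix x assume x: "x \<in> ball a (s/2)"
      have sum0: "(\<Sum>l\<le>k. q l (x - a)) = u a" for k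
        by (induction k) (simp_all add: q0 z)
      \<comment> \<open>All partial sums reduce to \<open>u a\<close>, so on half the radius the
        remainder bound is geometric in \<open>k\<close> and can be sent to 0.\<close>
      have le: "\<bar>u x - u a\<bar> \<le> B * (1/2) ^ Suc k" for k
      proof -
        have "\<bar>u x - u a\<bar> \<le> B * (s/2) ^ Suc k / s ^ Suc k" using approx[of "s/2" x k] x Q(3) by (simp add: sum0)
        also have "\<dots> = B * (1/2) ^ Suc k" using Q(3) by (simp add: power_divide)
        finally show ?thesis .
      qed
      have "(\<lambda>k. B * (1/2) ^ Suc k) \<longlonglongrightarrow> B * 0"
        by (intro tendsto_mult_left LIMSEQ_Suc LIMSEQ_power_zero) auto
      then have "\<bar>u x - u a\<bar> \<le> B * 0" by (rule LIMSEQ_le_const) (use le in auto)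
      then show "u x = u a" by simp
    qed (use Q(3) in auto)
    fix m :: nat assume m: "m \<ge> 1" and low: "\<And>k x. 1 \<le> k \<Longrightarrow> k < m \<Longrightarrow> q k x = 0"
    define R where "R z = G z - (\<Sum>l\<le>m. Q l (z - cvec a))" for z
    define \<rho> where "\<rho> x = u x - u a - q m (x - a)" for x
    have "holo (polydisc (cvec a) s) (\<lambda>z. Q l (z + - cvec a))" for l
      using holo_translate[OF Q(1)[of l], of "- cvec a"] by (rule holo_subset) auto
    then have "holo (polydisc (cvec a) s) (\<lambda>z. Q l (z - cvec a))" for l by simp
    then have R: "holo (polydisc (cvec a) s) R" unfolding R_def
      using holo_subset[OF G(2) polydisc_mono[OF Q(4)]] by (intro holo_diff holo_sum)
    have split: "{..m} = insert 0 (insert m {1..<m})" using m by auto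
    have rho: "\<rho> x = Re (R (cvec x))" if "cvec x \<in> polydisc (cvec a) s" for x
    proof -
      have "(\<Sum>l\<le>m. q l (x - a)) = u a + q m (x - a)"
        unfolding split using m by (simp add: q0 low)
      moreover have "u x = Re (G (cvec x))" using that G(3) polydisc_mono[OF Q(4)] by blast
      ultimately show ?thesis by (simp add: R_def \<rho>_def q_def cvec_diff)
    qed
    define C where "C = B / s ^ Suc m"
    have R0: "norm (R z) \<le> C * \<delta> ^ Suc m" if "0 < \<delta>" "\<delta> \<le> s" "z \<in> polydisc (cvec a) \<delta>" for \<delta> z
      using Q(5)[OF that, of m] by (simp add: R_def C_def)
    obtain p where p: "m = Suc p" using m by (cases m) auto
    have R1: "norm (cpartial i R z) \<le> (C * 2 ^ Suc m) * \<delta> ^ m"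
      if "0 < \<delta>" "\<delta> \<le> s / 2" "z \<in> polydisc (cvec a) \<delta>" for \<delta> z i
      by (rule cpartial_decay[OF R Q(3) order_refl R0 that])
    have R2: "norm (cpartial k (cpartial i R) z) \<le> ((C * 2 ^ Suc m) * 2 ^ Suc p) * \<delta> ^ p"
      if "0 < \<delta>" "\<delta> \<le> s / 2 / 2" "z \<in> polydisc (cvec a) \<delta>" for \<delta> z i k
    proof (rule cpartial_decay[OF holo_cpartial[OF R open_polydisc] _ _ _ that])
      show "norm (cpartial i R z) \<le> (C * 2 ^ Suc m) * \<delta> ^ Suc p"
        if "0 < \<delta>" "\<delta> \<le> s / 2" "z \<in> polydisc (cvec a) \<delta>" for \<delta> z
        using R1[OF that] by (simp only: p)
    qed (use Q(3) in auto)
    define D where "D = \<bar>C\<bar> + \<bar>C * 2 ^ Suc m\<bar> + \<bar>(C * 2 ^ Suc m) * 2 ^ Suc p\<bar>"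
    define v where "v x = q m (x - a)" for x
    have v: "cext UNIV v" unfolding v_def by (rule cext_translate[OF q_cext])
    have pv: "partial i v = (\<lambda>x. partial i (q m) (x - a))" for i
      unfolding v_def by (rule ext, rule partial_translate[OF cext_differentiable[OF q_cext]]) simp
    have ppv: "partial k (partial i v) x = partial k (partial i (q m)) (x - a)" for i k x
      unfolding pv by (rule partial_translate[OF cext_differentiable[OF cext_partial[OF q_cext]]]) simp
    have rho_cext: "cext (ball a s) \<rho>"
      unfolding cext_def
    proof
      fix b assume "b \<in> ball a s"
      then have "cvec b \<in> polydisc (cvec a) s" by (rule cvec_in_polydisc)
      then obtain t where t: "t > 0" "ball (cvec b) t \<subseteq> polydisc (cvec a) s"
        using open_polydisc open_contains_ball by blast
      have "polydisc (cvec b) (t / real CARD('n)) \<subseteq> polydisc (cvec a) s"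
        using polydisc_subset_ball t(2) by blast
      then show "\<exists>r>0. \<exists>G. holo (polydisc (cvec b) r) G \<and>
         (\<forall>x. cvec x \<in> polydisc (cvec b) r \<longrightarrow> \<rho> x = Re (G (cvec x)))"
        using t(1) R rho by (intro exI[of _ "t / real CARD('n)"] conjI exI[of _ R]) (auto intro: holo_subset)
    qed
    have u_eq: "u = (\<lambda>x. (\<rho> x + u a) + v x)" by (simp add: \<rho>_def v_def)
    have rd: "(\<lambda>x. \<rho> x + u a) differentiable (at x)" if "x \<in> ball a s" for x
      by (intro derivative_intros cext_differentiable[OF rho_cext that])
    have pu: "partial i u x = partial i \<rho> x + partial i v x" if "x \<in> ball a s" for i x
    proof -
      have "partial i u x = partial i (\<lambda>x. \<rho> x + u a) x + partial i v x"
        by (subst u_eq, rule partial_add[OF rd[OF that] cext_differentiable[OF v]]) simp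
      also have "partial i (\<lambda>x. \<rho> x + u a) x = partial i \<rho> x"
        using partial_add[OF cext_differentiable[OF rho_cext that], of "\<lambda>_. u a"] by simp
      finally show ?thesis .
    qed
    have ppu: "partial k (partial i u) x = partial k (partial i \<rho>) x + partial k (partial i v) x"
      if "x \<in> ball a s" for i k x
    proof -
      have "partial k (partial i u) x = partial k (\<lambda>x. partial i \<rho> x + partial i v x) x"
        by (rule partial_cong_open[of "ball a s"]) (use that pu in auto)
      also have "\<dots> = partial k (partial i \<rho>) x + partial k (partial i v) x"
        by (rule partial_add[OF cext_differentiable[OF cext_partial[OF rho_cext] that] cext_differentiable[OF cext_partial[OF v]]]) simp
      finally show ?thesis .
    qed
    have prho: "partial i \<rho> x = Re (cpartial i R (cvec x))" if "cvec x \<in> polydisc (cvec a) s" for i x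
      by (rule partial_Re_holo[OF R open_polydisc that rho])
    have pprho: "partial k (partial i \<rho>) x = Re (cpartial k (cpartial i R) (cvec x))"
      if "cvec x \<in> polydisc (cvec a) s" for i k x
      by (rule partial_Re_holo[OF holo_cpartial[OF R open_polydisc] open_polydisc that prho])
    show "\<exists>d>0. \<exists>B. \<forall>\<delta> x. 0 < \<delta> \<longrightarrow> \<delta> \<le> d \<longrightarrow> x \<in> ball a \<delta> \<longrightarrow>
         \<bar>u x - u a - q m (x - a)\<bar> \<le> B * \<delta> ^ Suc m \<and>
         (\<forall>i. \<bar>partial i u x - partial i (q m) (x - a)\<bar> \<le> B * \<delta> ^ m) \<and>
         (\<forall>i k. \<bar>partial k (partial i u) x - partial k (partial i (q m)) (x - a)\<bar> \<le> B * \<delta> ^ (m - 1))"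
    proof (rule exI[of _ "s/2/2"], rule conjI, use Q(3) in simp, rule exI[of _ D], intro allI impI conjI)
      fix \<delta> x assume \<delta>: "0 < \<delta>" "\<delta> \<le> s/2/2" and x: "x \<in> ball a \<delta>"
      have xs: "x \<in> ball a s" using x \<delta> Q(3) by auto
      have cx: "cvec x \<in> polydisc (cvec a) \<delta>" "cvec x \<in> polydisc (cvec a) s"
        using cvec_in_polydisc x xs by blast+
      have \<delta>s: "\<delta> \<le> s" "\<delta> \<le> s/2" using \<delta> Q(3) by auto
      have "\<bar>\<rho> x\<bar> \<le> C * \<delta> ^ Suc m"
        using abs_Re_le_cmod[of "R (cvec x)"] R0[OF \<delta>(1) \<delta>s(1) cx(1)] by (simp add: rho[OF cx(2)])
      also have "\<dots> \<le> D * \<delta> ^ Suc m" using \<delta> by (intro mult_right_mono) (auto simp: D_def)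
      finally show "\<bar>u x - u a - q m (x - a)\<bar> \<le> D * \<delta> ^ Suc m" by (simp add: \<rho>_def)
      fix i
      have "\<bar>partial i \<rho> x\<bar> \<le> (C * 2 ^ Suc m) * \<delta> ^ m"
        using abs_Re_le_cmod[of "cpartial i R (cvec x)"] R1[OF \<delta>(1) \<delta>s(2) cx(1), of i] by (simp add: prho[OF cx(2)])
      also have "\<dots> \<le> D * \<delta> ^ m" using \<delta> unfolding D_def by (intro mult_right_mono) (smt (verit), simp)
      finally show "\<bar>partial i u x - partial i (q m) (x - a)\<bar> \<le> D * \<delta> ^ m"
        using pu[OF xs, of i] by (simp add: pv)
      fix k
      have "\<bar>partial k (partial i \<rho>) x\<bar> \<le> ((C * 2 ^ Suc m) * 2 ^ Suc p) * \<delta> ^ p"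
        using abs_Re_le_cmod[of "cpartial k (cpartial i R) (cvec x)"] R2[OF \<delta> cx(1), of k i]
        by (simp add: pprho[OF cx(2)])
      also have "\<dots> \<le> D * \<delta> ^ p" using \<delta> unfolding D_def by (intro mult_right_mono) (smt (verit), simp)
      finally show "\<bar>partial k (partial i u) x - partial k (partial i (q m)) (x - a)\<bar> \<le> D * \<delta> ^ (m - 1)"
        using ppu[OF xs, of k i] by (simp add: ppv p)
    qed
  qed
qed

lemma tendsto_0_linear_bound:
  fixes g :: "real \<Rightarrow> real"
  assumes "d > 0" "\<And>t. 0 < t \<Longrightarrow> t < d \<Longrightarrow> \<bar>g t\<bar> \<le> C * t"
  shows "(g \<longlongrightarrow> 0) (at_right 0)"
proof (rule Lim_null_comparison)
  show "eventually (\<lambda>t. norm (g t) \<le> C * t) (at_right 0)"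
    using assms unfolding eventually_at_right_field by (intro exI[of _ d]) auto
  show "((\<lambda>t. C * t) \<longlongrightarrow> 0) (at_right 0)" by (auto intro!: tendsto_eq_intros)
qed

text \<open>The exponent \<open>m\<close> is common to the family: it is the lowest positive degree
  in which any member has a nonzero part, so single \<open>q j\<close> may vanish. A common scaling
  is needed because the distortion inequality couples the components of a map.\<close>

theorem blow_up:
  fixes u :: "'j \<Rightarrow> real^'n \<Rightarrow> real"
  assumes cx: "\<And>j. cext {a} (u j)" and nc: "\<And>e. e > 0 \<Longrightarrow> \<exists>x\<in>ball a e. u j0 x \<noteq> u j0 a"
  obtains m q where "m \<ge> 1" "\<And>j. cext UNIV (q j)" "\<And>j t x. q j (t *\<^sub>R x) = t ^ m * q j x"
    "\<exists>j x. q j x \<noteq> 0"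
    "\<And>j x. ((\<lambda>t. (u j (a + t *\<^sub>R x) - u j a) / t ^ m) \<longlongrightarrow> q j x) (at_right 0)"
    "\<And>j i x. ((\<lambda>t. t * partial i (u j) (a + t *\<^sub>R x) / t ^ m) \<longlongrightarrow> partial i (q j) x) (at_right 0)"
    "\<And>j i k x. ((\<lambda>t. t\<^sup>2 * partial k (partial i (u j)) (a + t *\<^sub>R x) / t ^ m)
        \<longlongrightarrow> partial k (partial i (q j)) x) (at_right 0)"
proof -
  have "\<forall>j. \<exists>q. (\<forall>k. cext UNIV (q k)) \<and> (\<forall>k t x. q k (t *\<^sub>R x) = t ^ k * q k x) \<and>
    ((\<forall>k x. k \<ge> 1 \<longrightarrow> q k x = 0) \<longrightarrow> (\<exists>e>0. \<forall>x\<in>ball a e. u j x = u j a)) \<and>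
    (\<forall>m. m \<ge> 1 \<longrightarrow> (\<forall>k x. 1 \<le> k \<longrightarrow> k < m \<longrightarrow> q k x = 0) \<longrightarrow>
       (\<exists>d>0. \<exists>B. \<forall>\<delta> x. 0 < \<delta> \<longrightarrow> \<delta> \<le> d \<longrightarrow> x \<in> ball a \<delta> \<longrightarrow>
         \<bar>u j x - u j a - q m (x - a)\<bar> \<le> B * \<delta> ^ Suc m \<and>
         (\<forall>i. \<bar>partial i (u j) x - partial i (q m) (x - a)\<bar> \<le> B * \<delta> ^ m) \<and>
         (\<forall>i k. \<bar>partial k (partial i (u j)) x - partial k (partial i (q m)) (x - a)\<bar> \<le> B * \<delta> ^ (m - 1))))"
    (is "\<forall>j. \<exists>q. ?P j q")
  proof
    fix j
    show "\<exists>q. ?P j q"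
    proof (rule cext_homogeneous_expansion[OF cx[of j]])
      fix q :: "nat \<Rightarrow> real^'n \<Rightarrow> real"
      assume q: "\<And>k. cext UNIV (q k)" "\<And>k t x. q k (t *\<^sub>R x) = t ^ k * q k x"
        "(\<And>k x. k \<ge> 1 \<Longrightarrow> q k x = 0) \<Longrightarrow> \<exists>e>0. \<forall>x\<in>ball a e. u j x = u j a"
        "\<And>m. m \<ge> 1 \<Longrightarrow> (\<And>k x. 1 \<le> k \<Longrightarrow> k < m \<Longrightarrow> q k x = 0) \<Longrightarrow>
          \<exists>d>0. \<exists>B. \<forall>\<delta> x. 0 < \<delta> \<longrightarrow> \<delta> \<le> d \<longrightarrow> x \<in> ball a \<delta> \<longrightarrow>
         \<bar>u j x - u j a - q m (x - a)\<bar> \<le> B * \<delta> ^ Suc m \<and>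
         (\<forall>i. \<bar>partial i (u j) x - partial i (q m) (x - a)\<bar> \<le> B * \<delta> ^ m) \<and>
         (\<forall>i k. \<bar>partial k (partial i (u j)) x - partial k (partial i (q m)) (x - a)\<bar> \<le> B * \<delta> ^ (m - 1))"
      show "\<exists>q. ?P j q"
        by (rule exI[of _ q], intro conjI allI impI) (rule q; blast)+
    qed
  qed
  then have "\<exists>Q. \<forall>j. ?P j (Q j)" by (rule choice)
  then obtain Q where P: "\<And>j. ?P j (Q j)" by blast
  have Q: "\<And>j k. cext UNIV (Q j k)" "\<And>j k t x. Q j k (t *\<^sub>R x) = t ^ k * Q j k x"
    "\<And>j. (\<And>k x. k \<ge> 1 \<Longrightarrow> Q j k x = 0) \<Longrightarrow> \<exists>e>0. \<forall>x\<in>ball a e. u j x = u j a"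
    "\<And>j m. m \<ge> 1 \<Longrightarrow> (\<And>k x. 1 \<le> k \<Longrightarrow> k < m \<Longrightarrow> Q j k x = 0) \<Longrightarrow>
       (\<exists>d>0. \<exists>B. \<forall>\<delta> x. 0 < \<delta> \<longrightarrow> \<delta> \<le> d \<longrightarrow> x \<in> ball a \<delta> \<longrightarrow>
         \<bar>u j x - u j a - Q j m (x - a)\<bar> \<le> B * \<delta> ^ Suc m \<and>
         (\<forall>i. \<bar>partial i (u j) x - partial i (Q j m) (x - a)\<bar> \<le> B * \<delta> ^ m) \<and>
         (\<forall>i k. \<bar>partial k (partial i (u j)) x - partial k (partial i (Q j m)) (x - a)\<bar> \<le> B * \<delta> ^ (m - 1)))"
    subgoal for j k using P[of j] by (elim conjE) (erule spec)
    subgoal for j k t x using P[of j] by (elim conjE) (drule spec[where x=k], drule spec[where x=t], erule spec)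
    subgoal for j using P[of j] by (elim conjE) (drule mp, simp, assumption)
    subgoal for j m using P[of j] by (elim conjE) (drule spec[where x=m], simp)
    done
  have "\<exists>k\<ge>1. \<exists>x. Q j0 k x \<noteq> 0"
  proof (rule ccontr)
    assume "\<not> ?thesis"
    then have z: "\<And>k x. k \<ge> 1 \<Longrightarrow> Q j0 k x = 0" by auto
    have "\<exists>e>0. \<forall>x\<in>ball a e. u j0 x = u j0 a" by (rule Q(3)[OF z])
    then obtain e where e: "e > 0" "\<forall>x\<in>ball a e. u j0 x = u j0 a" by (elim exE conjE)
    obtain x where "x \<in> ball a e" "u j0 x \<noteq> u j0 a" using nc[OF e(1)] by (elim bexE)
    with bspec[OF e(2)] show False by (simp only:)
  qed
  then obtain k0 x0 where "k0 \<ge> 1" "Q j0 k0 x0 \<noteq> 0" by (elim exE conjE)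
  then have ex: "\<exists>k. k \<ge> 1 \<and> (\<exists>j x. Q j k x \<noteq> 0)"
    by (intro exI[of _ k0] conjI exI[of _ j0] exI[of _ x0])
  define m where "m = (LEAST k. k \<ge> 1 \<and> (\<exists>j x. Q j k x \<noteq> 0))"
  have m: "m \<ge> 1" "\<exists>j x. Q j m x \<noteq> 0" using LeastI_ex[OF ex] by (auto simp: m_def)
  have low: "Q j k x = 0" if "1 \<le> k" "k < m" for j k x
    using not_less_Least[of k "\<lambda>k. k \<ge> 1 \<and> (\<exists>j x. Q j k x \<noteq> 0)"] that by (auto simp: m_def)
  obtain p where p: "m = Suc p" using m(1) by (cases m) auto
  have hom1: "t * partial i (Q j m) (t *\<^sub>R x) = t ^ m * partial i (Q j m) x" for t i j x
    by (rule partial_homogeneous[OF Q(1) Q(2)])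
  have hom2: "t\<^sup>2 * partial k (partial i (Q j m)) (t *\<^sub>R x) = t ^ m * partial k (partial i (Q j m)) x"
    if "t \<noteq> 0" for t i j k x
  proof -
    have "partial i (Q j m) (t *\<^sub>R x) = (t ^ m / t) * partial i (Q j m) x" for x
      using hom1[of t i j x] that by (simp add: field_simps)
    from partial_homogeneous[OF cext_partial[OF Q(1)] this, of k x]
    show ?thesis using that by (simp add: power2_eq_square field_simps)
  qed
  show thesis
  proof (rule that[of m "\<lambda>j. Q j m"])
    fix j and x :: "real^'n"
    obtain d B where dB: "d > 0" "\<And>\<delta> x. 0 < \<delta> \<Longrightarrow> \<delta> \<le> d \<Longrightarrow> x \<in> ball a \<delta> \<Longrightarrow>
         \<bar>u j x - u j a - Q j m (x - a)\<bar> \<le> B * \<delta> ^ Suc m \<and>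
         (\<forall>i. \<bar>partial i (u j) x - partial i (Q j m) (x - a)\<bar> \<le> B * \<delta> ^ m) \<and>
         (\<forall>i k. \<bar>partial k (partial i (u j)) x - partial k (partial i (Q j m)) (x - a)\<bar> \<le> B * \<delta> ^ (m - 1))"
      using Q(4)[OF m(1), of j] low by meson
    \<comment> \<open>Strictly larger than \<open>norm x\<close>, so that
      \<open>a + t *\<^sub>R x\<close> lies in the open ball of radius \<open>t * N\<close> about
      \<open>a\<close>.\<close>
    define N where "N = norm x + 1"
    have N: "N > 0" by (simp add: N_def add_nonneg_pos)
    have bnd: "\<bar>u j (a + t *\<^sub>R x) - u j a - Q j m (t *\<^sub>R x)\<bar> \<le> B * (t * N) ^ Suc m"
      "\<bar>partial i (u j) (a + t *\<^sub>R x) - partial i (Q j m) (t *\<^sub>R x)\<bar> \<le> B * (t * N) ^ m"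
      "\<bar>partial k (partial i (u j)) (a + t *\<^sub>R x) - partial k (partial i (Q j m)) (t *\<^sub>R x)\<bar> \<le> B * (t * N) ^ p"
      if "0 < t" "t < d / N" for t i k
    proof -
      have "t * N \<le> d" "0 < t * N" using that N by (auto simp: field_simps)
      moreover have "norm (t *\<^sub>R x) < t * N" using that by (simp add: N_def algebra_simps)
      then have "a + t *\<^sub>R x \<in> ball a (t * N)" by (simp add: dist_norm)
      ultimately show "\<bar>u j (a + t *\<^sub>R x) - u j a - Q j m (t *\<^sub>R x)\<bar> \<le> B * (t * N) ^ Suc m"
        "\<bar>partial i (u j) (a + t *\<^sub>R x) - partial i (Q j m) (t *\<^sub>R x)\<bar> \<le> B * (t * N) ^ m"
        "\<bar>partial k (partial i (u j)) (a + t *\<^sub>R x) - partial k (partial i (Q j m)) (t *\<^sub>R x)\<bar> \<le> B * (t * N) ^ p"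
        using dB(2)[of "t * N" "a + t *\<^sub>R x"] by (auto simp: p)
    qed
    have dN: "d / N > 0" using dB(1) N by simp
    have "((\<lambda>t. (u j (a + t *\<^sub>R x) - u j a) / t ^ m - Q j m x) \<longlongrightarrow> 0) (at_right 0)"
    proof (rule tendsto_0_linear_bound[OF dN])
      fix t assume t: "0 < t" "t < d / N"
      have "(u j (a + t *\<^sub>R x) - u j a) / t ^ m - Q j m x = (u j (a + t *\<^sub>R x) - u j a - Q j m (t *\<^sub>R x)) / t ^ m"
        using t by (simp add: Q(2) diff_divide_distrib)
      then have "\<bar>(u j (a + t *\<^sub>R x) - u j a) / t ^ m - Q j m x\<bar> \<le> B * (t * N) ^ Suc m / t ^ m"
        using bnd(1)[OF t] t by (simp add: abs_divide divide_right_mono)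
      also have "\<dots> = B * N ^ Suc m * t" using t by (simp add: power_mult_distrib)
      finally show "\<bar>(u j (a + t *\<^sub>R x) - u j a) / t ^ m - Q j m x\<bar> \<le> B * N ^ Suc m * t" .
    qed
    then show "((\<lambda>t. (u j (a + t *\<^sub>R x) - u j a) / t ^ m) \<longlongrightarrow> Q j m x) (at_right 0)"
      by (simp add: LIM_zero_iff)
    fix i
    have "((\<lambda>t. t * partial i (u j) (a + t *\<^sub>R x) / t ^ m - partial i (Q j m) x) \<longlongrightarrow> 0) (at_right 0)"
    proof (rule tendsto_0_linear_bound[OF dN])
      fix t assume t: "0 < t" "t < d / N"
      have "t * partial i (u j) (a + t *\<^sub>R x) / t ^ m - partial i (Q j m) x
          = t * (partial i (u j) (a + t *\<^sub>R x) - partial i (Q j m) (t *\<^sub>R x)) / t ^ m"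
        using t by (simp add: right_diff_distrib hom1 diff_divide_distrib)
      then have "\<bar>t * partial i (u j) (a + t *\<^sub>R x) / t ^ m - partial i (Q j m) x\<bar> \<le> t * (B * (t * N) ^ m) / t ^ m"
        using bnd(2)[OF t, of i] t by (simp add: abs_divide abs_mult divide_right_mono mult_left_mono)
      also have "\<dots> = B * N ^ m * t" using t by (simp add: power_mult_distrib)
      finally show "\<bar>t * partial i (u j) (a + t *\<^sub>R x) / t ^ m - partial i (Q j m) x\<bar> \<le> B * N ^ m * t" .
    qed
    then show "((\<lambda>t. t * partial i (u j) (a + t *\<^sub>R x) / t ^ m) \<longlongrightarrow> partial i (Q j m) x) (at_right 0)"
      by (simp add: LIM_zero_iff)
    fix k
    have "((\<lambda>t. t\<^sup>2 * partial k (partial i (u j)) (a + t *\<^sub>R x) / t ^ m - partial k (partial i (Q j m)) x) \<longlongrightarrow> 0) (at_right 0)"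
    proof (rule tendsto_0_linear_bound[OF dN])
      fix t assume t: "0 < t" "t < d / N"
      have "t\<^sup>2 * partial k (partial i (u j)) (a + t *\<^sub>R x) / t ^ m - partial k (partial i (Q j m)) x
          = t\<^sup>2 * (partial k (partial i (u j)) (a + t *\<^sub>R x) - partial k (partial i (Q j m)) (t *\<^sub>R x)) / t ^ m"
        using t by (simp add: right_diff_distrib hom2 diff_divide_distrib)
      then have "\<bar>t\<^sup>2 * partial k (partial i (u j)) (a + t *\<^sub>R x) / t ^ m - partial k (partial i (Q j m)) x\<bar>
          \<le> t\<^sup>2 * (B * (t * N) ^ p) / t ^ m"
        using bnd(3)[OF t, of k i] t by (simp add: abs_divide abs_mult divide_right_mono mult_left_mono)
      also have "\<dots> = B * N ^ p * t" using t by (simp add: power_mult_distrib p power2_eq_square)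
      finally show "\<bar>t\<^sup>2 * partial k (partial i (u j)) (a + t *\<^sub>R x) / t ^ m - partial k (partial i (Q j m)) x\<bar>
          \<le> B * N ^ p * t" .
    qed
    then show "((\<lambda>t. t\<^sup>2 * partial k (partial i (u j)) (a + t *\<^sub>R x) / t ^ m)
        \<longlongrightarrow> partial k (partial i (Q j m)) x) (at_right 0)"
      by (simp add: LIM_zero_iff)
  qed (use m Q in auto)
qed

section \<open>Smooth functions and integration by parts\<close>

lemma has_derivative_imp_partial:
  assumes "(u has_derivative D) (at x)"
  shows "partial i u x = D (axis i 1)"
  using frechet_derivative_at[OF assms] by (simp add: partial_def)

lemma partial_mult:
  assumes "u differentiable (at x)" "v differentiable (at x)"
  shows "partial i (\<lambda>y. u y * v y) x = u x * partial i v x + v x * partial i u x"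
proof -
  have "((\<lambda>y. u y * v y) has_derivative
      (\<lambda>h. u x * frechet_derivative v (at x) h + frechet_derivative u (at x) h * v x)) (at x)"
    using assms by (intro has_derivative_mult) (simp_all add: frechet_derivative_works)
  from has_derivative_imp_partial[OF this] show ?thesis by (simp add: partial_def)
qed

lemma differentiable_cong_open:
  assumes "open S" "x \<in> S" "\<And>y. y \<in> S \<Longrightarrow> u y = v y" "u differentiable (at x)"
  shows "v differentiable (at x)"
  using assms unfolding differentiable_def by (metis has_derivative_transform_within_open)

lemma Ck_on_differentiable:
  assumes "Ck_on (Suc k) S u" "open S" "x \<in> S"
  shows "u differentiable (at x)"
  using assms by (auto simp: differentiable_on_eq_differentiable_at)

lemma Ck_on_cong:
  assumes "open S" "\<And>x. x \<in> S \<Longrightarrow> u x = v x" "Ck_on k S u"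
  shows "Ck_on k S v"
  using assms(2,3)
proof (induction k arbitrary: u v)
  case (Suc k)
  have "v differentiable (at x)" if "x \<in> S" for x
    using differentiable_cong_open[where u = u and v = v, OF assms(1) that Suc.prems(1)] Ck_on_differentiable[OF Suc.prems(2) assms(1) that]
    by blast
  moreover have "Ck_on k S (partial i v)" for i
  proof (rule Suc.IH)
    show "partial i u x = partial i v x" if "x \<in> S" for x
      using partial_cong_open[where u = u and v = v, OF assms(1) that] Suc.prems(1) by blast
  qed (use Suc.prems in auto)
  ultimately show ?case using assms(1) by (simp add: differentiable_on_eq_differentiable_at)
qed (auto cong: continuous_on_cong)

lemma Ck_on_subset:
  assumes "Ck_on k S u" "T \<subseteq> S"
  shows "Ck_on k T u"
  using assms(1)
proof (induction k arbitrary: u)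
  case 0 then show ?case using assms(2) by (auto intro: continuous_on_subset)
next
  case (Suc k) then show ?case using assms(2) by (auto intro: differentiable_on_subset)
qed

lemma Ck_on_Un:
  assumes "open S" "open T" "Ck_on k S u" "Ck_on k T u"
  shows "Ck_on k (S \<union> T) u"
  using assms(3,4)
proof (induction k arbitrary: u)
  case 0 then show ?case using assms by (auto intro: continuous_on_open_Un)
next
  case (Suc k)
  then show ?case using assms(1,2) by (auto simp: differentiable_on_eq_differentiable_at open_Un)
qed

lemma Ck_on_Suc_lower:
  assumes "open S" "Ck_on (Suc k) S u"
  shows "Ck_on k S u"
  using assms(2)
proof (induction k arbitrary: u)
  case 0 then show ?case by (auto intro: differentiable_imp_continuous_on)
next
  case (Suc k) then show ?case by (meson Ck_on.simps(2))
qed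

lemma Ck_on_const: "Ck_on k (S :: (real^'n) set) (\<lambda>_. c)"
proof (induction k arbitrary: c)
  case (Suc k)
  have "partial i (\<lambda>_ :: real^'n. c) = (\<lambda>_. 0)" for i by (rule ext) simp
  with Suc show ?case by (simp add: differentiable_on_const)
qed simp

lemma Ck_on_add:
  assumes "open S" "Ck_on k S u" "Ck_on k S v"
  shows "Ck_on k S (\<lambda>x. u x + v x)"
  using assms(2,3)
proof (induction k arbitrary: u v)
  case (Suc k)
  have d: "u differentiable (at x)" "v differentiable (at x)" if "x \<in> S" for x
    using Ck_on_differentiable[OF _ assms(1) that] Suc.prems by blast+
  have "Ck_on k S (partial i (\<lambda>x. u x + v x))" for i
  proof (rule Ck_on_cong[OF assms(1)])
    show "Ck_on k S (\<lambda>x. partial i u x + partial i v x)" using Suc by auto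
  qed (simp add: partial_add d)
  then show ?case using d assms(1) by (simp add: differentiable_on_eq_differentiable_at)
qed (auto intro: continuous_on_add)

lemma Ck_on_mult:
  assumes "open S" "Ck_on k S u" "Ck_on k S v"
  shows "Ck_on k S (\<lambda>x. u x * v x)"
  using assms(2,3)
proof (induction k arbitrary: u v)
  case (Suc k)
  have d: "u differentiable (at x)" "v differentiable (at x)" if "x \<in> S" for x
    using Ck_on_differentiable[OF _ assms(1) that] Suc.prems by blast+
  have l: "Ck_on k S u" "Ck_on k S v" using Ck_on_Suc_lower[OF assms(1)] Suc.prems by blast+
  have "Ck_on k S (partial i (\<lambda>x. u x * v x))" for i
  proof (rule Ck_on_cong[OF assms(1)])
    show "Ck_on k S (\<lambda>x. u x * partial i v x + v x * partial i u x)"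
      using Suc.prems l by (intro Ck_on_add[OF assms(1)] Suc.IH) auto
  qed (simp add: partial_mult d)
  then show ?case using d assms(1) by (simp add: differentiable_on_eq_differentiable_at)
qed (auto intro: continuous_on_mult)

lemma Ck_on_prod:
  assumes "open S" "\<And>j. j \<in> A \<Longrightarrow> Ck_on k S (u j)"
  shows "Ck_on k S (\<lambda>x. \<Prod>j\<in>A. u j x)"
  using assms(2)
  by (induction A rule: infinite_finite_induct) (auto intro: Ck_on_mult Ck_on_const assms(1))

text \<open>The whole sequence of derivatives is passed as \<open>g\<close>; a partial derivative
  moves the start \<open>m\<close> up by one and \<open>k\<close> down by one, so the induction
  keeps \<open>m + k\<close> fixed.\<close>

lemma Ck_on_coordinate:
  fixes g :: "nat \<Rightarrow> real \<Rightarrow> real"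
  assumes "\<And>n t. n < m + k \<Longrightarrow> (g n has_real_derivative g (Suc n) t) (at t)"
    "continuous_on UNIV (g (m + k))"
  shows "Ck_on k S (\<lambda>x :: real^'n. g m (x $ i))"
  using assms
proof (induction k arbitrary: m)
  case 0
  then have "continuous_on S (\<lambda>x :: real^'n. g m (x $ i))"
    by (intro continuous_on_compose2[of UNIV "g m" S "\<lambda>x. x $ i"]) (auto intro!: continuous_intros)
  then show ?case by simp
next
  case (Suc k)
  have D: "((\<lambda>x :: real^'n. g m (x $ i)) has_derivative (\<lambda>h. g (Suc m) (x $ i) * h $ i)) (at x)" for x
    by (rule has_derivative_compose[OF bounded_linear_imp_has_derivative[OF bounded_linear_vec_nth]
          has_field_derivative_imp_has_derivative[OF Suc.prems(1)]]) simp
  have "Ck_on k S (partial j (\<lambda>x :: real^'n. g m (x $ i)))" for j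
  proof (cases "i = j")
    case True
    have "partial j (\<lambda>x :: real^'n. g m (x $ i)) = (\<lambda>x. g (Suc m) (x $ i))"
      using True by (intro ext) (subst has_derivative_imp_partial[OF D], simp add: axis_def)
    moreover have "Ck_on k S (\<lambda>x :: real^'n. g (Suc m) (x $ i))"
      by (rule Suc.IH) (use Suc.prems in auto)
    ultimately show ?thesis by simp
  next
    case False
    then have "partial j (\<lambda>x :: real^'n. g m (x $ i)) = (\<lambda>x. 0)"
      by (simp add: fun_eq_iff has_derivative_imp_partial[OF D] axis_def)
    then show ?thesis by (simp add: Ck_on_const)
  qed
  moreover have "(\<lambda>x :: real^'n. g m (x $ i)) differentiable_on S"
    using D by (meson differentiable_at_imp_differentiable_on differentiable_def)
  ultimately show ?case by simp
qed

text \<open>Nothing is known about \<open>u\<close> outside \<open>S\<close>. The product is regular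
  on \<open>S\<close> by the product rule and zero on the complement of \<open>C\<close>, and these
  two open sets cover the space.\<close>

lemma Ck_on_mult_cutoff:
  assumes "open S" "Ck_on k S u" "Ck_on k UNIV \<psi>" "closed C" "C \<subseteq> S" "\<And>x. x \<notin> C \<Longrightarrow> \<psi> x = 0"
  shows "Ck_on k UNIV (\<lambda>x. \<psi> x * u x)"
proof -
  have "Ck_on k S (\<lambda>x. \<psi> x * u x)"
    by (intro Ck_on_mult assms Ck_on_subset[OF assms(3)]) auto
  moreover have "Ck_on k (- C) (\<lambda>x. \<psi> x * u x)"
    by (rule Ck_on_cong[OF _ _ Ck_on_const[of _ _ 0]]) (use assms in auto)
  ultimately have "Ck_on k (S \<union> - C) (\<lambda>x. \<psi> x * u x)" using assms by (intro Ck_on_Un) auto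
  moreover have "S \<union> - C = UNIV" using assms(5) by auto
  ultimately show ?thesis by simp
qed

section \<open>Integration over the whole space\<close>

lemma integrable_compact_support:
  fixes h :: "'a::euclidean_space \<Rightarrow> real"
  assumes "continuous_on UNIV h" "\<And>x. norm x > R \<Longrightarrow> h x = 0"
  shows "integrable lborel h"
proof -
  have "integrable lborel (\<lambda>x. indicator (cball 0 R) x *\<^sub>R h x)"
    by (rule borel_integrable_compact) (use assms(1) in \<open>auto intro: continuous_on_subset\<close>)
  moreover have "indicator (cball 0 R) x *\<^sub>R h x = h x" for x
    using assms(2)[of x] by (auto simp: indicator_def)
  ultimately show ?thesis by (simp only: cong: Bochner_Integration.integrable_cong)
qed

lemma lborel_integral_translate:
  fixes h :: "'a::euclidean_space \<Rightarrow> real"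
  assumes "h \<in> borel_measurable borel"
  shows "(\<integral>x. h (c + x) \<partial>lborel) = (\<integral>x. h x \<partial>lborel)"
proof -
  have "(\<integral>x. h x \<partial>lborel) = (\<integral>x. h x \<partial>distr lborel borel ((+) c))"
    by (simp add: lborel_distr_plus)
  also have "\<dots> = (\<integral>x. h (c + x) \<partial>lborel)"
    by (rule integral_distr) (use assms in auto)
  finally show ?thesis by simp
qed

lemma partial_line:
  assumes "h differentiable (at (x + t *\<^sub>R axis i 1))"
  shows "((\<lambda>t. h (x + t *\<^sub>R axis i 1)) has_real_derivative partial i h (x + t *\<^sub>R axis i 1)) (at t)"
proof -
  have "((\<lambda>t. x + t *\<^sub>R axis i 1) has_derivative (\<lambda>s. s *\<^sub>R axis i 1)) (at t)"
    by (auto intro!: derivative_eq_intros)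
  from has_derivative_compose[OF this has_derivative_partial[OF assms]]
  have "((\<lambda>t. h (x + t *\<^sub>R axis i 1)) has_derivative
      (\<lambda>s. \<Sum>k\<in>UNIV. partial k h (x + t *\<^sub>R axis i 1) * (s *\<^sub>R axis i 1) $ k)) (at t)" .
  then show ?thesis
    unfolding has_field_derivative_def
    by (rule has_derivative_eq_rhs) (simp add: fun_eq_iff axis_def if_distrib cong: if_cong)
qed

text \<open>By translation invariance the integrals of the difference quotients vanish, so no Fubini argument is needed.\<close>

lemma integral_partial_eq_0:
  fixes h :: "real^'n \<Rightarrow> real"
  assumes diff: "\<And>x. h differentiable (at x)" and cont: "continuous_on UNIV (partial i h)"
    and supp: "\<And>x. norm x > R \<Longrightarrow> h x = 0"
  shows "(\<integral>x. partial i h x \<partial>lborel) = 0"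
proof -
  have conth: "continuous_on UNIV h"
    using diff by (meson continuous_at_imp_continuous_on differentiable_imp_continuous_within)
  have inth: "integrable lborel h" by (rule integrable_compact_support[OF conth supp])
  have [measurable]: "h \<in> borel_measurable borel" "partial i h \<in> borel_measurable borel"
    using conth cont by (auto intro: borel_measurable_continuous_onI)
  have psupp: "partial i h x = 0" if "norm x > R" for x
  proof -
    have "partial i h x = partial i (\<lambda>_. 0) x"
      by (rule partial_cong_open[of "{x. norm x > R}"])
         (use that supp in \<open>auto intro!: open_Collect_less continuous_intros\<close>)
    then show ?thesis by simp
  qed
  have "bounded (partial i h ` cball 0 R)"
    by (intro compact_imp_bounded compact_continuous_image continuous_on_subset[OF cont]) auto
  then obtain M where M: "\<And>x. norm x \<le> R \<Longrightarrow> \<bar>partial i h x\<bar> \<le> M"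
    unfolding bounded_iff by (metis imageI mem_cball_0 real_norm_def)
  define M' where "M' = \<bar>M\<bar>"
  have M': "\<bar>partial i h x\<bar> \<le> M'" for x
    using M[of x] psupp[of x] by (cases "norm x \<le> R") (auto simp: M'_def)
  define t where "t k = 1 / real (Suc k)" for k
  have t: "0 < t k" "t k \<le> 1" for k by (auto simp: t_def)
  define s where "s k x = (h (x + t k *\<^sub>R axis i 1) - h x) / t k" for k x
  have "(\<lambda>k. \<integral>x. s k x \<partial>lborel) \<longlonglongrightarrow> (\<integral>x. partial i h x \<partial>lborel)"
  proof (rule integral_dominated_convergence)
    \<comment> \<open>As \<open>t k\<close> is at most 1, the difference quotients vanish outside
      \<open>cball 0 (R + 1)\<close>; inside, the mean value theorem bounds them by
      \<open>M'\<close>.\<close>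
    show "integrable lborel (\<lambda>x. indicator (cball 0 (R + 1)) x * M' :: real)"
      by (intro integrable_mult_left integrable_real_indicator emeasure_bounded_finite) auto
    show "AE x in lborel. (\<lambda>k. s k x) \<longlonglongrightarrow> partial i h x"
    proof (rule AE_I2)
      fix x
      have "((\<lambda>t. h (x + t *\<^sub>R axis i 1)) has_real_derivative partial i h (x + 0 *\<^sub>R axis i 1)) (at 0)"
        by (rule partial_line[OF diff])
      then have lim: "((\<lambda>t. (h (x + t *\<^sub>R axis i 1) - h x) / t) \<longlongrightarrow> partial i h x) (at 0)"
        by (simp add: DERIV_def)
      have "filterlim t (at 0) sequentially"
        unfolding filterlim_at
      proof
        show "t \<longlonglongrightarrow> 0" unfolding t_def using LIMSEQ_inverse_real_of_nat by (simp add: inverse_eq_divide)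
        show "\<forall>\<^sub>F k in sequentially. t k \<in> UNIV \<and> t k \<noteq> 0" using t(1) by (simp add: less_imp_neq[symmetric] order_less_imp_not_eq2)
      qed
      from filterlim_compose[OF lim this] show "(\<lambda>k. s k x) \<longlonglongrightarrow> partial i h x" by (simp add: s_def)
    qed
    show "AE x in lborel. norm (s k x) \<le> indicator (cball 0 (R + 1)) x * M'" for k
    proof (rule AE_I2)
      fix x
      show "norm (s k x) \<le> indicator (cball 0 (R + 1)) x * M'"
      proof (cases "norm x \<le> R + 1")
        case False
        have "norm x \<le> norm (x + t k *\<^sub>R axis i 1) + norm (t k *\<^sub>R axis i 1 :: real^'n)"
          using norm_triangle_ineq4[of "x + t k *\<^sub>R axis i 1" "t k *\<^sub>R axis i 1"] by simp
        also have "norm (t k *\<^sub>R axis i 1 :: real^'n) \<le> 1" using t[of k] by simp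
        finally have "norm (x + t k *\<^sub>R axis i 1) > R" using False by simp
        then show ?thesis using False supp by (simp add: s_def)
      next
        case True
        obtain \<xi> where "h (x + t k *\<^sub>R axis i 1) - h (x + 0 *\<^sub>R axis i 1)
            = (t k - 0) * partial i h (x + \<xi> *\<^sub>R axis i 1)"
          using MVT2[OF t(1)[of k], of "\<lambda>t. h (x + t *\<^sub>R axis i 1)" "\<lambda>t. partial i h (x + t *\<^sub>R axis i 1)"]
            partial_line[OF diff] by blast
        then have "s k x = partial i h (x + \<xi> *\<^sub>R axis i 1)" using t(1)[of k] by (simp add: s_def field_simps)
        then show ?thesis using True M' by simp
      qed
    qed
  qed (simp_all add: s_def)
  moreover have "(\<integral>x. s k x \<partial>lborel) = 0" for k
  proof -
    have int2: "integrable lborel (\<lambda>x. h (x + t k *\<^sub>R axis i 1))"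
    proof (rule integrable_compact_support[of _ "R + 1"])
      show "continuous_on UNIV (\<lambda>x. h (x + t k *\<^sub>R axis i 1))"
        by (rule continuous_on_compose2[OF conth]) (auto intro!: continuous_intros)
      fix x :: "real^'n" assume "norm x > R + 1"
      moreover have "norm x \<le> norm (x + t k *\<^sub>R axis i 1) + norm (t k *\<^sub>R axis i 1 :: real^'n)"
        using norm_triangle_ineq4[of "x + t k *\<^sub>R axis i 1" "t k *\<^sub>R axis i 1"] by simp
      moreover have "norm (t k *\<^sub>R axis i 1 :: real^'n) \<le> 1" using t[of k] by simp
      ultimately show "h (x + t k *\<^sub>R axis i 1) = 0" by (intro supp) linarith
    qed
    have "(\<integral>x. h (x + t k *\<^sub>R axis i 1) \<partial>lborel) = (\<integral>x. h x \<partial>lborel)"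
      using lborel_integral_translate[of h "t k *\<^sub>R axis i 1"] by (simp add: add.commute)
    then show ?thesis unfolding s_def using int2 inth by simp
  qed
  ultimately show ?thesis using LIMSEQ_unique[of "\<lambda>_. 0 :: real"] by simp
qed

section \<open>Analyticity of harmonic functions\<close>

lemma DERIV_glue:
  fixes f g :: "real \<Rightarrow> real"
  assumes f: "\<And>t. t \<le> c \<Longrightarrow> (f has_real_derivative f' t) (at t)"
    and g: "\<And>t. t \<ge> c \<Longrightarrow> (g has_real_derivative g' t) (at t)"
    and "f c = g c" "f' c = g' c"
  shows "((\<lambda>t. if t \<le> c then f t else g t) has_real_derivative (if t \<le> c then f' t else g' t)) (at t)"
proof -
  consider "t < c" | "t > c" | "t = c" by linarith
  then show ?thesis
  proof cases
    case 1
    have "((\<lambda>t. if t \<le> c then f t else g t) has_real_derivative f' t) (at t)"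
      by (rule has_field_derivative_transform_within_open[OF f, of _ "{..<c}"]) (use 1 in auto)
    with 1 show ?thesis by simp
  next
    case 2
    have "((\<lambda>t. if t \<le> c then f t else g t) has_real_derivative g' t) (at t)"
      by (rule has_field_derivative_transform_within_open[OF g, of _ "{c<..}"]) (use 2 in auto)
    with 2 show ?thesis by simp
  next
    case 3
    have "((\<lambda>y. (f y - f c) / (y - c)) \<longlongrightarrow> f' c) (at_left c)"
      using f[of c] unfolding has_field_derivative_iff by (simp add: filterlim_at_split)
    then have l: "((\<lambda>y. ((if y \<le> c then f y else g y) - f c) / (y - c)) \<longlongrightarrow> f' c) (at_left c)"
      by (rule Lim_transform_eventually) (auto simp: eventually_at_filter)
    have "((\<lambda>y. (g y - g c) / (y - c)) \<longlongrightarrow> g' c) (at_right c)"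
      using g[of c] unfolding has_field_derivative_iff by (simp add: filterlim_at_split)
    then have r: "((\<lambda>y. ((if y \<le> c then f y else g y) - f c) / (y - c)) \<longlongrightarrow> f' c) (at_right c)"
      unfolding assms(4) assms(3) by (rule Lim_transform_eventually) (auto simp: eventually_at_filter)
    show ?thesis using l r 3 unfolding has_field_derivative_iff by (simp add: filterlim_at_split)
  qed
qed

text \<open>The Newton kernel as a function of the squared distance, replaced below \<open>1\<close> by its second-order
  Taylor polynomial so that it becomes \<open>C\<^sup>2\<close>, together with its two derivatives.\<close>

definition newton0 :: "real \<Rightarrow> real" where
  "newton0 s = (if s \<le> 1 then 1 - (s - 1) / 2 + 3 / 8 * (s - 1)\<^sup>2 else 1 / sqrt s)"

definition newton1 :: "real \<Rightarrow> real" where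
  "newton1 s = (if s \<le> 1 then - 1 / 2 + 3 / 4 * (s - 1) else - 1 / (2 * s * sqrt s))"

definition newton2 :: "real \<Rightarrow> real" where
  "newton2 s = (if s \<le> 1 then 3 / 4 else 3 / (4 * s\<^sup>2 * sqrt s))"

lemma newton0_deriv: "(newton0 has_real_derivative newton1 s) (at s)"
  unfolding newton0_def[abs_def] newton1_def
proof (rule DERIV_glue)
  show "((\<lambda>s. 1 - (s - 1) / 2 + 3 / 8 * (s - 1)\<^sup>2) has_real_derivative - 1 / 2 + 3 / 4 * (t - 1)) (at t)" for t :: real
    by (auto intro!: derivative_eq_intros)
  show "((\<lambda>s. 1 / sqrt s) has_real_derivative - 1 / (2 * t * sqrt t)) (at t)" if "1 \<le> t" for t
    using that by (auto intro!: derivative_eq_intros simp: field_simps power2_eq_square)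
qed auto

lemma newton1_deriv: "(newton1 has_real_derivative newton2 s) (at s)"
  unfolding newton1_def[abs_def] newton2_def
proof (rule DERIV_glue)
  show "((\<lambda>s. - 1 / 2 + 3 / 4 * (s - 1)) has_real_derivative 3 / 4) (at t)" for t :: real
    by (auto intro!: derivative_eq_intros)
  show "((\<lambda>s. - 1 / (2 * s * sqrt s)) has_real_derivative 3 / (4 * t\<^sup>2 * sqrt t)) (at t)" if "1 \<le> t" for t
  proof -
    have D: "((\<lambda>s. - 1 / (2 * s * sqrt s)) has_real_derivative
        (2 * sqrt t + 2 * t * (inverse (sqrt t) / 2)) / (2 * t * sqrt t)\<^sup>2) (at t)"
      using that by (auto intro!: derivative_eq_intros simp: power2_eq_square) (simp add: minus_divide_left mult.commute)
    have t: "t = sqrt t * sqrt t" "sqrt t > 0" using that by auto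
    have "(2 * sqrt t + 2 * t * (inverse (sqrt t) / 2)) / (2 * t * sqrt t)\<^sup>2 = 3 / (4 * t\<^sup>2 * sqrt t)"
      by (subst (1 2 3 4 5 6 7) t(1)) (use t(2) in \<open>simp add: field_simps power2_eq_square\<close>)
    with D show ?thesis by simp
  qed
qed auto

lemma continuous_newton2: "continuous_on UNIV newton2"
proof -
  have "continuous_on ({..1} \<union> {1..}) (\<lambda>s. if s \<le> 1 then 3 / 4 else 3 / (4 * s\<^sup>2 * sqrt s) :: real)"
    by (rule continuous_on_cases) (auto intro!: continuous_intros)
  moreover have "{..1} \<union> {1..} = (UNIV :: real set)" by auto
  ultimately show ?thesis by (simp add: newton2_def[abs_def])
qed

text \<open>The left-hand side is the Laplacian, in dimension three, of \<open>newton0\<close>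
  applied to the squared distance. Beyond 1 the Newton kernel is harmonic; within 1 the Taylor
  polynomial leaves a continuous function of one sign.\<close>

lemma newton_laplacian: "4 * s * newton2 s + 6 * newton1 s = - (15 / 2) * max 0 (1 - s)"
proof (cases "s \<le> 1")
  case False
  then have "4 * s * (3 / (4 * s\<^sup>2 * sqrt s)) + 6 * (- 1 / (2 * s * sqrt s)) = 0"
    by (simp add: field_simps power2_eq_square)
  then show ?thesis using False by (simp add: newton1_def newton2_def)
qed (simp add: newton1_def newton2_def field_simps)

lemma newton0_ge: "s \<ge> 1 \<Longrightarrow> newton0 s = 1 / sqrt s"
  by (auto simp: newton0_def)

section \<open>Radial functions and Green's identity\<close>

definition sqd :: "real^'n \<Rightarrow> real^'n \<Rightarrow> real" where "sqd x y = (y - x) \<bullet> (y - x)"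

lemma sqd_norm: "sqd x y = (norm (y - x))\<^sup>2" by (simp add: sqd_def power2_norm_eq_inner)

lemma sqd_has_derivative: "(sqd x has_derivative (\<lambda>h. 2 * ((y - x) \<bullet> h))) (at y)"
  unfolding sqd_def[abs_def] by (auto intro!: derivative_eq_intros simp: inner_commute)

lemma continuous_on_sqd [continuous_intros]:
  "continuous_on S f \<Longrightarrow> continuous_on S (\<lambda>y. sqd x (f y))"
  unfolding sqd_def by (intro continuous_intros)

lemma radial_has_derivative:
  assumes "(\<gamma> has_real_derivative \<gamma>' (sqd x y)) (at (sqd x y))"
  shows "((\<lambda>y. \<gamma> (sqd x y)) has_derivative (\<lambda>h. \<gamma>' (sqd x y) * (2 * ((y - x) \<bullet> h)))) (at y)"
  by (rule has_derivative_compose[OF sqd_has_derivative has_field_derivative_imp_has_derivative[OF assms]])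

lemma has_derivative_differentiable_on:
  assumes "\<And>x. (f has_derivative D x) (at x)"
  shows "f differentiable_on S"
  using assms by (meson differentiable_at_imp_differentiable_on differentiable_def)

lemma radial_C2:
  fixes x :: "real^'n"
  assumes "\<And>s. (\<gamma>0 has_real_derivative \<gamma>1 s) (at s)" "\<And>s. (\<gamma>1 has_real_derivative \<gamma>2 s) (at s)"
    "continuous_on UNIV \<gamma>2"
  shows "Ck_on 2 UNIV (\<lambda>y. \<gamma>0 (sqd x y))"
    and "laplacian (\<lambda>y. \<gamma>0 (sqd x y)) y = 4 * sqd x y * \<gamma>2 (sqd x y) + 2 * real CARD('n) * \<gamma>1 (sqd x y)"
proof -
  have p1: "partial i (\<lambda>y. \<gamma>0 (sqd x y)) = (\<lambda>y. \<gamma>1 (sqd x y) * (2 * (y - x) $ i))" for i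
    by (intro ext) (subst has_derivative_imp_partial[OF radial_has_derivative[where \<gamma> = \<gamma>0 and \<gamma>' = \<gamma>1, OF assms(1)]], simp add: inner_axis)
  have lin: "((\<lambda>y. 2 * (y - x) $ i) has_derivative (\<lambda>h. 2 * h $ i)) (at y)" for i y
    by (auto intro!: derivative_eq_intros bounded_linear_imp_has_derivative bounded_linear_vec_nth)
  have D2: "((\<lambda>y. \<gamma>1 (sqd x y) * (2 * (y - x) $ i)) has_derivative
     (\<lambda>h. \<gamma>1 (sqd x y) * (2 * h $ i) + \<gamma>2 (sqd x y) * (2 * ((y - x) \<bullet> h)) * (2 * (y - x) $ i))) (at y)" for i y
    by (rule has_derivative_mult[OF radial_has_derivative[where \<gamma> = \<gamma>1 and \<gamma>' = \<gamma>2, OF assms(2)] lin])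
  have p2: "partial j (\<lambda>y. \<gamma>1 (sqd x y) * (2 * (y - x) $ i)) =
     (\<lambda>y. \<gamma>1 (sqd x y) * (2 * axis j 1 $ i) + \<gamma>2 (sqd x y) * (2 * (y - x) $ j) * (2 * (y - x) $ i))" for i j
    by (intro ext) (subst has_derivative_imp_partial[OF D2], simp add: inner_axis)
  have c1: "continuous_on UNIV \<gamma>1" using assms(2) by (meson DERIV_isCont continuous_at_imp_continuous_on)
  have "continuous_on UNIV (\<lambda>y. \<gamma>1 (sqd x y) * (2 * axis j 1 $ i) + \<gamma>2 (sqd x y) * (2 * (y - x) $ j) * (2 * (y - x) $ i))" for i j
    by (intro continuous_intros continuous_on_compose2[OF c1] continuous_on_compose2[OF assms(3)]) auto
  moreover have "(\<lambda>y. \<gamma>0 (sqd x y)) differentiable_on UNIV"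
    by (rule has_derivative_differentiable_on[OF radial_has_derivative[where \<gamma> = \<gamma>0 and \<gamma>' = \<gamma>1, OF assms(1)]])
  moreover have "(\<lambda>y. \<gamma>1 (sqd x y) * (2 * (y - x) $ i)) differentiable_on UNIV" for i
    by (rule has_derivative_differentiable_on[OF D2])
  ultimately show "Ck_on 2 UNIV (\<lambda>y. \<gamma>0 (sqd x y))"
    by (simp only: numeral_2_eq_2 Ck_on.simps p1 p2) blast
  have sq: "sqd x y = (\<Sum>i\<in>UNIV. (y - x) $ i * (y - x) $ i)" by (simp add: sqd_def inner_vec_def)
  have alg: "g * (2 * t) * (2 * t) = (4 * g) * (t * t)" for g t :: real by simp
  have "(\<Sum>i\<in>UNIV. \<gamma>2 (sqd x y) * (2 * (y - x) $ i) * (2 * (y - x) $ i)) = 4 * sqd x y * \<gamma>2 (sqd x y)"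
    unfolding alg sum_distrib_left[symmetric] sq[symmetric] by simp
  then show "laplacian (\<lambda>y. \<gamma>0 (sqd x y)) y = 4 * sqd x y * \<gamma>2 (sqd x y) + 2 * real CARD('n) * \<gamma>1 (sqd x y)"
    unfolding laplacian_def p1 p2 sum.distrib by (simp add: axis_def)
qed

lemma Ck2_D:
  fixes v :: "real^'n \<Rightarrow> real"
  assumes "Ck_on 2 UNIV v"
  shows "v differentiable (at x)" "partial i v differentiable (at x)" "continuous_on UNIV (partial j (partial i v))"
    "continuous_on UNIV v" "continuous_on UNIV (partial i v)" "Ck_on 1 UNIV v" "Ck_on 1 UNIV (partial i v)"
    "continuous_on UNIV (laplacian v)"
proof -
  have 2: "Ck_on (Suc (Suc 0)) UNIV v" using assms by (simp add: numeral_2_eq_2)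
  show d: "v differentiable (at x)" for x using Ck_on_differentiable[OF 2] by simp
  show 1: "Ck_on 1 UNIV (partial i v)" for i using 2 by simp
  then have c1: "Ck_on (Suc 0) UNIV (partial i v)" for i by simp
  show d1: "partial i v differentiable (at x)" for i x using Ck_on_differentiable[OF c1] by simp
  show c2: "continuous_on UNIV (partial j (partial i v))" for i j using 2 by simp
  show "continuous_on UNIV v" "continuous_on UNIV (partial i v)"
    using d d1 by (meson continuous_at_imp_continuous_on differentiable_imp_continuous_within)+
  show "Ck_on 1 UNIV v" using Ck_on_Suc_lower[OF open_UNIV 2] by simp
  show "continuous_on UNIV (laplacian v)"
    unfolding laplacian_def[abs_def] by (intro continuous_on_sum c2)
qed

lemma partial_zero_outside:
  assumes "\<And>x. norm x > R \<Longrightarrow> h x = 0" "norm x > R"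
  shows "partial i h x = 0"
proof -
  have "partial i h x = partial i (\<lambda>_. 0) x"
    by (rule partial_cong_open[of "{x. norm x > R}"])
       (use assms in \<open>auto intro!: open_Collect_less continuous_intros\<close>)
  then show ?thesis by simp
qed

lemma laplacian_zero_outside:
  assumes "\<And>x. norm x > R \<Longrightarrow> h x = 0" "norm x > R"
  shows "laplacian h x = 0"
  unfolding laplacian_def
  by (rule sum.neutral, rule ballI, rule partial_zero_outside[OF partial_zero_outside]) (use assms in auto)

text \<open>The difference of the two integrands is the divergence of k grad v - v grad k, a vector
  field with compact support, so its integral vanishes coordinate by coordinate.\<close>

lemma green_identity:
  fixes v k :: "real^'n \<Rightarrow> real"
  assumes v: "Ck_on 2 UNIV v" and k: "Ck_on 2 UNIV k" and supp: "\<And>x. norm x > R \<Longrightarrow> v x = 0"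
  shows "(\<integral>x. k x * laplacian v x \<partial>lborel) = (\<integral>x. v x * laplacian k x \<partial>lborel)"
proof -
  \<comment> \<open>The sign is moved into \<open>w\<close>, so that the vector field
    \<open>h\<close> is made of sums and products only.\<close>
  define w where "w x = - 1 * v x" for x
  have w: "Ck_on 2 UNIV w" unfolding w_def by (intro Ck_on_mult Ck_on_const v open_UNIV)
  have pw: "partial i w x = - partial i v x" for i x
    unfolding w_def by (subst partial_cmult[OF Ck2_D(1)[OF v]]) simp
  define h where "h i x = k x * partial i v x + w x * partial i k x" for i x
  have hC: "Ck_on 1 UNIV (h i)" for i
    unfolding h_def by (intro Ck_on_add Ck_on_mult Ck2_D[OF v] Ck2_D[OF k] Ck2_D[OF w] open_UNIV)
  have ph: "partial i (h i) x = k x * partial i (partial i v) x - v x * partial i (partial i k) x" for i x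
  proof -
    note d = Ck2_D(1,2)[OF v] Ck2_D(1,2)[OF k] Ck2_D(1)[OF w]
    have "partial i (h i) x = partial i (\<lambda>x. k x * partial i v x) x + partial i (\<lambda>x. w x * partial i k x) x"
      unfolding h_def by (intro partial_add differentiable_mult d)
    also have "partial i (\<lambda>x. k x * partial i v x) x = k x * partial i (partial i v) x + partial i v x * partial i k x"
      by (rule partial_mult[OF d(3) d(2)])
    also have "partial i (\<lambda>x. w x * partial i k x) x = w x * partial i (partial i k) x + partial i k x * partial i w x"
      by (rule partial_mult[OF d(5) d(4)])
    finally show ?thesis by (simp add: pw w_def algebra_simps)
  qed
  have h0: "h i x = 0" if "norm x > R" for i x
    using supp[OF that] partial_zero_outside[OF supp that] by (simp add: h_def w_def)
  have z: "(\<integral>x. partial i (h i) x \<partial>lborel) = 0" for i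
  proof (rule integral_partial_eq_0[OF _ _ h0])
    have 1: "Ck_on (Suc 0) UNIV (h i)" using hC by simp
    show "h i differentiable (at x)" for x using Ck_on_differentiable[OF 1] by simp
    show "continuous_on UNIV (partial i (h i))" using 1 by simp
  qed
  have int: "integrable lborel (partial i (h i))" for i
    by (rule integrable_compact_support[OF _ partial_zero_outside[OF h0]]) (use hC[of i] in auto)
  have iv: "integrable lborel (\<lambda>x. k x * laplacian v x)"
    by (rule integrable_compact_support[of _ R])
       (auto intro!: continuous_intros Ck2_D[OF v] Ck2_D[OF k] laplacian_zero_outside supp)
  have ik: "integrable lborel (\<lambda>x. v x * laplacian k x)"
    by (rule integrable_compact_support[of _ R])
       (auto intro!: continuous_intros Ck2_D[OF v] Ck2_D[OF k] supp)
  have "(\<integral>x. k x * laplacian v x - v x * laplacian k x \<partial>lborel) = (\<integral>x. (\<Sum>i\<in>UNIV. partial i (h i) x) \<partial>lborel)"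
    by (simp add: ph laplacian_def sum_subtractf sum_distrib_left)
  also have "\<dots> = 0" using int z by (subst Bochner_Integration.integral_sum) auto
  finally show ?thesis using iv ik by simp
qed

text \<open>Minus the Laplacian of the truncated Newton kernel at scale \<open>e\<close>, which
  dictates the factor 15 / (2 * e ^ 3). The total mass is 4 * pi; the argument works with its
  positivity and its independence of \<open>e\<close>.\<close>

definition mollifier :: "real \<Rightarrow> real^3 \<Rightarrow> real" where
  "mollifier e y = 15 / (2 * e ^ 3) * max 0 (1 - sqd 0 y / e\<^sup>2)"

lemma continuous_mollifier: "continuous_on UNIV (mollifier e)"
  unfolding mollifier_def[abs_def]
  by (cases "e = 0") (auto intro!: continuous_intros)

lemma mollifier_nonneg: "e > 0 \<Longrightarrow> mollifier e y \<ge> 0"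
  by (simp add: mollifier_def)

lemma mollifier_support: "e > 0 \<Longrightarrow> norm y \<ge> e \<Longrightarrow> mollifier e y = 0"
  by (auto simp: mollifier_def sqd_norm max_def divide_simps dest: power_mono[of e "norm y" 2])

lemma integral_mollifier_pos:
  assumes "e > 0"
  shows "(\<integral>y. mollifier e y \<partial>lborel) > 0"
proof -
  have int: "integrable lborel (mollifier e)"
    by (rule integrable_compact_support[OF continuous_mollifier, of e]) (use assms mollifier_support in auto)
  define c where "c = 15 / (2 * e ^ 3) * (3 / 4)"
  have "0 < c * measure lborel (ball (0 :: real^3) (e / 2))"
    using assms by (intro mult_pos_pos content_ball_pos) (auto simp: c_def)
  also have "\<dots> = (\<integral>y. indicator (ball (0 :: real^3) (e / 2)) y * c \<partial>lborel)" by simp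
  also have "\<dots> \<le> (\<integral>y. mollifier e y \<partial>lborel)"
  proof (rule integral_mono)
    show "integrable lborel (\<lambda>y. indicator (ball (0 :: real^3) (e / 2)) y * c)"
      by (intro integrable_mult_left integrable_real_indicator emeasure_bounded_finite) auto
    show "indicator (ball 0 (e / 2)) y * c \<le> mollifier e y" for y :: "real^3"
    proof (cases "norm y < e / 2")
      case True
      then have "(norm y)\<^sup>2 \<le> (e / 2)\<^sup>2" by (intro power_mono) auto
      then have "sqd 0 y / e\<^sup>2 \<le> 1 / 4" using assms by (simp add: sqd_norm power_divide divide_simps)
      then have "3 / 4 \<le> 1 - sqd 0 y / e\<^sup>2" by linarith
      then have "3 / 4 \<le> max 0 (1 - sqd 0 y / e\<^sup>2)" by (rule max.coboundedI2)
      then have "c \<le> mollifier e y"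
        unfolding mollifier_def c_def by (rule mult_left_mono) (use assms in simp)
      then show ?thesis using True by simp
    qed (use mollifier_nonneg[OF assms] in auto)
  qed (rule int)
  finally show ?thesis .
qed

text \<open>The singular kernel may be replaced by the truncated one: the two agree at distance at
  least \<open>e\<close> from \<open>x\<close>, and closer to \<open>x\<close> the factor
  \<open>laplacian v\<close> vanishes. Green's identity then moves the Laplacian to the kernel,
  where it produces the mollifier.\<close>

lemma mollifier_identity:
  fixes v :: "real^3 \<Rightarrow> real"
  assumes v: "Ck_on 2 UNIV v" and supp: "\<And>x. norm x > R \<Longrightarrow> v x = 0"
    and e: "0 < e" and zero: "\<And>y. y \<in> ball x e \<Longrightarrow> laplacian v y = 0"
  shows "(\<integral>y. laplacian v y / norm (y - x) \<partial>lborel) = - (\<integral>y. mollifier e (y - x) * v y \<partial>lborel)"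
    and "continuous_on UNIV (\<lambda>y. laplacian v y / norm (y - x))"
proof -
  define \<gamma>0 where "\<gamma>0 s = newton0 (s / e\<^sup>2) / e" for s
  define \<gamma>1 where "\<gamma>1 s = newton1 (s / e\<^sup>2) / e ^ 3" for s
  define \<gamma>2 where "\<gamma>2 s = newton2 (s / e\<^sup>2) / e ^ 5" for s
  have e5: "e ^ 5 = e\<^sup>2 * e ^ 3" by (simp flip: power_add)
  have d0: "(\<gamma>0 has_real_derivative \<gamma>1 s) (at s)" for s
  proof -
    have "((\<lambda>s. newton0 (s / e\<^sup>2) / e) has_real_derivative (newton1 (s / e\<^sup>2) * (1 / e\<^sup>2)) / e) (at s)"
      by (intro DERIV_cdivide DERIV_chain2[OF newton0_deriv]) (auto intro!: derivative_eq_intros)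
    then show ?thesis using e by (simp add: \<gamma>0_def[abs_def] \<gamma>1_def power3_eq_cube power2_eq_square field_simps)
  qed
  have d1: "(\<gamma>1 has_real_derivative \<gamma>2 s) (at s)" for s
  proof -
    have "((\<lambda>s. newton1 (s / e\<^sup>2) / e ^ 3) has_real_derivative (newton2 (s / e\<^sup>2) * (1 / e\<^sup>2)) / e ^ 3) (at s)"
      by (intro DERIV_cdivide DERIV_chain2[OF newton1_deriv]) (auto intro!: derivative_eq_intros)
    also have "newton2 (s / e\<^sup>2) * (1 / e\<^sup>2) / e ^ 3 = newton2 (s / e\<^sup>2) / (e\<^sup>2 * e ^ 3)" by simp
    also have "\<dots> = \<gamma>2 s" unfolding e5[symmetric] \<gamma>2_def ..
    finally show ?thesis unfolding \<gamma>1_def[abs_def] .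
  qed
  have c2: "continuous_on UNIV \<gamma>2"
    unfolding \<gamma>2_def[abs_def] using e
    by (intro continuous_on_divide continuous_on_compose2[OF continuous_newton2] continuous_on_const continuous_on_id) auto
  define k where "k y = \<gamma>0 (sqd x y)" for y
  have k: "Ck_on 2 UNIV k" unfolding k_def by (rule radial_C2(1)[OF d0 d1 c2])
  have lk: "laplacian k y = - mollifier e (y - x)" for y
  proof -
    have "laplacian k y = 4 * sqd x y * (newton2 (sqd x y / e\<^sup>2) / (e\<^sup>2 * e ^ 3)) + 6 * (newton1 (sqd x y / e\<^sup>2) / e ^ 3)"
      unfolding k_def radial_C2(2)[OF d0 d1 c2] \<gamma>1_def \<gamma>2_def e5 by simp
    also have "\<dots> = (4 * (sqd x y / e\<^sup>2) * newton2 (sqd x y / e\<^sup>2) + 6 * newton1 (sqd x y / e\<^sup>2)) / e ^ 3"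
      by (simp add: add_divide_distrib)
    also have "\<dots> = - mollifier e (y - x)"
      unfolding newton_laplacian by (simp add: mollifier_def sqd_def)
    finally show ?thesis .
  qed
  have eq: "laplacian v y / norm (y - x) = k y * laplacian v y" for y
  proof (cases "y \<in> ball x e")
    case False
    then have n: "norm (y - x) \<ge> e" by (simp add: dist_norm norm_minus_commute)
    then have "e\<^sup>2 \<le> (norm (y - x))\<^sup>2" using e by (intro power_mono) auto
    then have "sqd x y / e\<^sup>2 \<ge> 1" using e by (simp add: sqd_norm)
    then have "k y = 1 / sqrt (sqd x y / e\<^sup>2) / e" by (simp add: k_def \<gamma>0_def newton0_ge)
    also have "\<dots> = 1 / norm (y - x)" using e by (simp add: sqd_norm real_sqrt_divide)
    finally show ?thesis by simp
  qed (simp add: zero)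
  show "continuous_on UNIV (\<lambda>y. laplacian v y / norm (y - x))"
    unfolding eq by (intro continuous_intros Ck2_D[OF v] Ck2_D[OF k])
  have "(\<integral>y. laplacian v y / norm (y - x) \<partial>lborel) = (\<integral>y. v y * laplacian k y \<partial>lborel)"
    unfolding eq by (rule green_identity[OF v k supp])
  also have "\<dots> = (\<integral>y. - (mollifier e (y - x) * v y) \<partial>lborel)" by (simp add: lk mult.commute)
  finally show "(\<integral>y. laplacian v y / norm (y - x) \<partial>lborel) = - (\<integral>y. mollifier e (y - x) * v y \<partial>lborel)" by simp
qed

text \<open>As \<open>e\<close> shrinks, the mollified mean of \<open>v\<close> tends to a multiple
  of \<open>v x\<close>. That the multiple does not depend on \<open>e\<close> is read off from the
  comparison function \<psi>, equal to 1 near \<open>x\<close>: its Newton integral \<open>N\<close>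
  is defined without \<open>e\<close>.\<close>

lemma newton_representation:
  fixes v :: "real^3 \<Rightarrow> real"
  assumes v: "Ck_on 2 UNIV v" "\<And>x. norm x > R \<Longrightarrow> v x = 0" "\<And>y. y \<in> ball x d \<Longrightarrow> laplacian v y = 0"
    and \<psi>: "Ck_on 2 UNIV \<psi>" "\<And>x. norm x > R \<Longrightarrow> \<psi> x = 0" "\<And>y. y \<in> ball x d \<Longrightarrow> \<psi> y = 1"
    and d: "d > 0"
  shows "(\<integral>y. laplacian v y / norm (y - x) \<partial>lborel) = - (\<integral>y. mollifier d y \<partial>lborel) * v x"
proof -
  define N where "N = (\<integral>y. laplacian \<psi> y / norm (y - x) \<partial>lborel)"
  define L where "L = (\<integral>y. laplacian v y / norm (y - x) \<partial>lborel)"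
  have lap\<psi>: "laplacian \<psi> y = 0" if "y \<in> ball x d" for y
  proof -
    have "partial i \<psi> z = 0" if "z \<in> ball x d" for z i
      using partial_cong_open[of "ball x d" z \<psi> "\<lambda>_. 1" i] that \<psi>(3) by simp
    then have "partial i (partial i \<psi>) y = 0" for i
      using partial_cong_open[of "ball x d" y "partial i \<psi>" "\<lambda>_. 0" i] that by simp
    then show ?thesis by (simp add: laplacian_def)
  qed
  have molt: "(\<integral>y. mollifier e (y - x) \<partial>lborel) = (\<integral>y. mollifier e y \<partial>lborel)" for e
    using lborel_integral_translate[of "mollifier e" "- x"] continuous_mollifier
    by (simp add: borel_measurable_continuous_onI)
  have molc: "continuous_on UNIV (\<lambda>y. mollifier e (y - x))" for e
    by (rule continuous_on_compose2[OF continuous_mollifier]) (auto intro!: continuous_intros)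
  have mols: "mollifier e (y - x) = 0" if "e > 0" "y \<notin> ball x e" for e y
    using that by (intro mollifier_support) (auto simp: dist_norm norm_minus_commute)
  have N: "N = - (\<integral>y. mollifier e y \<partial>lborel)" if e: "0 < e" "e \<le> d" for e
  proof -
    have "N = - (\<integral>y. mollifier e (y - x) * \<psi> y \<partial>lborel)"
      unfolding N_def by (rule mollifier_identity(1)[OF \<psi>(1,2) e(1)]) (use lap\<psi> e in auto)
    also have "(\<lambda>y. mollifier e (y - x) * \<psi> y) = (\<lambda>y. mollifier e (y - x))"
    proof
      fix y show "mollifier e (y - x) * \<psi> y = mollifier e (y - x)"
        using mols[OF e(1), of y] \<psi>(3)[of y] e(2) by (cases "y \<in> ball x e") auto
    qed
    finally show ?thesis by (simp add: molt)
  qed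
  have "\<bar>L - v x * N\<bar> \<le> \<bar>N\<bar> * \<eta>" if "\<eta> > 0" for \<eta>
  proof -
    have "continuous (at x) v" using Ck2_D(4)[OF v(1)] by (simp add: continuous_on_eq_continuous_at)
    then obtain e0 where e0: "e0 > 0" "\<And>y. dist y x < e0 \<Longrightarrow> \<bar>v y - v x\<bar> < \<eta>"
      using \<open>\<eta> > 0\<close> unfolding continuous_at_eps_delta by (auto simp: dist_norm)
    define e where "e = min e0 d"
    have e: "0 < e" "e \<le> d" "e \<le> e0" using e0 d by (auto simp: e_def)
    have L: "L = - (\<integral>y. mollifier e (y - x) * v y \<partial>lborel)"
      unfolding L_def by (rule mollifier_identity(1)[OF v(1,2) e(1)]) (use v(3) e in auto)
    have i1: "integrable lborel (\<lambda>y. mollifier e (y - x) * v y)"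
      by (rule integrable_compact_support[of _ R]) (auto intro!: continuous_intros molc Ck2_D[OF v(1)] v(2))
    have i2: "integrable lborel (\<lambda>y. mollifier e (y - x))"
    proof (rule integrable_compact_support[of _ "norm x + e", OF molc])
      fix y :: "real^3" assume "norm y > norm x + e"
      then have "norm (y - x) \<ge> e" using norm_triangle_ineq2[of y x] by simp
      then show "mollifier e (y - x) = 0" using e(1) by (intro mollifier_support)
    qed
    have "L - v x * N = - (\<integral>y. mollifier e (y - x) * v y \<partial>lborel) + (\<integral>y. mollifier e (y - x) * v x \<partial>lborel)"
      using i2 by (simp add: L N[OF e(1,2)] molt)
    also have "\<dots> = - (\<integral>y. mollifier e (y - x) * (v y - v x) \<partial>lborel)"
      using i1 i2 by (simp add: right_diff_distrib)
    also have "\<bar>\<dots>\<bar> \<le> (\<integral>y. mollifier e (y - x) * \<eta> \<partial>lborel)"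
    proof -
      have "\<bar>\<integral>y. mollifier e (y - x) * (v y - v x) \<partial>lborel\<bar> \<le> (\<integral>y. mollifier e (y - x) * \<eta> \<partial>lborel)"
        unfolding real_norm_def[symmetric]
      proof (rule Bochner_Integration.integral_norm_bound_integral)
        show "integrable lborel (\<lambda>y. mollifier e (y - x) * (v y - v x))"
          using i1 i2 by (simp add: right_diff_distrib)
        show "norm (mollifier e (y - x) * (v y - v x)) \<le> mollifier e (y - x) * \<eta>" for y
        proof (cases "y \<in> ball x e")
          case True
          then have "\<bar>v y - v x\<bar> \<le> \<eta>" using e0(2)[of y] e(3) by (simp add: dist_commute)
          then show ?thesis using mollifier_nonneg[OF e(1), of "y - x"] by (simp add: abs_mult mult_left_mono)
        qed (simp add: mols[OF e(1)])
      qed (use i2 in simp)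
      then show ?thesis by simp
    qed
    also have "\<dots> = \<bar>N\<bar> * \<eta>"
      using i2 integral_mollifier_pos[OF e(1)] by (simp add: N[OF e(1,2)] molt)
    finally show ?thesis .
  qed
  note bound = this
  have "L = v x * N"
  proof (rule ccontr)
    assume ne: "L \<noteq> v x * N"
    have Np: "\<bar>N\<bar> > 0" using integral_mollifier_pos[OF d] N[OF d order_refl] by simp
    define \<eta> where "\<eta> = \<bar>L - v x * N\<bar> / (2 * \<bar>N\<bar>)"
    have "\<eta> > 0" using ne Np by (simp add: \<eta>_def)
    from bound[OF this] have "\<bar>L - v x * N\<bar> \<le> \<bar>L - v x * N\<bar> / 2" using Np by (simp add: \<eta>_def)
    with ne show False by simp
  qed
  then show ?thesis using N[OF d order_refl] by (simp add: L_def)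
qed

section \<open>Cut-off functions from cubic splines\<close>

fun cube_pos :: "nat \<Rightarrow> real \<Rightarrow> real" where
  "cube_pos 0 t = (if t \<le> 0 then 0 else t ^ 3)"
| "cube_pos (Suc 0) t = (if t \<le> 0 then 0 else 3 * t\<^sup>2)"
| "cube_pos (Suc (Suc _)) t = (if t \<le> 0 then 0 else 6 * t)"

lemma cube_pos_deriv: "n < 2 \<Longrightarrow> (cube_pos n has_real_derivative cube_pos (Suc n) t) (at t)"
proof -
  have 0: "cube_pos 0 = (\<lambda>t. if t \<le> 0 then 0 else t ^ 3)" "cube_pos (Suc 0) = (\<lambda>t. if t \<le> 0 then 0 else 3 * t\<^sup>2)"
    by (simp_all add: fun_eq_iff)
  assume "n < 2"
  then consider "n = 0" | "n = Suc 0" by linarith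
  then show ?thesis
  proof cases
    case 1
    have "(cube_pos 0 has_real_derivative (if t \<le> 0 then 0 else 3 * t\<^sup>2)) (at t)"
      unfolding 0(1) by (rule DERIV_glue) (auto intro!: derivative_eq_intros)
    then show ?thesis using 1 by simp
  next
    case 2
    have "(cube_pos (Suc 0) has_real_derivative (if t \<le> 0 then 0 else 6 * t)) (at t)"
      unfolding 0(2) by (rule DERIV_glue) (auto intro!: derivative_eq_intros)
    then show ?thesis using 2 by simp
  qed
qed

lemma cube_pos_continuous: "continuous_on UNIV (cube_pos 2)"
proof -
  have "cube_pos 2 = (\<lambda>t. 6 * max 0 t)" by (auto simp: fun_eq_iff numeral_2_eq_2)
  then show ?thesis by (auto intro!: continuous_intros)
qed

text \<open>Third differences of the cubes: a \<open>C\<^sup>2\<close> step from \<open>0\<close> on \<open>t \<le> 0\<close> to \<open>1\<close> on \<open>t \<ge> 3\<close>.\<close>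

definition spline :: "nat \<Rightarrow> real \<Rightarrow> real" where
  "spline n t = (cube_pos n t - 3 * cube_pos n (t - 1) + 3 * cube_pos n (t - 2) - cube_pos n (t - 3)) / 6"

lemma spline_0: "t \<le> 0 \<Longrightarrow> spline 0 t = 0" by (simp add: spline_def)

lemma spline_1: "t \<ge> 3 \<Longrightarrow> spline 0 t = 1"
proof -
  assume "t \<ge> 3"
  then have c: "cube_pos 0 t = t ^ 3" "cube_pos 0 (t - 1) = (t - 1) ^ 3" "cube_pos 0 (t - 2) = (t - 2) ^ 3"
    "cube_pos 0 (t - 3) = (t - 3) ^ 3" by auto
  show ?thesis unfolding spline_def c by (simp add: power3_eq_cube algebra_simps)
qed

lemma spline_deriv: "n < 2 \<Longrightarrow> (spline n has_real_derivative spline (Suc n) t) (at t)"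
proof -
  assume n: "n < 2"
  have "((\<lambda>t. cube_pos n (t - c)) has_real_derivative cube_pos (Suc n) (t - c)) (at t)" for c
  proof -
    have "((\<lambda>t. t - c) has_real_derivative 1) (at t)" by (auto intro!: derivative_eq_intros)
    from DERIV_chain2[OF cube_pos_deriv[OF n] this] show ?thesis by simp
  qed
  from this this[of 0] show ?thesis
    unfolding spline_def[abs_def] by (auto intro!: derivative_eq_intros cube_pos_deriv[OF n])
qed

lemma spline_continuous: "continuous_on UNIV (spline 2)"
  unfolding spline_def[abs_def]
  by (intro continuous_intros continuous_on_compose2[OF cube_pos_continuous] cube_pos_continuous) auto

lemma plateau_exists:
  fixes a :: "real^'n"
  assumes "\<delta> > 0"
  obtains \<psi> where "Ck_on 2 UNIV \<psi>" "\<And>y. (\<And>i. \<bar>y $ i - a $ i\<bar> \<le> \<delta>) \<Longrightarrow> \<psi> y = 1"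
    "\<And>y i. \<bar>y $ i - a $ i\<bar> \<ge> 4 * \<delta> \<Longrightarrow> \<psi> y = 0"
proof
  define k where "k = 1 / \<delta>"
  \<comment> \<open>In the scaled coordinate u = (\<tau> - a $ i) / \<delta> this is a step rising
    on [-4, -1] minus a step rising on [1, 4], hence 1 for \<bar>u\<bar> \<le> 1 and 0 for
    \<bar>u\<bar> \<ge> 4; \<open>k ^ n\<close> is the chain rule factor.\<close>
  define g where "g i n \<tau> = k ^ n * (spline n ((\<tau> - a $ i) * k + 4) - spline n ((\<tau> - a $ i) * k - 1))" for i n \<tau>
  define \<psi> where "\<psi> y = (\<Prod>i\<in>UNIV. g i 0 (y $ i))" for y :: "real^'n"
  have "Ck_on 2 UNIV (\<lambda>y :: real^'n. g i 0 (y $ i))" for i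
  proof (rule Ck_on_coordinate)
    show "(g i n has_real_derivative g i (Suc n) t) (at t)" if "n < 0 + 2" for n t
    proof -
      have n: "n < 2" using that by simp
      have D: "((\<lambda>t. spline n ((t - a $ i) * k + c)) has_real_derivative spline (Suc n) ((t - a $ i) * k + c) * k) (at t)" for c
        by (rule DERIV_chain2[OF spline_deriv[OF n]]) (auto intro!: derivative_eq_intros)
      have alg: "k ^ n * (A * k - B * k) = k ^ Suc n * (A - B)" for A B by (simp add: algebra_simps)
      show ?thesis
        using DERIV_cmult[OF DERIV_diff[OF D[of 4] D[of "-1"]], of "k ^ n"]
        unfolding alg g_def[abs_def] by simp
    qed
    have c: "continuous_on UNIV (\<lambda>\<tau>. spline 2 ((\<tau> - a $ i) * k + b))" for b
      by (rule continuous_on_compose2[OF spline_continuous]) (auto intro!: continuous_intros)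
    show "continuous_on UNIV (g i (0 + 2))"
      unfolding g_def[abs_def] add_0
      by (intro continuous_on_mult continuous_on_const continuous_on_diff c c[of "-1", simplified])
  qed
  then show "Ck_on 2 UNIV \<psi>" unfolding \<psi>_def by (intro Ck_on_prod) auto
  show "\<psi> y = 1" if "\<And>i. \<bar>y $ i - a $ i\<bar> \<le> \<delta>" for y
  proof -
    have "g i 0 (y $ i) = 1" for i
    proof -
      have "- 1 \<le> (y $ i - a $ i) / \<delta>" "(y $ i - a $ i) / \<delta> \<le> 1"
        using that[of i] assms by (auto simp: abs_le_iff divide_simps)
      then show ?thesis by (simp add: g_def k_def spline_0 spline_1)
    qed
    then show ?thesis by (simp add: \<psi>_def)
  qed
  show "\<psi> y = 0" if "\<bar>y $ i - a $ i\<bar> \<ge> 4 * \<delta>" for y i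
  proof -
    have "(y $ i - a $ i) / \<delta> \<ge> 4 \<or> (y $ i - a $ i) / \<delta> \<le> - 4"
      using that assms by (auto simp: abs_if divide_simps split: if_splits)
    then have "g i 0 (y $ i) = 0" by (auto simp: g_def k_def spline_0 spline_1)
    then show ?thesis unfolding \<psi>_def by (meson UNIV_I finite_class.finite_UNIV prod_zero)
  qed
qed

section \<open>Holomorphic extension of Newton potentials\<close>

lemma holo_compose:
  assumes "holo U G" "f holomorphic_on V" "open V" "\<And>z. z \<in> U \<Longrightarrow> G z \<in> V"
  shows "holo U (\<lambda>z. f (G z))"
  unfolding holo_def
proof (intro conjI ballI allI)
  show "continuous_on U (\<lambda>z. f (G z))"
    by (rule continuous_on_compose2[OF holomorphic_on_imp_continuous_on[OF assms(2)] holo_continuous[OF assms(1)]])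
       (use assms in auto)
  fix z i assume z: "z \<in> U"
  have "f field_differentiable (at (G (z + axis i 0)))"
    using assms z by (auto intro: holomorphic_on_imp_differentiable_at)
  moreover have "(\<lambda>h. G (z + axis i h)) field_differentiable (at 0)" using assms(1) z by (simp add: holo_def)
  ultimately have "(f \<circ> (\<lambda>h. G (z + axis i h))) field_differentiable (at 0)"
    by (intro field_differentiable_compose)
  then show "(\<lambda>h. f (G (z + axis i h))) field_differentiable (at 0)" by (simp add: o_def)
qed

text \<open>The squared distance without complex conjugation: it is a polynomial in
  \<open>z\<close>, and its square root extends the norm to complex points.\<close>

definition csq :: "complex^'n \<Rightarrow> real^'n \<Rightarrow> complex" where
  "csq z y = (\<Sum>i\<in>UNIV. (z $ i - of_real (y $ i))\<^sup>2)"

text \<open>The three imaginary parts subtract at most 3 * (\<delta>/8)^2, while the coordinate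
  \<open>i\<close> alone contributes at least (\<delta>/2 - \<delta>/8)^2 = 9 * (\<delta>/8)^2. Thus
  \<open>csqrt\<close> is evaluated off its branch cut.\<close>

lemma Re_csq_pos:
  fixes a y :: "real^3"
  assumes "z \<in> polydisc (cvec a) (\<delta> / 8)" "\<bar>y $ i - a $ i\<bar> > \<delta> / 2" "\<delta> > 0"
  shows "Re (csq z y) > 0"
proof -
  have z: "norm (z $ j - of_real (a $ j)) < \<delta> / 8" for j using assms(1) by (simp add: polydisc_def)
  have Im: "(Im (z $ j))\<^sup>2 \<le> (\<delta> / 8)\<^sup>2" for j
  proof -
    have "\<bar>Im (z $ j)\<bar> \<le> \<delta> / 8" using abs_Im_le_cmod[of "z $ j - of_real (a $ j)"] z[of j] by simp
    then show ?thesis using assms(3) by (metis abs_ge_zero power2_abs power_mono)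
  qed
  have Re: "(3 * \<delta> / 8)\<^sup>2 \<le> (Re (z $ i) - y $ i)\<^sup>2"
  proof -
    have "\<bar>Re (z $ i) - a $ i\<bar> \<le> \<delta> / 8" using abs_Re_le_cmod[of "z $ i - of_real (a $ i)"] z[of i] by simp
    then have "3 * \<delta> / 8 \<le> \<bar>Re (z $ i) - y $ i\<bar>" using assms(2) by linarith
    then show ?thesis using assms(3) by (metis abs_ge_zero less_eq_real_def mult_pos_pos power2_abs power_mono zero_less_divide_iff zero_less_numeral)
  qed
  have "Re (csq z y) = (\<Sum>j\<in>UNIV. (Re (z $ j) - y $ j)\<^sup>2) - (\<Sum>j\<in>UNIV. (Im (z $ j))\<^sup>2)"
    by (simp add: csq_def power2_eq_square sum_subtractf)
  moreover have "(\<Sum>j\<in>UNIV. (Im (z $ j))\<^sup>2) \<le> (\<Sum>j\<in>(UNIV :: 3 set). (\<delta> / 8)\<^sup>2)" by (intro sum_mono Im)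
  moreover have "(Re (z $ i) - y $ i)\<^sup>2 \<le> (\<Sum>j\<in>UNIV. (Re (z $ j) - y $ j)\<^sup>2)"
    by (rule member_le_sum) auto
  ultimately have "Re (csq z y) \<ge> (3 * \<delta> / 8)\<^sup>2 - 3 * (\<delta> / 8)\<^sup>2" using Re by simp
  moreover have "(3 * \<delta> / 8)\<^sup>2 - 3 * (\<delta> / 8)\<^sup>2 > 0" using assms(3) by (simp add: power2_eq_square)
  ultimately show ?thesis by linarith
qed

lemma csq_cvec: "csq (cvec x) y = of_real (sqd x y)"
  by (simp add: csq_def sqd_def inner_vec_def power2_eq_square algebra_simps flip: of_real_diff of_real_mult of_real_sum)

text \<open>The kernel can be singular only for \<open>y\<close> near \<open>a\<close>, where
  \<open>F\<close> vanishes. The set where some coordinate of \<open>y - a\<close> exceeds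
  \<delta>/2 and the open cube of half-side \<delta> overlap and cover everything, and the integrand
  is continuous on either one.\<close>

lemma holo_newton_potential:
  fixes F :: "real^3 \<Rightarrow> real" and a :: "real^3"
  assumes F: "continuous_on UNIV F" and \<delta>: "\<delta> > 0" and zero: "\<And>y. (\<And>i. \<bar>y $ i - a $ i\<bar> < \<delta>) \<Longrightarrow> F y = 0"
  shows "holo (polydisc (cvec a) (\<delta> / 8)) (\<lambda>z. integral (cbox lo hi) (\<lambda>y. of_real (F y) * inverse (csqrt (csq z y))))"
proof (rule holo_integral[OF _ open_polydisc])
  have sq_hol: "(\<lambda>w. inverse (csqrt w)) holomorphic_on {w. Re w > 0}"
  proof (intro holomorphic_intros)
    show "csqrt w \<noteq> 0" if "w \<in> {w. Re w > 0}" for w using that by auto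
    show "w \<notin> \<real>\<^sub>\<le>\<^sub>0" if "w \<in> {w. Re w > 0}" for w using that by (auto simp: complex_nonpos_Reals_iff)
  qed
  have opn: "open {w. Re w > 0}" by (rule open_halfspace_Re_gt)
  show "continuous_on (polydisc (cvec a) (\<delta> / 8) \<times> cbox lo hi)
      (\<lambda>(z, y). of_real (F y) * inverse (csqrt (csq z y)))"
  proof (rule continuous_on_if_locally)
    fix p assume p: "p \<in> polydisc (cvec a) (\<delta> / 8) \<times> cbox lo hi"
    show "\<exists>N. open N \<and> p \<in> N \<and> continuous_on (polydisc (cvec a) (\<delta> / 8) \<times> cbox lo hi \<inter> N)
      (\<lambda>(z, y). of_real (F y) * inverse (csqrt (csq z y)))"
    proof (cases "\<exists>i. \<bar>snd p $ i - a $ i\<bar> > \<delta> / 2")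
      case True
      define N where "N = (\<Union>i. {q :: (complex^3) \<times> (real^3). \<bar>snd q $ i - a $ i\<bar> > \<delta> / 2})"
      have "open N" unfolding N_def by (intro open_UN ballI open_Collect_less continuous_intros)
      moreover have "continuous_on (polydisc (cvec a) (\<delta> / 8) \<times> cbox lo hi \<inter> N)
         (\<lambda>q. of_real (F (snd q)) * inverse (csqrt (csq (fst q) (snd q))))"
      proof (intro continuous_on_mult continuous_on_of_real)
        show "continuous_on (polydisc (cvec a) (\<delta> / 8) \<times> cbox lo hi \<inter> N) (\<lambda>q. F (snd q))"
          by (rule continuous_on_compose2[OF F]) (auto intro!: continuous_intros)
        show "continuous_on (polydisc (cvec a) (\<delta> / 8) \<times> cbox lo hi \<inter> N) (\<lambda>q. inverse (csqrt (csq (fst q) (snd q))))"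
        proof (rule continuous_on_compose2[OF holomorphic_on_imp_continuous_on[OF sq_hol]])
          show "continuous_on (polydisc (cvec a) (\<delta> / 8) \<times> cbox lo hi \<inter> N) (\<lambda>q. csq (fst q) (snd q))"
            unfolding csq_def by (intro continuous_intros)
          show "(\<lambda>q. csq (fst q) (snd q)) ` (polydisc (cvec a) (\<delta> / 8) \<times> cbox lo hi \<inter> N) \<subseteq> {w. Re w > 0}"
            using Re_csq_pos[OF _ _ \<delta>] by (auto simp: N_def)
        qed
      qed
      moreover have "p \<in> N" using True by (auto simp: N_def)
      ultimately show ?thesis by (auto simp: case_prod_unfold)
    next
      case False
      define N where "N = (\<Inter>i. {q :: (complex^3) \<times> (real^3). \<bar>snd q $ i - a $ i\<bar> < \<delta>})"
      have "open N" unfolding N_def by (intro open_INT ballI open_Collect_less continuous_intros) auto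
      moreover have "p \<in> N"
      proof -
        have "\<bar>snd p $ i - a $ i\<bar> < \<delta>" for i
        proof -
          have "\<bar>snd p $ i - a $ i\<bar> \<le> \<delta> / 2" using False by (meson not_less)
          then show ?thesis using \<delta> by linarith
        qed
        then show ?thesis by (simp add: N_def)
      qed
      moreover have "continuous_on (polydisc (cvec a) (\<delta> / 8) \<times> cbox lo hi \<inter> N)
         (\<lambda>(z, y). of_real (F y) * inverse (csqrt (csq z y)))"
        by (rule continuous_on_eq[OF continuous_on_const[of _ 0]]) (auto simp: N_def zero)
      ultimately show ?thesis by blast
    qed
  qed
  fix y assume "y \<in> cbox lo hi"
  show "holo (polydisc (cvec a) (\<delta> / 8)) (\<lambda>z. of_real (F y) * inverse (csqrt (csq z y)))"
  proof (cases "F y = 0")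
    case False
    then obtain i where "\<not> \<bar>y $ i - a $ i\<bar> < \<delta>" using zero by blast
    then have i: "\<bar>y $ i - a $ i\<bar> > \<delta> / 2" using \<delta> by simp
    have "holo (polydisc (cvec a) (\<delta> / 8)) (\<lambda>z. csq z y)"
      unfolding csq_def by (intro holo_sum holo_power holo_diff holo_coord holo_const)
    from holo_compose[OF this sq_hol opn] Re_csq_pos[OF _ i \<delta>]
    show ?thesis by (intro holo_cmult) auto
  qed (simp add: holo_const)
qed

text \<open>The cut-off product \<open>v\<close> has compact support and a Laplacian vanishing near
  \<open>a\<close>. Up to the factor \<open>c\<close> it is the Newton potential of that Laplacian,
  and for points near \<open>a\<close> the kernel stays away from its singularity.\<close>

theorem harmonic_cext:
  fixes u :: "real^3 \<Rightarrow> real"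
  assumes u: "harmonic_on S u" and S: "open S"
  shows "cext S u"
  unfolding cext_def
proof
  fix a assume a: "a \<in> S"
  obtain e where e: "e > 0" "ball a e \<subseteq> S" using S a open_contains_ball by blast
  \<comment> \<open>The plateau function is supported in a cube of half-side 4 * \<delta>, hence in
    the ball of radius 12 * \<delta> = e / 2, well inside \<open>S\<close>.\<close>
  define \<delta> where "\<delta> = e / 24"
  have \<delta>: "\<delta> > 0" using e by (simp add: \<delta>_def)
  have norm_le: "norm (y - a) \<le> 3 * t" if "\<And>i. \<bar>y $ i - a $ i\<bar> \<le> t" for y t
  proof -
    have "norm (y - a) \<le> (\<Sum>i\<in>UNIV. \<bar>(y - a) $ i\<bar>)" by (rule norm_le_l1_cart)
    also have "\<dots> \<le> (\<Sum>i\<in>(UNIV::3 set). t)" using that by (intro sum_mono) simp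
    finally show ?thesis by simp
  qed
  have comp_le: "\<bar>y $ i - a $ i\<bar> \<le> norm (y - a)" for y i
    using component_le_norm_cart[of "y - a" i] by simp
  obtain \<psi> where \<psi>: "Ck_on 2 UNIV \<psi>" "\<And>y. (\<And>i. \<bar>y $ i - a $ i\<bar> \<le> \<delta>) \<Longrightarrow> \<psi> y = 1"
    "\<And>y i. \<bar>y $ i - a $ i\<bar> \<ge> 4 * \<delta> \<Longrightarrow> \<psi> y = 0"
    using plateau_exists[OF \<delta>, of a] by metis
  have \<psi>0: "\<psi> y = 0" if "norm (y - a) > 12 * \<delta>" for y
  proof -
    have "\<exists>i. \<bar>y $ i - a $ i\<bar> \<ge> 4 * \<delta>"
    proof (rule ccontr)
      assume "\<not> ?thesis"
      then have "norm (y - a) \<le> 3 * (4 * \<delta>)" by (intro norm_le) (auto simp: not_le intro: less_imp_le)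
      with that show False by simp
    qed
    with \<psi>(3) show ?thesis by blast
  qed
  have \<psi>1: "\<psi> y = 1" if "norm (y - a) \<le> \<delta>" for y
    using \<psi>(2) comp_le that by (meson order_trans)
  define v where "v y = \<psi> y * u y" for y
  have v: "Ck_on 2 UNIV v"
    unfolding v_def
  proof (rule Ck_on_mult_cutoff[OF S _ \<psi>(1), of _ "cball a (12 * \<delta>)"])
    show "Ck_on 2 S u" using u by (simp add: harmonic_on_def)
    show "cball a (12 * \<delta>) \<subseteq> S" using e by (auto simp: \<delta>_def)
    show "\<psi> y = 0" if "y \<notin> cball a (12 * \<delta>)" for y
      using that by (intro \<psi>0) (simp add: dist_norm norm_minus_commute)
  qed auto
  have lap0: "laplacian v y = 0" if "\<And>i. \<bar>y $ i - a $ i\<bar> < \<delta>" for y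
  proof -
    define B where "B = (\<Inter>i. {y :: real^3. \<bar>y $ i - a $ i\<bar> < \<delta>})"
    have "open B" unfolding B_def by (intro open_INT ballI open_Collect_less continuous_intros) auto
    have "y \<in> B" using that by (simp add: B_def)
    have vu: "v z = u z" if "z \<in> B" for z
    proof -
      have "\<psi> z = 1" using that by (intro \<psi>(2)) (auto simp: B_def intro: less_imp_le)
      then show ?thesis by (simp add: v_def)
    qed
    have p: "partial i v z = partial i u z" if "z \<in> B" for i z
      by (rule partial_cong_open[OF \<open>open B\<close> that vu])
    have "partial i (partial i v) y = partial i (partial i u) y" for i
      by (rule partial_cong_open[OF \<open>open B\<close> \<open>y \<in> B\<close> p])
    then have "laplacian v y = laplacian u y" by (simp add: laplacian_def)
    moreover have "y \<in> S"
    proof -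
      have "norm (y - a) \<le> 3 * \<delta>" using that by (intro norm_le less_imp_le)
      then show ?thesis using e by (auto simp: \<delta>_def dist_norm norm_minus_commute intro!: subsetD[OF e(2)])
    qed
    ultimately show ?thesis using u by (simp add: harmonic_on_def)
  qed
  define R where "R = norm a + 12 * \<delta>"
  have far: "norm (y - a) > 12 * \<delta>" if "norm y > R" for y
    using that norm_triangle_ineq2[of y a] by (simp add: R_def)
  have vR: "v y = 0" and \<psi>R: "\<psi> y = 0" if "norm y > R" for y
    using \<psi>0[OF far[OF that]] by (simp_all add: v_def)
  define F where "F = laplacian v"
  have F: "continuous_on UNIV F" unfolding F_def by (rule Ck2_D(8)[OF v])
  have F0: "F y = 0" if "norm y > R" for y unfolding F_def by (rule laplacian_zero_outside[OF vR that])
  define lo hi :: "real^3" where "lo = (\<chi> i. - R)" and "hi = (\<chi> i. R)"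
  have out: "norm y > R" if "y \<notin> cbox lo hi" for y
  proof -
    have "\<exists>i. \<not> (- R \<le> y $ i \<and> y $ i \<le> R)" using that by (simp add: mem_box_cart lo_def hi_def)
    then obtain i where "\<not> (- R \<le> y $ i \<and> y $ i \<le> R)" by (elim exE)
    then have "\<bar>y $ i\<bar> > R" by linarith
    then show ?thesis using component_le_norm_cart[of y i] by linarith
  qed
  \<comment> \<open>The radius \<delta> / 2 serves all points \<open>x\<close> considered: they
    satisfy norm (x - a) \<le> 3 * \<delta> / 8, so their balls of radius \<delta> / 2 lie in the
    \<delta>-ball about \<open>a\<close>.\<close>
  define c where "c = - (\<integral>y. mollifier (\<delta> / 2) y \<partial>lborel)"
  have c: "c \<noteq> 0" using integral_mollifier_pos[of "\<delta> / 2"] \<delta> by (simp add: c_def)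
  define G where "G z = of_real (1 / c) * integral (cbox lo hi) (\<lambda>y. of_real (F y) * inverse (csqrt (csq z y)))" for z
  have "holo (polydisc (cvec a) (\<delta> / 8)) G"
    unfolding G_def by (intro holo_cmult holo_newton_potential F \<delta>) (simp add: F_def lap0)
  moreover have "u x = Re (G (cvec x))" if x: "cvec x \<in> polydisc (cvec a) (\<delta> / 8)" for x
  proof -
    have xi: "\<bar>x $ i - a $ i\<bar> < \<delta> / 8" for i
      using x by (auto simp: polydisc_def simp flip: of_real_diff)
    have nx: "norm (x - a) \<le> 3 * (\<delta> / 8)" using xi by (intro norm_le less_imp_le)
    have near: "norm (y - a) < \<delta>" if "y \<in> ball x (\<delta> / 2)" for y
      using that nx \<delta> norm_triangle_ineq[of "y - x" "x - a"] by (auto simp: dist_norm norm_minus_commute)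
    have near_lap: "laplacian v y = 0" if "y \<in> ball x (\<delta> / 2)" for y
      using near[OF that] comp_le by (intro lap0) (meson le_less_trans)
    have rep: "(\<integral>y. laplacian v y / norm (y - x) \<partial>lborel) = c * v x"
      unfolding c_def
      by (rule newton_representation[where d = "\<delta> / 2", OF v vR near_lap \<psi>(1) \<psi>R])
         (use near \<psi>1 \<delta> in \<open>auto intro: less_imp_le\<close>)
    have cont: "continuous_on UNIV (\<lambda>y. laplacian v y / norm (y - x))"
      by (rule mollifier_identity(2)[where e = "\<delta> / 2", OF v vR _ near_lap]) (use \<delta> in auto)
    have int: "integrable lborel (\<lambda>y. laplacian v y / norm (y - x))"
      by (rule integrable_compact_support[OF cont, of R]) (simp add: F0[unfolded F_def])
    have hu: "((\<lambda>y. laplacian v y / norm (y - x)) has_integral c * v x) UNIV"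
      using has_integral_integral_lborel[OF int] rep by simp
    have "((\<lambda>y. laplacian v y / norm (y - x)) has_integral c * v x) (cbox lo hi)"
    proof -
      have "(\<lambda>y. if y \<in> cbox lo hi then laplacian v y / norm (y - x) else 0) = (\<lambda>y. laplacian v y / norm (y - x))"
        using out F0 by (auto simp: F_def fun_eq_iff)
      then show ?thesis
        using hu has_integral_restrict_UNIV[of "cbox lo hi" "\<lambda>y. laplacian v y / norm (y - x)"] by simp
    qed
    from has_integral_linear[OF this bounded_linear_of_real[where 'a = complex]]
    have "((\<lambda>y. complex_of_real (laplacian v y / norm (y - x))) has_integral of_real (c * v x)) (cbox lo hi)"
      unfolding o_def .
    moreover have "complex_of_real (laplacian v y / norm (y - x)) = of_real (F y) * inverse (csqrt (csq (cvec x) y))" for y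
    proof -
      have "csqrt (csq (cvec x) y) = of_real (norm (y - x))"
        by (simp add: csq_cvec csqrt_of_real_nonneg sqd_norm)
      then show ?thesis by (simp add: F_def divide_inverse)
    qed
    ultimately have "integral (cbox lo hi) (\<lambda>y. of_real (F y) * inverse (csqrt (csq (cvec x) y))) = of_real (c * v x)"
      by (simp add: integral_unique)
    then have "G (cvec x) = of_real (v x)" using c by (simp add: G_def)
    moreover have "\<psi> x = 1" using nx \<delta> by (intro \<psi>1) simp
    ultimately show ?thesis by (simp add: v_def)
  qed
  ultimately show "\<exists>r>0. \<exists>G. holo (polydisc (cvec a) r) G \<and>
      (\<forall>x. cvec x \<in> polydisc (cvec a) r \<longrightarrow> u x = Re (G (cvec x)))"
    using \<delta> by (intro exI[of _ "\<delta> / 8"] conjI exI[of _ G]) auto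
qed

section \<open>From weak derivatives to a pointwise distortion inequality\<close>

lemma DERIV_zero_quadratic_bound:
  fixes f :: "real \<Rightarrow> real"
  assumes "\<And>t. \<bar>f t\<bar> \<le> C * (t - t0)\<^sup>2"
  shows "(f has_real_derivative 0) (at t0)"
proof -
  have f0: "f t0 = 0" using assms[of t0] by simp
  have "((\<lambda>t. (f t - f t0) / (t - t0)) \<longlongrightarrow> 0) (at t0)"
  proof (rule Lim_null_comparison)
    show "eventually (\<lambda>t. norm ((f t - f t0) / (t - t0)) \<le> C * \<bar>t - t0\<bar>) (at t0)"
      unfolding eventually_at_filter
    proof (intro always_eventually allI impI)
      fix t assume "t \<noteq> t0"
      then have "\<bar>f t\<bar> / \<bar>t - t0\<bar> \<le> C * (t - t0)\<^sup>2 / \<bar>t - t0\<bar>" by (intro divide_right_mono assms) auto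
      also have "\<dots> = C * \<bar>t - t0\<bar>" 
      proof -
        have "(t - t0)\<^sup>2 = \<bar>t - t0\<bar> * \<bar>t - t0\<bar>" by (simp add: power2_eq_square)
        moreover have "C * (m * m) / m = C * m" for m :: real by simp
        ultimately show ?thesis by (simp only:)
      qed
      finally show "norm ((f t - f t0) / (t - t0)) \<le> C * \<bar>t - t0\<bar>" by (simp add: f0 abs_divide)
    qed
    have "((\<lambda>t. C * \<bar>t - t0\<bar>) \<longlongrightarrow> C * \<bar>t0 - t0\<bar>) (at t0)" by (intro tendsto_intros)
    then show "((\<lambda>t. C * \<bar>t - t0\<bar>) \<longlongrightarrow> 0) (at t0)" by simp
  qed
  then show ?thesis by (simp add: has_field_derivative_iff)
qed

lemma exp_minus_le_power:
  fixes x :: real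
  assumes "x > 0"
  shows "exp (- x) \<le> (real N / x) ^ N"
proof (cases "N = 0")
  case False
  have "(x / real N) ^ N \<le> exp (x / real N) ^ N"
  proof (rule power_mono)
    show "x / real N \<le> exp (x / real N)" using exp_ge_add_one_self[of "x / real N"] by linarith
  qed (use assms in auto)
  also have "\<dots> = exp x" using False by (simp flip: exp_of_nat_mult)
  finally have "inverse (exp x) \<le> inverse ((x / real N) ^ N)"
    using assms False by (intro le_imp_inverse_le) auto
  then show ?thesis by (simp add: exp_minus power_divide field_simps)
qed (use assms in auto)

text \<open>The functions \<open>exp (- c / ((t - a) (b - t)))\<close> on \<open>(a, b)\<close>, extended by zero, are smooth and tend
  to the indicator of \<open>(a, b)\<close> as \<open>c\<close> decreases to \<open>0\<close>. Their \<open>n\<close>-th derivatives have the same shape.\<close>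

definition gap :: "real \<Rightarrow> real \<Rightarrow> real poly" where "gap a b = [:- a, 1:] * [:b, - 1:]"

text \<open>With q = \<open>gap a b\<close>, the derivative of p * q^(-2n) * exp (-c / q) has the
  numerator p' q^2 - 2 n p q' q + c p q' over q^(2n + 2); this is the recursion.\<close>

primrec bump_poly :: "real \<Rightarrow> real \<Rightarrow> real \<Rightarrow> nat \<Rightarrow> real poly" where
  "bump_poly c a b 0 = 1"
| "bump_poly c a b (Suc n) = pderiv (bump_poly c a b n) * (gap a b)\<^sup>2
     - smult (2 * real n) (bump_poly c a b n * pderiv (gap a b) * gap a b)
     + smult c (bump_poly c a b n * pderiv (gap a b))"

definition bump :: "real \<Rightarrow> real \<Rightarrow> real \<Rightarrow> nat \<Rightarrow> real \<Rightarrow> real" where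
  "bump c a b n t = (if a < t \<and> t < b
     then poly (bump_poly c a b n) t * inverse (poly (gap a b) t) ^ (2 * n) * exp (- c * inverse (poly (gap a b) t)) else 0)"

lemma poly_gap: "poly (gap a b) t = (t - a) * (b - t)"
  by (simp add: gap_def algebra_simps)

lemma bump_deriv_interior:
  assumes "a < t" "t < b"
  shows "(bump c a b n has_real_derivative bump c a b (Suc n) t) (at t)"
proof -
  define p q where "p = bump_poly c a b n" and "q = gap a b"
  define r where "r = inverse (poly q t)"
  have q: "poly q t \<noteq> 0" using assms by (simp add: q_def poly_gap)
  then have rq: "poly q t * r = 1" by (simp add: r_def)
  have Dr: "((\<lambda>t. inverse (poly q t)) has_real_derivative - (poly (pderiv q) t * r\<^sup>2)) (at t)"
    using q by (auto intro!: derivative_eq_intros poly_DERIV simp: r_def power2_eq_square)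
  have D: "((\<lambda>t. poly p t * inverse (poly q t) ^ (2 * n) * exp (- c * inverse (poly q t))) has_real_derivative
      (poly (pderiv p) t * r ^ (2 * n) + poly p t * (real (2 * n) * r ^ (2 * n - 1) * (- (poly (pderiv q) t * r\<^sup>2)))) * exp (- c * r)
      + poly p t * r ^ (2 * n) * (exp (- c * r) * (- c * (- (poly (pderiv q) t * r\<^sup>2))))) (at t)"
    by (rule derivative_eq_intros poly_DERIV Dr refl)+ (simp add: r_def algebra_simps)
  have pw: "real (2 * n) * r ^ (2 * n - 1) * r\<^sup>2 = real (2 * n) * r ^ (2 * n) * r"
    by (cases n) (simp_all add: power2_eq_square)
  have "(poly (pderiv p) t * r ^ (2 * n) + poly p t * (real (2 * n) * r ^ (2 * n - 1) * (- (poly (pderiv q) t * r\<^sup>2)))) * exp (- c * r)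
      + poly p t * r ^ (2 * n) * (exp (- c * r) * (- c * (- (poly (pderiv q) t * r\<^sup>2))))
    = (poly (pderiv p) t * r ^ (2 * n) - poly p t * poly (pderiv q) t * (real (2 * n) * r ^ (2 * n - 1) * r\<^sup>2)
      + c * poly p t * poly (pderiv q) t * r ^ (2 * n) * r\<^sup>2) * exp (- c * r)"
    by (simp add: algebra_simps)
  also have "\<dots> = r ^ (2 * n) * (poly (pderiv p) t - real (2 * n) * poly p t * poly (pderiv q) t * r
      + c * poly p t * poly (pderiv q) t * r\<^sup>2) * exp (- c * r)"
    unfolding pw by (simp add: algebra_simps)
  also have "poly (pderiv p) t - real (2 * n) * poly p t * poly (pderiv q) t * r + c * poly p t * poly (pderiv q) t * r\<^sup>2
     = poly (bump_poly c a b (Suc n)) t * r\<^sup>2"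
  proof -
    have "poly (bump_poly c a b (Suc n)) t * r\<^sup>2 = poly (pderiv p) t * (poly q t * r)\<^sup>2
       - 2 * real n * poly p t * poly (pderiv q) t * (poly q t * r) * r + c * poly p t * poly (pderiv q) t * r\<^sup>2"
      by (simp add: p_def q_def algebra_simps power2_eq_square)
    then show ?thesis unfolding rq by simp
  qed
  also have "r ^ (2 * n) * (poly (bump_poly c a b (Suc n)) t * r\<^sup>2) * exp (- c * r) = bump c a b (Suc n) t"
    using assms by (simp add: bump_def r_def q_def power2_eq_square)
  finally have "((\<lambda>t. poly p t * inverse (poly q t) ^ (2 * n) * exp (- c * inverse (poly q t))) has_real_derivative
      bump c a b (Suc n) t) (at t)" using D by simp
  then show ?thesis
    by (rule has_field_derivative_transform_within_open[of _ _ _ "{a<..<b}"])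
       (use assms in \<open>auto simp: bump_def p_def q_def\<close>)
qed

text \<open>The exponential bound with exponent 2 n + 2 absorbs the pole of order 2 n and leaves the
  square of the gap. The resulting quadratic decay at both end points forces every derivative to
  vanish there.\<close>

lemma bump_bound:
  assumes "c > 0" "a < b"
  obtains C where "C \<ge> 0" "\<And>t. \<bar>bump c a b n t\<bar> \<le> C * (t - a)\<^sup>2" "\<And>t. \<bar>bump c a b n t\<bar> \<le> C * (t - b)\<^sup>2"
proof -
  have "bounded (poly (bump_poly c a b n) ` {a..b})"
    by (intro compact_imp_bounded compact_continuous_image continuous_intros) auto
  then obtain M where M: "\<And>t. t \<in> {a..b} \<Longrightarrow> \<bar>poly (bump_poly c a b n) t\<bar> \<le> M"
    unfolding bounded_iff by (metis imageI real_norm_def)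
  define K where "K = (real (2 * n + 2) / c) ^ (2 * n + 2)"
  have K: "K \<ge> 0" using assms by (simp add: K_def)
  have M0: "M \<ge> 0" using M[of a] assms by (meson abs_ge_zero atLeastAtMost_iff less_imp_le order.trans order_refl)
  have main: "\<bar>bump c a b n t\<bar> \<le> M * K * ((t - a)\<^sup>2 * (t - b)\<^sup>2)" for t
  proof (cases "a < t \<and> t < b")
    case True
    define q where "q = poly (gap a b) t"
    have q: "q > 0" using True by (simp add: q_def poly_gap)
    have "exp (- (c * inverse q)) \<le> (real (2 * n + 2) / (c * inverse q)) ^ (2 * n + 2)"
      using assms q by (intro exp_minus_le_power) simp
    also have "\<dots> = (real (2 * n + 2) / c * q) ^ (2 * n + 2)"
    proof -
      have "y / (c * inverse q) = y / c * q" for y using q by (simp add: field_simps)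
      then show ?thesis by (simp only:)
    qed
    also have "\<dots> = K * q ^ (2 * n + 2)" unfolding K_def by (rule power_mult_distrib)
    finally have "inverse q ^ (2 * n) * exp (- c * inverse q) \<le> inverse q ^ (2 * n) * (K * q ^ (2 * n + 2))"
      using q by (intro mult_left_mono) auto
    also have "\<dots> = K * q\<^sup>2 * (inverse q * q) ^ (2 * n)"
      by (simp only: power_add power_mult_distrib mult_ac)
    also have "\<dots> = K * q\<^sup>2" using q by simp
    finally have e: "inverse q ^ (2 * n) * exp (- c * inverse q) \<le> K * q\<^sup>2" .
    have "\<bar>bump c a b n t\<bar> = \<bar>poly (bump_poly c a b n) t\<bar> * (inverse q ^ (2 * n) * exp (- c * inverse q))"
      using True q by (simp add: bump_def q_def[symmetric] abs_mult)
    also have "\<dots> \<le> M * (K * q\<^sup>2)" using M[of t] True e M0 q by (rule_tac mult_mono) auto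
    also have "q\<^sup>2 = (t - a)\<^sup>2 * (t - b)\<^sup>2"
      by (simp add: q_def poly_gap power_mult_distrib power2_commute)
    finally show ?thesis by (simp add: mult.assoc)
  qed (use M0 K in \<open>auto simp: bump_def\<close>)
  have outside: "bump c a b n t = 0" if "\<not> (a < t \<and> t < b)" for t using that by (auto simp: bump_def)
  have sq: "(t - s)\<^sup>2 \<le> (b - a)\<^sup>2" if "a < t" "t < b" "s \<in> {a, b}" for t s
  proof -
    have "\<bar>t - s\<bar> \<le> b - a" using that by auto
    then show ?thesis by (metis abs_ge_zero power2_abs power_mono)
  qed
  define C where "C = M * K * (b - a)\<^sup>2"
  have C: "C \<ge> 0" using M0 K by (simp add: C_def)
  show thesis
  proof (rule that[of C])
    show "\<bar>bump c a b n t\<bar> \<le> C * (t - a)\<^sup>2" for t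
    proof (cases "a < t \<and> t < b")
      case True
      have "\<bar>bump c a b n t\<bar> \<le> M * K * ((t - a)\<^sup>2 * (t - b)\<^sup>2)" by (rule main)
      also have "\<dots> \<le> M * K * ((t - a)\<^sup>2 * (b - a)\<^sup>2)"
        using M0 K sq True by (intro mult_left_mono) auto
      finally show ?thesis by (simp add: C_def mult_ac)
    qed (use outside C in auto)
    show "\<bar>bump c a b n t\<bar> \<le> C * (t - b)\<^sup>2" for t
    proof (cases "a < t \<and> t < b")
      case True
      have "\<bar>bump c a b n t\<bar> \<le> M * K * ((t - a)\<^sup>2 * (t - b)\<^sup>2)" by (rule main)
      also have "\<dots> \<le> M * K * ((b - a)\<^sup>2 * (t - b)\<^sup>2)"
        using M0 K sq True by (intro mult_left_mono mult_right_mono) auto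
      finally show ?thesis by (simp add: C_def mult_ac)
    qed (use outside C in auto)
  qed (rule C)
qed

lemma bump_deriv:
  assumes "c > 0" "a < b"
  shows "(bump c a b n has_real_derivative bump c a b (Suc n) t) (at t)"
proof (cases "a < t \<and> t < b")
  case False
  obtain C where C: "C \<ge> 0" "\<And>t. \<bar>bump c a b n t\<bar> \<le> C * (t - a)\<^sup>2" "\<And>t. \<bar>bump c a b n t\<bar> \<le> C * (t - b)\<^sup>2"
    using bump_bound[OF assms] by metis
  have "\<bar>bump c a b n s\<bar> \<le> C * (s - t)\<^sup>2" for s
  proof (cases "a < s \<and> s < b")
    case True
    consider "t \<le> a" | "t \<ge> b" using False by linarith
    then show ?thesis
    proof cases
      case 1
      then have "(s - a)\<^sup>2 \<le> (s - t)\<^sup>2" using True by (intro power_mono) auto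
      then have "C * (s - a)\<^sup>2 \<le> C * (s - t)\<^sup>2" using C(1) by (rule mult_left_mono)
      with C(2)[of s] show ?thesis by linarith
    next
      case 2
      then have "(b - s)\<^sup>2 \<le> (t - s)\<^sup>2" using True by (intro power_mono) auto
      then have "C * (s - b)\<^sup>2 \<le> C * (s - t)\<^sup>2" using C(1) by (intro mult_left_mono) (simp_all add: power2_commute)
      with C(3)[of s] show ?thesis by linarith
    qed
  qed (use C(1) in \<open>auto simp: bump_def\<close>)
  moreover have "bump c a b (Suc n) t = 0" unfolding bump_def using False by (simp only: if_False)
  ultimately show ?thesis using DERIV_zero_quadratic_bound by metis
qed (use bump_deriv_interior in blast)

section \<open>Test functions converging to the indicator of a box\<close>

definition box_bump :: "real \<Rightarrow> real^'n \<Rightarrow> real^'n \<Rightarrow> real^'n \<Rightarrow> real" where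
  "box_bump c lo hi x = (\<Prod>i\<in>UNIV. bump c (lo $ i) (hi $ i) 0 (x $ i))"

lemma bump_0: "bump c a b 0 t = (if a < t \<and> t < b then exp (- c * inverse ((t - a) * (b - t))) else 0)"
  by (simp add: bump_def poly_gap)

lemma box_bump_outside: "x \<notin> box lo hi \<Longrightarrow> box_bump c lo hi x = 0"
  unfolding box_bump_def mem_box_cart
  by (rule prod_zero) (auto simp: bump_0)

lemma box_bump_outside_cbox: "x \<notin> cbox lo hi \<Longrightarrow> box_bump c lo hi x = 0"
  using box_bump_outside box_subset_cbox by blast

lemma box_bump_bounds:
  assumes "c > 0"
  shows "0 \<le> box_bump c lo hi x" "box_bump c lo hi x \<le> 1"
proof -
  have "0 \<le> bump c (lo $ i) (hi $ i) 0 (x $ i) \<and> bump c (lo $ i) (hi $ i) 0 (x $ i) \<le> 1" for i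
    using assms by (auto simp: bump_0)
  then show "0 \<le> box_bump c lo hi x" "box_bump c lo hi x \<le> 1"
    unfolding box_bump_def by (auto intro: prod_nonneg prod_le_1)
qed

lemma box_bump_tendsto:
  "(\<lambda>j. box_bump (1 / real (Suc j)) lo hi x) \<longlonglongrightarrow> indicator (box lo hi) x"
proof (cases "x \<in> box lo hi")
  case True
  have "(\<lambda>j. bump (1 / real (Suc j)) (lo $ i) (hi $ i) 0 (x $ i)) \<longlonglongrightarrow> 1" for i
  proof -
    define r where "r = inverse ((x $ i - lo $ i) * (hi $ i - x $ i))"
    have "(\<lambda>j. exp (- (1 / real (Suc j)) * r)) \<longlonglongrightarrow> exp (- 0 * r)"
      by (intro tendsto_intros LIMSEQ_Suc lim_1_over_n)
    moreover have "bump c (lo $ i) (hi $ i) 0 (x $ i) = exp (- c * r)" for c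
      using True by (auto simp: bump_0 r_def mem_box_cart)
    ultimately show ?thesis by simp
  qed
  then have "(\<lambda>j. box_bump (1 / real (Suc j)) lo hi x) \<longlonglongrightarrow> (\<Prod>i\<in>(UNIV::'a set). 1)"
    unfolding box_bump_def by (rule tendsto_prod)
  then show ?thesis using True by simp
qed (simp add: box_bump_outside)

lemma box_bump_smooth:
  assumes "c > 0" "\<And>i. lo $ i < hi $ i"
  shows "Ck_on k UNIV (box_bump c lo hi)"
  unfolding box_bump_def[abs_def]
proof (intro Ck_on_prod open_UNIV)
  fix i
  have D: "(bump c (lo $ i) (hi $ i) n has_real_derivative bump c (lo $ i) (hi $ i) (Suc n) t) (at t)" for n t
    by (rule bump_deriv) (use assms in auto)
  show "Ck_on k UNIV (\<lambda>x. bump c (lo $ i) (hi $ i) 0 (x $ i))"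
    by (rule Ck_on_coordinate[where m = 0]) (use D DERIV_isCont continuous_at_imp_continuous_on in blast)+
qed

lemma test_function_box_bump:
  assumes "c > 0" "\<And>i. lo $ i < hi $ i" "cbox lo hi \<subseteq> \<Omega>"
  shows "test_function \<Omega> (box_bump c lo hi)"
  unfolding test_function_def
  using box_bump_smooth[OF assms(1,2)] assms(3)
  by (intro conjI allI exI[of _ "cbox lo hi"]) (auto intro!: box_bump_outside_cbox)

lemma continuous_mult_cutoff:
  fixes u \<phi> :: "real^'n \<Rightarrow> real"
  assumes "open \<Omega>" "continuous_on \<Omega> u" "continuous_on UNIV \<phi>" "closed C" "C \<subseteq> \<Omega>" "\<And>x. x \<notin> C \<Longrightarrow> \<phi> x = 0"
  shows "continuous_on UNIV (\<lambda>x. \<phi> x * u x)"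
  using Ck_on_mult_cutoff[of \<Omega> 0 u \<phi> C] assms by simp

lemma integral_lebesgue_lborel:
  fixes h :: "'a::euclidean_space \<Rightarrow> real"
  assumes "continuous_on UNIV h"
  shows "(\<integral>x. h x \<partial>lebesgue) = (\<integral>x. h x \<partial>lborel)"
  using assms by (intro integral_completion) (auto intro: borel_measurable_continuous_onI)

text \<open>The product \<open>\<phi> x * u x\<close> is extended by zero beyond \<Omega>; its
  partial derivative integrates to zero over the whole space, and the product rule splits that
  integral.\<close>

lemma classical_integration_by_parts:
  fixes u :: "real^'n \<Rightarrow> real"
  assumes \<Omega>: "open \<Omega>" and u: "Ck_on 1 \<Omega> u" and \<phi>: "Ck_on 1 UNIV \<phi>"
    and C: "compact C" "C \<subseteq> \<Omega>" "\<And>x. x \<notin> C \<Longrightarrow> \<phi> x = 0"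
  shows "(LINT x:\<Omega>|lebesgue. u x * partial i \<phi> x) = - (LINT x:\<Omega>|lebesgue. partial i u x * \<phi> x)"
proof -
  have cl: "closed C" using C(1) by (rule compact_imp_closed)
  obtain R where R: "\<And>x. x \<in> C \<Longrightarrow> norm x \<le> R"
    using compact_imp_bounded[OF C(1)] by (auto simp: bounded_iff)
  have R': "x \<notin> C" if "norm x > R" for x using R[of x] that by auto
  have u1: "Ck_on (Suc 0) \<Omega> u" and \<phi>1: "Ck_on (Suc 0) UNIV \<phi>" using u \<phi> by simp_all
  have du: "u differentiable (at x)" if "x \<in> \<Omega>" for x by (rule Ck_on_differentiable[OF u1 \<Omega> that])
  have d\<phi>: "\<phi> differentiable (at x)" for x using Ck_on_differentiable[OF \<phi>1] by simp
  have cu: "continuous_on \<Omega> u" "continuous_on \<Omega> (partial i u)"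
    using u1 by (auto intro: differentiable_imp_continuous_on)
  have c\<phi>: "continuous_on UNIV \<phi>" "continuous_on UNIV (partial i \<phi>)"
    using \<phi>1 by (auto intro: differentiable_imp_continuous_on)
  have \<phi>'0: "partial i \<phi> x = 0" if "x \<notin> C" for x
  proof -
    have "partial i \<phi> x = partial i (\<lambda>_. 0) x"
      by (rule partial_cong_open[of "- C"]) (use cl that C in auto)
    then show ?thesis by simp
  qed
  note A = continuous_mult_cutoff[OF \<Omega> cu(1) c\<phi>(2) cl C(2) \<phi>'0]
  note B = continuous_mult_cutoff[OF \<Omega> cu(2) c\<phi>(1) cl C(2,3)]
  have A2: "indicator \<Omega> x *\<^sub>R (u x * partial i \<phi> x) = partial i \<phi> x * u x" for x
    using C(2) \<phi>'0[of x] by (cases "x \<in> \<Omega>") auto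
  have B2: "indicator \<Omega> x *\<^sub>R (partial i u x * \<phi> x) = \<phi> x * partial i u x" for x
    using C(2,3) by (cases "x \<in> \<Omega>") auto
  define h where "h x = \<phi> x * u x" for x
  have hC: "Ck_on 1 UNIV h" unfolding h_def by (rule Ck_on_mult_cutoff[OF \<Omega> u \<phi> cl C(2,3)])
  then have h1: "Ck_on (Suc 0) UNIV h" by simp
  have ph: "partial i h x = partial i \<phi> x * u x + \<phi> x * partial i u x" for x
  proof (cases "x \<in> \<Omega>")
    case True
    then show ?thesis unfolding h_def using partial_mult[OF d\<phi> du[OF True]] by (simp add: mult.commute)
  next
    case False
    then have "x \<notin> C" using C(2) by auto
    have "partial i h x = partial i (\<lambda>_. 0) x"
      by (rule partial_cong_open[of "- C"]) (use cl \<open>x \<notin> C\<close> C(3) in \<open>auto simp: h_def\<close>)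
    then show ?thesis using C(3) \<phi>'0 \<open>x \<notin> C\<close> by simp
  qed
  have "(\<integral>x. partial i h x \<partial>lborel) = 0"
  proof (rule integral_partial_eq_0)
    show "h differentiable (at x)" for x using Ck_on_differentiable[OF h1] by simp
    show "continuous_on UNIV (partial i h)" using h1 by simp
    show "h x = 0" if "norm x > R" for x
    proof -
      have "x \<notin> C" using R[of x] that by auto
      then show ?thesis by (simp add: h_def C(3))
    qed
  qed
  moreover have "integrable lborel (\<lambda>x. partial i \<phi> x * u x)"
  proof (rule integrable_compact_support[OF A, of R])
    show "partial i \<phi> x * u x = 0" if "norm x > R" for x
      using \<phi>'0[OF R'[OF that]] by simp
  qed
  moreover have "integrable lborel (\<lambda>x. \<phi> x * partial i u x)"
  proof (rule integrable_compact_support[OF B, of R])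
    show "\<phi> x * partial i u x = 0" if "norm x > R" for x
      using C(3)[OF R'[OF that]] by simp
  qed
  ultimately have "(\<integral>x. partial i \<phi> x * u x \<partial>lborel) = - (\<integral>x. \<phi> x * partial i u x \<partial>lborel)"
    by (simp add: ph)
  moreover have "(\<integral>x. partial i \<phi> x * u x \<partial>lebesgue) = (\<integral>x. partial i \<phi> x * u x \<partial>lborel)"
    by (rule integral_lebesgue_lborel[OF A])
  moreover have "(\<integral>x. \<phi> x * partial i u x \<partial>lebesgue) = (\<integral>x. \<phi> x * partial i u x \<partial>lborel)"
    by (rule integral_lebesgue_lborel[OF B])
  ultimately show ?thesis
    unfolding set_lebesgue_integral_def A2 B2 by (metis (no_types))
qed

section \<open>Weak derivatives of continuously differentiable functions\<close>

lemma Lp_loc_1_integrable: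
  assumes "Lp_loc 1 \<Omega> g" "compact C" "C \<subseteq> \<Omega>"
  shows "integrable lebesgue (\<lambda>x. indicator C x * g x)"
proof -
  have m: "(\<lambda>x. indicator C x * g x) \<in> borel_measurable lebesgue"
    and i: "integrable lebesgue (\<lambda>x. indicator C x * \<bar>g x\<bar>)"
    using assms by (auto simp: Lp_loc_def set_borel_measurable_def set_integrable_def)
  have "integrable lebesgue (\<lambda>x. \<bar>indicator C x * g x\<bar>)"
    using i by (simp add: abs_mult)
  then show ?thesis using m by (simp add: integrable_abs_iff)
qed

text \<open>Boxes are an intersection-stable generator of the Borel sets, so Dynkin's argument
  extends the hypothesis to all Borel sets. Its complement step needs the total integral, obtained
  as a limit over growing cubes.\<close>

lemma AE_zero_if_box_integrals_zero:
  fixes f :: "'a::euclidean_space \<Rightarrow> real"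
  assumes f: "integrable lborel f" and z: "\<And>a b. (LINT x:box a b|lborel. f x) = 0"
  shows "AE x in lborel. f x = 0"
proof -
  have si: "set_integrable lborel A f" if "A \<in> sets borel" for A
    using integrable_mult_indicator[OF _ f, of A] that by (simp add: set_integrable_def)
  have total: "(\<integral>x. f x \<partial>lborel) = 0"
  proof -
    define B where "B k = box (- real k *\<^sub>R One) (real k *\<^sub>R One :: 'a)" for k
    have "(\<lambda>k. \<integral>x. indicator (B k) x *\<^sub>R f x \<partial>lborel) \<longlonglongrightarrow> (\<integral>x. f x \<partial>lborel)"
    proof (rule integral_dominated_convergence)
      show "integrable lborel (\<lambda>x. norm (f x))" using f by simp
      show "AE x in lborel. (\<lambda>k. indicator (B k) x *\<^sub>R f x) \<longlonglongrightarrow> f x"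
      proof (rule AE_I2)
        fix x :: 'a
        obtain k0 where k0: "norm x < real k0" using reals_Archimedean2 by blast
        have "indicator (B k) x *\<^sub>R f x = f x" if "k \<ge> k0" for k
        proof -
          have "\<bar>x \<bullet> i\<bar> < real k" if "i \<in> Basis" for i
            using Basis_le_norm[OF that, of x] k0 \<open>k \<ge> k0\<close> by linarith
          then have "x \<in> B k" by (auto simp: B_def mem_box abs_less_iff minus_less_iff)
          then show ?thesis by simp
        qed
        then show "(\<lambda>k. indicator (B k) x *\<^sub>R f x) \<longlonglongrightarrow> f x"
          by (intro tendsto_eventually) (auto simp: eventually_sequentially)
      qed
    qed (use f in \<open>auto simp: B_def indicator_def\<close>)
    moreover have "(\<integral>x. indicator (B k) x *\<^sub>R f x \<partial>lborel) = 0" for k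
      using z by (simp add: B_def set_lebesgue_integral_def)
    ultimately show ?thesis using LIMSEQ_unique[of "\<lambda>_. 0 :: real"] by simp
  qed
  have zero: "(LINT x:A|lborel. f x) = 0" if "A \<in> sets borel" for A
  proof -
    have "Int_stable (range (\<lambda>(a, b). box a b :: 'a set))"
    proof (rule Int_stableI)
      fix A B assume "A \<in> range (\<lambda>(a, b). box a b :: 'a set)" "B \<in> range (\<lambda>(a, b). box a b :: 'a set)"
      then obtain a b c d where "A = box a b" "B = box c d" by auto
      then show "A \<inter> B \<in> range (\<lambda>(a, b). box a b :: 'a set)" by (auto simp: box_Int_box)
    qed
    moreover have "range (\<lambda>(a, b). box a b :: 'a set) \<subseteq> Pow UNIV" by simp
    moreover have "A \<in> sigma_sets UNIV (range (\<lambda>(a, b). box a b :: 'a set))"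
      using that unfolding borel_eq_box by simp
    ultimately show ?thesis
    proof (induction rule: sigma_sets_induct_disjoint)
      case (basic A)
      then show ?case using z by auto
    next
      case empty
      show ?case by (simp add: set_lebesgue_integral_def)
    next
      case (compl A)
      then have A: "A \<in> sets borel" unfolding borel_eq_box by simp
      have "(LINT x:UNIV - A|lborel. f x) = (\<integral>x. f x - indicator A x *\<^sub>R f x \<partial>lborel)"
        unfolding set_lebesgue_integral_def by (intro Bochner_Integration.integral_cong) (auto simp: indicator_def)
      also have "\<dots> = 0"
        using si[OF A] f total compl.IH by (simp add: set_integrable_def set_lebesgue_integral_def)
      finally show ?case .
    next
      case (union A)
      then have A: "A i \<in> sets borel" for i unfolding borel_eq_box by auto
      have "(LINT x:(\<Union>i. A i)|lborel. f x) = (\<Sum>i. LINT x:A i|lborel. f x)"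
      proof (rule lebesgue_integral_countable_add)
        show "A i \<inter> A j = {}" if "i \<noteq> j" for i j using union.hyps(1) that by (auto simp: disjoint_family_on_def)
        show "set_integrable lborel (\<Union>i. A i) f" by (intro si) (use A in auto)
      qed (use A in auto)
      then show ?case using union.IH by simp
    qed
  qed
  have "AE x in lborel. f x = (\<lambda>_. 0) x"
    by (rule density_unique_real[OF f]) (use zero in \<open>auto simp: set_lebesgue_integral_def\<close>)
  then show ?thesis by simp
qed

text \<open>Testing with \<open>box_bump c\<close> and letting \<open>c\<close> tend to 0 shows by
  dominated convergence that \<open>g - partial i u\<close> has integral zero over every box inside
  \<open>box lo hi\<close>.\<close>

lemma weak_partial_eq_classical_on_box:
  fixes u :: "real^'n \<Rightarrow> real"
  assumes \<Omega>: "open \<Omega>" and u: "Ck_on 1 \<Omega> u" and w: "has_weak_partial \<Omega> i u g"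
    and box: "cbox lo hi \<subseteq> \<Omega>"
  shows "AE x in lebesgue. x \<in> box lo hi \<longrightarrow> g x = partial i u x"
proof -
  define f where "f x = indicator (cbox lo hi) x * g x - indicator (cbox lo hi) x * partial i u x" for x
  have cu: "continuous_on \<Omega> (partial i u)" using u by simp
  have pint: "integrable lborel (\<lambda>x. indicator (cbox lo hi) x *\<^sub>R partial i u x)"
    by (rule borel_integrable_compact) (use cu box in \<open>auto intro: continuous_on_subset\<close>)
  have gint: "integrable lebesgue (\<lambda>x. indicator (cbox lo hi) x * g x)"
    using w box by (intro Lp_loc_1_integrable[of \<Omega>]) (auto simp: has_weak_partial_def)
  have pintL: "integrable lebesgue (\<lambda>x. indicator (cbox lo hi) x * partial i u x)"
    using pint by (subst integrable_completion) auto
  from gint pintL have fint: "integrable lebesgue f" unfolding f_def by (rule Bochner_Integration.integrable_diff)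
  have sub: "(LINT x:box a b|lebesgue. f x) = 0" if ab: "box a b \<subseteq> box lo hi" "\<And>i. a $ i < b $ i" for a b
  proof -
    have cab: "cbox a b \<subseteq> cbox lo hi"
    proof -
      have "box a b \<noteq> {}" using ab(2) by (auto simp: interval_ne_empty_cart)
      then have "cbox a b = closure (box a b)" by (simp add: closure_box)
      also have "\<dots> \<subseteq> closure (cbox lo hi)" using ab(1) box_subset_cbox by (intro closure_mono) blast
      finally show ?thesis by simp
    qed
    define \<phi> where "\<phi> j = box_bump (1 / real (Suc j)) a b" for j
    have z: "(\<integral>x. \<phi> j x * f x \<partial>lebesgue) = 0" for j
    proof -
      have t: "test_function \<Omega> (\<phi> j)"
        unfolding \<phi>_def by (rule test_function_box_bump) (use ab cab box in auto)
      have C1: "Ck_on 1 UNIV (\<phi> j)" using t by (simp add: test_function_def)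
      have "(LINT x:\<Omega>|lebesgue. u x * partial i (\<phi> j) x) = - (LINT x:\<Omega>|lebesgue. partial i u x * \<phi> j x)"
        by (rule classical_integration_by_parts[OF \<Omega> u C1, of "cbox a b"])
           (use cab box in \<open>auto simp: \<phi>_def intro!: box_bump_outside_cbox\<close>)
      moreover have "(LINT x:\<Omega>|lebesgue. u x * partial i (\<phi> j) x) = - (LINT x:\<Omega>|lebesgue. g x * \<phi> j x)"
        using w t by (simp add: has_weak_partial_def)
      ultimately have eq: "(LINT x:\<Omega>|lebesgue. g x * \<phi> j x) = (LINT x:\<Omega>|lebesgue. partial i u x * \<phi> j x)" by simp
      have ind: "indicator \<Omega> x *\<^sub>R (k x * \<phi> j x) = \<phi> j x * (indicator (cbox lo hi) x * k x)" for k :: "_ \<Rightarrow> real" and x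
      proof (cases "x \<in> box a b")
        case True
        then have "x \<in> cbox lo hi" "x \<in> \<Omega>" using cab box box_subset_cbox by blast+
        then show ?thesis by simp
      qed (simp add: \<phi>_def box_bump_outside)
      have bm: "\<phi> j \<in> borel_measurable lebesgue"
        using Ck_on_Suc_lower[of UNIV 0 "\<phi> j"] C1
        by (intro borel_measurable_continuous_onI measurable_completion) (auto intro: borel_measurable_continuous_onI)
      have bnd: "\<bar>\<phi> j x\<bar> \<le> 1" for x using box_bump_bounds[of "1 / real (Suc j)" a b x] by (simp add: \<phi>_def)
      have int: "integrable lebesgue (\<lambda>x. \<phi> j x * k x)" if "integrable lebesgue k" for k
      proof (rule Bochner_Integration.integrable_bound[OF that])
        show "(\<lambda>x. \<phi> j x * k x) \<in> borel_measurable lebesgue" using bm that by auto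
        show "AE x in lebesgue. norm (\<phi> j x * k x) \<le> norm (k x)"
          using bnd by (intro AE_I2) (simp add: abs_mult mult_left_le_one_le)
      qed
      have "(\<integral>x. \<phi> j x * f x \<partial>lebesgue) = (\<integral>x. \<phi> j x * (indicator (cbox lo hi) x * g x) \<partial>lebesgue)
          - (\<integral>x. \<phi> j x * (indicator (cbox lo hi) x * partial i u x) \<partial>lebesgue)"
        unfolding f_def right_diff_distrib
        by (rule Bochner_Integration.integral_diff; rule int)
           (rule gint pintL)+
      then show ?thesis using eq unfolding set_lebesgue_integral_def ind by simp
    qed
    have "(\<lambda>j. \<integral>x. \<phi> j x * f x \<partial>lebesgue) \<longlonglongrightarrow> (\<integral>x. indicator (box a b) x * f x \<partial>lebesgue)"
    proof (rule integral_dominated_convergence)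
      show "integrable lebesgue (\<lambda>x. norm (f x))" using fint by simp
      show "AE x in lebesgue. (\<lambda>j. \<phi> j x * f x) \<longlonglongrightarrow> indicator (box a b) x * f x"
        unfolding \<phi>_def by (intro AE_I2 tendsto_mult_right box_bump_tendsto)
      show "AE x in lebesgue. norm (\<phi> j x * f x) \<le> norm (f x)" for j
      proof (rule AE_I2)
        fix x
        have "\<bar>\<phi> j x\<bar> \<le> 1" using box_bump_bounds[of "1 / real (Suc j)" a b x] by (simp add: \<phi>_def)
        then show "norm (\<phi> j x * f x) \<le> norm (f x)" by (simp add: abs_mult mult_left_le_one_le)
      qed
      have "Ck_on 0 UNIV (\<phi> j)" for j unfolding \<phi>_def by (rule box_bump_smooth) (use ab in auto)
      then have "\<phi> j \<in> borel_measurable lebesgue" for j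
        by (intro measurable_completion) (auto intro: borel_measurable_continuous_onI)
      then show "(\<lambda>x. \<phi> j x * f x) \<in> borel_measurable lebesgue" for j using fint by auto
      have "(indicator (box a b) :: _ \<Rightarrow> real) \<in> borel_measurable (lebesgue :: (real^'n) measure)" by (intro measurable_completion) auto
      then show "(\<lambda>x. indicator (box a b) x * f x) \<in> borel_measurable lebesgue" using fint by auto
    qed
    then show ?thesis
      using LIMSEQ_unique[of "\<lambda>_. 0 :: real"] by (simp add: z set_lebesgue_integral_def)
  qed
  \<comment> \<open>\<open>f\<close> is merely Lebesgue measurable, whereas the generator argument
    concerns Borel functions; \<open>f'\<close> is a Borel representative.\<close>
  obtain f' where f': "f' \<in> borel_measurable lborel" "AE x in lborel. f x = f' x"
    using completion_ex_borel_measurable_real[of f lborel] fint by auto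
  have AE': "AE x in lebesgue. f x = f' x" using f'(2) by (rule AE_completion)
  have f'int: "integrable lborel f'"
  proof -
    have "integrable lebesgue f'"
      by (rule integrable_cong_AE[THEN iffD1, OF borel_measurable_integrable[OF fint]
            measurable_completion[OF f'(1)] AE' fint])
    then show ?thesis using integrable_completion[OF f'(1)] by simp
  qed
  define h where "h x = indicator (box lo hi) x * f' x" for x
  have hint: "integrable lborel h" unfolding h_def
    using integrable_mult_indicator[OF _ f'int, of "box lo hi"] by simp
  have "AE x in lborel. h x = 0"
  proof (rule AE_zero_if_box_integrals_zero[OF hint])
    fix a b :: "real^'n"
    define a' b' where "a' = (\<chi> i. max (a $ i) (lo $ i))" and "b' = (\<chi> i. min (b $ i) (hi $ i))"
    have int: "box a b \<inter> box lo hi = box a' b'" by (auto simp: a'_def b'_def mem_box_cart)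
    have "(LINT x:box a b|lborel. h x) = (\<integral>x. indicator (box a' b') x * f' x \<partial>lborel)"
      unfolding set_lebesgue_integral_def h_def int[symmetric]
      by (intro Bochner_Integration.integral_cong) (auto simp: indicator_def)
    also have "\<dots> = 0"
    proof (cases "\<forall>i. a' $ i < b' $ i")
      case True
      have m: "(indicator (box a' b') :: _ \<Rightarrow> real) \<in> borel_measurable (lebesgue :: (real^'n) measure)" by (intro measurable_completion) auto
      have "(\<integral>x. indicator (box a' b') x * f' x \<partial>lborel) = (\<integral>x. indicator (box a' b') x * f' x \<partial>lebesgue)"
        using f'(1) by (intro integral_completion[symmetric]) auto
      also have "\<dots> = (\<integral>x. indicator (box a' b') x * f x \<partial>lebesgue)"
        using AE' m fint f'(1) by (intro integral_cong_AE) (auto intro: measurable_completion)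
      also have "\<dots> = 0"
        using sub[of a' b'] True int by (auto simp: set_lebesgue_integral_def)
      finally show ?thesis .
    next
      case False
      then have "box a' b' = {}" by (auto simp: mem_box_cart) (meson order.strict_trans)
      then show ?thesis by simp
    qed
    finally show "(LINT x:box a b|lborel. h x) = 0" .
  qed
  then have "AE x in lebesgue. h x = 0" by (rule AE_completion)
  with AE' show ?thesis
  proof eventually_elim
    case (elim x)
    show ?case
    proof
      assume x: "x \<in> box lo hi"
      then have "x \<in> cbox lo hi" using box_subset_cbox by blast
      with elim x show "g x = partial i u x" by (simp add: h_def f_def)
    qed
  qed
qed

text \<open>By Lindelof's theorem countably many open boxes with closure in \<Omega> cover it, so
  the exceptional null sets can be united.\<close>

lemma weak_partial_eq_classical:
  fixes u :: "real^'n \<Rightarrow> real"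
  assumes \<Omega>: "open \<Omega>" and u: "Ck_on 1 \<Omega> u" and w: "has_weak_partial \<Omega> i u g"
  shows "AE x in lebesgue. x \<in> \<Omega> \<longrightarrow> g x = partial i u x"
proof -
  define \<F> where "\<F> = {box lo hi | lo hi. cbox lo hi \<subseteq> \<Omega>}"
  have cover: "\<Union>\<F> = \<Omega>"
  proof
    show "\<Union>\<F> \<subseteq> \<Omega>" using box_subset_cbox by (fastforce simp: \<F>_def)
    show "\<Omega> \<subseteq> \<Union>\<F>"
    proof
      fix x assume "x \<in> \<Omega>"
      then obtain a b where "cbox a b \<subseteq> \<Omega>" "x \<in> box a b"
        using open_contains_cbox[OF \<Omega>] by metis
      then show "x \<in> \<Union>\<F>" by (auto simp: \<F>_def)
    qed
  qed
  obtain \<F>' where F': "\<F>' \<subseteq> \<F>" "countable \<F>'" "\<Union>\<F>' = \<Union>\<F>"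
    using Lindelof[of \<F>] by (auto simp: \<F>_def open_box)
  have "AE x in lebesgue. \<forall>B\<in>\<F>'. x \<in> B \<longrightarrow> g x = partial i u x"
  proof (subst AE_ball_countable[OF F'(2)], rule ballI)
    fix B assume "B \<in> \<F>'"
    then obtain lo hi where "B = box lo hi" "cbox lo hi \<subseteq> \<Omega>" using F'(1) by (auto simp: \<F>_def)
    then show "AE x in lebesgue. x \<in> B \<longrightarrow> g x = partial i u x"
      using weak_partial_eq_classical_on_box[OF \<Omega> u w] by simp
  qed
  then show ?thesis
  proof eventually_elim
    case (elim x)
    then show ?case using F'(3) cover by auto
  qed
qed

lemma AE_nonneg_imp_nonneg:
  fixes h :: "real^'n \<Rightarrow> real"
  assumes "open \<Omega>" "continuous_on \<Omega> h" "AE x in lebesgue. x \<in> \<Omega> \<longrightarrow> h x \<ge> 0" "x \<in> \<Omega>"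
  shows "h x \<ge> 0"
proof (rule ccontr)
  assume "\<not> h x \<ge> 0"
  define N where "N = {x\<in>\<Omega>. h x < 0}"
  have "N = \<Omega> \<inter> h -` {..<0}" by (auto simp: N_def)
  then have "open N" using continuous_open_preimage[OF assms(2,1), of "{..<0}"] by simp
  moreover have "N \<noteq> {}" using \<open>\<not> h x \<ge> 0\<close> assms(4) by (auto simp: N_def)
  moreover have "negligible N"
  proof -
    have "AE x in lebesgue. x \<notin> N" using assms(3) by eventually_elim (auto simp: N_def)
    then have "N \<in> null_sets lebesgue"
      using \<open>open N\<close> by (subst (asm) AE_iff_null_sets[symmetric]) auto
    then show ?thesis by (simp add: negligible_iff_null_sets)
  qed
  ultimately show False using open_not_negligible by blast
qed

definition jac :: "(real^'n \<Rightarrow> real^'m) \<Rightarrow> real^'n \<Rightarrow> real^'n^'m" where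
  "jac f x = (\<chi> j i. partial i (\<lambda>y. f y $ j) x)"

lemma continuous_on_det:
  fixes A :: "'a::topological_space \<Rightarrow> real^'n^'n"
  assumes "continuous_on S A"
  shows "continuous_on S (\<lambda>x. det (A x))"
  unfolding det_def by (intro continuous_intros assms)

text \<open>The distortion inequality without operator norms, in a form that is visibly closed under limits.\<close>

definition qr_matrix :: "real \<Rightarrow> real^'n^'n \<Rightarrow> bool" where
  "qr_matrix K A \<longleftrightarrow> det A \<ge> 0 \<and> (\<forall>v. norm (A *v v) ^ CARD('n) \<le> K * det A * norm v ^ CARD('n))"

text \<open>The weak differential agrees almost everywhere with the continuous matrix
  \<open>jac f\<close>, and an inequality between continuous functions that holds almost everywhere
  on an open set holds at each of its points.\<close>

theorem quasiregular_pointwise: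
  fixes f :: "real^'n \<Rightarrow> real^'n"
  assumes \<Omega>: "open \<Omega>" and f: "\<And>j. Ck_on 1 \<Omega> (\<lambda>x. f x $ j)" and qr: "sp_K_quasiregular K \<Omega> f" and x: "x \<in> \<Omega>"
  shows "qr_matrix K (jac f x)"
proof -
  obtain D where D: "has_weak_differential \<Omega> f D"
    "AE x in lebesgue. x \<in> \<Omega> \<longrightarrow> det (D x) \<ge> 0"
    "AE x in lebesgue. x \<in> \<Omega> \<longrightarrow> onorm ((*v) (D x)) ^ CARD('n) \<le> K * det (D x)"
    using qr by (auto simp: sp_K_quasiregular_def)
  have "AE x in lebesgue. \<forall>j\<in>UNIV. \<forall>i\<in>UNIV. x \<in> \<Omega> \<longrightarrow> D x $ j $ i = partial i (\<lambda>y. f y $ j) x"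
    using weak_partial_eq_classical[OF \<Omega> f] D(1)
    by (intro AE_finite_allI) (auto simp: has_weak_differential_def)
  then have J: "AE x in lebesgue. x \<in> \<Omega> \<longrightarrow> D x = jac f x"
    by eventually_elim (auto simp: jac_def vec_eq_iff)
  have cj: "continuous_on \<Omega> (jac f)"
    unfolding jac_def using f by (intro continuous_on_vec_lambda) auto
  have "AE x in lebesgue. x \<in> \<Omega> \<longrightarrow> det (jac f x) \<ge> 0"
    using J D(2) by eventually_elim auto
  then have "det (jac f x) \<ge> 0"
    by (rule AE_nonneg_imp_nonneg[OF \<Omega> continuous_on_det[OF cj] _ x])
  moreover have "norm (jac f x *v v) ^ CARD('n) \<le> K * det (jac f x) * norm v ^ CARD('n)" for v
  proof -
    have "AE x in lebesgue. x \<in> \<Omega> \<longrightarrow> K * det (jac f x) * norm v ^ CARD('n) - norm (jac f x *v v) ^ CARD('n) \<ge> 0"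
      using J D(3)
    proof eventually_elim
      case (elim x)
      show ?case
      proof
        assume "x \<in> \<Omega>"
        then have o: "onorm ((*v) (jac f x)) ^ CARD('n) \<le> K * det (jac f x)" using elim by auto
        have "norm (jac f x *v v) ^ CARD('n) \<le> (onorm ((*v) (jac f x)) * norm v) ^ CARD('n)"
          by (intro power_mono onorm matrix_vector_mul_bounded_linear) auto
        also have "\<dots> \<le> K * det (jac f x) * norm v ^ CARD('n)"
          unfolding power_mult_distrib using o by (intro mult_right_mono) auto
        finally show "K * det (jac f x) * norm v ^ CARD('n) - norm (jac f x *v v) ^ CARD('n) \<ge> 0" by simp
      qed
    qed
    moreover have "continuous_on \<Omega> (\<lambda>x. K * det (jac f x) * norm v ^ CARD('n) - norm (jac f x *v v) ^ CARD('n))"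
    proof -
      have "continuous_on \<Omega> (\<lambda>x. jac f x *v v)"
        unfolding matrix_vector_mult_def by (intro continuous_on_vec_lambda continuous_intros cj)
      then show ?thesis by (intro continuous_intros continuous_on_det[OF cj])
    qed
    ultimately have "K * det (jac f x) * norm v ^ CARD('n) - norm (jac f x *v v) ^ CARD('n) \<ge> 0"
      using AE_nonneg_imp_nonneg[OF \<Omega> _ _ x] by blast
    then show ?thesis by simp
  qed
  ultimately show ?thesis by (simp add: qr_matrix_def)
qed

section \<open>Proper local homeomorphisms\<close>

text \<open>The image is open and, by properness, closed in \<open>S\<close>, so \<open>p\<close> is
  onto. Fibres are compact and discrete, hence finite, and their points have disjoint neighbourhoods
  \<open>W x\<close>; a neighbourhood of \<open>y\<close> is evenly covered once its preimage lies
  in the union of these.\<close>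

lemma proper_local_homeomorphism_covering_space:
  fixes p :: "'a::euclidean_space \<Rightarrow> 'b::euclidean_space"
  assumes contp: "continuous_on C p" and C: "open C" "C \<noteq> {}" and S: "open S" "connected S" and pC: "p ` C \<subseteq> S"
    and loc: "\<And>x. x \<in> C \<Longrightarrow> \<exists>U V q. open U \<and> x \<in> U \<and> U \<subseteq> C \<and> open V \<and> V \<subseteq> S \<and> homeomorphism U V p q"
    and proper: "\<And>K. compact K \<Longrightarrow> K \<subseteq> S \<Longrightarrow> compact (C \<inter> p -` K)"
  shows "covering_space C p S"
proof
  show "continuous_on C p" by (rule contp)
  have opn: "open (p ` C)"
  proof (subst open_subopen, rule ballI)
    fix y assume "y \<in> p ` C"
    then obtain x where x: "x \<in> C" "y = p x" by auto
    obtain U V q where "open U \<and> x \<in> U \<and> U \<subseteq> C \<and> open V \<and> V \<subseteq> S \<and> homeomorphism U V p q"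
      using loc[OF x(1)] by (elim exE)
    then have "x \<in> U" "U \<subseteq> C" "open V" "homeomorphism U V p q" by simp_all
    then have "y \<in> V" "V \<subseteq> p ` C" using x(2) by (auto simp: homeomorphism_def)
    with \<open>open V\<close> show "\<exists>T. open T \<and> y \<in> T \<and> T \<subseteq> p ` C" by blast
  qed
  have closed: "closedin (top_of_set S) (p ` C)"
  proof -
    have "y \<in> p ` C" if y: "y \<in> S" "y \<in> closure (p ` C)" for y
    proof -
      obtain r where r: "r > 0" "cball y r \<subseteq> S" using S(1) y(1) open_contains_cball by blast
      define K where "K = p ` (C \<inter> p -` cball y r)"
      have "compact K" unfolding K_def
        by (intro compact_continuous_image proper continuous_on_subset[OF contp]) (use r in auto)
      then have "closed K" by (rule compact_imp_closed)
      moreover have "y \<in> closure K"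
        unfolding closure_approachable
      proof (intro allI impI)
        fix e :: real assume "e > 0"
        then obtain z where "z \<in> p ` C" "dist z y < min e r"
          using y(2) r(1) unfolding closure_approachable by (meson min_less_iff_conj)
        then show "\<exists>z\<in>K. dist z y < e" by (intro bexI[of _ z]) (auto simp: K_def dist_commute)
      qed
      ultimately show ?thesis by (auto simp: K_def)
    qed
    then have "p ` C = S \<inter> closure (p ` C)" using pC closure_subset[of "p ` C"] by auto
    then show ?thesis by (metis closed_closure closedin_closed_Int)
  qed
  have "openin (top_of_set S) (p ` C)" using opn pC by (simp add: open_subset)
  with closed S(2) C(2) show "p ` C = S" by (auto simp: connected_clopen)
  fix y assume y: "y \<in> S"
  define F where "F = C \<inter> p -` {y}"
  have "compact F" unfolding F_def by (rule proper) (use y in auto)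
  have "\<forall>x\<in>F. \<exists>U V q. open U \<and> x \<in> U \<and> U \<subseteq> C \<and> open V \<and> V \<subseteq> S \<and> homeomorphism U V p q"
    using loc unfolding F_def by simp
  from bchoice[OF this] obtain U where "\<forall>x\<in>F. \<exists>V q. open (U x) \<and> x \<in> U x \<and> U x \<subseteq> C \<and> open V \<and> V \<subseteq> S \<and> homeomorphism (U x) V p q"
    by (elim exE)
  from bchoice[OF this] obtain V where "\<forall>x\<in>F. \<exists>q. open (U x) \<and> x \<in> U x \<and> U x \<subseteq> C \<and> open (V x) \<and> V x \<subseteq> S \<and> homeomorphism (U x) (V x) p q"
    by (elim exE)
  from bchoice[OF this] obtain q where UVq: "\<And>x. x \<in> F \<Longrightarrow> open (U x) \<and> x \<in> U x \<and> U x \<subseteq> C \<and> open (V x) \<and> V x \<subseteq> S \<and> homeomorphism (U x) (V x) p (q x)"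
    by auto
  have sing: "U x \<inter> F = {x}" if "x \<in> F" for x
  proof -
    have "inj_on p (U x)" using UVq[OF that] by (auto intro: inj_on_inverseI homeomorphism_apply1)
    then show ?thesis using UVq[OF that] that by (auto simp: F_def inj_on_def)
  qed
  have finF: "finite F"
  proof -
    obtain D where D: "D \<subseteq> F" "finite D" "F \<subseteq> (\<Union>x\<in>D. U x)"
    proof (rule compactE_image[OF \<open>compact F\<close>, of F U])
      show "open (U x)" if "x \<in> F" for x using UVq[OF that] by simp
      show "F \<subseteq> (\<Union>x\<in>F. U x)" using UVq by auto
    qed
    have "F \<subseteq> D"
    proof
      fix z assume "z \<in> F"
      then obtain x where "x \<in> D" "z \<in> U x" using D(3) by blast
      then have "z = x" using sing[of x] D(1) \<open>z \<in> F\<close> by blast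
      with \<open>x \<in> D\<close> show "z \<in> D" by simp
    qed
    with D(2) show ?thesis by (rule rev_finite_subset)
  qed
  obtain s where s: "s > 0" "\<And>x x'. x \<in> F \<Longrightarrow> x' \<in> F \<Longrightarrow> x \<noteq> x' \<Longrightarrow> 2 * s \<le> dist x x'"
  proof -
    define E where "E = insert 1 ((\<lambda>(x, x'). dist x x') ` {(x, x'). x \<in> F \<and> x' \<in> F \<and> x \<noteq> x'})"
    have "finite {(x, x'). x \<in> F \<and> x' \<in> F \<and> x \<noteq> x'}"
      by (rule finite_subset[of _ "F \<times> F"]) (use finF in auto)
    then have "finite E" "E \<noteq> {}" by (auto simp: E_def)
    moreover have "\<forall>e\<in>E. e > 0" by (auto simp: E_def)
    ultimately have "Min E > 0" by simp
    moreover have "2 * (Min E / 2) \<le> dist x x'" if "x \<in> F" "x' \<in> F" "x \<noteq> x'" for x x'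
      using \<open>finite E\<close> that by (auto simp: E_def intro!: Min_le)
    ultimately show ?thesis using that[of "Min E / 2"] by auto
  qed
  define W where "W x = U x \<inter> ball x s" for x
  have W: "open (W x)" "x \<in> W x" "W x \<subseteq> U x" if "x \<in> F" for x using UVq[OF that] s by (auto simp: W_def)
  have Wdisj: "W x \<inter> W x' = {}" if "x \<in> F" "x' \<in> F" "x \<noteq> x'" for x x'
  proof -
    have "ball x s \<inter> ball x' s = {}" using s(2)[OF that] by (intro disjoint_ballI) simp
    then show ?thesis by (auto simp: W_def)
  qed
  have pW: "open (p ` W x)" "y \<in> p ` W x" if "x \<in> F" for x
  proof -
    have h: "homeomorphism (U x) (V x) p (q x)" using UVq[OF that] by blast
    have "openin (top_of_set (U x)) (W x)" using W[OF that] by (simp add: open_subset)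
    then have "openin (top_of_set (V x)) (p ` W x)" using homeomorphism_imp_open_map[OF h] by blast
    then show "open (p ` W x)" using UVq[OF that] openin_open_trans by blast
    show "y \<in> p ` W x" using W(2)[OF that] that by (auto simp: F_def)
  qed
  obtain r where r: "r > 0" "cball y r \<subseteq> S" using S(1) y open_contains_cball by blast
  \<comment> \<open>The values near \<open>y\<close> attained outside the chosen sheets. This set is
    compact and misses \<open>y\<close>, so \<open>T\<close> can avoid it, and then no further sheet
    lies over \<open>T\<close>.\<close>
  define K where "K = p ` ((C \<inter> p -` cball y r) - (\<Union>x\<in>F. W x))"
  have "compact ((C \<inter> p -` cball y r) - (\<Union>x\<in>F. W x))"
    by (intro compact_diff proper open_UN ballI) (use r W in auto)
  then have "compact K" unfolding K_def
    by (rule compact_continuous_image[OF continuous_on_subset[OF contp], rotated]) auto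
  then have "closed K" by (rule compact_imp_closed)
  have "y \<notin> K" using W(2) by (auto simp: K_def F_def)
  define T where "T = ball y r \<inter> (- K) \<inter> (\<Inter>x\<in>F. p ` W x)"
  have T: "open T" "y \<in> T"
    using \<open>closed K\<close> \<open>y \<notin> K\<close> r(1) pW finF by (auto simp: T_def intro!: open_Int open_INT)
  have TS: "T \<subseteq> S" using r by (auto simp: T_def)
  define v where "v = (\<lambda>x. W x \<inter> p -` T) ` F"
  show "\<exists>T. y \<in> T \<and> openin (top_of_set S) T \<and>
      (\<exists>v. \<Union>v = C \<inter> p -` T \<and> (\<forall>u\<in>v. openin (top_of_set C) u) \<and> pairwise disjnt v \<and> (\<forall>u\<in>v. \<exists>q. homeomorphism u T p q))"
  proof (intro exI[of _ T] conjI exI[of _ v] ballI)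
    show "y \<in> T" by (rule T)
    show "openin (top_of_set S) T" using T(1) TS by (simp add: open_subset)
    show "\<Union>v = C \<inter> p -` T"
    proof
      show "\<Union>v \<subseteq> C \<inter> p -` T" using W(3) UVq by (fastforce simp: v_def)
      show "C \<inter> p -` T \<subseteq> \<Union>v"
      proof
        fix z assume z: "z \<in> C \<inter> p -` T"
        then have "p z \<in> cball y r" "p z \<notin> K" by (auto simp: T_def)
        then have "z \<in> (\<Union>x\<in>F. W x)" using z by (auto simp: K_def)
        with z show "z \<in> \<Union>v" by (auto simp: v_def)
      qed
    qed
    show "pairwise disjnt v"
      unfolding pairwise_def v_def disjnt_def using Wdisj by blast
  next
    fix u assume "u \<in> v"
    then obtain x where x: "x \<in> F" "u = W x \<inter> p -` T" by (auto simp: v_def)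
    have WC: "W x \<subseteq> C" using W(3)[OF x(1)] UVq[OF x(1)] by blast
    have "open u" unfolding x(2)
      using continuous_open_preimage[OF continuous_on_subset[OF contp WC] W(1)[OF x(1)] T(1)] .
    then show "openin (top_of_set C) u" using WC x(2) by (intro open_subset) auto
    have h: "homeomorphism (U x) (V x) p (q x)" using UVq[OF x(1)] by blast
    have "T \<subseteq> p ` W x" using x by (auto simp: T_def)
    then have pu: "p ` u = T" unfolding x(2) by blast
    have "u \<subseteq> U x" using W(3)[OF x(1)] x(2) by blast
    from homeomorphism_of_subsets[OF h this _ pu] have "homeomorphism u T p (q x)"
      using \<open>u \<subseteq> U x\<close> pu homeomorphism_image1[OF h] by blast
    then show "\<exists>q. homeomorphism u T p q" by blast
  qed
qed

text \<open>Simple connectedness lifts the identity of \<open>S\<close> to a section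
  \<open>g\<close> through \<open>x0\<close>. Both \<open>g \<circ> p\<close> and the identity of
  \<open>C\<close> are lifts of \<open>p\<close> that agree at \<open>x0\<close>, so they coincide
  on the connected \<open>C\<close>.\<close>

lemma covering_space_simply_connected_inj_on:
  fixes p :: "'a::real_normed_vector \<Rightarrow> 'b::real_normed_vector"
  assumes cov: "covering_space C p S" and C: "connected C" and S: "simply_connected S" "locally path_connected S"
  shows "inj_on p C"
proof (cases "C = {}")
  case False
  then obtain x0 where x0: "x0 \<in> C" by blast
  have contp: "continuous_on C p" and im: "p ` C = S"
    using cov by (simp_all add: covering_space_imp_continuous covering_space_imp_surjective)
  obtain g where g: "continuous_on S g" "g \<in> S \<rightarrow> C" "g (p x0) = x0" "\<And>y. y \<in> S \<Longrightarrow> p (g y) = y"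
    using covering_space_lift_strong[OF cov x0, of "p x0" S "\<lambda>y. y"] im x0 S by auto
  have "(g \<circ> p) x = id x" if "x \<in> C" for x
  proof (rule covering_space_lift_unique[OF cov, where f = p and T = C and a = x0 and ?g1.0 = "g \<circ> p" and ?g2.0 = id])
    show "continuous_on C (g \<circ> p)" using contp g(1) im by (intro continuous_on_compose) auto
  qed (use that x0 g im contp C in \<open>auto simp: Pi_iff\<close>)
  then show ?thesis by (intro inj_on_inverseI[of C g p]) simp
qed simp

section \<open>Analytic local inverses\<close>

lemma cpartial_cmult:
  assumes "holo U G" "z \<in> U"
  shows "cpartial i (\<lambda>z. c * G z) z = c * cpartial i G z"
  using assms unfolding cpartial_def holo_def by (intro deriv_cmult) auto

text \<open>\<open>partial_Re_holo\<close> is applied to \<open>G\<close> and to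
  \<open>- \<i> * G\<close>, whose real part vanishes on real points; together they give the real
  and the imaginary part of the derivative.\<close>

lemma cpartial_real:
  assumes G: "holo U G" "open U" "cvec x \<in> U" "\<And>y. cvec y \<in> U \<Longrightarrow> G (cvec y) = of_real (u y)"
  shows "cpartial i G (cvec x) = of_real (partial i u x)"
proof -
  have "partial i u x = Re (cpartial i G (cvec x))"
    by (rule partial_Re_holo[OF G(1-3)]) (simp add: G(4))
  moreover have "partial i (\<lambda>_. 0) x = Re (cpartial i (\<lambda>z. - \<i> * G z) (cvec x))"
    by (rule partial_Re_holo[OF holo_cmult[OF G(1)] G(2,3)]) (simp add: G(4))
  then have "Im (cpartial i G (cvec x)) = 0"
    unfolding cpartial_cmult[OF G(1,3)] by simp
  ultimately show ?thesis by (simp add: complex_eq_iff)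
qed

definition cmat :: "real^'n^'m \<Rightarrow> complex^'n^'m" where
  "cmat A = (\<chi> i j. of_real (A $ i $ j))"

lemma cmat_mult: "cmat A ** cmat B = cmat (A ** B)"
  by (simp add: cmat_def matrix_matrix_mult_def vec_eq_iff)

lemma cmat_1: "cmat (mat 1) = mat 1"
  by (simp add: cmat_def mat_def vec_eq_iff)

lemma vec_mult_axis: "c *s axis k 1 = (axis k c :: complex^'n)"
  by (simp add: vec_eq_iff axis_def)

text \<open>The inverse function theorem is applied to the complexified map \<open>F\<close>,
  regarded over the reals. The derivative of the inverse inverts a complex linear map and so is
  complex linear: the inverse is holomorphic and extends the inverse of \<open>f\<close>.\<close>

theorem cext_local_inverse:
  fixes f :: "real^'n \<Rightarrow> real^'n"
  assumes f: "\<And>j. cext \<Omega> (\<lambda>x. f x $ j)" and \<Omega>: "open \<Omega>" and x0: "x0 \<in> \<Omega>" and J: "det (jac f x0) \<noteq> 0"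
  obtains U V g where "open U" "x0 \<in> U" "U \<subseteq> \<Omega>" "open V" "homeomorphism U V f g" "\<And>j. cext V (\<lambda>y. g y $ j)"
proof -
  have "\<forall>j. \<exists>r G. r > 0 \<and> holo (polydisc (cvec x0) r) G \<and>
      (\<forall>x. cvec x \<in> polydisc (cvec x0) r \<longrightarrow> G (cvec x) = of_real (f x $ j))"
  proof
    fix j
    obtain r G where "r > 0" "holo (polydisc (cvec x0) r) G"
      "\<And>x. cvec x \<in> polydisc (cvec x0) r \<Longrightarrow> G (cvec x) = of_real (f x $ j)"
      by (rule cext_real_extension[OF f[of j] x0]) (rule that)
    then show "\<exists>r G. r > 0 \<and> holo (polydisc (cvec x0) r) G \<and>
      (\<forall>x. cvec x \<in> polydisc (cvec x0) r \<longrightarrow> G (cvec x) = of_real (f x $ j))"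
      by (intro exI[of _ r] exI[of _ G]) simp
  qed
  from choice[OF this] obtain r where "\<forall>j. \<exists>G. r j > 0 \<and> holo (polydisc (cvec x0) (r j)) G \<and>
      (\<forall>x. cvec x \<in> polydisc (cvec x0) (r j) \<longrightarrow> G (cvec x) = of_real (f x $ j))" by (elim exE)
  from choice[OF this] obtain G where "\<forall>j. r j > 0 \<and> holo (polydisc (cvec x0) (r j)) (G j) \<and>
      (\<forall>x. cvec x \<in> polydisc (cvec x0) (r j) \<longrightarrow> G j (cvec x) = of_real (f x $ j))" by (elim exE)
  then have rG: "\<And>j. r j > 0" "\<And>j. holo (polydisc (cvec x0) (r j)) (G j)"
    "\<And>j x. cvec x \<in> polydisc (cvec x0) (r j) \<Longrightarrow> G j (cvec x) = of_real (f x $ j)"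
    by simp_all
  define \<rho> where "\<rho> = Min (range r)"
  have \<rho>: "\<rho> > 0" "\<rho> \<le> r j" for j using rG(1) by (auto simp: \<rho>_def)
  \<comment> \<open>The second condition keeps real parts in \<Omega>, so that real points of the
    neighbourhood lie in the domain of \<open>f\<close>.\<close>
  define D where "D = polydisc (cvec x0) \<rho> \<inter> {z. (\<chi> i. Re (z $ i)) \<in> \<Omega>}"
  have "open D"
  proof -
    have "open ((\<lambda>z :: complex^'n. (\<chi> i. Re (z $ i))) -` \<Omega>)"
      by (intro open_vimage \<Omega> continuous_intros)
    then show ?thesis unfolding D_def vimage_def by (intro open_Int open_polydisc)
  qed
  have x0D: "cvec x0 \<in> D" using \<rho>(1) x0 by (simp add: D_def)
  have G: "holo D (G j)" "cvec x \<in> D \<Longrightarrow> G j (cvec x) = of_real (f x $ j)" for j x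
  proof -
    have sub: "D \<subseteq> polydisc (cvec x0) (r j)" using polydisc_mono[OF \<rho>(2)] by (auto simp: D_def)
    show "holo D (G j)" by (rule holo_subset[OF rG(2) sub])
    show "cvec x \<in> D \<Longrightarrow> G j (cvec x) = of_real (f x $ j)" using rG(3) sub by blast
  qed
  have D\<Omega>: "x \<in> \<Omega>" if "cvec x \<in> D" for x
  proof -
    have "(\<chi> i. Re (cvec x $ i)) = x" by (simp add: vec_eq_iff)
    then show ?thesis using that by (simp add: D_def)
  qed
  define F where "F z = (\<chi> j. G j z)" for z
  have Fc: "F (cvec x) = cvec (f x)" if "cvec x \<in> D" for x
    using G(2)[OF that] by (simp add: F_def vec_eq_iff)
  define M where "M z = (\<chi> j i. cpartial i (G j) z)" for z
  define F' where "F' z = Blinfun ((*v) (M z))" for z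
  have F'_apply: "blinfun_apply (F' z) = (*v) (M z)" for z
    by (simp add: F'_def bounded_linear_Blinfun_apply)
  have derF: "(F has_derivative blinfun_apply (F' z)) (at z)" if "z \<in> D" for z
  proof -
    have "((\<lambda>z. F z $ j) has_derivative (\<lambda>h. (M z *v h) $ j)) (at z)" for j
      using holo_has_derivative[OF G(1) \<open>open D\<close> that] by (simp add: F_def M_def matrix_vector_mult_def)
    then show ?thesis unfolding F'_apply
      by (subst has_derivative_componentwise_within)
         (auto simp: Basis_vec_def inner_axis intro!: has_derivative_inner_left)
  qed
  have contF': "continuous_on D F'"
  proof (rule continuous_on_blinfun_componentwise)
    fix b :: "complex^'n"
    have "continuous_on D (\<lambda>z. M z *v b)"
      unfolding matrix_vector_mult_def M_def
      unfolding vec_lambda_beta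
      by (intro continuous_on_vec_lambda continuous_on_sum continuous_on_mult continuous_on_const
          holo_continuous[OF holo_cpartial[OF G(1) \<open>open D\<close>]])
    then show "continuous_on D (\<lambda>z. blinfun_apply (F' z) b)" by (simp add: F'_apply)
  qed
  have Mx0: "M (cvec x0) = cmat (jac f x0)"
    using cpartial_real[OF G(1) \<open>open D\<close> x0D G(2)] by (simp add: M_def cmat_def jac_def vec_eq_iff)
  obtain B where B: "B ** jac f x0 = mat 1" using J by (auto simp: invertible_det_nz[symmetric] invertible_def)
  define inv0 where "inv0 = Blinfun ((*v) (cmat B))"
  have inv0: "inv0 o\<^sub>L F' (cvec x0) = id_blinfun"
    by (rule blinfun_eqI)
       (simp add: inv0_def F'_apply bounded_linear_Blinfun_apply Mx0
          matrix_vector_mul_assoc cmat_mult B cmat_1)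
  obtain U' V' g g' where g: "open U'" "U' \<subseteq> D" "cvec x0 \<in> U'" "open V'" "homeomorphism U' V' F g"
    "\<And>y. y \<in> V' \<Longrightarrow> (g has_derivative (g' y)) (at y)"
    "\<And>y. y \<in> V' \<Longrightarrow> g' y = inv (blinfun_apply (F' (g y)))"
    "\<And>y. y \<in> V' \<Longrightarrow> bij (blinfun_apply (F' (g y)))"
    using inverse_function_theorem[OF \<open>open D\<close> derF contF' x0D inv0] by metis
  have g'_lin: "g' y (c *s h) = c *s g' y h" if "y \<in> V'" for y c h
  proof -
    have b: "bij ((*v) (M (g y)))" and i: "g' y = inv ((*v) (M (g y)))"
      using g(7,8)[OF that] by (simp_all add: F'_apply)
    have "M (g y) *v (c *s g' y h) = c *s (M (g y) *v g' y h)" by (simp add: vec.scale)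
    also have "\<dots> = c *s h" unfolding i using b by (simp add: bij_is_surj surj_f_inv_f)
    finally show ?thesis unfolding i using b by (metis bij_inv_eq_iff)
  qed
  have holg: "holo V' (\<lambda>z. g z $ j)" for j
    unfolding holo_def
  proof (intro conjI ballI allI)
    have "continuous_on V' g" using g(5) by (simp add: homeomorphism_def)
    then show "continuous_on V' (\<lambda>z. g z $ j)" by (intro continuous_intros)
    fix z k assume z: "z \<in> V'"
    have "((\<lambda>h. z + axis k h) has_derivative (\<lambda>h. 0 + axis k h)) (at 0)"
      by (intro has_derivative_add has_derivative_const bounded_linear_imp_has_derivative bounded_linear_axis)
    then have lin: "((\<lambda>h. z + axis k h) has_derivative axis k) (at 0)" by simp
    have "(g has_derivative g' z) (at (z + axis k 0))" using g(6)[OF z] by simp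
    from has_derivative_compose[OF lin this]
    have "((\<lambda>h. g (z + axis k h)) has_derivative (\<lambda>h. g' z (axis k h))) (at 0)" .
    then have "((\<lambda>h. g (z + axis k h) $ j) has_derivative (\<lambda>h. g' z (axis k h) $ j)) (at 0)"
      by (rule bounded_linear.has_derivative[OF bounded_linear_vec_nth])
    moreover have "(\<lambda>h. g' z (axis k h) $ j) = (*) (g' z (axis k 1) $ j)"
    proof
      fix h
      show "g' z (axis k h) $ j = (g' z (axis k 1) $ j) * h"
        using g'_lin[OF z, of h "axis k 1"] by (simp add: vec_mult_axis)
    qed
    ultimately have "((\<lambda>h. g (z + axis k h) $ j) has_field_derivative (g' z (axis k 1) $ j)) (at 0)"
      unfolding has_field_derivative_def by (simp only:)
    then show "(\<lambda>h. g (z + axis k h) $ j) field_differentiable at 0"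
      by (auto simp: field_differentiable_def)
  qed
  define U where "U = {x. cvec x \<in> U'}"
  \<comment> \<open>The image of \<open>U\<close> rather than the real points of \<open>V'\<close>,
    whose preimages under \<open>F\<close> need not be real; invariance of domain shows that it is
    open.\<close>
  define V where "V = f ` U"
  define gr where "gr y = (\<chi> i. Re (g (cvec y) $ i))" for y :: "real^'n"
  have "open U" unfolding U_def using g(1) by (rule open_cvec_vimage)
  have U\<Omega>: "U \<subseteq> \<Omega>" using g(2) D\<Omega> by (auto simp: U_def)
  have fV: "cvec (f x) \<in> V'" "gr (f x) = x" if "x \<in> U" for x
  proof -
    have x: "cvec x \<in> U'" "cvec x \<in> D" using that g(2) by (auto simp: U_def)
    then show "cvec (f x) \<in> V'" using g(5) Fc[OF x(2)] by (metis homeomorphism_def imageI)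
    have "g (cvec (f x)) = cvec x" using g(5) x Fc[OF x(2)] by (metis homeomorphism_def)
    then show "gr (f x) = x" by (simp add: gr_def vec_eq_iff)
  qed
  have contf: "continuous_on U f"
    using cext_continuous_on[OF f] U\<Omega>
    by (subst continuous_on_componentwise) (auto simp: Basis_vec_def inner_axis intro: continuous_on_subset)
  have inj: "inj_on f U" using fV(2) by (metis inj_onI)
  have "open V" unfolding V_def by (rule invariance_of_domain[OF contf \<open>open U\<close> inj])
  have VV': "cvec y \<in> V'" if "y \<in> V" for y using that fV(1) by (auto simp: V_def)
  have cextV: "cext V (\<lambda>y. gr y $ j)" for j
    unfolding cext_def
  proof
    fix y assume "y \<in> V"
    then obtain e where e: "e > 0" "ball (cvec y) e \<subseteq> V'" using VV' g(4) open_contains_ball by blast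
    have sub: "polydisc (cvec y) (e / real CARD('n)) \<subseteq> V'" using polydisc_subset_ball e(2) by blast
    show "\<exists>r>0. \<exists>G. holo (polydisc (cvec y) r) G \<and>
        (\<forall>x. cvec x \<in> polydisc (cvec y) r \<longrightarrow> gr x $ j = Re (G (cvec x)))"
      using e(1) holo_subset[OF holg sub]
      by (intro exI[of _ "e / real CARD('n)"] conjI exI[of _ "\<lambda>z. g z $ j"]) (auto simp: gr_def)
  qed
  have "continuous_on V gr"
    using cext_continuous_on[OF cextV]
    by (subst continuous_on_componentwise) (auto simp: Basis_vec_def inner_axis)
  then have hom: "homeomorphism U V f gr"
    using contf fV(2) by (intro homeomorphismI) (auto simp: V_def)
  show thesis
    by (rule that[OF \<open>open U\<close> _ U\<Omega> \<open>open V\<close> hom cextV]) (use g(3) in \<open>simp add: U_def\<close>)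
qed

section \<open>Planar harmonic functions\<close>

text \<open>The circle integral for \<open>cpartial i G\<close> is differentiated in the direction
  \<open>j\<close> under the integral, which yields the circle integral for
  \<open>cpartial i (cpartial j G)\<close>.\<close>

lemma cpartial_commute:
  fixes G :: "complex^'n \<Rightarrow> complex"
  assumes G: "holo U G" and U: "open U" and z: "z \<in> U"
  shows "cpartial i (cpartial j G) z = cpartial j (cpartial i G) z"
proof -
  obtain r' where r': "r' > 0" "cball z r' \<subseteq> U" using U z open_contains_cball by blast
  define r where "r = r' / 2"
  have r: "r > 0" "cball z (2*r) \<subseteq> U" using r' by (auto simp: r_def)
  note mem = cball_line[OF r(2)]
  define e where "e \<theta> = of_real r * exp (2 * of_real pi * \<i> * of_real \<theta>)" for \<theta> :: real
  have e: "norm (e \<theta>) \<le> r" "e \<theta> \<noteq> 0" for \<theta> using r by (simp_all add: e_def norm_mult)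
  have conte: "continuous_on S (\<lambda>x. e (k x))" if "continuous_on S k" for S and k :: "'b::topological_space \<Rightarrow> real"
    unfolding e_def using that by (intro continuous_intros)
  have ball: "z + axis j h \<in> ball z r" if "h \<in> ball 0 r" for h
    using that by (simp add: dist_norm)
  have memU: "z + axis j h + axis i (e \<theta>) \<in> U" if "h \<in> ball 0 r" for h \<theta>
    by (rule mem[OF ball[OF that] e(1)])
  note cj = holo_cpartial[OF G U, of j]
  have circ: "cpartial i F w = integral (cbox 0 1) (\<lambda>\<theta>. F (w + axis i (e \<theta>)) / e \<theta>)"
    if "holo U F" "w \<in> ball z r" for F w
    unfolding e_def by (rule cpartial_circle_integral[OF that(1) U mem[OF that(2)] r(1)])
  have cont: "continuous_on (ball 0 r \<times> cbox 0 1) (\<lambda>p. F (z + axis j (fst p) + axis i (e (snd p))) / e (snd p))"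
    if "holo U F" for F
    by (intro continuous_on_divide continuous_on_compose2[OF holo_continuous[OF that]] continuous_intros conte)
       (use memU e in auto)
  have "((\<lambda>h. integral (cbox 0 1) (\<lambda>\<theta>. G (z + axis j h + axis i (e \<theta>)) / e \<theta>)) has_field_derivative
      integral (cbox 0 1) (\<lambda>\<theta>. cpartial j G (z + axis j 0 + axis i (e \<theta>)) / e \<theta>)) (at 0 within ball 0 r)"
  proof (rule leibniz_rule_field_derivative)
    fix h \<theta> assume h: "h \<in> ball (0::complex) r"
    have swap: "z + axis i (e \<theta>) + axis j h = z + axis j h + axis i (e \<theta>)" for h by simp
    have "z + axis i (e \<theta>) + axis j h \<in> U" unfolding swap by (rule memU[OF h])
    from holo_has_cpartial[OF G this, unfolded swap]
    have "((\<lambda>h. G (z + axis j h + axis i (e \<theta>))) has_field_derivative cpartial j G (z + axis j h + axis i (e \<theta>))) (at h)"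
      .
    then show "((\<lambda>h. G (z + axis j h + axis i (e \<theta>)) / e \<theta>) has_field_derivative
        cpartial j G (z + axis j h + axis i (e \<theta>)) / e \<theta>) (at h within ball 0 r)"
      by (rule has_field_derivative_at_within[OF DERIV_cdivide])
  next
    fix h assume h: "h \<in> ball (0::complex) r"
    have "continuous_on (cbox 0 1) (\<lambda>\<theta>. (\<lambda>p. G (z + axis j (fst p) + axis i (e (snd p))) / e (snd p)) (h, \<theta>))"
      by (rule continuous_on_compose2[OF cont[OF G]]) (use h in \<open>auto intro!: continuous_intros\<close>)
    then show "(\<lambda>\<theta>. G (z + axis j h + axis i (e \<theta>)) / e \<theta>) integrable_on cbox 0 1"
      by (intro integrable_continuous) simp
  next
    show "continuous_on (ball 0 r \<times> cbox 0 1) (\<lambda>(h, \<theta>). cpartial j G (z + axis j h + axis i (e \<theta>)) / e \<theta>)"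
      using cont[OF cj] by (simp add: case_prod_unfold)
  qed (use r in auto)
  then have D: "((\<lambda>h. integral (cbox 0 1) (\<lambda>\<theta>. G (z + axis j h + axis i (e \<theta>)) / e \<theta>)) has_field_derivative
      cpartial i (cpartial j G) z) (at 0)"
    using circ[OF cj, of z] r at_within_open[of 0 "ball (0::complex) r"] by simp
  have "((\<lambda>h. cpartial i G (z + axis j h)) has_field_derivative cpartial i (cpartial j G) z) (at 0)"
    by (rule has_field_derivative_transform_within_open[OF D, of "ball 0 r"]) (use circ[OF G ball] r in auto)
  then show ?thesis unfolding cpartial_def[of j "cpartial i G"] by (rule DERIV_imp_deriv[symmetric])
qed

lemma cext_partial_commute:
  assumes "cext S u" "a \<in> S"
  shows "partial i (partial j u) a = partial j (partial i u) a"
proof -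
  obtain r G where G: "r > 0" "holo (polydisc (cvec a) r) G"
    "\<And>x. cvec x \<in> polydisc (cvec a) r \<Longrightarrow> u x = Re (G (cvec x))"
    using cextE[OF assms] by blast
  have a: "cvec a \<in> polydisc (cvec a) r" using G(1) by simp
  note p1 = partial_Re_holo[OF G(2) open_polydisc _ G(3)]
  have "partial i (partial j u) a = Re (cpartial i (cpartial j G) (cvec a))" for i j
    by (rule partial_Re_holo[OF holo_cpartial[OF G(2) open_polydisc] open_polydisc a p1])
  then show ?thesis using cpartial_commute[OF G(2) open_polydisc a] by simp
qed

definition grad :: "(real^'n \<Rightarrow> real) \<Rightarrow> real^'n \<Rightarrow> real^'n" where
  "grad u x = (\<chi> i. partial i u x)"

lemma grad_nth [simp]: "grad u x $ i = partial i u x" by (simp add: grad_def)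

lemma grad_inner: "grad u x \<bullet> v = (\<Sum>i\<in>UNIV. partial i u x * v $ i)"
  by (simp add: grad_def inner_vec_def)

lemma cext_grad_has_derivative:
  assumes "cext S u" "x \<in> S"
  shows "(u has_derivative (\<lambda>h. grad u x \<bullet> h)) (at x)"
  using cext_has_derivative[OF assms] by (simp add: grad_inner)

lemma continuous_on_grad: "cext S u \<Longrightarrow> continuous_on S (grad u)"
  unfolding grad_def[abs_def] by (intro continuous_on_vec_lambda cext_continuous_on cext_partial)

definition hessian :: "(real^'n \<Rightarrow> real) \<Rightarrow> real^'n \<Rightarrow> real^'n^'n" where
  "hessian u x = (\<chi> i k. partial k (partial i u) x)"

lemma grad_inner_has_derivative:
  assumes "cext S u" "x \<in> S"
  shows "((\<lambda>y. grad u y \<bullet> b) has_derivative (\<lambda>h. (hessian u x *v h) \<bullet> b)) (at x)"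
proof -
  have D: "((\<lambda>y. partial i u y * b $ i) has_derivative (\<lambda>h. (\<Sum>k\<in>UNIV. partial k (partial i u) x * h $ k) * b $ i)) (at x)" for i
    by (rule has_derivative_mult_left[OF cext_has_derivative[OF cext_partial[OF assms(1)] assms(2)]])
  have "((\<lambda>y. \<Sum>i\<in>UNIV. partial i u y * b $ i) has_derivative
      (\<lambda>h. \<Sum>i\<in>UNIV. (\<Sum>k\<in>UNIV. partial k (partial i u) x * h $ k) * b $ i)) (at x)"
    by (rule has_derivative_sum[OF D])
  then show ?thesis by (simp add: grad_inner inner_vec_def hessian_def matrix_vector_mult_def)
qed

lemma hessian_symmetric:
  assumes "cext S u" "x \<in> S"
  shows "(hessian u x *v a) \<bullet> b = (hessian u x *v b) \<bullet> a"
proof -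
  have "(hessian u x *v a) \<bullet> b = (\<Sum>i\<in>UNIV. \<Sum>k\<in>UNIV. partial k (partial i u) x * a $ k * b $ i)"
    by (simp add: hessian_def inner_vec_def matrix_vector_mult_def sum_distrib_right)
  also have "\<dots> = (\<Sum>k\<in>UNIV. \<Sum>i\<in>UNIV. partial k (partial i u) x * a $ k * b $ i)" by (rule sum.swap)
  also have "\<dots> = (\<Sum>k\<in>UNIV. \<Sum>i\<in>UNIV. partial i (partial k u) x * b $ i * a $ k)"
    by (intro sum.cong refl) (simp add: cext_partial_commute[OF assms] mult_ac)
  also have "\<dots> = (hessian u x *v b) \<bullet> a"
    by (simp add: hessian_def inner_vec_def matrix_vector_mult_def sum_distrib_right)
  finally show ?thesis .
qed

text \<open>Orthonormality says \<open>R ** transpose R = mat 1\<close>; the claims are the reversed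
  product \<open>transpose R ** R = mat 1\<close>, read entrywise and applied to a vector.\<close>

lemma orthonormal_rows:
  fixes \<alpha> \<beta> n :: "real^3"
  assumes "\<alpha> \<bullet> \<alpha> = 1" "\<beta> \<bullet> \<beta> = 1" "n \<bullet> n = 1" "\<alpha> \<bullet> \<beta> = 0" "\<alpha> \<bullet> n = 0" "\<beta> \<bullet> n = 0"
  shows "\<alpha> $ i * \<alpha> $ k + \<beta> $ i * \<beta> $ k + n $ i * n $ k = (if i = k then 1 else 0)"
    and "x = (x \<bullet> \<alpha>) *\<^sub>R \<alpha> + (x \<bullet> \<beta>) *\<^sub>R \<beta> + (x \<bullet> n) *\<^sub>R n"
proof -
  define R :: "real^3^3" where "R = (\<chi> r. if r = 1 then \<alpha> else if r = 2 then \<beta> else n)"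
  have Rr: "R $ 1 = \<alpha>" "R $ 2 = \<beta>" "R $ 3 = n" by (simp_all add: R_def)
  have "(R ** transpose R) $ r $ s = R $ r \<bullet> R $ s" for r s
    by (simp add: matrix_matrix_mult_def transpose_def inner_vec_def)
  then have "R ** transpose R = mat 1"
    using assms by (simp add: vec_eq_iff forall_3 Rr mat_def inner_commute)
  then have "transpose R ** R = mat 1" using matrix_left_right_inverse by blast
  then have "(transpose R ** R) $ i $ k = mat 1 $ i $ k" for i k by simp
  then show *: "\<alpha> $ i * \<alpha> $ k + \<beta> $ i * \<beta> $ k + n $ i * n $ k = (if i = k then 1 else 0)" for i k
    by (simp add: matrix_matrix_mult_def transpose_def sum_3 Rr mat_def)
  show "x = (x \<bullet> \<alpha>) *\<^sub>R \<alpha> + (x \<bullet> \<beta>) *\<^sub>R \<beta> + (x \<bullet> n) *\<^sub>R n"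
  proof (simp only: vec_eq_iff, rule allI)
    fix i
    have "x $ i = (\<Sum>k\<in>UNIV. (if i = k then 1 else 0) * x $ k)" by (simp add: if_distrib [of "\<lambda>c. c * _"] cong: if_cong)
    also have "\<dots> = (\<Sum>k\<in>UNIV. (\<alpha> $ i * \<alpha> $ k + \<beta> $ i * \<beta> $ k + n $ i * n $ k) * x $ k)"
      by (simp only: *)
    also have "\<dots> = ((x \<bullet> \<alpha>) *\<^sub>R \<alpha> + (x \<bullet> \<beta>) *\<^sub>R \<beta> + (x \<bullet> n) *\<^sub>R n) $ i"
      by (simp add: inner_vec_def sum_distrib_right sum.distrib algebra_simps sum_distrib_left)
    finally show "x $ i = ((x \<bullet> \<alpha>) *\<^sub>R \<alpha> + (x \<bullet> \<beta>) *\<^sub>R \<beta> + (x \<bullet> n) *\<^sub>R n) $ i" .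
  qed
qed

text \<open>The exponential of \<open>h\<close> is entire and bounded, so Liouville's theorem makes
  it constant, and the derivative of \<open>h\<close> vanishes.\<close>

lemma entire_nonpos_Re_zero:
  assumes hol: "h holomorphic_on UNIV" and le: "\<And>z. Re (h z) \<le> 0" and 0: "h 0 = 0"
  shows "h z = 0"
proof -
  have "bounded (range (\<lambda>z. exp (h z)))" using le by (auto simp: bounded_iff intro!: exI[of _ 1])
  then have "(\<lambda>z. exp (h z)) constant_on UNIV"
    using hol by (intro Liouville_theorem holomorphic_intros)
  then obtain c where c: "\<And>z. exp (h z) = c" by (auto simp: constant_on_def)
  have "(h has_field_derivative 0) (at z)" for z
  proof -
    have d: "(h has_field_derivative deriv h z) (at z)"
      using hol by (meson UNIV_I holomorphic_derivI open_UNIV)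
    then have "((\<lambda>z. exp (h z)) has_field_derivative exp (h z) * deriv h z) (at z)"
      by (auto intro!: derivative_eq_intros)
    moreover have "((\<lambda>z. exp (h z)) has_field_derivative 0) (at z)" by (simp add: c)
    ultimately have "exp (h z) * deriv h z = 0" by (rule DERIV_unique)
    with d show ?thesis by simp
  qed
  then have "\<exists>c. \<forall>z\<in>UNIV. h z = c"
    by (intro has_field_derivative_zero_constant) auto
  then have "h z = h 0" by auto
  with 0 show ?thesis by simp
qed

text \<open>A harmonic function invariant in the direction \<open>n\<close> is planar, so two orthogonal components of its gradient
  form an entire function; a one-sided bound on one of them forces it to be constant.\<close>

lemma planar_harmonic_rigidity:
  fixes q :: "real^3 \<Rightarrow> real"
  assumes q: "cext UNIV q" and harm: "\<And>x. laplacian q x = 0"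
    and n: "n \<noteq> 0" "\<And>x. grad q x \<bullet> n = 0"
    and \<xi>: "\<And>s. \<xi> \<noteq> s *\<^sub>R n" "\<And>x. grad q x \<bullet> \<xi> \<le> 0"
    and grad0: "grad q 0 = 0" and euler: "\<And>x. grad q x \<bullet> x = k * q x" and k: "k \<noteq> 0"
  shows "q x = 0"
proof -
  define \<nu> where "\<nu> = (1 / norm n) *\<^sub>R n"
  have \<nu>: "\<nu> \<bullet> \<nu> = 1" using n(1) by (simp add: \<nu>_def dot_square_norm power2_eq_square)
  have g\<nu>: "grad q x \<bullet> \<nu> = 0" for x using n(2) by (simp add: \<nu>_def)
  \<comment> \<open>The part of \<xi> orthogonal to \<open>n\<close>. The sign condition carries
    over to it, because the gradient has no component along \<open>n\<close>.\<close>
  define \<alpha>' where "\<alpha>' = \<xi> - (\<xi> \<bullet> \<nu>) *\<^sub>R \<nu>"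
  have "\<alpha>' \<noteq> 0"
  proof
    assume "\<alpha>' = 0"
    then have "\<xi> = ((\<xi> \<bullet> \<nu>) / norm n) *\<^sub>R n" by (simp add: \<alpha>'_def \<nu>_def)
    with \<xi>(1) show False by blast
  qed
  define \<alpha> where "\<alpha> = (1 / norm \<alpha>') *\<^sub>R \<alpha>'"
  have \<alpha>: "\<alpha> \<bullet> \<alpha> = 1" using \<open>\<alpha>' \<noteq> 0\<close> by (simp add: \<alpha>_def dot_square_norm power2_eq_square)
  have \<alpha>\<nu>: "\<alpha> \<bullet> \<nu> = 0" by (simp add: \<alpha>_def \<alpha>'_def inner_diff_left \<nu>)
  have g\<alpha>: "grad q x \<bullet> \<alpha> \<le> 0" for x
  proof -
    have "grad q x \<bullet> \<alpha>' \<le> 0" using \<xi>(2)[of x] by (simp add: \<alpha>'_def inner_diff_right g\<nu>)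
    then show ?thesis by (simp add: \<alpha>_def divide_nonpos_nonneg)
  qed
  define \<beta> where "\<beta> = cross3 \<nu> \<alpha>"
  have \<beta>\<nu>: "\<beta> \<bullet> \<nu> = 0" and \<alpha>\<beta>: "\<alpha> \<bullet> \<beta> = 0"
    by (simp_all add: \<beta>_def dot_cross_self)
  have \<beta>: "\<beta> \<bullet> \<beta> = 1"
  proof -
    have "(norm \<beta>)\<^sup>2 = (norm \<nu>)\<^sup>2 * (norm \<alpha>)\<^sup>2 - (\<nu> \<bullet> \<alpha>)\<^sup>2" unfolding \<beta>_def by (rule norm_cross)
    then show ?thesis using \<alpha> \<nu> \<alpha>\<nu> by (simp add: power2_norm_eq_inner inner_commute)
  qed
  note ortho = orthonormal_rows[OF \<alpha> \<beta> \<nu> \<alpha>\<beta> \<alpha>\<nu> \<beta>\<nu>]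
  define H where "H = hessian q"
  have H\<nu>: "(H x *v v) \<bullet> \<nu> = 0" for x v
  proof -
    have "((\<lambda>y. grad q y \<bullet> \<nu>) has_derivative (\<lambda>h. (H x *v h) \<bullet> \<nu>)) (at x)"
      unfolding H_def by (rule grad_inner_has_derivative[OF q]) simp
    moreover have "((\<lambda>y. grad q y \<bullet> \<nu>) has_derivative (\<lambda>h. 0)) (at x)" by (simp add: g\<nu>)
    ultimately have "(\<lambda>h. (H x *v h) \<bullet> \<nu>) = (\<lambda>h. 0)" by (rule has_derivative_unique)
    then show ?thesis by (rule fun_cong)
  qed
  have trace: "(H x *v \<alpha>) \<bullet> \<alpha> + (H x *v \<beta>) \<bullet> \<beta> = 0" for x
  proof -
    have "(H x *v \<alpha>) \<bullet> \<alpha> + (H x *v \<beta>) \<bullet> \<beta> = (H x *v \<alpha>) \<bullet> \<alpha> + (H x *v \<beta>) \<bullet> \<beta> + (H x *v \<nu>) \<bullet> \<nu>"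
      by (simp add: H\<nu>)
    also have "\<dots> = (\<Sum>i\<in>UNIV. \<Sum>k\<in>UNIV. H x $ i $ k * (\<alpha> $ i * \<alpha> $ k + \<beta> $ i * \<beta> $ k + \<nu> $ i * \<nu> $ k))"
      by (simp add: inner_vec_def matrix_vector_mult_def sum_3 algebra_simps)
    also have "\<dots> = (\<Sum>i\<in>UNIV. H x $ i $ i)"
      unfolding ortho(1) by (simp add: if_distrib [of "\<lambda>c. _ * c"] cong: if_cong)
    also have "\<dots> = laplacian q x" by (simp add: laplacian_def H_def hessian_def)
    finally show ?thesis using harm by simp
  qed
  have sym: "(H x *v a) \<bullet> b = (H x *v b) \<bullet> a" for x a b
    unfolding H_def by (rule hessian_symmetric[OF q]) simp
  define p where "p z = Re z *\<^sub>R \<alpha> + Im z *\<^sub>R \<beta>" for z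
  \<comment> \<open>In coordinates along \<alpha> and \<beta> this is the x-derivative of
    \<open>q\<close> minus \<i> times its y-derivative. Its Cauchy-Riemann equations are the
    symmetry of the Hessian and the vanishing of its trace on the plane, the latter thanks to the
    invariance along \<nu>.\<close>
  define h where "h z = of_real (grad q (p z) \<bullet> \<alpha>) - \<i> * of_real (grad q (p z) \<bullet> \<beta>)" for z
  have dp: "(p has_derivative p) (at z)" for z
    unfolding p_def by (auto intro!: derivative_eq_intros)
  have "(h has_field_derivative (of_real ((H (p z) *v \<alpha>) \<bullet> \<alpha>) - \<i> * of_real ((H (p z) *v \<beta>) \<bullet> \<alpha>))) (at z)" for z
  proof -
    define x where "x = p z"
    have d: "((\<lambda>z. grad q (p z) \<bullet> b) has_derivative (\<lambda>\<zeta>. (H x *v p \<zeta>) \<bullet> b)) (at z)" for b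
      unfolding x_def H_def using grad_inner_has_derivative[OF q, of "p z" b] by (intro has_derivative_compose[OF dp]) auto
    have "(h has_derivative (\<lambda>\<zeta>. of_real ((H x *v p \<zeta>) \<bullet> \<alpha>) - \<i> * of_real ((H x *v p \<zeta>) \<bullet> \<beta>))) (at z)"
      unfolding h_def by (intro has_derivative_diff has_derivative_mult_right has_derivative_of_real d)
    moreover have "(\<lambda>\<zeta>. complex_of_real ((H x *v p \<zeta>) \<bullet> \<alpha>) - \<i> * of_real ((H x *v p \<zeta>) \<bullet> \<beta>))
        = (*) (of_real ((H x *v \<alpha>) \<bullet> \<alpha>) - \<i> * of_real ((H x *v \<beta>) \<bullet> \<alpha>))"
    proof
      fix \<zeta>
      have Hp: "H x *v p \<zeta> = Re \<zeta> *\<^sub>R (H x *v \<alpha>) + Im \<zeta> *\<^sub>R (H x *v \<beta>)"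
        by (simp add: p_def matrix_vector_right_distrib matrix_vector_mult_scaleR)
      have bb: "(H x *v \<beta>) \<bullet> \<beta> = - ((H x *v \<alpha>) \<bullet> \<alpha>)" using trace[of x] by simp
      have ab: "(H x *v \<alpha>) \<bullet> \<beta> = (H x *v \<beta>) \<bullet> \<alpha>" by (rule sym)
      show "complex_of_real ((H x *v p \<zeta>) \<bullet> \<alpha>) - \<i> * of_real ((H x *v p \<zeta>) \<bullet> \<beta>)
        = (of_real ((H x *v \<alpha>) \<bullet> \<alpha>) - \<i> * of_real ((H x *v \<beta>) \<bullet> \<alpha>)) * \<zeta>"
        unfolding Hp by (simp add: inner_add_left bb ab complex_eq_iff algebra_simps)
    qed
    ultimately show ?thesis unfolding has_field_derivative_def x_def by simp
  qed
  then have "h holomorphic_on UNIV" by (auto simp: holomorphic_on_def field_differentiable_def)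
  then have h0: "h z = 0" for z
    by (rule entire_nonpos_Re_zero) (use g\<alpha> grad0 in \<open>auto simp: h_def p_def\<close>)
  have gp: "grad q (p z) = 0" for z
  proof -
    have "Re (h z) = 0" "Im (h z) = 0" using h0[of z] by simp_all
    then have "grad q (p z) \<bullet> \<alpha> = 0" "grad q (p z) \<bullet> \<beta> = 0" by (simp_all add: h_def)
    then show ?thesis using ortho(2)[of "grad q (p z)"] g\<nu> by simp
  qed
  define z where "z = Complex (x \<bullet> \<alpha>) (x \<bullet> \<beta>)"
  have xz: "x = p z + (x \<bullet> \<nu>) *\<^sub>R \<nu>" using ortho(2)[of x] by (simp add: p_def z_def)
  have "((\<lambda>t. q (p z + t *\<^sub>R \<nu>)) has_real_derivative 0) (at t)" for t
  proof -
    have "((\<lambda>t. p z + t *\<^sub>R \<nu>) has_derivative (\<lambda>s. s *\<^sub>R \<nu>)) (at t)" by (auto intro!: derivative_eq_intros)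
    from has_derivative_compose[OF this cext_grad_has_derivative[OF q UNIV_I]]
    show ?thesis by (simp add: g\<nu> has_field_derivative_def lambda_zero[symmetric])
  qed
  then have "q (p z + (x \<bullet> \<nu>) *\<^sub>R \<nu>) = q (p z + 0 *\<^sub>R \<nu>)"
    using DERIV_isconst_all[of "\<lambda>t. q (p z + t *\<^sub>R \<nu>)"] by blast
  moreover have "q (p z) = 0" using euler[of "p z"] gp k by simp
  ultimately show ?thesis using xz by simp
qed

section \<open>Homogeneous functions and distortion under blow-up\<close>

lemma det_scaleR:
  fixes A :: "real^'n^'n"
  shows "det (c *\<^sub>R A) = c ^ CARD('n) * det A"
proof -
  have "c *\<^sub>R A = matrix ((*\<^sub>R) c) ** A"
    by (simp add: matrix_scaleR mat_def matrix_matrix_mult_def vec_eq_iff if_distrib [of "\<lambda>x. x * _"] cong: if_cong)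
  then show ?thesis by (simp add: det_mul)
qed

lemma qr_matrix_det_0:
  fixes A :: "real^'n^'n"
  assumes "qr_matrix K A" "det A = 0"
  shows "A = 0"
proof -
  have "norm (A *v v) ^ CARD('n) \<le> 0" for v using assms by (auto simp: qr_matrix_def)
  then have "A *v v = 0" for v by (metis norm_eq_zero norm_ge_zero power_eq_0_iff antisym zero_le_power)
  then show ?thesis by (metis matrix_eq matrix_vector_mult_0)
qed

text \<open>Both sides of the distortion inequality scale by \<open>c ^ CARD('n)\<close>; this is
  why blow-ups keep the constant \<open>K\<close>.\<close>

lemma qr_matrix_scaleR:
  fixes A :: "real^'n^'n"
  assumes "qr_matrix K A" "c \<ge> 0"
  shows "qr_matrix K (c *\<^sub>R A)"
proof -
  have "norm ((c *\<^sub>R A) *v v) ^ CARD('n) = c ^ CARD('n) * norm (A *v v) ^ CARD('n)" for v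
    using assms(2) by (simp add: scaleR_matrix_vector_assoc[symmetric] power_mult_distrib)
  moreover have "c ^ CARD('n) * norm (A *v v) ^ CARD('n) \<le> c ^ CARD('n) * (K * det A * norm v ^ CARD('n))" for v
    using assms by (intro mult_left_mono) (auto simp: qr_matrix_def)
  ultimately show ?thesis using assms by (simp add: qr_matrix_def det_scaleR mult_ac)
qed

lemma tendsto_det:
  fixes A :: "'a \<Rightarrow> real^'n^'n"
  assumes "(A \<longlongrightarrow> B) F"
  shows "((\<lambda>t. det (A t)) \<longlongrightarrow> det B) F"
  unfolding det_def by (intro tendsto_intros assms)

lemma tendsto_matrix_vector_mult:
  fixes A :: "'a \<Rightarrow> real^'n^'m"
  assumes "(A \<longlongrightarrow> B) F" "(v \<longlongrightarrow> w) F"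
  shows "((\<lambda>t. A t *v v t) \<longlongrightarrow> B *v w) F"
  unfolding matrix_vector_mult_def by (intro tendsto_vec_lambda tendsto_intros assms)

lemma qr_matrix_limit:
  fixes A :: "'a \<Rightarrow> real^'n^'n"
  assumes "(A \<longlongrightarrow> B) F" "F \<noteq> bot" "eventually (\<lambda>t. qr_matrix K (A t)) F"
  shows "qr_matrix K B"
  unfolding qr_matrix_def
proof (intro conjI allI)
  show "det B \<ge> 0"
    by (rule tendsto_lowerbound[OF tendsto_det[OF assms(1)] _ assms(2)])
       (use assms(3) in \<open>auto simp: qr_matrix_def elim: eventually_mono\<close>)
  fix v
  have l: "((\<lambda>t. norm (A t *v v) ^ CARD('n)) \<longlongrightarrow> norm (B *v v) ^ CARD('n)) F"
    by (intro tendsto_intros tendsto_matrix_vector_mult assms(1))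
  have r: "((\<lambda>t. K * det (A t) * norm v ^ CARD('n)) \<longlongrightarrow> K * det B * norm v ^ CARD('n)) F"
    by (intro tendsto_intros tendsto_det assms(1))
  show "norm (B *v v) ^ CARD('n) \<le> K * det B * norm v ^ CARD('n)"
    by (rule tendsto_le[OF assms(2) r l])
       (use assms(3) in \<open>auto simp: qr_matrix_def elim: eventually_mono\<close>)
qed

lemma jac_nth [simp]: "jac f x $ j $ i = partial i (\<lambda>y. f y $ j) x" by (simp add: jac_def)

lemma jac_row: "jac f x $ j = grad (\<lambda>y. f y $ j) x" by (simp add: vec_eq_iff)

lemma continuous_on_jac:
  assumes "\<And>j. cext S (\<lambda>x. f x $ j)"
  shows "continuous_on S (jac f)"
  unfolding jac_def[abs_def] by (intro continuous_on_vec_lambda cext_continuous_on cext_partial assms)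

lemma tendsto_laplacian_blow_up:
  assumes "\<And>i. ((\<lambda>t. t\<^sup>2 * partial i (partial i u) (a + t *\<^sub>R x) / t ^ m) \<longlongrightarrow> partial i (partial i q) x) (at_right 0)"
    and "e > 0" "\<And>y. y \<in> ball a e \<Longrightarrow> laplacian u y = 0"
  shows "laplacian q x = 0"
proof -
  have "((\<lambda>t. \<Sum>i\<in>UNIV. t\<^sup>2 * partial i (partial i u) (a + t *\<^sub>R x) / t ^ m) \<longlongrightarrow> laplacian q x) (at_right 0)"
    unfolding laplacian_def by (rule tendsto_sum[OF assms(1)])
  moreover have "((\<lambda>t. \<Sum>i\<in>UNIV. t\<^sup>2 * partial i (partial i u) (a + t *\<^sub>R x) / t ^ m) \<longlongrightarrow> 0) (at_right 0)"
  proof (rule tendsto_eventually)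
    show "eventually (\<lambda>t. (\<Sum>i\<in>UNIV. t\<^sup>2 * partial i (partial i u) (a + t *\<^sub>R x) / t ^ m) = 0) (at_right 0)"
      unfolding eventually_at_right_field
    proof (intro exI[of _ "e / (norm x + 1)"] conjI allI impI)
      show "0 < e / (norm x + 1)" using assms(2) by (simp add: add_nonneg_pos)
      fix t :: real assume t: "0 < t" "t < e / (norm x + 1)"
      have "norm (t *\<^sub>R x) \<le> t * (norm x + 1)" using t by (simp add: algebra_simps)
      also have "\<dots> < e" using t(2) by (simp add: pos_less_divide_eq add_nonneg_pos)
      finally have "laplacian u (a + t *\<^sub>R x) = 0" by (intro assms(3)) (simp add: dist_norm)
      then show "(\<Sum>i\<in>UNIV. t\<^sup>2 * partial i (partial i u) (a + t *\<^sub>R x) / t ^ m) = 0"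
        by (simp add: laplacian_def flip: sum_divide_distrib sum_distrib_left)
    qed
  qed
  ultimately show ?thesis by (rule tendsto_unique[OF trivial_limit_at_right_real])
qed

lemma tendsto_grad_blow_up:
  assumes "\<And>i. ((\<lambda>t. t * partial i u (a + t *\<^sub>R x) / t ^ m) \<longlongrightarrow> partial i q x) (at_right 0)"
  shows "((\<lambda>t. (t / t ^ m) *\<^sub>R grad u (a + t *\<^sub>R x)) \<longlongrightarrow> grad q x) (at_right 0)"
proof -
  have "(\<lambda>t. (t / t ^ m) *\<^sub>R grad u (a + t *\<^sub>R x)) = (\<lambda>t. \<chi> i. t * partial i u (a + t *\<^sub>R x) / t ^ m)"
    by (simp add: fun_eq_iff vec_eq_iff)
  then show ?thesis unfolding grad_def[of q] using assms by (simp add: tendsto_vec_lambda)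
qed

section \<open>Homogeneous functions and Euler's identity\<close>

definition homogeneous :: "nat \<Rightarrow> (real^'n \<Rightarrow> real) \<Rightarrow> bool" where
  "homogeneous m u \<longleftrightarrow> (\<forall>t x. u (t *\<^sub>R x) = t ^ m * u x)"

lemma homogeneousD: "homogeneous m u \<Longrightarrow> u (t *\<^sub>R x) = t ^ m * u x"
  by (simp add: homogeneous_def)

lemma homogeneous_zero: "homogeneous m u \<Longrightarrow> m \<ge> 1 \<Longrightarrow> u 0 = 0"
  using homogeneousD[of m u 0 0] by (simp add: power_0_left split: if_splits)

lemma grad_homogeneous:
  assumes "cext UNIV u" "homogeneous m u"
  shows "t *\<^sub>R grad u (t *\<^sub>R x) = t ^ m *\<^sub>R grad u x"
  using partial_homogeneous[OF assms(1) homogeneousD[OF assms(2)]] by (simp add: vec_eq_iff)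

lemma euler_homogeneous:
  assumes "cext UNIV u" "homogeneous m u"
  shows "grad u x \<bullet> x = real m * u x"
proof -
  have "((\<lambda>t. t *\<^sub>R x) has_derivative (\<lambda>s. s *\<^sub>R x)) (at 1)" by (auto intro!: derivative_eq_intros)
  from has_derivative_compose[OF this cext_grad_has_derivative[OF assms(1) UNIV_I]]
  have "((\<lambda>t. u (t *\<^sub>R x)) has_derivative (\<lambda>s. s * (grad u x \<bullet> x))) (at 1)" by simp
  then have "((\<lambda>t. u (t *\<^sub>R x)) has_real_derivative grad u x \<bullet> x) (at 1)"
    by (simp add: has_field_derivative_def mult_commute_abs)
  moreover have "((\<lambda>t. t ^ m * u x) has_real_derivative real m * 1 ^ (m - 1) * u x) (at 1)"
    by (auto intro!: derivative_eq_intros)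
  ultimately show ?thesis
    unfolding homogeneousD[OF assms(2)] using DERIV_unique by fastforce
qed

text \<open>Euler's identity at \<open>a + t *\<^sub>R x\<close> expresses the derivative in the
  direction \<open>a\<close> through the value of \<open>u\<close> and the derivative in the
  direction \<open>x\<close>. After scaling, both of these carry an extra factor \<open>t\<close>
  and disappear in the limit.\<close>

lemma blow_up_invariant:
  assumes u: "cext UNIV u" "homogeneous k u" and a: "u a = 0"
    and lim0: "((\<lambda>t. (u (a + t *\<^sub>R x) - u a) / t ^ m) \<longlongrightarrow> q x) (at_right 0)"
    and lim1: "((\<lambda>t. (t / t ^ m) *\<^sub>R grad u (a + t *\<^sub>R x)) \<longlongrightarrow> grad q x) (at_right 0)"
  shows "grad q x \<bullet> a = 0"
proof -
  have "((\<lambda>t. ((t / t ^ m) *\<^sub>R grad u (a + t *\<^sub>R x)) \<bullet> a) \<longlongrightarrow> grad q x \<bullet> a) (at_right 0)"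
    by (intro tendsto_intros lim1)
  moreover have "((t / t ^ m) *\<^sub>R grad u (a + t *\<^sub>R x)) \<bullet> a
      = t * real k * ((u (a + t *\<^sub>R x) - u a) / t ^ m) - t * (((t / t ^ m) *\<^sub>R grad u (a + t *\<^sub>R x)) \<bullet> x)" for t
  proof -
    define g where "g = grad u (a + t *\<^sub>R x)"
    have "g \<bullet> (a + t *\<^sub>R x) = real k * u (a + t *\<^sub>R x)" unfolding g_def by (rule euler_homogeneous[OF u])
    then have "g \<bullet> a = real k * u (a + t *\<^sub>R x) - t * (g \<bullet> x)" by (simp add: inner_add_right)
    then show ?thesis by (simp add: a flip: g_def) (simp add: algebra_simps diff_divide_distrib)
  qed
  moreover have "((\<lambda>t. t * real k * ((u (a + t *\<^sub>R x) - u a) / t ^ m) - t * (((t / t ^ m) *\<^sub>R grad u (a + t *\<^sub>R x)) \<bullet> x))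
      \<longlongrightarrow> 0 * real k * q x - 0 * (grad q x \<bullet> x)) (at_right 0)"
    by (intro tendsto_intros lim0 lim1)
  ultimately show ?thesis
    using tendsto_unique[OF trivial_limit_at_right_real] by fastforce
qed

lemma homogeneous_not_locally_constant:
  assumes u: "cext UNIV u" "homogeneous m u" "m \<ge> 1" and x: "u x \<noteq> 0" and e: "e > 0"
  shows "\<exists>y\<in>ball a e. u y \<noteq> u a"
proof (rule ccontr)
  assume "\<not> ?thesis"
  then have "\<And>y. y \<in> ball a e \<Longrightarrow> u y = u a" by blast
  then have c: "u y = u a" for y
    using cext_unique_continuation[OF u(1) open_UNIV connected_UNIV UNIV_I e] by blast
  have "u x = u 0" using c[of x] c[of 0] by simp
  with x homogeneous_zero[OF u(2,3)] show False by simp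
qed

text \<open>Cramer's rule serves as the definition: the entries are quotients of determinants, which
  makes continuity in the matrix and in the right-hand side evident.\<close>

definition linear_solve :: "real^'n^'n \<Rightarrow> real^'n \<Rightarrow> real^'n" where
  "linear_solve A b = (\<chi> k. det (\<chi> i j. if j = k then b $ i else A $ i $ j) / det A)"

lemma linear_solve:
  assumes "det A \<noteq> 0"
  shows "A *v linear_solve A b = b" "A *v x = b \<Longrightarrow> x = linear_solve A b"
proof -
  have eq: "x = linear_solve A b" if "A *v x = b" for x b
  proof -
    have "det (\<chi> i j. if j = k then b $ i else A $ i $ j) = x $ k * det A" for k
      using cramer_lemma[of k A x] unfolding that .
    then show ?thesis using assms by (simp add: linear_solve_def vec_eq_iff)
  qed
  then show "A *v x = b \<Longrightarrow> x = linear_solve A b" .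
  obtain B where "A ** B = mat 1" using assms by (auto simp: invertible_det_nz[symmetric] invertible_def)
  then have "A *v (B *v b) = b" by (simp add: matrix_vector_mul_assoc)
  with eq[of "B *v b" b] show "A *v linear_solve A b = b" by simp
qed

lemma tendsto_linear_solve:
  assumes A: "(A \<longlongrightarrow> B) F" and b: "(b \<longlongrightarrow> c) F" and "det B \<noteq> 0"
  shows "((\<lambda>t. linear_solve (A t) (b t)) \<longlongrightarrow> linear_solve B c) F"
proof -
  have M: "((\<lambda>t. \<chi> i j. if j = k then b t $ i else A t $ i $ j) \<longlongrightarrow> (\<chi> i j. if j = k then c $ i else B $ i $ j)) F" for k
    by (intro tendsto_vec_lambda)
      (auto intro: tendsto_vec_nth[OF b] tendsto_vec_nth[OF tendsto_vec_nth[OF A]])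
  then show ?thesis
    unfolding linear_solve_def by (intro tendsto_vec_lambda[OF tendsto_divide] tendsto_det[OF M] tendsto_det[OF A] assms(3))
qed

lemma tendsto_transpose:
  fixes A :: "'a \<Rightarrow> real^'n^'m"
  assumes "(A \<longlongrightarrow> B) F"
  shows "((\<lambda>t. transpose (A t)) \<longlongrightarrow> transpose B) F"
  unfolding transpose_def by (intro tendsto_vec_lambda tendsto_vec_nth assms)

lemma inner_matrix_transpose:
  fixes A :: "real^'n^'m"
  shows "(A *v x) \<bullet> y = x \<bullet> (transpose A *v y)"
  by (metis dot_lmul_matrix inner_commute transpose_matrix_vector)

text \<open>With \<open>c\<close> the minimum of \<open>norm (P x)\<close> on the unit sphere,
  homogeneity gives norm (P x) \<ge> c * norm x beyond the unit ball, so preimages of bounded sets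
  are bounded. The preimage of \<open>K\<close> is closed and misses the origin because
  \<open>P 0 = 0\<close>.\<close>

lemma proper_homogeneous:
  fixes P :: "real^'n \<Rightarrow> real^'n"
  assumes cont: "continuous_on UNIV P" and hom: "\<And>t x. P (t *\<^sub>R x) = t ^ m *\<^sub>R P x" and m: "m \<ge> 1"
    and nz: "\<And>x. x \<noteq> 0 \<Longrightarrow> P x \<noteq> 0" and K: "compact K" "K \<subseteq> - {0}"
  shows "compact (- {0} \<inter> P -` K)"
proof -
  have P0: "P 0 = 0" using hom[of 0 0] m by (simp add: power_0_left split: if_splits)
  then have "0 \<notin> P -` K" using K(2) by auto
  then have eq: "- {0} \<inter> P -` K = P -` K" by blast
  have "closed (P -` K)" using cont K(1) by (metis closed_vimage compact_imp_closed)
  moreover have "bounded (P -` K)"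
  proof -
    have "sphere (0 :: real^'n) 1 \<noteq> {}" by simp
    then obtain y where y: "y \<in> sphere 0 1" "\<And>x. x \<in> sphere 0 1 \<Longrightarrow> norm (P y) \<le> norm (P x)"
      using continuous_attains_inf[of "sphere 0 1" "\<lambda>x. norm (P x)"] continuous_on_norm[OF continuous_on_subset[OF cont]]
      by (metis compact_sphere top_greatest)
    define c where "c = norm (P y)"
    have "y \<noteq> 0" using y(1) by auto
    then have c: "c > 0" using nz[of y] by (simp add: c_def)
    obtain R where R: "\<And>z. z \<in> K \<Longrightarrow> norm z \<le> R" using compact_imp_bounded[OF K(1)] by (auto simp: bounded_iff)
    have "norm x \<le> max 1 (R / c)" if "x \<in> P -` K" for x
    proof (cases "norm x \<le> 1")
      case False
      define w where "w = (1 / norm x) *\<^sub>R x"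
      have w: "norm w = 1" "x = norm x *\<^sub>R w" using False by (auto simp: w_def)
      have "norm x * c \<le> norm x ^ m * c"
        using False m c by (intro mult_right_mono) (auto intro: self_le_power)
      also have "\<dots> \<le> norm x ^ m * norm (P w)"
        using y(2)[of w] w(1) by (intro mult_left_mono) (auto simp: c_def)
      also have "\<dots> = norm (P x)" using hom[of "norm x" w] w(2) by simp
      also have "\<dots> \<le> R" using R that by auto
      finally show ?thesis using c by (simp add: pos_le_divide_eq le_max_iff_disj)
    qed simp
    then show ?thesis by (auto simp: bounded_iff)
  qed
  ultimately show ?thesis unfolding eq by (simp add: compact_eq_bounded_closed)
qed

text \<open>Chosen because its gradient vanishes on the third axis, which forces the constant \<open>Y\<close> below to be zero.\<close>

definition zpow :: "nat \<Rightarrow> complex^3 \<Rightarrow> complex" where "zpow m z = (z $ 1 + \<i> * z $ 2) ^ m"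

text \<open>The coordinate derivatives of z1 + \<i> * z2. Their squares add up to 0, which makes
  every power of this linear form harmonic.\<close>

definition zdir :: "3 \<Rightarrow> complex" where "zdir i = (if i = 1 then 1 else if i = 2 then \<i> else 0)"

lemma holo_zpow: "holo U (\<lambda>z. c * zpow m z)"
  unfolding zpow_def by (intro holo_mult holo_power holo_add holo_const holo_coord)

lemma cpartial_zpow: "cpartial i (\<lambda>z. c * zpow m z) z = c * of_nat m * zdir i * zpow (m - 1) z"
proof -
  have "zpow m (z + axis i h) = ((z $ 1 + \<i> * z $ 2) + zdir i * h) ^ m" for h
    by (auto simp: zpow_def zdir_def axis_def algebra_simps)
  moreover have "((\<lambda>h. c * ((z $ 1 + \<i> * z $ 2) + zdir i * h) ^ m) has_field_derivative
      c * (of_nat m * zdir i * zpow (m - 1) z)) (at 0)"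
    by (auto intro!: derivative_eq_intros simp: zpow_def)
  ultimately show ?thesis unfolding cpartial_def by (simp add: DERIV_imp_deriv mult.assoc)
qed

definition test_harmonic :: "nat \<Rightarrow> real^3 \<Rightarrow> real" where
  "test_harmonic m x = Re (zpow m (cvec x))"

lemma test_harmonic:
  shows "cext UNIV (test_harmonic m)" "homogeneous m (test_harmonic m)" "laplacian (test_harmonic m) x = 0"
    "m \<ge> 2 \<Longrightarrow> grad (test_harmonic m) (axis 3 1) = 0" "test_harmonic m (axis 1 1) = 1"
proof -
  have h: "holo UNIV (\<lambda>z. c * zpow m z)" for c m by (rule holo_zpow)
  show "cext UNIV (test_harmonic m)"
    unfolding test_harmonic_def[abs_def] using h[of 1 m] by (intro holo_cext_UNIV) simp
  have p1: "partial i (test_harmonic m) x = Re (of_nat m * zdir i * zpow (m - 1) (cvec x))" for i x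
    using partial_Re_holo[OF h[of 1 m] open_UNIV UNIV_I, where x = x and i = i and u = "test_harmonic m"]
    unfolding cpartial_zpow by (simp add: test_harmonic_def)
  have p2: "partial k (partial i (test_harmonic m)) x
      = Re ((of_nat m * zdir i) * of_nat (m - 1) * zdir k * zpow (m - 1 - 1) (cvec x))" for i k x
    using partial_Re_holo[OF h[of "of_nat m * zdir i" "m - 1"] open_UNIV UNIV_I, where x = x and i = k and u = "partial i (test_harmonic m)"]
    unfolding cpartial_zpow by (simp add: p1)
  show "laplacian (test_harmonic m) x = 0"
    unfolding laplacian_def p2 sum_3 by (simp add: zdir_def)
  show "homogeneous m (test_harmonic m)"
    unfolding homogeneous_def
  proof (intro allI)
    fix t and x :: "real^3"
    have "zpow m (cvec (t *\<^sub>R x)) = of_real (t ^ m) * zpow m (cvec x)"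
      by (simp add: zpow_def power_mult_distrib[symmetric] algebra_simps)
    then show "test_harmonic m (t *\<^sub>R x) = t ^ m * test_harmonic m x"
      by (simp add: test_harmonic_def del: of_real_power)
  qed
  \<comment> \<open>On the third axis the base z1 + \<i> * z2 is 0, and for \<open>m \<ge> 2\<close>
    its exponent m - 1 in the gradient is positive; for \<open>m = 1\<close> the value 0^0 = 1 would
    remain.\<close>
  show "grad (test_harmonic m) (axis 3 1) = 0" if "m \<ge> 2"
    using that by (simp add: vec_eq_iff p1 zpow_def axis_def power_0_left)
  show "test_harmonic m (axis 1 1) = 1"
    by (simp add: test_harmonic_def zpow_def axis_def)
qed

section \<open>Homogeneous harmonic quasiregular maps\<close>

lemma jac_mult_nth: "(jac f x *v v) $ j = grad (\<lambda>y. f y $ j) x \<bullet> v"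
  by (simp add: matrix_vector_mul_component jac_row)

lemma transpose_jac_mult: "transpose (jac f x) *v v = (\<Sum>j\<in>UNIV. v $ j *\<^sub>R grad (\<lambda>y. f y $ j) x)"
  by (simp add: vec_eq_iff matrix_vector_mult_def transpose_def mult.commute)

lemma det_eq_0_if_kernel:
  fixes A :: "real^'n^'n"
  assumes "A *v v = 0" "v \<noteq> 0"
  shows "det A = 0"
proof (rule ccontr)
  assume d: "det A \<noteq> 0"
  have "v = linear_solve A 0" by (rule linear_solve(2)[OF d assms(1)])
  moreover have "0 = linear_solve A 0" by (rule linear_solve(2)[OF d]) simp
  ultimately show False using assms(2) by simp
qed

lemma tendsto_jac_blow_up:
  assumes "\<And>j. ((\<lambda>t. (t / t ^ m) *\<^sub>R grad (\<lambda>y. f y $ j) (a + t *\<^sub>R x)) \<longlongrightarrow> grad (\<lambda>y. g y $ j) x) (at_right 0)"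
  shows "((\<lambda>t. (t / t ^ m) *\<^sub>R jac f (a + t *\<^sub>R x)) \<longlongrightarrow> jac g x) (at_right 0)"
proof -
  have "((\<lambda>t. \<chi> j. (t / t ^ m) *\<^sub>R grad (\<lambda>y. f y $ j) (a + t *\<^sub>R x)) \<longlongrightarrow> (\<chi> j. grad (\<lambda>y. g y $ j) x)) (at_right 0)"
    by (intro tendsto_vec_lambda assms)
  moreover have "(\<lambda>t. \<chi> j. (t / t ^ m) *\<^sub>R grad (\<lambda>y. f y $ j) (a + t *\<^sub>R x)) = (\<lambda>t. (t / t ^ m) *\<^sub>R jac f (a + t *\<^sub>R x))"
    by (simp add: fun_eq_iff vec_eq_iff)
  moreover have "(\<chi> j. grad (\<lambda>y. g y $ j) x) = jac g x" by (simp add: vec_eq_iff)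
  ultimately show ?thesis by simp
qed

lemma qr_matrix_blow_up:
  fixes f g :: "real^'n \<Rightarrow> real^'n"
  assumes "\<And>j. ((\<lambda>t. (t / t ^ m) *\<^sub>R grad (\<lambda>y. f y $ j) (a + t *\<^sub>R x)) \<longlongrightarrow> grad (\<lambda>y. g y $ j) x) (at_right 0)"
    and e: "e > 0" "\<And>y. y \<in> ball a e \<Longrightarrow> qr_matrix K (jac f y)"
  shows "qr_matrix K (jac g x)"
proof (rule qr_matrix_limit[OF tendsto_jac_blow_up[OF assms(1)] trivial_limit_at_right_real])
  have "((\<lambda>t. a + t *\<^sub>R x) \<longlongrightarrow> a + 0 *\<^sub>R x) (at_right 0)" by (intro tendsto_intros)
  then have "eventually (\<lambda>t. a + t *\<^sub>R x \<in> ball a e) (at_right 0)"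
    using e(1) by (intro topological_tendstoD[of _ a]) auto
  with eventually_at_right_less[of 0]
  show "eventually (\<lambda>t. qr_matrix K ((t / t ^ m) *\<^sub>R jac f (a + t *\<^sub>R x))) (at_right 0)"
    by eventually_elim (auto intro!: qr_matrix_scaleR e(2))
qed

definition analytic_harmonic :: "(real^'n) set \<Rightarrow> (real^'n \<Rightarrow> real) \<Rightarrow> bool" where
  "analytic_harmonic S u \<longleftrightarrow> cext S u \<and> (\<forall>x\<in>S. laplacian u x = 0)"

lemma grad_add:
  assumes "cext S u" "cext S v" "x \<in> S"
  shows "grad (\<lambda>x. u x + v x) x = grad u x + grad v x"
  using assms by (simp add: vec_eq_iff partial_add cext_differentiable[of S])

lemma grad_cmult:
  assumes "cext S u" "x \<in> S"
  shows "grad (\<lambda>x. c * u x) x = c *\<^sub>R grad u x"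
  using assms by (simp add: vec_eq_iff partial_cmult cext_differentiable[of S])

lemma grad_sum:
  assumes "\<And>j. j \<in> A \<Longrightarrow> cext S (u j)" "x \<in> S"
  shows "grad (\<lambda>x. \<Sum>j\<in>A. u j x) x = (\<Sum>j\<in>A. grad (u j) x)"
  using assms
proof (induction A rule: infinite_finite_induct)
  case (insert j A)
  then show ?case by (simp add: grad_add[of S] cext_sum)
qed (simp_all add: vec_eq_iff)

lemma analytic_harmonic_add:
  assumes "analytic_harmonic S u" "analytic_harmonic S v" "open S"
  shows "analytic_harmonic S (\<lambda>x. u x + v x)"
  unfolding analytic_harmonic_def
proof (intro conjI ballI)
  have c: "cext S u" "cext S v" using assms by (auto simp: analytic_harmonic_def)
  then show "cext S (\<lambda>x. u x + v x)" by (rule cext_add)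
  fix x assume x: "x \<in> S"
  have "partial i (partial i (\<lambda>x. u x + v x)) x = partial i (partial i u) x + partial i (partial i v) x" for i
  proof -
    have "partial i (partial i (\<lambda>x. u x + v x)) x = partial i (\<lambda>x. partial i u x + partial i v x) x"
      by (rule partial_cong_open[OF assms(3) x]) (intro partial_add cext_differentiable[OF c(1)] cext_differentiable[OF c(2)])
    also have "\<dots> = partial i (partial i u) x + partial i (partial i v) x"
      by (intro partial_add cext_differentiable[OF cext_partial[OF c(1)] x] cext_differentiable[OF cext_partial[OF c(2)] x])
    finally show ?thesis .
  qed
  then have "laplacian (\<lambda>x. u x + v x) x = laplacian u x + laplacian v x"
    by (simp add: laplacian_def sum.distrib)
  then show "laplacian (\<lambda>x. u x + v x) x = 0" using assms x by (auto simp: analytic_harmonic_def)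
qed

lemma analytic_harmonic_cmult:
  assumes "analytic_harmonic S u" "open S"
  shows "analytic_harmonic S (\<lambda>x. c * u x)"
  unfolding analytic_harmonic_def
proof (intro conjI ballI)
  have c: "cext S u" using assms by (auto simp: analytic_harmonic_def)
  then show "cext S (\<lambda>x. c * u x)" by (rule cext_cmult)
  fix x assume x: "x \<in> S"
  have "partial i (partial i (\<lambda>x. c * u x)) x = c * partial i (partial i u) x" for i
  proof -
    have "partial i (partial i (\<lambda>x. c * u x)) x = partial i (\<lambda>x. c * partial i u x) x"
      by (rule partial_cong_open[OF assms(2) x]) (intro partial_cmult cext_differentiable[OF c])
    also have "\<dots> = c * partial i (partial i u) x"
      by (intro partial_cmult cext_differentiable[OF cext_partial[OF c] x])
    finally show ?thesis .
  qed
  then have "laplacian (\<lambda>x. c * u x) x = c * laplacian u x"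
    by (simp add: laplacian_def sum_distrib_left)
  then show "laplacian (\<lambda>x. c * u x) x = 0" using assms x by (auto simp: analytic_harmonic_def)
qed

lemma analytic_harmonic_const: "analytic_harmonic S (\<lambda>_. c)"
proof -
  have "partial i (\<lambda>_ :: real^'a. c) = (\<lambda>_. 0)" for i by (simp add: fun_eq_iff)
  then show ?thesis by (simp add: analytic_harmonic_def cext_const laplacian_def)
qed

lemma analytic_harmonic_sum:
  assumes "\<And>j. j \<in> A \<Longrightarrow> analytic_harmonic S (u j)" "open S"
  shows "analytic_harmonic S (\<lambda>x. \<Sum>j\<in>A. u j x)"
  using assms by (induction A rule: infinite_finite_induct)
    (auto intro: analytic_harmonic_add analytic_harmonic_const)

text \<open>What a blow-up at a hypothetical zero of the Jacobian would satisfy; the assumptions are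
  inconsistent, and the locale ends with \<open>False\<close>. The bound on the degree is essential:
  for degree 1 and \<open>K = 1\<close> the identity map has all the other properties.\<close>

locale homogeneous_qr_map =
  fixes K :: real and m :: nat and P :: "real^3 \<Rightarrow> real^3"
  assumes m: "m \<ge> 2"
    and harmonic_P: "\<And>j. analytic_harmonic UNIV (\<lambda>x. P x $ j)"
    and homogeneous_P: "\<And>j. homogeneous m (\<lambda>x. P x $ j)"
    and qr_P: "\<And>x. qr_matrix K (jac P x)"
    and nonzero_P: "\<exists>x. P x \<noteq> 0"
begin

lemma cext_P: "cext UNIV (\<lambda>x. P x $ j)"
  using harmonic_P by (simp add: analytic_harmonic_def)

lemma P_scaleR: "P (t *\<^sub>R x) = t ^ m *\<^sub>R P x"
  using homogeneousD[OF homogeneous_P] by (simp add: vec_eq_iff)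

lemma euler_P: "jac P x *v x = real m *\<^sub>R P x"
  using euler_homogeneous[OF cext_P homogeneous_P] by (simp add: vec_eq_iff jac_mult_nth)

lemma jac_P_scaleR: "t *\<^sub>R jac P (t *\<^sub>R x) = t ^ m *\<^sub>R jac P x"
  using grad_homogeneous[OF cext_P homogeneous_P] by (simp add: vec_eq_iff)

text \<open>For the blow-up \<open>Q\<close> at a zero \<open>p\<close> of the determinant, the
  vector \<open>p\<close> lies in the kernel of every \<open>jac Q x\<close>. Distortion turns a
  vanishing determinant into a vanishing matrix, and Euler's identity then gives
  \<open>Q = 0\<close>, against the choice of the blow-up.\<close>

lemma det_pos:
  assumes "p \<noteq> 0"
  shows "det (jac P p) > 0"
proof (rule ccontr)
  assume "\<not> ?thesis"
  then have "det (jac P p) = 0" using qr_P[of p] by (simp add: qr_matrix_def)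
  then have "jac P p = 0" by (rule qr_matrix_det_0[OF qr_P])
  then have Pp: "P p = 0" using euler_P[of p] m by simp
  obtain x0 j0 where x0: "P x0 $ j0 \<noteq> 0" using nonzero_P by (auto simp: vec_eq_iff)
  have nc: "\<exists>x\<in>ball p e. P x $ j0 \<noteq> P p $ j0" if "e > 0" for e
    by (rule homogeneous_not_locally_constant[OF cext_P homogeneous_P _ x0 that]) (use m in simp)
  have cp: "cext {p} (\<lambda>x. P x $ j)" for j by (rule cext_subset[OF cext_P]) simp
  obtain k q where q: "k \<ge> 1" "\<And>j. cext UNIV (q j)" "\<And>j t x. q j (t *\<^sub>R x) = t ^ k * q j x"
    "\<exists>j x. q j x \<noteq> 0"
    "\<And>j x. ((\<lambda>t. (P (p + t *\<^sub>R x) $ j - P p $ j) / t ^ k) \<longlongrightarrow> q j x) (at_right 0)"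
    "\<And>j i x. ((\<lambda>t. t * partial i (\<lambda>x. P x $ j) (p + t *\<^sub>R x) / t ^ k) \<longlongrightarrow> partial i (q j) x) (at_right 0)"
    by (rule blow_up[of p "\<lambda>j x. P x $ j" j0, OF cp nc], assumption) (rule that)
  define Q where "Q x = (\<chi> j. q j x)" for x
  have Qj: "(\<lambda>x. Q x $ j) = q j" for j by (simp add: Q_def)
  have "q j x = 0" for j x
  proof -
    have lim: "((\<lambda>t. (t / t ^ k) *\<^sub>R grad (\<lambda>y. P y $ j) (p + t *\<^sub>R x)) \<longlongrightarrow> grad (\<lambda>y. Q y $ j) x) (at_right 0)" for j
      unfolding Qj by (rule tendsto_grad_blow_up[OF q(6)])
    have qr: "qr_matrix K (jac Q x)"
      by (rule qr_matrix_blow_up[OF lim zero_less_one qr_P])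
    have "grad (q j) x \<bullet> p = 0" for j
      by (rule blow_up_invariant[OF cext_P homogeneous_P _ q(5) lim[unfolded Qj]]) (simp add: Pp)
    then have "jac Q x *v p = 0" by (simp add: vec_eq_iff jac_mult_nth Qj)
    then have "det (jac Q x) = 0" using assms by (rule det_eq_0_if_kernel)
    then have "jac Q x = 0" by (rule qr_matrix_det_0[OF qr])
    then have "grad (q j) x = 0" using jac_row[of Q x j] by (simp add: Qj)
    then show "q j x = 0"
      using euler_homogeneous[OF q(2), of k j x] q(3) q(1) by (simp add: homogeneous_def)
  qed
  with q(4) show False by blast
qed

text \<open>For even degree \<open>jac P (- a)\<close> is the negative of \<open>jac P a\<close>; in
  odd dimension this reverses the sign of the determinant, which is positive at both points.\<close>

lemma odd_m: "odd m"
proof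
  assume ev: "even m"
  define a :: "real^3" where "a = axis 1 1"
  have a: "a \<noteq> 0" by (simp add: a_def axis_eq_0_iff)
  have "(-1) *\<^sub>R jac P (- a) = jac P a" using jac_P_scaleR[of "-1" a] ev by simp
  then have "det (jac P a) = (-1) ^ CARD(3) * det (jac P (- a))" using det_scaleR[of "-1" "jac P (- a)"] by simp
  then show False using det_pos[of a] det_pos[of "- a"] a by simp
qed

lemma P_nonzero:
  assumes "x \<noteq> 0"
  shows "P x \<noteq> 0"
  using euler_P[of x] det_pos[OF assms] det_eq_0_if_kernel[OF _ assms, of "jac P x"] by fastforce

lemma continuous_on_P: "continuous_on UNIV P"
  using continuous_on_vec_lambda[of UNIV "\<lambda>j x. P x $ j", OF cext_continuous_on[OF cext_P]] by simp

text \<open>Dimension three enters through the simple connectedness of the punctured space: in the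
  punctured plane the power map z^m is a covering that is not injective.\<close>

lemma inj_on_P: "inj_on P (- {0})"
proof (rule covering_space_simply_connected_inj_on)
  show "covering_space (- {0}) P (- {0})"
  proof (rule proper_local_homeomorphism_covering_space)
    show "continuous_on (- {0}) P" by (rule continuous_on_subset[OF continuous_on_P]) simp
    show "- {0 :: real^3} \<noteq> {}" by (metis Compl_iff empty_iff singletonD axis_eq_0_iff zero_neq_one)
    show "connected (- {0 :: real^3})" by (rule connected_punctured_universe) simp
    show "P ` (- {0}) \<subseteq> - {0}" by (rule image_subsetI) (simp add: P_nonzero)
    fix x :: "real^3" assume x: "x \<in> - {0}"
    then have d: "det (jac P x) \<noteq> 0" using det_pos[of x] by simp
    have o: "open (- {0 :: real^3})" by (simp add: open_Compl)
    obtain U V g where *: "open U" "x \<in> U" "U \<subseteq> - {0}" "open V" "homeomorphism U V P g"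
      using cext_local_inverse[of "- {0}" P x, OF cext_subset[OF cext_P subset_UNIV] o x d] .
    have "V = P ` U" using *(5) by (simp add: homeomorphism_def)
    moreover have "P ` U \<subseteq> - {0}"
    proof (rule image_subsetI)
      fix v assume "v \<in> U"
      then have "v \<noteq> 0" using *(3) by blast
      then show "P v \<in> - {0}" by (simp add: P_nonzero)
    qed
    ultimately have "V \<subseteq> - {0}" by simp
    with * show "\<exists>U V q. open U \<and> x \<in> U \<and> U \<subseteq> - {0} \<and> open V \<and> V \<subseteq> - {0} \<and> homeomorphism U V P q"
      by blast
  next
    fix C :: "(real^3) set" assume "compact C" "C \<subseteq> - {0}"
    then show "compact (- {0} \<inter> P -` C)"
      using proper_homogeneous[OF continuous_on_P P_scaleR _ P_nonzero] m by simp
  qed (simp_all add: open_Compl)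
  show "connected (- {0 :: real^3})" by (rule connected_punctured_universe) simp
  show "simply_connected (- {0 :: real^3})" by (rule simply_connected_punctured_universe) simp
  show "locally path_connected (- {0 :: real^3})" by (rule open_imp_locally_path_connected) (simp add: open_Compl)
qed

section \<open>The auxiliary field \<open>Y\<close> and its extrema\<close>

definition Y :: "real^3 \<Rightarrow> real^3" where
  "Y x = linear_solve (transpose (jac P x)) (grad (test_harmonic m) x)"

lemma Y_eq: "x \<noteq> 0 \<Longrightarrow> transpose (jac P x) *v Y x = grad (test_harmonic m) x"
  unfolding Y_def using det_pos[of x] by (intro linear_solve(1)) (simp add: det_transpose)

lemma Y_unique: "x \<noteq> 0 \<Longrightarrow> transpose (jac P x) *v v = grad (test_harmonic m) x \<Longrightarrow> v = Y x"
  unfolding Y_def using det_pos[of x] by (intro linear_solve(2)) (simp_all add: det_transpose)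

text \<open>Both sides of the defining equation scale by t^(m - 1), for negative \<open>t\<close> as
  well; so \<open>Y\<close> is constant on each punctured line through the origin, not only on
  rays.\<close>

lemma Y_scaleR:
  assumes "x \<noteq> 0" "t \<noteq> 0"
  shows "Y (t *\<^sub>R x) = Y x"
proof -
  have tr: "c *\<^sub>R (transpose A *v v) = transpose (c *\<^sub>R A) *v v" for c and A :: "real^3^3" and v
    by (simp add: vec_eq_iff matrix_vector_mult_def transpose_def sum_distrib_left mult_ac)
  have "t *\<^sub>R (transpose (jac P (t *\<^sub>R x)) *v Y x) = t ^ m *\<^sub>R (transpose (jac P x) *v Y x)"
    by (simp only: tr jac_P_scaleR)
  also have "\<dots> = t *\<^sub>R grad (test_harmonic m) (t *\<^sub>R x)"
    unfolding Y_eq[OF assms(1)] by (rule grad_homogeneous[OF test_harmonic(1,2), symmetric])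
  finally have "transpose (jac P (t *\<^sub>R x)) *v Y x = grad (test_harmonic m) (t *\<^sub>R x)" using assms by simp
  then show ?thesis by (intro Y_unique[symmetric]) (use assms in simp_all)
qed

lemma continuous_on_Y: "continuous_on (- {0}) Y"
proof -
  have "continuous_on UNIV (jac P)" "continuous_on UNIV (grad (test_harmonic m))"
    by (intro continuous_on_jac cext_P continuous_on_grad test_harmonic)+
  then have "(jac P \<longlongrightarrow> jac P x) (at x within - {0})"
     "(grad (test_harmonic m) \<longlongrightarrow> grad (test_harmonic m) x) (at x within - {0})" for x
    by (auto simp: continuous_on_def intro: tendsto_within_subset)
  then show ?thesis
    unfolding continuous_on_def Y_def[abs_def]
    using det_pos by (intro ballI tendsto_linear_solve tendsto_transpose) (simp_all add: det_transpose less_imp_neq[THEN not_sym])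
qed

text \<open>At a maximum of \<open>e \<bullet> Y\<close>, blowing up \<open>test_harmonic m - Y x\<^sub>1 \<bullet> P\<close>, whose gradient is
  \<open>(jac P)\<^sup>T (Y - Y x\<^sub>1)\<close>, would give a planar harmonic function that is monotone in one direction.\<close>

lemma max_direction:
  assumes x1: "x1 \<noteq> 0" and max: "\<And>x. x \<noteq> 0 \<Longrightarrow> e \<bullet> Y x \<le> e \<bullet> Y x1"
    and nc: "x0 \<noteq> 0" "Y x0 \<noteq> Y x1"
  shows "\<exists>s. e = s *\<^sub>R P x1"
proof (rule ccontr)
  assume no: "\<not> ?thesis"
  define \<eta> where "\<eta> = Y x1"
  define u where "u x = test_harmonic m x + (\<Sum>j\<in>UNIV. - \<eta> $ j * P x $ j)" for x
  have uh: "analytic_harmonic UNIV u" unfolding u_def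
    by (intro analytic_harmonic_add analytic_harmonic_sum analytic_harmonic_cmult harmonic_P open_UNIV)
       (simp add: analytic_harmonic_def test_harmonic)
  then have u: "cext UNIV u" by (simp add: analytic_harmonic_def)
  have hu: "homogeneous m u"
    unfolding homogeneous_def u_def
    by (simp add: homogeneousD[OF test_harmonic(2)] P_scaleR distrib_left sum_distrib_left sum_negf algebra_simps)
  have "grad u x = grad (test_harmonic m) x + (\<Sum>j\<in>UNIV. (- \<eta> $ j) *\<^sub>R grad (\<lambda>y. P y $ j) x)" for x
    unfolding u_def
    by (subst grad_add[of UNIV] grad_sum[of _ UNIV] grad_cmult[of UNIV]; (intro test_harmonic cext_sum cext_cmult cext_P UNIV_I)?)+ simp
  then have gu0: "grad u x = grad (test_harmonic m) x - transpose (jac P x) *v \<eta>" for x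
    unfolding transpose_jac_mult by (simp add: sum_negf)
  have gu: "grad u x = transpose (jac P x) *v (Y x - \<eta>)" if "x \<noteq> 0" for x
    unfolding gu0 Y_eq[OF that, symmetric] by (simp add: matrix_vector_mult_diff_distrib)
  have gx1: "grad u x1 = 0" using gu[OF x1] by (simp add: \<eta>_def)
  have ux1: "u x1 = 0" using euler_homogeneous[OF u hu, of x1] gx1 m by simp
  \<comment> \<open>If \<open>u\<close> vanished identically, the fixed vector \<eta> would solve
    the defining equation of \<open>Y\<close> at \<open>x0\<close>, against the choice of
    \<open>x0\<close>.\<close>
  have "\<exists>x. u x \<noteq> 0"
  proof (rule ccontr)
    assume "\<not> ?thesis"
    then have "u = (\<lambda>_. 0)" by (simp add: fun_eq_iff)
    then have "grad u x0 = 0" by (simp add: vec_eq_iff)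
    then have "transpose (jac P x0) *v \<eta> = grad (test_harmonic m) x0" unfolding gu0 by simp
    from Y_unique[OF nc(1) this] nc(2) show False by (simp add: \<eta>_def)
  qed
  then obtain y where y: "u y \<noteq> 0" by blast
  have ncu: "\<exists>x\<in>ball x1 r. u x \<noteq> u x1" if "r > 0" for r
    by (rule homogeneous_not_locally_constant[OF u hu _ y that]) (use m in simp)
  have cu: "cext {x1} u" by (rule cext_subset[OF u]) simp
  obtain k and q' :: "unit \<Rightarrow> real^3 \<Rightarrow> real" where q': "k \<ge> 1" "\<And>j. cext UNIV (q' j)" "\<And>j t x. q' j (t *\<^sub>R x) = t ^ k * q' j x"
    "\<exists>j x. q' j x \<noteq> 0"
    "\<And>j x. ((\<lambda>t. (u (x1 + t *\<^sub>R x) - u x1) / t ^ k) \<longlongrightarrow> q' j x) (at_right 0)"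
    "\<And>j i x. ((\<lambda>t. t * partial i u (x1 + t *\<^sub>R x) / t ^ k) \<longlongrightarrow> partial i (q' j) x) (at_right 0)"
    "\<And>j i l x. ((\<lambda>t. t\<^sup>2 * partial l (partial i u) (x1 + t *\<^sub>R x) / t ^ k) \<longlongrightarrow> partial l (partial i (q' j)) x) (at_right 0)"
    by (rule blow_up[of x1 "\<lambda>_ :: unit. u" "()", OF cu ncu], assumption) (rule that)
  define q where "q = q' ()"
  have hq: "homogeneous k q" using q'(3) by (simp add: q_def homogeneous_def)
  have lim: "((\<lambda>t. (t / t ^ k) *\<^sub>R grad u (x1 + t *\<^sub>R x)) \<longlongrightarrow> grad q x) (at_right 0)" for x
    unfolding q_def by (rule tendsto_grad_blow_up[OF q'(6)])
  \<comment> \<open>The direction that \<open>jac P x1\<close> maps to \<open>e\<close>. The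
    analogous direction at a nearby point \<open>z\<close> has the inner product
    \<open>(Y z - \<eta>) \<bullet> e\<close> with \<open>grad u z\<close>, which is nonpositive by
    maximality; the blow-up inherits the sign.\<close>
  define \<xi> where "\<xi> = linear_solve (jac P x1) e"
  have J1: "det (jac P x1) \<noteq> 0" using det_pos[OF x1] by simp
  have "q x = 0" for x
  proof (rule planar_harmonic_rigidity)
    show "cext UNIV q" unfolding q_def by (rule q'(2))
    show "laplacian q x = 0" for x
      unfolding q_def by (rule tendsto_laplacian_blow_up[OF q'(7) zero_less_one])
        (use uh in \<open>simp add: analytic_harmonic_def\<close>)
    show "x1 \<noteq> 0" by (rule x1)
    show "grad q x \<bullet> x1 = 0" for x
      by (rule blow_up_invariant[OF u hu ux1 _ lim]) (simp add: q_def q'(5))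
    \<comment> \<open>By Euler's identity \<open>jac P x1\<close> maps \<open>x1\<close> to a
      multiple of \<open>P x1\<close>, so a \<xi> parallel to \<open>x1\<close> is exactly the case
      excluded by \<open>no\<close>.\<close>
    show "\<xi> \<noteq> s *\<^sub>R x1" for s
    proof
      assume "\<xi> = s *\<^sub>R x1"
      then have "e = jac P x1 *v (s *\<^sub>R x1)" using linear_solve(1)[OF J1, of e] by (simp add: \<xi>_def)
      also have "\<dots> = (s * real m) *\<^sub>R P x1" by (simp add: matrix_vector_mult_scaleR euler_P)
      finally show False using no by blast
    qed
    show "grad q x \<bullet> \<xi> \<le> 0" for x
    proof -
      define z where "z t = x1 + t *\<^sub>R x" for t
      have z: "(z \<longlongrightarrow> x1) (at_right 0)"
      proof -
        have "((\<lambda>t. x1 + t *\<^sub>R x) \<longlongrightarrow> x1 + 0 *\<^sub>R x) (at_right 0)" by (intro tendsto_intros)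
        then show ?thesis by (simp add: z_def[abs_def])
      qed
      have "isCont (jac P) x1"
        using continuous_on_jac[OF cext_P] by (simp add: continuous_on_eq_continuous_at)
      then have "((\<lambda>t. jac P (z t)) \<longlongrightarrow> jac P x1) (at_right 0)" by (rule isCont_tendsto_compose[OF _ z])
      then have "((\<lambda>t. linear_solve (jac P (z t)) e) \<longlongrightarrow> \<xi>) (at_right 0)"
        unfolding \<xi>_def by (rule tendsto_linear_solve[OF _ tendsto_const J1])
      then have L: "((\<lambda>t. ((t / t ^ k) *\<^sub>R grad u (z t)) \<bullet> linear_solve (jac P (z t)) e) \<longlongrightarrow> grad q x \<bullet> \<xi>) (at_right 0)"
        unfolding z_def by (intro tendsto_inner lim)
      show ?thesis
      proof (rule tendsto_upperbound[OF L _ trivial_limit_at_right_real])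
        show "eventually (\<lambda>t. ((t / t ^ k) *\<^sub>R grad u (z t)) \<bullet> linear_solve (jac P (z t)) e \<le> 0) (at_right 0)"
          using tendsto_imp_eventually_ne[OF z x1] eventually_at_right_less[of 0]
        proof eventually_elim
          case (elim t)
          have "det (jac P (z t)) \<noteq> 0" using det_pos[OF elim(1)] by simp
          then have "grad u (z t) \<bullet> linear_solve (jac P (z t)) e = (Y (z t) - \<eta>) \<bullet> e"
            unfolding gu[OF elim(1)] by (metis inner_commute inner_matrix_transpose linear_solve(1))
          also have "\<dots> \<le> 0" using max[OF elim(1)] by (simp add: \<eta>_def inner_diff_right inner_commute[of _ e])
          finally show ?case using elim(2) by (simp add: divide_nonneg_pos mult_nonneg_nonpos divide_le_0_iff mult_le_0_iff)
        qed
      qed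
    qed
    have "((\<lambda>t. (t / t ^ k) *\<^sub>R grad u (x1 + t *\<^sub>R 0)) \<longlongrightarrow> 0) (at_right 0)" by (simp add: gx1)
    then show "grad q 0 = 0" using tendsto_unique[OF trivial_limit_at_right_real lim] by blast
    show "grad q x \<bullet> x = real k * q x" for x
      by (rule euler_homogeneous[OF _ hq]) (simp add: q_def q'(2))
    show "real k \<noteq> 0" using q'(1) by simp
  qed
  then show False using q'(4) by (simp add: q_def)
qed

lemma Y_constant:
  assumes "x \<noteq> 0" "y \<noteq> 0"
  shows "Y x = Y y"
proof (rule ccontr)
  assume ne: "Y x \<noteq> Y y"
  define e where "e = Y x - Y y"
  have nc: "\<exists>x0. x0 \<noteq> 0 \<and> Y x0 \<noteq> Y z" for z using ne assms by metis
  have sub: "sphere (0 :: real^3) 1 \<subseteq> - {0}" by auto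
  have co: "continuous_on (sphere 0 1) (\<lambda>z. e \<bullet> Y z)"
    by (intro continuous_intros continuous_on_subset[OF continuous_on_Y sub])
  have ne_sph: "sphere (0 :: real^3) 1 \<noteq> {}" by simp
  obtain x1 where x1: "x1 \<in> sphere 0 1" "\<And>z. z \<in> sphere 0 1 \<Longrightarrow> e \<bullet> Y z \<le> e \<bullet> Y x1"
    using continuous_attains_sup[OF compact_sphere ne_sph co] by blast
  obtain x2 where x2: "x2 \<in> sphere 0 1" "\<And>z. z \<in> sphere 0 1 \<Longrightarrow> e \<bullet> Y x2 \<le> e \<bullet> Y z"
    using continuous_attains_inf[OF compact_sphere ne_sph co] by blast
  have norm1: "\<exists>v\<in>sphere 0 1. Y v = Y z" if "z \<noteq> 0" for z
    using that Y_scaleR[of z "1 / norm z"] by (intro bexI[of _ "(1 / norm z) *\<^sub>R z"]) auto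
  have max: "e \<bullet> Y z \<le> e \<bullet> Y x1" if "z \<noteq> 0" for z using norm1[OF that] x1(2) by metis
  have min: "e \<bullet> Y x2 \<le> e \<bullet> Y z" if "z \<noteq> 0" for z using norm1[OF that] x2(2) by metis
  have nz: "x1 \<noteq> 0" "x2 \<noteq> 0" using x1(1) x2(1) by auto
  have e: "e \<noteq> 0" using ne by (simp add: e_def)
  obtain s where s: "e = s *\<^sub>R P x1" using max_direction[OF nz(1) max] nc[of x1] by blast
  obtain s' where s': "- e = s' *\<^sub>R P x2"
    using max_direction[OF nz(2), of "- e"] min nc[of x2] by auto
  have s0: "s \<noteq> 0" "s' \<noteq> 0" using s s' e by auto
  \<comment> \<open>Since \<open>m\<close> is odd, the real root exists for either sign of the
    quotient; points \<open>x2\<close> on the ray opposite to \<open>x1\<close> are reached with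
    negative \<open>c\<close>.\<close>
  define c where "c = root m (- s / s')"
  have cm: "c ^ m = - s / s'" unfolding c_def by (rule odd_real_root_pow[OF odd_m])
  have c: "c \<noteq> 0" using cm s0 m by (auto simp: power_0_left split: if_splits)
  have "s' *\<^sub>R P x2 = s' *\<^sub>R P (c *\<^sub>R x1)" using s s' s0 by (simp add: P_scaleR cm)
  then have "P x2 = P (c *\<^sub>R x1)" using s0 by simp
  then have "x2 = c *\<^sub>R x1" using inj_onD[OF inj_on_P, of x2 "c *\<^sub>R x1"] nz c by simp
  then have "Y x2 = Y x1" using Y_scaleR[OF nz(1) c] by simp
  then have const: "e \<bullet> Y z = e \<bullet> Y x1" if "z \<noteq> 0" for z using max[OF that] min[OF that] by simp
  have "e \<bullet> e = e \<bullet> Y x - e \<bullet> Y y" unfolding e_def by (simp add: inner_diff_right)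
  also have "\<dots> = 0" using const assms by simp
  finally show False using e by simp
qed

lemma contradiction: False
proof -
  define a b :: "real^3" where "a = axis 3 1" and "b = axis 1 1"
  have ab: "a \<noteq> 0" "b \<noteq> 0" by (simp_all add: a_def b_def axis_eq_0_iff)
  have "transpose (jac P a) *v Y a = 0" using Y_eq[OF ab(1)] test_harmonic(4)[OF m] by (simp add: a_def)
  then have "Y a = 0" using det_eq_0_if_kernel[of "transpose (jac P a)" "Y a"] det_pos[OF ab(1)]
    by (auto simp: det_transpose)
  then have "Y b = 0" using Y_constant[OF ab] by simp
  then have "grad (test_harmonic m) b = 0" using Y_eq[OF ab(2)] by simp
  then have "test_harmonic m b = 0" using euler_homogeneous[OF test_harmonic(1,2), of m b] m by simp
  then show False using test_harmonic(5) by (simp add: b_def)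
qed

end

section \<open>Positivity of the Jacobian\<close>

lemma has_derivative_jac:
  fixes f :: "real^'n \<Rightarrow> real^'m"
  assumes "\<And>j. cext S (\<lambda>x. f x $ j)" "x \<in> S"
  shows "(f has_derivative (*v) (jac f x)) (at x)"
  unfolding has_derivative_componentwise_within[of f]
proof
  fix b :: "real^'m" assume "b \<in> Basis"
  then obtain j where b: "b = axis j 1" by (auto simp: Basis_vec_def)
  show "((\<lambda>x. f x \<bullet> b) has_derivative (\<lambda>h. (jac f x *v h) \<bullet> b)) (at x)"
    using cext_grad_has_derivative[OF assms(1)[of j] assms(2)] by (simp add: b inner_axis jac_mult_nth)
qed

lemma jacobian_det_eq:
  assumes "\<And>j. cext S (\<lambda>x. f x $ j)" "x \<in> S"
  shows "jacobian_det f x = det (jac f x)"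
  unfolding jacobian_det_def jacobian_def
  by (simp add: frechet_derivative_at[OF has_derivative_jac[OF assms], symmetric])

lemma cext_not_locally_constant:
  assumes \<Omega>: "open \<Omega>" "connected \<Omega>" and f: "\<And>j. cext \<Omega> (\<lambda>x. f x $ j)"
    and "\<not> f constant_on \<Omega>" and x0: "x0 \<in> \<Omega>"
  obtains j where "\<And>e. e > 0 \<Longrightarrow> \<exists>x\<in>ball x0 e. f x $ j \<noteq> f x0 $ j"
proof (rule ccontr)
  assume "\<not> thesis"
  then have loc: "\<exists>e>0. \<forall>x\<in>ball x0 e. f x $ j = f x0 $ j" for j using that by blast
  have "f x $ j = f x0 $ j" if "x \<in> \<Omega>" for x j
  proof -
    obtain e where e: "e > 0" "\<forall>x\<in>ball x0 e. f x $ j = f x0 $ j" using loc by blast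
    show ?thesis using cext_unique_continuation[OF f \<Omega> x0 e(1) _ that] e(2) by blast
  qed
  then have "f x = f x0" if "x \<in> \<Omega>" for x using that by (simp add: vec_eq_iff)
  then have "f constant_on \<Omega>" unfolding constant_on_def by blast
  with assms(4) show False by blast
qed

lemma analytic_harmonic_qr_det_pos:
  fixes f :: "real^3 \<Rightarrow> real^3"
  assumes \<Omega>: "open \<Omega>" "connected \<Omega>" and f: "\<And>j. analytic_harmonic \<Omega> (\<lambda>x. f x $ j)"
    and qr: "\<And>x. x \<in> \<Omega> \<Longrightarrow> qr_matrix K (jac f x)" and nc: "\<not> f constant_on \<Omega>" and x0: "x0 \<in> \<Omega>"
  shows "det (jac f x0) > 0"
proof (rule ccontr)
  assume "\<not> ?thesis"
  then have "det (jac f x0) = 0" using qr[OF x0] by (simp add: qr_matrix_def)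
  then have "jac f x0 = 0" by (rule qr_matrix_det_0[OF qr[OF x0]])
  then have g0: "grad (\<lambda>x. f x $ j) x0 = 0" for j using jac_row[of f x0 j] by simp
  have cf: "cext \<Omega> (\<lambda>x. f x $ j)" for j using f by (simp add: analytic_harmonic_def)
  obtain j0 where j0: "\<And>e. e > 0 \<Longrightarrow> \<exists>x\<in>ball x0 e. f x $ j0 \<noteq> f x0 $ j0"
    by (rule cext_not_locally_constant[OF \<Omega> cf nc x0]) (rule that)
  have cx: "cext {x0} (\<lambda>x. f x $ j)" for j using x0 by (intro cext_subset[OF cf]) simp
  obtain k q where q: "k \<ge> 1" "\<And>j. cext UNIV (q j)" "\<And>j t x. q j (t *\<^sub>R x) = t ^ k * q j x"
    "\<exists>j x. q j x \<noteq> 0"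
    "\<And>j x. ((\<lambda>t. (f (x0 + t *\<^sub>R x) $ j - f x0 $ j) / t ^ k) \<longlongrightarrow> q j x) (at_right 0)"
    "\<And>j i x. ((\<lambda>t. t * partial i (\<lambda>x. f x $ j) (x0 + t *\<^sub>R x) / t ^ k) \<longlongrightarrow> partial i (q j) x) (at_right 0)"
    "\<And>j i l x. ((\<lambda>t. t\<^sup>2 * partial l (partial i (\<lambda>x. f x $ j)) (x0 + t *\<^sub>R x) / t ^ k)
        \<longlongrightarrow> partial l (partial i (q j)) x) (at_right 0)"
    by (rule blow_up[of x0 "\<lambda>j x. f x $ j" j0, OF cx j0], assumption) (rule that)
  have hq: "homogeneous k (q j)" for j using q(3) by (simp add: homogeneous_def)
  have lim: "((\<lambda>t. (t / t ^ k) *\<^sub>R grad (\<lambda>y. f y $ j) (x0 + t *\<^sub>R x)) \<longlongrightarrow> grad (q j) x) (at_right 0)" for j x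
    by (rule tendsto_grad_blow_up[OF q(6)])
  define P where "P x = (\<chi> j. q j x)" for x
  have Pj: "(\<lambda>x. P x $ j) = q j" for j by (simp add: P_def)
  obtain e where e: "e > 0" "ball x0 e \<subseteq> \<Omega>" using \<Omega>(1) x0 open_contains_ball by blast
  \<comment> \<open>In degree one the gradient of \<open>q j\<close> is constant on rays, hence by
    continuity equal to its value at 0. That value is a limit of multiples of the vanishing gradient
    of \<open>f\<close> at \<open>x0\<close>, and Euler's identity then gives
    \<open>q j = 0\<close>.\<close>
  have k: "k \<ge> 2"
  proof (rule ccontr)
    assume "\<not> k \<ge> 2"
    then have k1: "k = 1" using q(1) by simp
    have "q j x = 0" for j x
    proof -
      have "((\<lambda>t. (t / t ^ k) *\<^sub>R grad (\<lambda>y. f y $ j) (x0 + t *\<^sub>R 0)) \<longlongrightarrow> 0) (at_right 0)" by (simp add: g0)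
      then have z: "grad (q j) 0 = 0" using tendsto_unique[OF trivial_limit_at_right_real lim] by blast
      have ge: "grad (q j) (t *\<^sub>R x) = grad (q j) x" if "t > 0" for t
        using grad_homogeneous[OF q(2) hq, of t j x] that by (simp add: k1)
      have "isCont (grad (q j)) 0" using continuous_on_grad[OF q(2)] by (simp add: continuous_on_eq_continuous_at)
      moreover have "((\<lambda>t. t *\<^sub>R x) \<longlongrightarrow> 0 *\<^sub>R x) (at_right 0)" by (intro tendsto_intros)
      ultimately have "((\<lambda>t. grad (q j) (t *\<^sub>R x)) \<longlongrightarrow> 0) (at_right 0)"
        using isCont_tendsto_compose[of 0 "grad (q j)"] z by simp
      moreover have "((\<lambda>t. grad (q j) (t *\<^sub>R x)) \<longlongrightarrow> grad (q j) x) (at_right 0)"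
        using eventually_at_right_less[of 0] by (intro tendsto_eventually) (auto elim!: eventually_mono simp: ge)
      ultimately have "grad (q j) x = 0" using tendsto_unique[OF trivial_limit_at_right_real] by blast
      then show ?thesis using euler_homogeneous[OF q(2) hq, of j x] k1 by simp
    qed
    with q(4) show False by blast
  qed
  interpret homogeneous_qr_map K k P
  proof
    show "k \<ge> 2" by (rule k)
    show "analytic_harmonic UNIV (\<lambda>x. P x $ j)" for j
      unfolding Pj analytic_harmonic_def
    proof (intro conjI ballI)
      show "laplacian (q j) x = 0" for x
        by (rule tendsto_laplacian_blow_up[OF q(7) e(1)]) (use f e(2) in \<open>auto simp: analytic_harmonic_def\<close>)
    qed (rule q(2))
    show "homogeneous k (\<lambda>x. P x $ j)" for j unfolding Pj by (rule hq)
    show "qr_matrix K (jac P x)" for x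
      by (rule qr_matrix_blow_up[of k f x0 x P, OF _ e(1)]) (use lim qr e(2) in \<open>auto simp: Pj\<close>)
    show "\<exists>x. P x \<noteq> 0" using q(4) by (auto simp: vec_eq_iff P_def)
  qed
  show False by (rule contradiction)
qed

section \<open>Application to quasiregular and quasiconformal maps\<close>

lemma sp_quasiregular_det_pos:
  fixes f :: "real^3 \<Rightarrow> real^3"
  assumes \<Omega>: "is_domain \<Omega>" and qr: "sp_quasiregular \<Omega> f"
    and f: "\<And>j. analytic_harmonic \<Omega> (\<lambda>x. f x $ j)" and x: "x \<in> \<Omega>"
  shows "det (jac f x) > 0"
proof -
  obtain K where K: "sp_K_quasiregular K \<Omega> f" using qr by (auto simp: sp_quasiregular_def)
  have o: "open \<Omega>" "connected \<Omega>" using \<Omega> by (auto simp: is_domain_def)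
  have c: "Ck_on 1 \<Omega> (\<lambda>x. f x $ j)" for j using f by (intro cext_Ck_on) (simp add: analytic_harmonic_def)
  show ?thesis
    by (rule analytic_harmonic_qr_det_pos[OF o f quasiregular_pointwise[OF o(1) c K] _ x])
      (use K in \<open>auto simp: sp_K_quasiregular_def\<close>)
qed

lemma harmonic_map_analytic_harmonic:
  fixes f :: "real^3 \<Rightarrow> real^3"
  assumes "harmonic_map_on \<Omega> f" "open \<Omega>"
  shows "analytic_harmonic \<Omega> (\<lambda>x. f x $ j)"
  using assms by (auto simp: harmonic_map_on_def analytic_harmonic_def intro: harmonic_cext) (simp add: harmonic_on_def)

lemma locally_real_analytic_diffeomorphism_if_det_nonzero:
  assumes f: "\<And>j. cext \<Omega> (\<lambda>x. f x $ j)" and \<Omega>: "open \<Omega>" and J: "\<And>x. x \<in> \<Omega> \<Longrightarrow> det (jac f x) \<noteq> 0"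
  shows "locally_real_analytic_diffeomorphism \<Omega> f"
  unfolding locally_real_analytic_diffeomorphism_def
proof
  fix x assume x: "x \<in> \<Omega>"
  obtain U V g where *: "open U" "x \<in> U" "U \<subseteq> \<Omega>" "open V" "homeomorphism U V f g" "\<And>j. cext V (\<lambda>y. g y $ j)"
    by (rule cext_local_inverse[OF f \<Omega> x J[OF x]]) (rule that)
  have "real_analytic_map_on U f"
    unfolding real_analytic_map_on_def using cext_real_analytic_on[OF cext_subset[OF f *(3)]] by blast
  moreover have "real_analytic_map_on V g"
    unfolding real_analytic_map_on_def using cext_real_analytic_on[OF *(6)] by blast
  ultimately have "real_analytic_diffeomorphism U V f"
    unfolding real_analytic_diffeomorphism_def using * by blast
  then show "\<exists>U V. x \<in> U \<and> U \<subseteq> \<Omega> \<and> real_analytic_diffeomorphism U V f" using * by blast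
qed

text \<open>The linear part of the reflection: the reflected components are linear combinations of
  the original ones plus constants, which keeps them harmonic.\<close>

definition reflection_matrix :: "real^'n \<Rightarrow> real^'n^'n" where
  "reflection_matrix v = (\<chi> j i. (if j = i then 1 else 0) - 2 * v $ i * v $ j / (v \<bullet> v))"

lemma hyperplane_reflection_nth:
  "hyperplane_reflection a v y $ j = (\<Sum>i\<in>UNIV. reflection_matrix v $ j $ i * y $ i) + 2 * (a \<bullet> v) / (v \<bullet> v) * v $ j"
proof -
  have "(\<Sum>i\<in>UNIV. reflection_matrix v $ j $ i * y $ i)
      = (\<Sum>i\<in>UNIV. (if j = i then y $ i else 0) - (2 * v $ j / (v \<bullet> v)) * (y $ i * v $ i))"
    by (intro sum.cong refl) (simp add: reflection_matrix_def algebra_simps)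
  also have "\<dots> = y $ j - (2 * v $ j / (v \<bullet> v)) * (y \<bullet> v)"
    unfolding sum_subtractf sum_distrib_left[symmetric] by (simp add: inner_vec_def)
  finally show ?thesis
    by (simp add: hyperplane_reflection_def inner_diff_left algebra_simps diff_divide_distrib)
qed

lemma analytic_harmonic_reflection:
  assumes "\<And>j. analytic_harmonic \<Omega> (\<lambda>x. f x $ j)" "open \<Omega>"
  shows "analytic_harmonic \<Omega> (\<lambda>x. (hyperplane_reflection a v \<circ> f) x $ j)"
  unfolding o_def hyperplane_reflection_nth
  by (intro analytic_harmonic_add analytic_harmonic_sum analytic_harmonic_cmult analytic_harmonic_const assms)

lemma jac_reflection:
  assumes "\<And>j. cext \<Omega> (\<lambda>x. f x $ j)" "x \<in> \<Omega>"
  shows "jac (hyperplane_reflection a v \<circ> f) x = reflection_matrix v ** jac f x"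
proof -
  have "grad (\<lambda>x. (hyperplane_reflection a v \<circ> f) x $ j) x = (\<Sum>i\<in>UNIV. reflection_matrix v $ j $ i *\<^sub>R grad (\<lambda>x. f x $ i) x)" for j
    unfolding o_def hyperplane_reflection_nth using assms
    by (simp add: grad_add[of \<Omega>] grad_sum[of _ \<Omega>] grad_cmult[of \<Omega>] cext_sum cext_cmult cext_const)
      (simp add: vec_eq_iff)
  then show ?thesis
    by (simp add: vec_eq_iff matrix_matrix_mult_def flip: grad_nth)
qed

theorem theorem1p1:
  shows
    "(\<forall>(\<Omega> :: (real^3) set) (f :: real^3 \<Rightarrow> real^3).
        is_domain \<Omega> \<and> sp_quasiregular \<Omega> f \<and> harmonic_map_on \<Omega> f \<longrightarrow>
          (\<forall>x\<in>\<Omega>. jacobian_det f x > 0) \<and> locally_real_analytic_diffeomorphism \<Omega> f) \<and>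
     (\<forall>(\<Omega> :: (real^3) set) (\<Omega>' :: (real^3) set) (f :: real^3 \<Rightarrow> real^3).
        is_domain \<Omega> \<and> is_domain \<Omega>' \<and> quasiconformal \<Omega> \<Omega>' f \<and> harmonic_map_on \<Omega> f \<longrightarrow>
          (\<forall>x\<in>\<Omega>. jacobian_det f x \<noteq> 0))"
proof (intro conjI allI impI ballI; elim conjE)
  fix \<Omega> :: "(real^3) set" and f :: "real^3 \<Rightarrow> real^3"
  assume \<Omega>: "is_domain \<Omega>" and qr: "sp_quasiregular \<Omega> f" and harm: "harmonic_map_on \<Omega> f"
  have o: "open \<Omega>" using \<Omega> by (simp add: is_domain_def)
  note ah = harmonic_map_analytic_harmonic[OF harm o]
  have c: "cext \<Omega> (\<lambda>x. f x $ j)" for j using ah by (simp add: analytic_harmonic_def)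
  note pos = sp_quasiregular_det_pos[OF \<Omega> qr ah]
  show "jacobian_det f x > 0" if "x \<in> \<Omega>" for x
    using pos[OF that] by (simp add: jacobian_det_eq[OF c that])
  show "locally_real_analytic_diffeomorphism \<Omega> f"
    by (rule locally_real_analytic_diffeomorphism_if_det_nonzero[OF c o]) (use pos in force)
next
  fix \<Omega> \<Omega>' :: "(real^3) set" and f :: "real^3 \<Rightarrow> real^3" and x
  assume \<Omega>: "is_domain \<Omega>" and qc: "quasiconformal \<Omega> \<Omega>' f" and harm: "harmonic_map_on \<Omega> f" and x: "x \<in> \<Omega>"
  have o: "open \<Omega>" using \<Omega> by (simp add: is_domain_def)
  note ah = harmonic_map_analytic_harmonic[OF harm o]
  have c: "cext \<Omega> (\<lambda>x. f x $ j)" for j using ah by (simp add: analytic_harmonic_def)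
  consider "sp_quasiregular \<Omega> f" | a v where "sp_quasiregular \<Omega> (hyperplane_reflection a v \<circ> f)"
    using qc by (auto simp: quasiconformal_def)
  then have "det (jac f x) \<noteq> 0"
  proof cases
    case 1
    then show ?thesis using sp_quasiregular_det_pos[OF \<Omega> _ ah x] by simp
  next
    case (2 a v)
    \<comment> \<open>This determinant is a product with \<open>det (jac f x)\<close> as a factor,
      so that factor is nonzero; the determinant of the reflection need not be computed.\<close>
    have "det (jac (hyperplane_reflection a v \<circ> f) x) > 0"
      by (rule sp_quasiregular_det_pos[OF \<Omega> 2 analytic_harmonic_reflection[OF ah o] x])
    then show ?thesis by (auto simp: jac_reflection[OF c x] det_mul)
  qed
  then show "jacobian_det f x \<noteq> 0" by (simp add: jacobian_det_eq[OF c x])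
qed

end
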